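(* Let $n\ge 3$ and let $a_1=0,a_2,\ldots,a_n$ be distinct points of $\mathbb{CP}^1$. A universal covering map $f:\mathbb{H}\to\mathbb{CP}^1\setminus\{a_1=0,a_2,\ldots,a_n\}$ which vanishes at infinity can be given by the expansion $$f=f(\tau)=A\left(q_k+\frac{B}{A}q_k^2+\mathbf{c}_3\!\left(A,\tfrac{B}{A}\right)q_k^3+\sum_{m=4}^{\infty}\mathbf{c}_m\!\left(A,\tfrac{B}{A}\right)q_k^m\right)$$ in $q_k=\exp\{\frac{2\pi i}{k}\tau\}$, $\tau\in\mathbb{H}$, for some real number $k$, where $A,B$ are constants depending only on $a_2,\ldots,a_n$, and the coefficient $\mathbf{c}_m(A,\frac{B}{A})$ is a polynomial in $A$ and $\frac{B}{A}$ for every $m\ge 3$. In particular, $$\mathbf{c}_3\!\left(A,\tfrac{B}{A}\right)=\frac{1}{16}\left[19\frac{B^2}{A^2}-A^2\sum_{j=2}^{n}\left(\frac{1}{a_j^2}-\frac{1}{a_j}\frac{2\beta_j}{\alpha_j}\right)\right],$$ where $\alpha_j,\beta_j$ are the constants defined in the context. Consequently, the complete Kähler-Einstein metric on $\mathbb{CP}^1\setminus\{a_1=0,a_2,\ldots,a_n\}$ can be given by the asymptotic expansion $$|ds|=\frac{1}{|f|\,\bigl|\log|\frac{f}{A}|\bigr|}\left|1-\left(\frac{B}{A}\frac{f}{A}-\frac{\operatorname{Re}\left(\frac{B}{A}\frac{f}{A}\right)}{\log|\frac{f}{A}|}\right)+\sum_{m=2}^{\infty}R_m\!\left(A,\frac{B}{A},\frac{f}{A},\frac{f^s\,\overline{f^{m-s}}}{A^s\,\overline{A^{m-s}}\,\log^j|\frac{f}{A}|}\right)\right||df|$$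 at the cusp $0$, where now $f$ denotes the coordinate of a point of $\mathbb{CP}^1\setminus\{a_1=0,a_2,\ldots,a_n\}$, and for every $m\ge2$, $R_m$ is a polynomial in $A$, $\frac{B}{A}$, $\frac{f}{A}$ and the quantities $\frac{f^s\overline{f^{m-s}}}{A^s\overline{A^{m-s}}\log^j|\frac{f}{A}|}$, $s,j=0,1,\ldots,m$, with constant coefficients.
   Context: $\mathbb{H}$ is the upper half plane. "$f$ vanishes at infinity" means that $f(\tau)\to 0$ as $\operatorname{Im}\tau\to\infty$, i.e. the cusp $\infty$ (the fixed point of a parabolic generator $\tau\mapsto\tau+k$ of the deck group) corresponds to the puncture $a_1=0$. The complete Kähler-Einstein metric on the punctured sphere is the one induced through the covering map from the Poincaré metric $ds^2=\frac{-4}{(\tau-\bar\tau)^2}|d\tau|^2=\frac{|d\tau|^2}{(\operatorname{Im}\tau)^2}$ on $\mathbb{H}$. The Schwarzian derivative is $\{g,z\}=2\left(\frac{g_{zz}}{g_z}\right)_z-\left(\frac{g_{zz}}{g_z}\right)^2$. Let $\tau=\tau(f)$ be a (multivalued) inverse of the covering map. Its Schwarzian derivative $\{\tau,f\}$ is single valued. Constants $\alpha_j,\beta_j$: the loop around a finite puncture $a_j$ corresponds to a parabolic deck transformation with fixed point $r_j\in\mathbb{R}\cup\{\infty\}$ and translation constant $k_j$ (that is, $-\frac{1}{\gamma(\tau)-r_j}=-\frac1{\tau-r_j}+k_j$ if $r_j\ne\infty$, and $\gamma(\tau)=\tau+k_j$ if $r_j=\infty$). The uniformizing function $\Phi_j(f)=\exp\{-\frac{2\pi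 i}{k_j}\frac{1}{\tau(f)-r_j}\}$ (respectively $\exp\{\frac{2\pi i}{k_j}\tau(f)\}$ if $r_j=\infty$) is single valued near $a_j$ and has the expansion $\Phi_j(f)=\alpha_j(f-a_j)+\beta_j(f-a_j)^2+\cdots$ with $\alpha_j\neq0$. With these constants $$\{\tau,f\}=\sum_{j}\left(\frac{1}{(f-a_j)^2}+\frac{2\beta_j}{\alpha_j}\frac{1}{f-a_j}\right),$$ the sum being over the finite punctures. If one of the $a_j$ is $\infty$, its terms are omitted from this sum and from the sum in the formula for $\mathbf{c}_3$. The constant coefficients of the polynomials may, as the formula for $\mathbf{c}_3$ shows, involve the $a_j$ and $\beta_j/\alpha_j$.
   Formalization: The q-expansion is asserted at τ with no pole of f at height ≥ Im τ (all of ℍ if ∞ is a puncture; otherwise f has poles in ℍ); A, B are fixed by the a_j up to A→uA, B→u²B, |u|=1; coefficients of R_m may involve conjugates of A, B/A, 1/a_j, β_j/α_j. *)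

theory Defs
  imports "HOL-Complex_Analysis.Complex_Analysis" "HOL-Library.Landau_Symbols"
begin

text \<open>The complex projective line, glued from the two charts \<^term>\<open>z\<close> and \<^term>\<open>1 / z\<close>.\<close>

datatype cp1 = Fin_pt complex | Inf_pt

definition chart_inf :: "complex \<Rightarrow> cp1" where
  "chart_inf w = (if w = 0 then Inf_pt else Fin_pt (1 / w))"

instantiation cp1 :: topological_space
begin

definition open_cp1 :: "cp1 set \<Rightarrow> bool" where
  "open_cp1 U \<longleftrightarrow> open (Fin_pt -` U) \<and> open (chart_inf -` U)"

instance
proof
  show "open (UNIV :: cp1 set)"
    by (simp add: open_cp1_def)
  show "open (S \<inter> T)" if "open S" "open T" for S T :: "cp1 set"
    using that by (simp add: open_cp1_def open_Int)
  show "open (\<Union>K)" if "\<forall>S\<in>K. open S" for K :: "cp1 set set"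
    using that by (auto simp: open_cp1_def vimage_Union)
qed

end

text \<open>The affine coordinate, and the coordinate at infinity; the values at the point outside the
  respective chart are \<^term>\<open>0 :: complex\<close>. For the coordinate at infinity this is only used away
  from \<^term>\<open>Fin_pt 0\<close>.\<close>

fun affine_coord :: "cp1 \<Rightarrow> complex" where
  "affine_coord (Fin_pt z) = z"
| "affine_coord Inf_pt = 0"

fun recip_coord :: "cp1 \<Rightarrow> complex" where
  "recip_coord (Fin_pt z) = 1 / z"
| "recip_coord Inf_pt = 0"

definition holomorphic_to_cp1_on :: "(complex \<Rightarrow> cp1) \<Rightarrow> complex set \<Rightarrow> bool" where
  "holomorphic_to_cp1_on f S \<longleftrightarrow>
     (\<forall>z\<in>S. \<exists>r>0. \<exists>g. ball z r \<subseteq> S \<and> g holomorphic_on ball z r \<and>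
        ((\<forall>w\<in>ball z r. f w = Fin_pt (g w)) \<or> (\<forall>w\<in>ball z r. f w = chart_inf (g w))))"

definition upper_half_plane :: "complex set" where
  "upper_half_plane = {\<tau>. Im \<tau> > 0}"

text \<open>As the upper half plane is simply connected, a covering by it is universal.\<close>

definition universal_covering_map :: "(complex \<Rightarrow> cp1) \<Rightarrow> cp1 set \<Rightarrow> bool" where
  "universal_covering_map f X \<longleftrightarrow>
     holomorphic_to_cp1_on f upper_half_plane \<and> covering_space upper_half_plane f X"

definition vanishes_at_infinity :: "(complex \<Rightarrow> cp1) \<Rightarrow> bool" where
  "vanishes_at_infinity f \<longleftrightarrow> (f \<longlongrightarrow> Fin_pt 0) (filtercomap Im at_top)"

text \<open>The density with respect to \<open>|dz|\<close>, at the point with affine coordinate \<open>z\<close>, of the complete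
  metric whose pullback under the covering map is the Poincare metric \<open>|d\<tau>| / Im \<tau>\<close>.\<close>

definition ke_density :: "(complex \<Rightarrow> cp1) \<Rightarrow> complex \<Rightarrow> real" where
  "ke_density f z =
     (THE l. \<forall>\<tau>\<in>upper_half_plane. f \<tau> = Fin_pt z \<longrightarrow>
        l * norm (deriv (\<lambda>\<sigma>. affine_coord (f \<sigma>)) \<tau>) = 1 / Im \<tau>)"

text \<open>A boundary point of the upper half plane is given as \<^term>\<open>None\<close> (infinity) or
  \<^term>\<open>Some r\<close> with \<open>r\<close> real. In the coordinate below a parabolic transformation fixing that
  point is a translation.\<close>

fun cusp_coord :: "real option \<Rightarrow> complex \<Rightarrow> complex" where
  "cusp_coord None \<tau> = \<tau>"
| "cusp_coord (Some r) \<tau> = - 1 / (\<tau> - of_real r)"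

text \<open>\<open>\<alpha>\<close> and \<open>\<beta>\<close> are the first two coefficients of the uniformizing function at the finite puncture
  \<open>p\<close>. The values over a punctured disc around \<open>p\<close> of a branch of the inverse of \<open>f\<close>, together with
  all its continuations around \<open>p\<close>, form a component \<open>U\<close> of the preimage of that disc; \<open>\<gamma>\<close> is
  the deck transformation which the positively oriented loop around \<open>p\<close> induces there. The power
  series in the last clause is the (single valued) function
  \<open>\<Phi> = exp (2 \<pi> i / k * cusp_coord r \<tau>)\<close> of \<open>w = f \<tau>\<close>.\<close>

definition uniformizing_coeffs :: "(complex \<Rightarrow> cp1) \<Rightarrow> complex \<Rightarrow> complex \<Rightarrow> complex \<Rightarrow> bool" where
  "uniformizing_coeffs f p \<alpha> \<beta> \<longleftrightarrow> \<alpha> \<noteq> 0 \<and>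
     (\<exists>(\<epsilon>::real) U \<gamma> r (k::real) \<phi>.
        \<epsilon> > 0 \<and> k \<noteq> 0 \<and>
        Fin_pt ` (ball p \<epsilon> - {p}) \<subseteq> f ` upper_half_plane \<and>
        U \<in> components (upper_half_plane \<inter> f -` (Fin_pt ` (ball p \<epsilon> - {p}))) \<and>
        (\<forall>\<tau>\<in>upper_half_plane. \<gamma> \<tau> \<in> upper_half_plane \<and> f (\<gamma> \<tau>) = f \<tau> \<and>
           cusp_coord r (\<gamma> \<tau>) = cusp_coord r \<tau> + of_real k) \<and>
        (\<forall>g d. path g \<and> path_image g \<subseteq> U \<and>
           (\<forall>t\<in>{0..1}. f (g t) = Fin_pt (p + d * exp (2 * of_real pi * \<i> * of_real t)))
           \<longrightarrow> pathfinish g = \<gamma> (pathstart g)) \<and>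
        \<phi> (0::nat) = 0 \<and> \<phi> 1 = \<alpha> \<and> \<phi> 2 = \<beta> \<and>
        (\<forall>\<tau>\<in>U. \<forall>w. f \<tau> = Fin_pt w \<longrightarrow>
           (\<lambda>m. \<phi> m * (w - p) ^ m) sums
             exp (2 * of_real pi * \<i> / of_real k * cusp_coord r \<tau>)))"

text \<open>The functions which are polynomials with rational coefficients in finitely many functions
  from \<open>G\<close>.\<close>

inductive_set polynomials_in :: "('x \<Rightarrow> complex) set \<Rightarrow> ('x \<Rightarrow> complex) set"
  for G :: "('x \<Rightarrow> complex) set"
where
  const: "c \<in> \<rat> \<Longrightarrow> (\<lambda>_. c) \<in> polynomials_in G"
| gen: "g \<in> G \<Longrightarrow> g \<in> polynomials_in G"
| add: "p \<in> polynomials_in G \<Longrightarrow> q \<in> polynomials_in G \<Longrightarrow> (\<lambda>e. p e + q e) \<in> polynomials_in G"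
| mult: "p \<in> polynomials_in G \<Longrightarrow> q \<in> polynomials_in G \<Longrightarrow> (\<lambda>e. p e * q e) \<in> polynomials_in G"

text \<open>An argument \<open>(A, b, x, \<rho>)\<close> stands for \<open>A\<close>, \<open>b = B / A\<close>, \<open>x j = 1 / a\<^sub>j\<close> and
  \<open>\<rho> j = \<beta>\<^sub>j / \<alpha>\<^sub>j\<close>. The coefficients of a polynomial in \<open>A\<close> and \<open>b\<close> may involve the
  puncture data, but only polynomially: were they arbitrary functions of \<open>a\<^sub>j\<close> and
  \<open>\<beta>\<^sub>j / \<alpha>\<^sub>j\<close>, which determine \<open>A\<close> and \<open>b\<close> up to a rotation, polynomiality would be void.\<close>

type_synonym cusp_data = "complex \<times> complex \<times> (nat \<Rightarrow> complex) \<times> (nat \<Rightarrow> complex)"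

definition data_gens :: "nat \<Rightarrow> (cusp_data \<Rightarrow> complex) set" where
  "data_gens n =
     {\<lambda>(A, b, x, \<rho>). A, \<lambda>(A, b, x, \<rho>). b}
     \<union> (\<lambda>j (A, b, x, \<rho>). x j) ` {2..n}
     \<union> (\<lambda>j (A, b, x, \<rho>). \<rho> j) ` {2..n}"

text \<open>The polynomials in the expansion of the metric also depend on \<open>w = f / A\<close>. As in the term
  \<open>Re (b * w)\<close> of first order, the complex conjugates of \<open>A\<close>, \<open>b\<close> and of the puncture data occur
  as well.\<close>

definition metric_gens :: "nat \<Rightarrow> nat \<Rightarrow> (cusp_data \<times> complex \<Rightarrow> complex) set" where
  "metric_gens n m =
     (\<lambda>g (d, w). g d) ` data_gens n
     \<union> (\<lambda>g (d, w). cnj (g d)) ` data_gens n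
     \<union> {\<lambda>(d, w). w}
     \<union> (\<lambda>(s, j) (d, w). w ^ s * cnj w ^ (m - s) / of_real (ln (norm w)) ^ j) ` ({0..m} \<times> {0..m})"

end

theory Submission
  imports Defs
begin

text \<open>The function \<open>F = 1 / f\<close> is a holomorphic covering of a plane domain by the upper half plane.
  Its deck transformations are real Moebius transformations, and as a loop around a puncture can be
  made arbitrarily short in the hyperbolic metric, the Schwarz-Pick lemma forces the induced deck
  transformation to be parabolic. At the cusp infinity this makes \<open>F\<close> a function of
  \<open>q = exp (2 \<pi> i \<tau> / k)\<close>, with a simple pole at \<open>q = 0\<close>. The Schwarzian derivative of the inverse of
  \<open>F\<close> is single valued, with double poles at the punctures and bounded growth at infinity, hence a
  rational function by Liouville's theorem. Solving the resulting Riccati equation for the logarithm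
  of \<open>q\<close> as a function of \<open>w = f / A\<close> by power series gives coefficients which are polynomials in
  \<open>A\<close>, \<open>B / A\<close> and the puncture data; reverting the series gives those of \<open>f\<close>. Finally the
  density of the metric is \<open>|dq / dw| / (|A q| |log |q||)\<close> in these terms, which is expanded in
  homogeneous parts in \<open>w\<close> and its conjugate.\<close>

unbundle no vec_syntax

text \<open>The polynomials have to be fixed before the punctures and the covering are known. The
  formal side is therefore built first, by recursions in free variables \<open>A\<close>,
  \<open>b\<close>, \<open>x j\<close>, \<open>\<rho> j\<close>; the analysis only shows that every
  covering obeys them. Two facts close the recursions. The residue of the Schwarzian at the puncture
  0 is itself expressed by \<open>A\<close> and \<open>B\<close>, as
  \<open>- 2 * B / A\<^sup>2\<close>. And a puncture at infinity has reciprocal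
  \<open>x j = 0\<close>, so its term drops out by itself: passing to \<open>1 / f\<close> makes
  infinity an ordinary point of the plane and sends the cusp at 0 to infinity, a full neighbourhood
  of which lies in the domain. The main obstacle is the deck transformation at this cusp: that it
  fixes infinity and is not the identity does not follow directly from
  \<open>vanishes_at_infinity\<close>. Finally, a translation of \<tau> multiplies q by a constant
  of modulus 1, so the punctures determine \<open>A\<close> and \<open>B\<close> only up to
  \<open>A \<mapsto> u * A\<close>, \<open>B \<mapsto> u\<^sup>2 * B\<close>.\<close>

lemma polynomials_in_sum:
  assumes "\<And>i. i \<in> I \<Longrightarrow> g i \<in> polynomials_in G"
  shows "(\<lambda>e. \<Sum>i\<in>I. g i e) \<in> polynomials_in G"
  using assms
proof (induction I rule: infinite_finite_induct)
  case (insert i I)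
  then show ?case
    using polynomials_in.add[of "g i" G "\<lambda>e. \<Sum>i\<in>I. g i e"] by simp
qed (auto intro: polynomials_in.const)

lemma polynomials_in_power:
  "g \<in> polynomials_in G \<Longrightarrow> (\<lambda>e. g e ^ m) \<in> polynomials_in G"
  by (induction m) (auto intro: polynomials_in.const polynomials_in.mult)

lemma polynomials_in_cmult:
  "c \<in> \<rat> \<Longrightarrow> g \<in> polynomials_in G \<Longrightarrow> (\<lambda>e. c * g e) \<in> polynomials_in G"
  using polynomials_in.mult[OF polynomials_in.const] .

lemma polynomials_in_diff:
  assumes "g \<in> polynomials_in G" "h \<in> polynomials_in G"
  shows "(\<lambda>e. g e - h e) \<in> polynomials_in G"
  using polynomials_in.add[OF assms(1) polynomials_in_cmult[of "-1", OF _ assms(2)]] by simp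

lemma polynomials_in_divide_nat:
  assumes "g \<in> polynomials_in G"
  shows "(\<lambda>e. g e / of_nat m) \<in> polynomials_in G"
proof -
  have "1 / of_nat m \<in> (\<rat> :: complex set)" by simp
  from polynomials_in_cmult[OF this assms] show ?thesis by simp
qed

text \<open>Substitution acts on the generators alone; this moves polynomials from one set of
  generators to another, in particular along the projection \<open>fst\<close> of
  \<open>cusp_data \<times> complex\<close>.\<close>

lemma polynomials_in_map:
  assumes "p \<in> polynomials_in G" "\<And>g. g \<in> G \<Longrightarrow> (\<lambda>e. g (h e)) \<in> polynomials_in G'"
  shows "(\<lambda>e. p (h e)) \<in> polynomials_in G'"
  using assms(1)
  by induction (auto intro: polynomials_in.const assms(2) polynomials_in.add polynomials_in.mult)

text \<open>Conjugation is a ring homomorphism and fixes the rational constants, so it only has to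
  be followed on the generators.\<close>

lemma polynomials_in_cnj_map:
  assumes "p \<in> polynomials_in G" "\<And>g. g \<in> G \<Longrightarrow> (\<lambda>e. cnj (g (h e))) \<in> polynomials_in G'"
  shows "(\<lambda>e. cnj (p (h e))) \<in> polynomials_in G'"
  using assms(1)
proof induction
  case (const c)
  then obtain r where r: "c = of_rat r" by (auto elim: Rats_cases)
  have "cnj c = c" unfolding r by (cases r) (simp add: of_rat_rat)
  with const have "cnj c \<in> \<rat>" by simp
  then show ?case by (rule polynomials_in.const)
qed (auto intro: assms(2) polynomials_in.add polynomials_in.mult)

text \<open>Polynomiality is a property of the whole family of series as a function of the data; for
  a single value of the data it would say nothing.\<close>

definition coeffs_in :: "('x \<Rightarrow> complex) set \<Rightarrow> ('x \<Rightarrow> complex fps) \<Rightarrow> bool" where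
  "coeffs_in G \<phi> \<longleftrightarrow> (\<forall>m. (\<lambda>d. fps_nth (\<phi> d) m) \<in> polynomials_in G)"

lemma coeffs_in_mult:
  assumes "coeffs_in G \<phi>" "coeffs_in G \<psi>"
  shows "coeffs_in G (\<lambda>d. \<phi> d * \<psi> d)"
  using assms unfolding coeffs_in_def fps_mult_nth
  by (intro allI polynomials_in_sum polynomials_in.mult) auto

lemma coeffs_in_power:
  assumes "coeffs_in G \<phi>"
  shows "coeffs_in G (\<lambda>d. \<phi> d ^ k)"
proof (induction k)
  case 0
  have "fps_nth (1 :: complex fps) m \<in> \<rat>" for m by (cases m) auto
  then show ?case unfolding coeffs_in_def by (auto intro: polynomials_in.const)
next
  case (Suc k)
  from coeffs_in_mult[OF assms this] show ?case by simp
qed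

text \<open>The recursion for the compositional inverse divides only by powers of the linear
  coefficient; as this is 1, the recursion stays polynomial.\<close>

lemma coeffs_in_fps_inv:
  assumes "coeffs_in G \<phi>" "\<And>d. fps_nth (\<phi> d) 1 = 1"
  shows "coeffs_in G (\<lambda>d. fps_inv (\<phi> d))"
proof -
  have "(\<lambda>d. compinv (\<phi> d) m) \<in> polynomials_in G" for m
  proof (induction m rule: less_induct)
    case (less m)
    show ?case
    proof (cases m)
      case 0
      then show ?thesis by (simp add: polynomials_in.const)
    next
      case (Suc k)
      have 1: "(\<lambda>d. \<Sum>i=0..k. compinv (\<phi> d) i * (\<phi> d ^ i) $ Suc k) \<in> polynomials_in G"
        using coeffs_in_power[OF assms(1)] less.IH Suc unfolding coeffs_in_def
        by (intro polynomials_in_sum polynomials_in.mult) auto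
      have 2: "(\<lambda>d. fps_X $ Suc k) \<in> polynomials_in G"
        by (intro polynomials_in.const) (auto simp: fps_X_def)
      from polynomials_in_diff[OF 2 1] show ?thesis
        using assms(2) by (simp add: Suc)
    qed
  qed
  then show ?thesis unfolding coeffs_in_def fps_inv_def by simp
qed

subsection \<open>The formal solution of the Schwarzian equation\<close>

text \<open>With \<open>\<psi> = exp (2 \<pi> i \<tau> / k)\<close> as a function of \<open>w = f / A\<close>, and with \<open>\<theta> = w d/dw\<close>,
  \<open>y = \<theta>\<psi> / \<psi>\<close> and \<open>u = \<theta>y / y\<close>, the formula for the Schwarzian derivative becomes the
  Riccati equation \<open>2 \<theta>u - u\<^sup>2 = rhs\<close>. Every division in the recursions below is by a positive
  integer.\<close>

fun rhs_coeff :: "nat \<Rightarrow> cusp_data \<Rightarrow> nat \<Rightarrow> complex" where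
  "rhs_coeff n (A, b, x, \<rho>) m =
     (if m = 0 then 0 else if m = 1 then - 2 * b
      else A ^ m * (\<Sum>j=2..n. of_nat (m - 1) * x j ^ m - 2 * \<rho> j * x j ^ (m - 1)))"

fun riccati_coeff :: "(nat \<Rightarrow> complex) \<Rightarrow> nat \<Rightarrow> complex" where
  "riccati_coeff G m =
     (if m = 0 then 0
      else (G m + (\<Sum>i\<in>{1..<m}. riccati_coeff G i * riccati_coeff G (m - i))) / of_nat (2 * m))"

fun linear_coeff :: "(nat \<Rightarrow> complex) \<Rightarrow> nat \<Rightarrow> complex" where
  "linear_coeff u m =
     (if m = 0 then 1 else (\<Sum>i\<in>{1..m}. u i * linear_coeff u (m - i)) / of_nat m)"

declare riccati_coeff.simps [simp del] linear_coeff.simps [simp del]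

text \<open>In degree \<open>m\<close> the operator \<open>2 \<theta>\<close> multiplies by
  \<open>2 * m\<close>, and \<open>u $ 0 = 0\<close> leaves only lower coefficients in the square,
  so the equation is a recursion for \<open>u\<close>.\<close>

lemma riccati_coeff_unique:
  fixes u G :: "complex fps"
  assumes "u $ 0 = 0" "2 * (fps_X * fps_deriv u) - u\<^sup>2 = G"
  shows "u $ m = riccati_coeff (fps_nth G) m"
proof (induction m rule: less_induct)
  case (less m)
  show ?case
  proof (cases "m = 0")
    case True
    then show ?thesis using assms by (simp add: riccati_coeff.simps)
  next
    case False
    have "G $ m = 2 * (of_nat m * u $ m) - (\<Sum>i=0..m. u $ i * u $ (m - i))"
      using False by (subst assms(2)[symmetric])
        (simp add: power2_eq_square fps_mult_nth[of u] numeral_fps_const)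
    \<comment> \<open>Both end terms contain the factor \<open>u $ 0\<close>; without them
      \<open>u $ m\<close> no longer occurs on the right.\<close>
    also have "(\<Sum>i=0..m. u $ i * u $ (m - i)) = (\<Sum>i\<in>{1..<m}. u $ i * u $ (m - i))"
      using False assms(1) by (intro sum.mono_neutral_cong_right) (auto simp: not_less Suc_le_eq)
    also have "\<dots> = (\<Sum>i\<in>{1..<m}. riccati_coeff (fps_nth G) i * riccati_coeff (fps_nth G) (m - i))"
      by (intro sum.cong refl) (simp add: less.IH)
    finally show ?thesis
      using False by (subst riccati_coeff.simps) (simp add: field_simps)
  qed
qed

text \<open>On the right hand side \<open>y $ m\<close> is multiplied by \<open>u $ 0 = 0\<close>,
  so a solution is determined by its constant coefficient.\<close>

lemma linear_coeff_unique:
  fixes u y :: "complex fps"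
  assumes "u $ 0 = 0" "y $ 0 = 1" "fps_X * fps_deriv y = u * y"
  shows "y $ m = linear_coeff (fps_nth u) m"
proof (induction m rule: less_induct)
  case (less m)
  show ?case
  proof (cases "m = 0")
    case True
    then show ?thesis using assms by (simp add: linear_coeff.simps)
  next
    case False
    have "of_nat m * y $ m = (fps_X * fps_deriv y) $ m"
      using False by simp
    also have "\<dots> = (\<Sum>i=0..m. u $ i * y $ (m - i))"
      by (simp add: assms(3) fps_mult_nth)
    also have "\<dots> = (\<Sum>i\<in>{1..m}. u $ i * y $ (m - i))"
      using assms(1) by (simp add: sum.atLeast_Suc_atMost)
    also have "\<dots> = (\<Sum>i\<in>{1..m}. u $ i * linear_coeff (fps_nth u) (m - i))"
      by (intro sum.cong refl) (simp add: less.IH False)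
    finally show ?thesis
      using False by (subst linear_coeff.simps) (simp add: field_simps)
  qed
qed

lemma linear_coeff_low:
  "linear_coeff u 0 = 1" "linear_coeff u 1 = u 1" "linear_coeff u 2 = ((u 1)\<^sup>2 + u 2) / 2"
proof -
  show 0: "linear_coeff u 0 = 1" by (simp add: linear_coeff.simps)
  then show 1: "linear_coeff u 1 = u 1" by (simp add: linear_coeff.simps[of _ "Suc 0"])
  show "linear_coeff u 2 = ((u 1)\<^sup>2 + u 2) / 2"
    using 0 1 by (simp add: linear_coeff.simps[of _ "Suc (Suc 0)"] atLeastAtMostSuc_conv
        numeral_2_eq_2 power2_eq_square)
qed

definition u_coeff :: "nat \<Rightarrow> cusp_data \<Rightarrow> nat \<Rightarrow> complex" where
  "u_coeff n d = riccati_coeff (rhs_coeff n d)"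

definition y_coeff :: "nat \<Rightarrow> cusp_data \<Rightarrow> nat \<Rightarrow> complex" where
  "y_coeff n d = linear_coeff (u_coeff n d)"

text \<open>With \<open>\<psi> = w g\<close> the equation \<open>\<theta>\<psi> = y \<psi>\<close>
  becomes \<open>\<theta>g = (y - 1) g\<close>; this is why the constant coefficient of
  \<open>y\<close>, which is 1, is replaced by 0.\<close>

definition psi_fps :: "nat \<Rightarrow> cusp_data \<Rightarrow> complex fps" where
  "psi_fps n d = fps_X * Abs_fps (linear_coeff (\<lambda>m. if m = 0 then 0 else y_coeff n d m))"

text \<open>As \<open>psi_fps\<close> expands q in powers of \<open>w = f / A\<close>, its
  compositional inverse expands \<open>f / A\<close> in powers of q.\<close>

definition cusp_coeff :: "nat \<Rightarrow> nat \<Rightarrow> cusp_data \<Rightarrow> complex" where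
  "cusp_coeff n m d = fps_inv (psi_fps n d) $ m"

lemma riccati_coeff_poly:
  assumes "\<And>m. (\<lambda>d. G d m) \<in> polynomials_in P"
  shows "(\<lambda>d. riccati_coeff (G d) m) \<in> polynomials_in P"
proof (induction m rule: less_induct)
  case (less m)
  show ?case
  proof (cases "m = 0")
    case False
    have "(\<lambda>d. (G d m + (\<Sum>i\<in>{1..<m}. riccati_coeff (G d) i * riccati_coeff (G d) (m - i)))
              / of_nat (2 * m)) \<in> polynomials_in P"
      by (intro polynomials_in_divide_nat polynomials_in.add polynomials_in_sum
            polynomials_in.mult less.IH assms) auto
    then show ?thesis using False by (subst riccati_coeff.simps) simp
  qed (simp add: riccati_coeff.simps polynomials_in.const)
qed

lemma linear_coeff_poly:
  assumes "\<And>m. (\<lambda>d. u d m) \<in> polynomials_in P"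
  shows "(\<lambda>d. linear_coeff (u d) m) \<in> polynomials_in P"
proof (induction m rule: less_induct)
  case (less m)
  show ?case
  proof (cases "m = 0")
    case False
    have "(\<lambda>d. (\<Sum>i\<in>{1..m}. u d i * linear_coeff (u d) (m - i)) / of_nat m) \<in> polynomials_in P"
      using False by (intro polynomials_in_divide_nat polynomials_in_sum
            polynomials_in.mult less.IH assms) auto
    then show ?thesis using False by (subst linear_coeff.simps) simp
  qed (simp add: linear_coeff.simps polynomials_in.const)
qed

lemma rhs_coeff_poly: "(\<lambda>d. rhs_coeff n d m) \<in> polynomials_in (data_gens n)"
proof -
  let ?P = "polynomials_in (data_gens n)"
  have A: "(\<lambda>(A, b, x, \<rho>). A) \<in> ?P" and b: "(\<lambda>(A, b, x, \<rho>). b) \<in> ?P"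
    by (auto intro!: polynomials_in.gen simp: data_gens_def)
  have x: "(\<lambda>(A, b, x, \<rho>). x j) \<in> ?P" and r: "(\<lambda>(A, b, x, \<rho>). \<rho> j) \<in> ?P" if "j \<in> {2..n}" for j
    using that by (auto intro!: polynomials_in.gen simp: data_gens_def)
  consider "m = 0" | "m = 1" | "m \<ge> 2" by linarith
  then show ?thesis
  proof cases
    case 1
    have "(\<lambda>d. rhs_coeff n d m) = (\<lambda>_. 0)" by (auto simp: 1)
    then show ?thesis by (simp add: polynomials_in.const)
  next
    case 2
    have "(\<lambda>d. rhs_coeff n d m) = (\<lambda>d. (-2) * (case d of (A, b, x, \<rho>) \<Rightarrow> b))" by (auto simp: 2)
    also have "\<dots> \<in> ?P"
      by (rule polynomials_in_cmult[OF _ b]) simp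
    finally show ?thesis .
  next
    case 3
    have "(\<lambda>d. rhs_coeff n d m) = (\<lambda>d. (case d of (A, b, x, \<rho>) \<Rightarrow> A) ^ m *
        (\<Sum>j=2..n. of_nat (m - 1) * (case d of (A, b, x, \<rho>) \<Rightarrow> x j) ^ m
             - 2 * ((case d of (A, b, x, \<rho>) \<Rightarrow> \<rho> j) * (case d of (A, b, x, \<rho>) \<Rightarrow> x j) ^ (m - 1))))"
      using 3 by (auto simp: fun_eq_iff mult.assoc)
    also have "\<dots> \<in> ?P"
      by (intro polynomials_in.mult polynomials_in_power A polynomials_in_sum polynomials_in_diff
          polynomials_in_cmult x r) auto
    finally show ?thesis .
  qed
qed

lemma y_coeff_poly: "(\<lambda>d. y_coeff n d m) \<in> polynomials_in (data_gens n)"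
  unfolding y_coeff_def u_coeff_def
  by (intro linear_coeff_poly riccati_coeff_poly rhs_coeff_poly)

lemma psi_fps_nth_1: "psi_fps n d $ 1 = 1"
  by (simp add: psi_fps_def linear_coeff.simps)

lemma cusp_coeff_poly: "cusp_coeff n m \<in> polynomials_in (data_gens n)"
proof -
  have "(\<lambda>d. linear_coeff (\<lambda>m. if m = 0 then 0 else y_coeff n d m) k) \<in> polynomials_in (data_gens n)" for k
  proof (intro linear_coeff_poly)
    show "(\<lambda>d. if m = 0 then 0 else y_coeff n d m) \<in> polynomials_in (data_gens n)" for m
      by (cases "m = 0") (simp_all add: polynomials_in.const y_coeff_poly)
  qed
  then have "coeffs_in (data_gens n) (psi_fps n)"
    unfolding coeffs_in_def psi_fps_def
    by (intro allI, case_tac m) (simp_all add: polynomials_in.const)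
  from coeffs_in_fps_inv[OF this] show ?thesis
    by (simp add: psi_fps_nth_1[unfolded One_nat_def] coeffs_in_def cusp_coeff_def[abs_def])
qed

text \<open>The origin of the number 19: in degree 2 the coefficient of \<open>b\<^sup>2\<close> is
  1/4 in \<open>u\<close>, 5/8 in \<open>y\<close> and 13/16 in \<open>\<psi> / w\<close>, and
  reverting the series gives 2 - 13/16 = 19/16.\<close>

lemma cusp_coeff_low:
  "cusp_coeff n 0 d = 0" "cusp_coeff n 1 d = 1"
  "cusp_coeff n 2 (A, b, x, \<rho>) = b"
  "cusp_coeff n 3 (A, b, x, \<rho>)
     = (19 * b\<^sup>2 - A\<^sup>2 * (\<Sum>j=2..n. (x j)\<^sup>2 - 2 * \<rho> j * x j)) / 16"
proof -
  define g where "g = linear_coeff (\<lambda>m. if m = 0 then 0 else y_coeff n (A, b, x, \<rho>) m)"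
  define S where "S = (\<Sum>j=2..n. (x j)\<^sup>2 - 2 * \<rho> j * x j)"
  have u0: "u_coeff n (A, b, x, \<rho>) 0 = 0" and u1: "u_coeff n (A, b, x, \<rho>) 1 = - b"
    by (simp_all add: u_coeff_def riccati_coeff.simps)
  have u2: "u_coeff n (A, b, x, \<rho>) 2 = (A\<^sup>2 * S + b\<^sup>2) / 4"
    using u1 by (simp add: u_coeff_def riccati_coeff.simps[of _ 2] S_def atLeastLessThan_nat_numeral power2_eq_square)
  have y1: "y_coeff n (A, b, x, \<rho>) 1 = - b"
    using u1 by (simp add: y_coeff_def linear_coeff_low[unfolded One_nat_def])
  have y2: "y_coeff n (A, b, x, \<rho>) 2 = (A\<^sup>2 * S + 5 * b\<^sup>2) / 8"
    unfolding y_coeff_def linear_coeff_low u1 u2 by (simp add: field_simps)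
  have g0: "g 0 = 1" by (simp add: g_def linear_coeff_low)
  have g1: "g 1 = - b" using y1 by (simp add: g_def linear_coeff_low[unfolded One_nat_def])
  have "g 2 = ((y_coeff n (A, b, x, \<rho>) 1)\<^sup>2 + y_coeff n (A, b, x, \<rho>) 2) / 2"
    by (simp add: g_def linear_coeff_low)
  then have g2: "g 2 = (A\<^sup>2 * S + 13 * b\<^sup>2) / 16"
    unfolding y1 y2 by (simp add: field_simps)
  have psi: "psi_fps n (A, b, x, \<rho>) = fps_X * Abs_fps g"
    by (simp add: psi_fps_def g_def)
  let ?p = "fps_X * Abs_fps g"
  have c0: "compinv ?p 0 = 0" by simp
  have c1: "compinv ?p (Suc 0) = 1" by (simp add: g0)
  have p2: "?p $ Suc (Suc 0) = - b" and p3: "?p $ Suc (Suc (Suc 0)) = (A\<^sup>2 * S + 13 * b\<^sup>2) / 16"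
    using g1 g2 by (simp_all add: numeral_2_eq_2)
  have sq: "(?p ^ 2) $ Suc (Suc (Suc 0)) = - 2 * b"
    using g1 g0 by (simp add: power2_eq_square fps_mult_nth[of ?p] atLeast0_atMost_Suc)
  have c2: "compinv ?p (Suc (Suc 0)) = b"
    using c0 c1 p2 g0 by (simp add: atLeast0_atMost_Suc)
  \<comment> \<open>Reversion in degree 3: minus the cubic coefficient of \<open>?p\<close>,
    corrected by \<open>b\<close> times the cubic coefficient \<open>- 2 * b\<close> of its
    square.\<close>
  have c3: "compinv ?p (Suc (Suc (Suc 0))) = 2 * b\<^sup>2 - (A\<^sup>2 * S + 13 * b\<^sup>2) / 16"
    using c0 c1 c2 p3 g0 sq by (simp add: atLeast0_atMost_Suc numeral_2_eq_2 power2_eq_square del: compinv.simps(2) add: compinv.simps(2)[of _ "Suc (Suc 0)"])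
  show "cusp_coeff n 2 (A, b, x, \<rho>) = b"
    unfolding cusp_coeff_def fps_inv_def psi numeral_2_eq_2 by (simp only: c2 fps_nth_Abs_fps)
  show "cusp_coeff n 3 (A, b, x, \<rho>) = (19 * b\<^sup>2 - A\<^sup>2 * (\<Sum>j=2..n. (x j)\<^sup>2 - 2 * \<rho> j * x j)) / 16"
    unfolding cusp_coeff_def fps_inv_def psi numeral_3_eq_3 S_def[symmetric]
    by (simp only: c3 fps_nth_Abs_fps) (simp add: field_simps)
  show "cusp_coeff n 0 d = 0" by (simp add: cusp_coeff_def fps_inv_def)
  show "cusp_coeff n 1 d = 1" using psi_fps_nth_1[of n d] by (simp add: cusp_coeff_def fps_inv_def)
qed

subsection \<open>The coefficients of the metric\<close>

text \<open>A grading: total degree \<open>m\<close> in \<open>w\<close> and its conjugate, with at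
  most \<open>m\<close> powers of the logarithm in the denominator. Both numbers add up under
  multiplication, which keeps products of series within the class.\<close>

inductive_set bihomogeneous :: "(cusp_data \<Rightarrow> complex) set \<Rightarrow> nat \<Rightarrow> (cusp_data \<times> complex \<Rightarrow> complex) set"
  for P :: "(cusp_data \<Rightarrow> complex) set" and m :: nat
where
  mono: "\<kappa> \<in> polynomials_in P \<Longrightarrow> s \<le> m \<Longrightarrow> j \<le> m \<Longrightarrow>
     (\<lambda>(d, w). \<kappa> d * (w ^ s * cnj w ^ (m - s) / of_real (ln (norm w)) ^ j)) \<in> bihomogeneous P m"
| add: "p \<in> bihomogeneous P m \<Longrightarrow> q \<in> bihomogeneous P m \<Longrightarrow> (\<lambda>e. p e + q e) \<in> bihomogeneous P m"

lemma bihomogeneous_zero: "(\<lambda>_. 0) \<in> bihomogeneous P m"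
  using bihomogeneous.mono[OF polynomials_in.const[of 0 P], of 0 m 0] by (simp add: case_prod_unfold)

lemma bihomogeneous_const: "c \<in> \<rat> \<Longrightarrow> (\<lambda>_. c) \<in> bihomogeneous P 0"
  using bihomogeneous.mono[OF polynomials_in.const[of c P], of 0 0 0] by (simp add: case_prod_unfold)

lemma bihomogeneous_sum:
  assumes "\<And>i. i \<in> I \<Longrightarrow> g i \<in> bihomogeneous P m"
  shows "(\<lambda>e. \<Sum>i\<in>I. g i e) \<in> bihomogeneous P m"
  using assms
proof (induction I rule: infinite_finite_induct)
  case (insert i I)
  then show ?case
    using bihomogeneous.add[of "g i" P m "\<lambda>e. \<Sum>i\<in>I. g i e"] by simp
qed (auto intro: bihomogeneous_zero)

lemma bihomogeneous_mult:
  assumes "p \<in> bihomogeneous P m" "q \<in> bihomogeneous P l"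
  shows "(\<lambda>e. p e * q e) \<in> bihomogeneous P (m + l)"
  using assms(1)
proof induction
  case (mono \<kappa> s j)
  note 1 = this
  show ?case using assms(2)
  proof induction
    case (mono \<kappa>' s' j')
    have "(\<lambda>(d, w). (\<kappa> d * \<kappa>' d) * (w ^ (s + s') * cnj w ^ (m + l - (s + s')) / of_real (ln (norm w)) ^ (j + j')))
       \<in> bihomogeneous P (m + l)"
      using 1 mono by (intro bihomogeneous.mono polynomials_in.mult) auto
    moreover have "m + l - (s + s') = (m - s) + (l - s')" using 1 mono by simp
    ultimately show ?case
      by (simp add: case_prod_unfold power_add mult_ac)
  next
    case (add p q)
    from bihomogeneous.add[OF add.IH] show ?case by (simp add: distrib_left)
  qed
next
  case (add p q)
  from bihomogeneous.add[OF add.IH] show ?case by (simp add: distrib_right)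
qed

lemma bihomogeneous_uminus:
  assumes "p \<in> bihomogeneous P m"
  shows "(\<lambda>e. - p e) \<in> bihomogeneous P m"
  using bihomogeneous_mult[OF bihomogeneous_const[of "-1"] assms] by simp

text \<open>The constant term 1 makes the recursion for the reciprocal free of division, and every
  product in it has total weight \<open>m\<close>.\<close>

lemma bihomogeneous_fps_inverse:
  assumes "\<And>m. (\<lambda>e. \<phi> e $ m) \<in> bihomogeneous P m" and one: "\<And>e. \<phi> e $ 0 = 1"
  shows "(\<lambda>e. inverse (\<phi> e) $ m) \<in> bihomogeneous P m"
proof (induction m rule: less_induct)
  case (less m)
  show ?case
  proof (cases "m = 0")
    case True
    then show ?thesis using one by (simp add: bihomogeneous_const)
  next
    case False
    have eq: "inverse (\<phi> e) $ m = - (\<Sum>i=1..m. \<phi> e $ i * inverse (\<phi> e) $ (m - i))" for e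
    proof -
      have "0 = (\<phi> e * inverse (\<phi> e)) $ m"
        using one[of e] False by (simp add: inverse_mult_eq_1')
      also have "\<dots> = (\<Sum>i=0..m. \<phi> e $ i * inverse (\<phi> e) $ (m - i))"
        by (simp add: fps_mult_nth)
      also have "\<dots> = inverse (\<phi> e) $ m + (\<Sum>i=1..m. \<phi> e $ i * inverse (\<phi> e) $ (m - i))"
        using one by (simp add: sum.atLeast_Suc_atMost)
      finally show ?thesis by (simp add: eq_neg_iff_add_eq_0)
    qed
    have "(\<lambda>e. \<phi> e $ i * inverse (\<phi> e) $ (m - i)) \<in> bihomogeneous P m" if "i \<in> {1..m}" for i
      using bihomogeneous_mult[OF assms(1)[of i] less.IH[of "m - i"]] that by simp
    then show ?thesis
      unfolding eq by (intro bihomogeneous_uminus bihomogeneous_sum)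
  qed
qed

text \<open>The coefficients of \<open>\<eta> = log (\<psi> / w)\<close>, because
  \<open>\<theta>\<eta> = y - 1\<close>.\<close>

definition eta_coeff :: "nat \<Rightarrow> cusp_data \<Rightarrow> nat \<Rightarrow> complex" where
  "eta_coeff n d m = (if m = 0 then 0 else y_coeff n d m / of_nat m)"

text \<open>The series variable is an auxiliary scale \<open>t\<close> that multiplies
  \<open>w\<close> and its conjugate alike. It records the total degree in both, which a power
  series in \<open>w\<close> alone cannot do.\<close>

definition numer_fps :: "nat \<Rightarrow> cusp_data \<times> complex \<Rightarrow> complex fps" where
  "numer_fps n = (\<lambda>(d, w). Abs_fps (\<lambda>m. y_coeff n d m * w ^ m))"

text \<open>From \<open>\<psi> = w exp \<eta>\<close>, the quotient of the logarithms of the moduli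
  of \<open>\<psi>\<close> and \<open>w\<close> is \<open>1 + Re \<eta> / ln (norm w)\<close>. The
  real part is half the sum with the conjugate, and \<open>ln (norm w)\<close> stays fixed while
  \<open>w\<close> is scaled.\<close>

definition denom_fps :: "nat \<Rightarrow> cusp_data \<times> complex \<Rightarrow> complex fps" where
  "denom_fps n = (\<lambda>(d, w). Abs_fps (\<lambda>m. if m = 0 then 1 else
     (eta_coeff n d m * w ^ m + cnj (eta_coeff n d m) * cnj w ^ m) / 2 / of_real (ln (norm w))))"

definition metric_coeff :: "nat \<Rightarrow> nat \<Rightarrow> cusp_data \<times> complex \<Rightarrow> complex" where
  "metric_coeff n m e = (numer_fps n e * inverse (denom_fps n e)) $ m"

lemma metric_coeff_poly: "metric_coeff n m \<in> polynomials_in (metric_gens n m)"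
proof -
  define P where "P = data_gens n \<union> (\<lambda>g d. cnj (g d)) ` data_gens n"
  have y: "(\<lambda>d. y_coeff n d m) \<in> polynomials_in P" for m
    using polynomials_in_map[OF y_coeff_poly, where h = "\<lambda>d. d" and G' = P]
    by (auto simp: P_def intro: polynomials_in.gen)
  have cy: "(\<lambda>d. cnj (y_coeff n d m)) \<in> polynomials_in P" for m
    using polynomials_in_cnj_map[OF y_coeff_poly, where h = "\<lambda>d. d" and G' = P]
    by (auto simp: P_def intro: polynomials_in.gen)
  have num: "(\<lambda>e. numer_fps n e $ m) \<in> bihomogeneous P m" for m
    using bihomogeneous.mono[OF y[of m], of m m 0] by (simp add: numer_fps_def case_prod_unfold)
  have den: "(\<lambda>e. denom_fps n e $ m) \<in> bihomogeneous P m" for m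
  proof (cases "m = 0")
    case False
    have 1: "(\<lambda>d. eta_coeff n d m / of_nat 2) \<in> polynomials_in P"
      using False polynomials_in_divide_nat[OF polynomials_in_divide_nat[OF y], of m m 2] by (simp add: eta_coeff_def)
    have 2: "(\<lambda>d. cnj (eta_coeff n d m) / of_nat 2) \<in> polynomials_in P"
      using False polynomials_in_divide_nat[OF polynomials_in_divide_nat[OF cy], of m m 2] by (simp add: eta_coeff_def)
    from bihomogeneous.add[OF bihomogeneous.mono[OF 1, of m m 1] bihomogeneous.mono[OF 2, of 0 m 1]] False
    show ?thesis by (simp add: denom_fps_def case_prod_unfold add_divide_distrib)
  qed (auto simp: denom_fps_def case_prod_unfold bihomogeneous_const)
  have "(\<lambda>e. denom_fps n e $ 0) = (\<lambda>_. 1)" by (auto simp: denom_fps_def)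
  then have inv: "(\<lambda>e. inverse (denom_fps n e) $ m) \<in> bihomogeneous P m" for m
    by (intro bihomogeneous_fps_inverse den) (metis)
  have "(\<lambda>e. numer_fps n e $ i * inverse (denom_fps n e) $ (m - i)) \<in> bihomogeneous P m" if "i \<in> {0..m}" for i
    using bihomogeneous_mult[OF num[of i] inv[of "m - i"]] that by simp
  then have "metric_coeff n m \<in> bihomogeneous P m"
    unfolding metric_coeff_def[abs_def] fps_mult_nth by (intro bihomogeneous_sum)
  \<comment> \<open>A monomial of weight \<open>m\<close> is a polynomial in the data and their
    conjugates times exactly one of the mixed quantities in \<open>metric_gens n m\<close>.\<close>
  moreover have "p \<in> polynomials_in (metric_gens n m)" if "p \<in> bihomogeneous P m" for p
    using that
  proof induction
    case (mono \<kappa> s j)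
    have "(\<lambda>e. \<kappa> (fst e)) \<in> polynomials_in (metric_gens n m)"
    proof (rule polynomials_in_map[OF mono(1)])
      fix g assume "g \<in> P"
      then have "(\<lambda>(d, w). g d) \<in> metric_gens n m"
        by (auto simp: P_def metric_gens_def)
      then show "(\<lambda>e. g (fst e)) \<in> polynomials_in (metric_gens n m)"
        using polynomials_in.gen by (fastforce simp: case_prod_unfold)
    qed
    moreover have "(\<lambda>(d, w). w ^ s * cnj w ^ (m - s) / of_real (ln (norm w)) ^ j) \<in> metric_gens n m"
      unfolding metric_gens_def using mono(2,3) by (auto intro!: image_eqI[of _ _ "(s, j)"])
    ultimately show ?case
      using polynomials_in.mult[OF _ polynomials_in.gen] by (fastforce simp: case_prod_unfold)
  qed (rule polynomials_in.add)
  ultimately show ?thesis by blast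
qed

lemma metric_coeff_low:
  "metric_coeff n 0 e = 1"
  "metric_coeff n 1 ((A, b, x, \<rho>), w) = - (b * w - of_real (Re (b * w) / ln (norm w)))"
proof -
  have y0: "y_coeff n d 0 = 1" for d by (simp add: y_coeff_def linear_coeff.simps)
  have u1: "u_coeff n (A, b, x, \<rho>) 1 = - b"
    by (simp add: u_coeff_def riccati_coeff.simps)
  have y1: "y_coeff n (A, b, x, \<rho>) 1 = - b"
    using u1 y0 by (simp add: y_coeff_def linear_coeff.simps[of _ "Suc 0"])
  show "metric_coeff n 0 e = 1"
    using y0 by (simp add: metric_coeff_def numer_fps_def denom_fps_def case_prod_unfold)
  have d0: "denom_fps n e $ 0 = 1" for e by (simp add: denom_fps_def case_prod_unfold)
  define e where "e = ((A, b, x, \<rho>), w)"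
  define L where "L = complex_of_real (Re (b * w) / ln (norm w))"
  have "inverse (denom_fps n e) $ 1 = - denom_fps n e $ 1"
  proof -
    have "0 = (denom_fps n e * inverse (denom_fps n e)) $ 1"
      using d0[of e] by (simp add: inverse_mult_eq_1')
    then show ?thesis using d0[of e] by (simp add: fps_mult_nth atLeast0_atMost_Suc eq_neg_iff_add_eq_0 add.commute)
  qed
  moreover have "denom_fps n e $ 1 = - L"
  proof -
    define r where "r = Re (b * w)"
    have r: "- b * w + cnj (- b) * cnj w = - 2 * of_real r"
      by (simp add: complex_eq_iff r_def)
    have "denom_fps n e $ 1 = (- b * w + cnj (- b) * cnj w) / 2 / of_real (ln (norm w))"
      using y1 by (simp add: denom_fps_def e_def eta_coeff_def)
    also have "\<dots> = of_real (- r / ln (norm w))" unfolding r by simp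
    finally show ?thesis by (simp add: r_def L_def del: times_complex.sel)
  qed
  moreover have "numer_fps n e $ 0 = 1" "numer_fps n e $ 1 = - b * w"
    using y0 y1 by (simp_all add: numer_fps_def e_def)
  ultimately show "metric_coeff n 1 ((A, b, x, \<rho>), w) = - (b * w - of_real (Re (b * w) / ln (norm w)))"
    using d0[of e] unfolding metric_coeff_def e_def[symmetric] L_def[symmetric]
    by (simp add: fps_mult_nth atLeast0_atMost_Suc)
qed

section \<open>Elementary facts on the upper half plane\<close>

abbreviation UH :: "complex set" where "UH \<equiv> upper_half_plane"

lemma UH_iff: "\<tau> \<in> UH \<longleftrightarrow> Im \<tau> > 0"
  by (simp add: upper_half_plane_def)

lemma open_UH: "open UH" and convex_UH: "convex UH" and connected_UH: "connected UH"
proof -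
  show "open UH" "convex UH"
    unfolding upper_half_plane_def by (simp_all add: open_halfspace_Im_gt convex_halfspace_Im_gt)
  then show "connected UH" by (simp add: convex_connected)
qed

lemma i_in_UH: "\<i> \<in> UH" by (simp add: UH_iff)

subsection \<open>Holomorphic self-maps of the upper half plane\<close>

text \<open>Its modulus is the pseudohyperbolic distance \<open>tanh (d / 2)\<close> of
  \<open>p\<close> and \<open>\<tau>\<close>, where \<open>d\<close> is the hyperbolic distance;
  displacements are measured in this form below.\<close>

definition cayley :: "complex \<Rightarrow> complex \<Rightarrow> complex" where
  "cayley p \<tau> = (\<tau> - p) / (\<tau> - cnj p)"

definition cayley_inv :: "complex \<Rightarrow> complex \<Rightarrow> complex" where
  "cayley_inv p z = (p - cnj p * z) / (1 - z)"

lemma UH_diff_cnj_nz: "p \<in> UH \<Longrightarrow> \<tau> \<in> UH \<Longrightarrow> \<tau> - cnj p \<noteq> 0"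
  by (auto simp: UH_iff complex_eq_iff)

text \<open>The source of the bound \<open>norm (cayley p \<tau>) < 1\<close> and of the
  displacement estimate for Moebius transformations.\<close>

lemma norm_diff_cnj: "(norm (\<tau> - cnj p))\<^sup>2 = (norm (\<tau> - p))\<^sup>2 + 4 * Im \<tau> * Im p"
  unfolding cmod_power2 by (simp add: power2_eq_square algebra_simps)

lemma norm_cayley_less: "p \<in> UH \<Longrightarrow> \<tau> \<in> UH \<Longrightarrow> norm (cayley p \<tau>) < 1"
proof -
  assume p: "p \<in> UH" and t: "\<tau> \<in> UH"
  then have "(norm (\<tau> - p))\<^sup>2 < (norm (\<tau> - cnj p))\<^sup>2"
    unfolding norm_diff_cnj by (simp add: UH_iff)
  then have "norm (\<tau> - p) < norm (\<tau> - cnj p)"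
    using power2_less_imp_less norm_ge_zero by blast
  then show ?thesis
    using UH_diff_cnj_nz[OF p t] by (simp add: cayley_def norm_divide)
qed

lemma cayley_inv_in: "p \<in> UH \<Longrightarrow> norm z < 1 \<Longrightarrow> cayley_inv p z \<in> UH"
proof -
  assume p: "p \<in> UH" and z: "norm z < 1"
  then have nz: "1 - z \<noteq> 0" by auto
  have eq: "cayley_inv p z = (p - cnj p * z) * cnj (1 - z) / of_real ((norm (1 - z))\<^sup>2)"
    unfolding cayley_inv_def by (rule complex_div_cnj)
  have "Im ((p - cnj p * z) * cnj (1 - z)) = Im p * (1 - (norm z)\<^sup>2)"
    unfolding cmod_power2 by (simp add: power2_eq_square algebra_simps)
  moreover have "(norm z)\<^sup>2 < 1" using z by (simp add: abs_square_less_1)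
  ultimately have "Im ((p - cnj p * z) * cnj (1 - z)) > 0"
    using p by (simp add: UH_iff)
  moreover have "(norm (1 - z))\<^sup>2 > 0" using nz by simp
  ultimately show ?thesis unfolding eq UH_iff Im_divide_of_real by simp
qed

lemma cayley_inv_cayley: "p \<in> UH \<Longrightarrow> \<tau> \<in> UH \<Longrightarrow> cayley_inv p (cayley p \<tau>) = \<tau>"
proof -
  assume p: "p \<in> UH" and t: "\<tau> \<in> UH"
  have 1: "\<tau> - cnj p \<noteq> 0" and 2: "p - cnj p \<noteq> 0"
    using UH_diff_cnj_nz p t by auto
  have e1: "1 - cayley p \<tau> = (p - cnj p) / (\<tau> - cnj p)"
    using 1 by (simp add: cayley_def field_simps)
  have e2: "p - cnj p * cayley p \<tau> = \<tau> * (p - cnj p) / (\<tau> - cnj p)"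
    using 1 by (simp add: cayley_def field_simps)
  show ?thesis unfolding cayley_inv_def e1 e2 using 1 2 by simp
qed

text \<open>Moving \<open>p\<close> and \<open>g p\<close> to the centre of the disc makes the
  Schwarz lemma applicable; the last clause translates its conclusion back.\<close>

lemma cayley_conj_Schwarz:
  assumes g: "g holomorphic_on UH" "g ` UH \<subseteq> UH" and p: "p \<in> UH"
  defines "G \<equiv> \<lambda>z. cayley (g p) (g (cayley_inv p z))"
  shows "G holomorphic_on ball 0 1" "G 0 = 0" "\<And>z. norm z < 1 \<Longrightarrow> norm (G z) < 1"
    "\<And>\<tau>. \<tau> \<in> UH \<Longrightarrow> G (cayley p \<tau>) = cayley (g p) (g \<tau>)"
proof -
  have gp: "g p \<in> UH" using g p by auto
  have 1: "cayley_inv p holomorphic_on ball 0 1"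
    unfolding cayley_inv_def[abs_def] by (intro holomorphic_intros) auto
  have 2: "(g \<circ> cayley_inv p) holomorphic_on ball 0 1"
    using cayley_inv_in[OF p] by (intro holomorphic_on_compose_gen[OF 1 g(1)]) auto
  have 3: "cayley (g p) holomorphic_on UH"
    unfolding cayley_def[abs_def] using UH_diff_cnj_nz[OF gp] by (intro holomorphic_intros) auto
  have "(cayley (g p) \<circ> (g \<circ> cayley_inv p)) holomorphic_on ball 0 1"
    using cayley_inv_in[OF p] g(2) by (intro holomorphic_on_compose_gen[OF 2 3]) auto
  then show "G holomorphic_on ball 0 1" by (simp add: G_def o_def)
  show "G 0 = 0" by (simp add: G_def cayley_def cayley_inv_def)
  show "norm (G z) < 1" if "norm z < 1" for z
    unfolding G_def using cayley_inv_in[OF p that] g gp by (intro norm_cayley_less) auto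
  show "G (cayley p \<tau>) = cayley (g p) (g \<tau>)" if "\<tau> \<in> UH" for \<tau>
    using cayley_inv_cayley[OF p that] by (simp add: G_def)
qed

lemma Schwarz_Pick_UH:
  assumes g: "g holomorphic_on UH" "g ` UH \<subseteq> UH" and p: "p \<in> UH" and t: "\<tau> \<in> UH"
  shows "norm (cayley (g p) (g \<tau>)) \<le> norm (cayley p \<tau>)"
  using Schwarz_Lemma(1)[OF cayley_conj_Schwarz(1-3)[OF g p] norm_cayley_less[OF p t]]
    cayley_conj_Schwarz(4)[OF g p t] by simp

section \<open>Real Moebius transformations\<close>

definition real_moebius :: "real \<Rightarrow> real \<Rightarrow> real \<Rightarrow> real \<Rightarrow> complex \<Rightarrow> complex" where
  "real_moebius a b c d \<tau> = (of_real a * \<tau> + of_real b) / (of_real c * \<tau> + of_real d)"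

lemma real_moebius_denom_nz:
  assumes "a * d - b * c = 1" "\<tau> \<in> UH"
  shows "of_real c * \<tau> + of_real d \<noteq> 0"
  using assms by (auto simp: complex_eq_iff UH_iff)

lemma Im_real_moebius:
  assumes "a * d - b * c = 1" "\<tau> \<in> UH"
  shows "Im (real_moebius a b c d \<tau>) = Im \<tau> / (norm (of_real c * \<tau> + of_real d))\<^sup>2"
proof -
  have "Im ((of_real a * \<tau> + of_real b) * cnj (of_real c * \<tau> + of_real d)) = (a * d - b * c) * Im \<tau>"
    by (simp add: algebra_simps)
  moreover have "real_moebius a b c d \<tau>
      = (of_real a * \<tau> + of_real b) * cnj (of_real c * \<tau> + of_real d) / of_real ((norm (of_real c * \<tau> + of_real d))\<^sup>2)"
    unfolding real_moebius_def by (rule complex_div_cnj)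
  ultimately show ?thesis using assms(1) by (simp only: Im_divide_of_real)
qed

lemma real_moebius_has_derivative:
  assumes "a * d - b * c = 1" "\<tau> \<in> UH"
  shows "(real_moebius a b c d has_field_derivative 1 / (of_real c * \<tau> + of_real d)\<^sup>2) (at \<tau>)"
proof -
  have nz: "of_real c * \<tau> + of_real d \<noteq> (0::complex)" by (rule real_moebius_denom_nz[OF assms])
  have "complex_of_real (a * d - b * c) = 1" using assms(1) by simp
  then have e: "of_real a * (of_real c * \<tau> + of_real d) - (of_real a * \<tau> + of_real b) * of_real c = (1::complex)"
    by (simp add: algebra_simps)
  have "((\<lambda>\<tau>. (of_real a * \<tau> + of_real b) / (of_real c * \<tau> + of_real d)) has_field_derivative
     (of_real a * (of_real c * \<tau> + of_real d) - (of_real a * \<tau> + of_real b) * of_real c)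
       / ((of_real c * \<tau> + of_real d) * (of_real c * \<tau> + of_real d))) (at \<tau>)"
    using nz by (auto intro!: derivative_eq_intros)
  then show ?thesis unfolding real_moebius_def[abs_def] e power2_eq_square .
qed

text \<open>The left inverse \<open>h\<close> turns the Schwarz-Pick inequality into an equality, so
  the map conjugated to the disc is a rotation by some \<open>\<alpha>\<close>. The rest extracts a
  real matrix of determinant 1 from \<open>\<alpha>\<close> and \<open>q = g \<i>\<close>.\<close>

lemma UH_automorphism_moebius:
  assumes g: "g holomorphic_on UH" "g ` UH \<subseteq> UH" and h: "h holomorphic_on UH" "h ` UH \<subseteq> UH"
    and inv: "\<And>\<tau>. \<tau> \<in> UH \<Longrightarrow> h (g \<tau>) = \<tau>"
  obtains a b c d where "a * d - b * c = 1" "\<And>\<tau>. \<tau> \<in> UH \<Longrightarrow> g \<tau> = real_moebius a b c d \<tau>"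
proof -
  define q where "q = g \<i>"
  have q: "q \<in> UH" using g i_in_UH by (auto simp: q_def)
  define G where "G = (\<lambda>z. cayley (g \<i>) (g (cayley_inv \<i> z)))"
  have G: "G holomorphic_on ball 0 1" "G 0 = 0" "\<And>z. norm z < 1 \<Longrightarrow> norm (G z) < 1"
    "\<And>\<tau>. \<tau> \<in> UH \<Longrightarrow> G (cayley \<i> \<tau>) = cayley (g \<i>) (g \<tau>)"
    unfolding G_def using cayley_conj_Schwarz[OF g i_in_UH] by blast+
  \<comment> \<open>Any point other than \<open>\<i>\<close> would do: equality in the Schwarz lemma
    at one nonzero point forces a rotation.\<close>
  define \<tau>1 :: complex where "\<tau>1 = 2 * \<i>"
  have t1: "\<tau>1 \<in> UH" by (simp add: \<tau>1_def UH_iff)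
  have "norm (cayley \<i> \<tau>1) \<le> norm (cayley q (g \<tau>1))"
    using Schwarz_Pick_UH[OF h q, of "g \<tau>1"] inv[OF i_in_UH] inv[OF t1] g t1 by (auto simp: q_def)
  moreover have "norm (cayley q (g \<tau>1)) \<le> norm (cayley \<i> \<tau>1)"
    using Schwarz_Pick_UH[OF g i_in_UH t1] by (simp add: q_def)
  ultimately have "norm (G (cayley \<i> \<tau>1)) = norm (cayley \<i> \<tau>1)"
    using G(4)[OF t1] by (simp add: q_def)
  moreover have "norm (cayley \<i> \<tau>1) < 1" by (rule norm_cayley_less[OF i_in_UH t1])
  moreover have "cayley \<i> \<tau>1 \<noteq> 0" by (simp add: cayley_def \<tau>1_def)
  ultimately obtain \<alpha> where \<alpha>: "\<And>z. norm z < 1 \<Longrightarrow> G z = \<alpha> * z" "norm \<alpha> = 1"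
    using Schwarz_Lemma(3)[OF G(1-3), of 0] by auto
  \<comment> \<open>The square root splits \<open>\<alpha> = \<omega> / cnj \<omega>\<close> between
    the two sides of the equation for \<open>g \<tau>\<close>; after collecting terms every
    coefficient is \<open>2 * \<i>\<close> times a real number.\<close>
  define \<omega> where "\<omega> = csqrt \<alpha>"
  have \<omega>2: "\<omega>\<^sup>2 = \<alpha>" by (simp add: \<omega>_def)
  then have "(norm \<omega>)\<^sup>2 = 1" using \<alpha>(2) by (metis norm_power)
  then have n\<omega>: "norm \<omega> = 1" by (simp add: power2_eq_1_iff) (use norm_ge_zero[of \<omega>] in linarith)
  have \<omega>c: "\<omega> * cnj \<omega> = 1" using n\<omega> by (simp add: complex_norm_square[symmetric])
  \<comment> \<open>The real matrix read off from the equation has determinant \<open>Im q\<close>;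
    division by its square root normalises it.\<close>
  define r where "r = sqrt (Im q)"
  have r: "r > 0" "r * r = Im q" using q by (simp_all add: r_def UH_iff)
  define a where "a = Im (cnj \<omega> * q) / r"
  define b where "b = Re (cnj \<omega> * q) / r"
  define c where "c = - Im \<omega> / r"
  define d where "d = Re \<omega> / r"
  have "(Re \<omega>)\<^sup>2 + (Im \<omega>)\<^sup>2 = 1" using \<open>(norm \<omega>)\<^sup>2 = 1\<close> by (simp add: cmod_power2)
  then have "Im (cnj \<omega> * q) * Re \<omega> + Re (cnj \<omega> * q) * Im \<omega> = Im q"
    by (simp add: power2_eq_square algebra_simps) (metis (no_types) distrib_left mult.commute mult.left_commute mult_1)
  then have det: "a * d - b * c = 1"
    using r q by (simp add: a_def b_def c_def d_def divide_simps UH_iff)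
  have "g \<tau> = real_moebius a b c d \<tau>" if t: "\<tau> \<in> UH" for \<tau>
  proof -
    define g0 where "g0 = g \<tau>"
    have gt: "g0 \<in> UH" using g t by (auto simp: g0_def)
    have K: "cayley q g0 = \<alpha> * cayley \<i> \<tau>"
      using \<alpha>(1)[OF norm_cayley_less[OF i_in_UH t]] G(4)[OF t] by (simp add: q_def g0_def)
    have nz1: "g0 - cnj q \<noteq> 0" by (rule UH_diff_cnj_nz[OF q gt])
    have nz2: "\<tau> + \<i> \<noteq> 0" using UH_diff_cnj_nz[OF i_in_UH t] by simp
    have K': "(g0 - q) * (\<tau> + \<i>) = \<alpha> * (\<tau> - \<i>) * (g0 - cnj q)"
      using K nz1 nz2 by (simp add: cayley_def field_simps)
    have "cnj \<omega> * \<alpha> = \<omega>" using \<omega>c by (simp add: \<omega>2[symmetric] power2_eq_square mult_ac)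
    then have K'': "cnj \<omega> * ((g0 - q) * (\<tau> + \<i>)) = \<omega> * (\<tau> - \<i>) * (g0 - cnj q)"
      unfolding K' by (simp add: mult.assoc[symmetric])
    have I: "cnj \<omega> - \<omega> = - 2 * \<i> * of_real (Im \<omega>)" "cnj \<omega> + \<omega> = 2 * of_real (Re \<omega>)"
       "cnj \<omega> * q - \<omega> * cnj q = 2 * \<i> * of_real (Im (cnj \<omega> * q))"
       "cnj \<omega> * q + \<omega> * cnj q = 2 * of_real (Re (cnj \<omega> * q))"
      by (simp_all add: complex_eq_iff)
    have "g0 * ((cnj \<omega> - \<omega>) * \<tau> + \<i> * (cnj \<omega> + \<omega>)) = (cnj \<omega> * q - \<omega> * cnj q) * \<tau> + \<i> * (cnj \<omega> * q + \<omega> * cnj q)"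
      using K'' by (simp add: algebra_simps)
    then have "(2 * \<i>) * (g0 * (of_real (- Im \<omega>) * \<tau> + of_real (Re \<omega>))) = (2 * \<i>) * (of_real (Im (cnj \<omega> * q)) * \<tau> + of_real (Re (cnj \<omega> * q)))"
      unfolding I by (simp add: algebra_simps)
    then have e1: "g0 * (of_real (- Im \<omega>) * \<tau> + of_real (Re \<omega>)) = of_real (Im (cnj \<omega> * q)) * \<tau> + of_real (Re (cnj \<omega> * q))"
      by (subst (asm) mult_cancel_left) simp
    have rc: "complex_of_real r \<noteq> 0" using r by simp
    have "- Im \<omega> = r * c" "Re \<omega> = r * d" "Im (cnj \<omega> * q) = r * a" "Re (cnj \<omega> * q) = r * b"
      using r(1) by (simp_all add: a_def b_def c_def d_def)
    then have "of_real r * (g0 * (of_real c * \<tau> + of_real d)) = of_real r * (of_real a * \<tau> + of_real b)"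
      using e1 by (simp add: algebra_simps)
    then have "g0 * (of_real c * \<tau> + of_real d) = of_real a * \<tau> + of_real b"
      using rc by simp
    then show ?thesis using real_moebius_denom_nz[OF det t]
      by (simp add: real_moebius_def g0_def field_simps)
  qed
  with det show ?thesis by (rule that)
qed

text \<open>With \<open>P \<tau> = c \<tau>\<^sup>2 + (d - a) \<tau> - b\<close>, the ratio \<open>norm (P \<tau>) / Im \<tau>\<close> measures the hyperbolic
  displacement of \<open>\<tau>\<close>.\<close>

lemma moebius_displacement:
  assumes det: "a * d - b * c = 1" and t: "\<tau> \<in> UH"
    and le: "norm (cayley \<tau> (real_moebius a b c d \<tau>)) \<le> \<delta>" and \<delta>: "0 \<le> \<delta>" "\<delta> \<le> 1 / 2"
  shows "((c * ((Re \<tau>)\<^sup>2 + (Im \<tau>)\<^sup>2) + (d - a) * Re \<tau> - b) / Im \<tau>)\<^sup>2 + ((a + d)\<^sup>2 - 4) \<le> 16 / 3 * \<delta>\<^sup>2"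
proof -
  define g where "g = real_moebius a b c d \<tau>"
  define D where "D = of_real c * \<tau> + of_real d"
  define x where "x = Re \<tau>"
  define y where "y = Im \<tau>"
  have y: "y > 0" using t by (simp add: y_def UH_iff)
  have Img: "Im g = y / (norm D)\<^sup>2" using Im_real_moebius[OF det t] by (simp add: g_def D_def y_def)
  have D: "D \<noteq> 0" using real_moebius_denom_nz[OF det t] by (simp add: D_def)
  have gU: "g \<in> UH" using Img y D by (simp add: UH_iff)
  define N where "N = (norm (g - \<tau>))\<^sup>2"
  have "(norm (g - cnj \<tau>))\<^sup>2 = N + 4 * Im g * y" by (simp add: norm_diff_cnj N_def y_def)
  moreover have "N \<le> \<delta>\<^sup>2 * (norm (g - cnj \<tau>))\<^sup>2"
  proof -
    have "norm (g - \<tau>) \<le> \<delta> * norm (g - cnj \<tau>)"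
      using le UH_diff_cnj_nz[OF t gU] by (simp add: cayley_def g_def norm_divide divide_simps)
    then have "(norm (g - \<tau>))\<^sup>2 \<le> (\<delta> * norm (g - cnj \<tau>))\<^sup>2" by (intro power_mono) auto
    then show ?thesis by (simp add: N_def power_mult_distrib)
  qed
  ultimately have "N \<le> \<delta>\<^sup>2 * (N + 4 * Im g * y)" by simp
  then have N1: "N * (1 - \<delta>\<^sup>2) \<le> \<delta>\<^sup>2 * (4 * Im g * y)" by (simp add: algebra_simps)
  have d4: "\<delta>\<^sup>2 \<le> 1 / 4" using power_mono[OF \<delta>(2) \<delta>(1), of 2] by (simp add: power2_eq_square)
  have N0: "N \<ge> 0" by (simp add: N_def)
  \<comment> \<open>Since \<open>\<delta> \<le> 1 / 2\<close>, the factor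
    \<open>1 - \<delta>\<^sup>2\<close> is at least 3/4; this is the origin of 16/3 = 4 /
    (3/4).\<close>
  have "N * (3 / 4) \<le> N * (1 - \<delta>\<^sup>2)" using d4 N0 by (intro mult_left_mono) auto
  then have "N * (3/4) \<le> \<delta>\<^sup>2 * (4 * Im g * y)" using N1 by linarith
  then have N2: "N \<le> 16 / 3 * \<delta>\<^sup>2 * (Im g * y)" by simp
  have P: "(g - \<tau>) * D = - (of_real c * \<tau>\<^sup>2 + of_real (d - a) * \<tau> - of_real b)"
  proof -
    have "g * D = of_real a * \<tau> + of_real b" using D by (simp add: g_def real_moebius_def D_def)
    then have "(g - \<tau>) * D = of_real a * \<tau> + of_real b - \<tau> * D" by (simp add: left_diff_distrib)
    then show ?thesis by (simp add: D_def power2_eq_square algebra_simps)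
  qed
  have "N * (norm D)\<^sup>2 = (norm (of_real c * \<tau>\<^sup>2 + of_real (d - a) * \<tau> - of_real b))\<^sup>2"
    using arg_cong[OF P, of norm] by (simp add: norm_mult N_def norm_minus_commute power_mult_distrib[symmetric])
  also have "\<dots> = (c * (x\<^sup>2 - y\<^sup>2) + (d - a) * x - b)\<^sup>2 + (y * (2 * c * x + (d - a)))\<^sup>2"
    unfolding cmod_power2 by (simp add: x_def y_def power2_eq_square algebra_simps)
  \<comment> \<open>A regrouping of the two squares whose remainder
    \<open>(d - a)\<^sup>2 + 4 * b * c\<close> is the discriminant of the fixed point equation,
    hence depends on the trace only.\<close>
  also have "\<dots> = (c * (x\<^sup>2 + y\<^sup>2) + (d - a) * x - b)\<^sup>2 + y\<^sup>2 * ((d - a)\<^sup>2 + 4 * b * c)"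
    by (simp add: power2_eq_square algebra_simps)
  also have "(d - a)\<^sup>2 + 4 * b * c = (a + d)\<^sup>2 - 4"
    using det by (simp add: power2_eq_square algebra_simps)
  finally have E: "N * (norm D)\<^sup>2 = (c * (x\<^sup>2 + y\<^sup>2) + (d - a) * x - b)\<^sup>2 + y\<^sup>2 * ((a + d)\<^sup>2 - 4)" .
  have "N * (norm D)\<^sup>2 \<le> 16 / 3 * \<delta>\<^sup>2 * (Im g * y) * (norm D)\<^sup>2"
    using N2 by (intro mult_right_mono) auto
  also have "\<dots> = 16 / 3 * \<delta>\<^sup>2 * y\<^sup>2" using D by (simp add: Img power2_eq_square)
  finally have "(c * (x\<^sup>2 + y\<^sup>2) + (d - a) * x - b)\<^sup>2 + y\<^sup>2 * ((a + d)\<^sup>2 - 4) \<le> 16 / 3 * \<delta>\<^sup>2 * y\<^sup>2"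
    using E by simp
  then have "((c * (x\<^sup>2 + y\<^sup>2) + (d - a) * x - b)\<^sup>2 + y\<^sup>2 * ((a + d)\<^sup>2 - 4)) / y\<^sup>2 \<le> 16 / 3 * \<delta>\<^sup>2"
    using y by (simp add: divide_le_eq)
  also have "((c * (x\<^sup>2 + y\<^sup>2) + (d - a) * x - b)\<^sup>2 + y\<^sup>2 * ((a + d)\<^sup>2 - 4)) / y\<^sup>2
     = ((c * (x\<^sup>2 + y\<^sup>2) + (d - a) * x - b) / y)\<^sup>2 + ((a + d)\<^sup>2 - 4)"
    using y by (simp add: add_divide_distrib power_divide)
  finally show ?thesis unfolding x_def y_def .
qed

text \<open>The fixed point equation \<open>c \<tau>\<^sup>2 + (d - a) \<tau> - b = 0\<close> has
  discriminant \<open>(a + d)\<^sup>2 - 4 < 0\<close>, so its roots are complex conjugate and one of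
  them lies above the real axis.\<close>

lemma moebius_fixed_point:
  assumes det: "a * d - b * c = 1" and tr: "(a + d)\<^sup>2 < 4"
  obtains \<tau> where "\<tau> \<in> UH" "real_moebius a b c d \<tau> = \<tau>"
proof -
  have c: "c \<noteq> 0"
  proof
    assume "c = 0"
    then have "(a - d)\<^sup>2 = (a + d)\<^sup>2 - 4" using det by (simp add: power2_eq_square algebra_simps)
    then have "(a - d)\<^sup>2 < 0" using tr by simp
    then show False by simp
  qed
  define s where "s = sqrt (4 - (a + d)\<^sup>2)"
  have s: "s > 0" "s * s = 4 - (a + d)\<^sup>2" using tr by (simp_all add: s_def)
  \<comment> \<open>A root of that quadratic equation; \<open>\<bar>c\<bar>\<close> in place of
    \<open>c\<close> selects the upper one.\<close>
  define \<tau> where "\<tau> = Complex ((a - d) / (2 * c)) (s / (2 * \<bar>c\<bar>))"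
  have t: "\<tau> \<in> UH" using s c by (simp add: \<tau>_def UH_iff)
  have "4 * (c * c) = 4 * (\<bar>c\<bar> * \<bar>c\<bar>)" by simp
  have "c * ((Re \<tau>)\<^sup>2 - (Im \<tau>)\<^sup>2) + (d - a) * Re \<tau> - b = 0"
  proof -
    have 1: "(Re \<tau>)\<^sup>2 = (a - d)\<^sup>2 / (4 * c\<^sup>2)" "(Im \<tau>)\<^sup>2 = (4 - (a + d)\<^sup>2) / (4 * c\<^sup>2)"
      using s(2) by (simp_all add: \<tau>_def power_divide power_mult_distrib power2_eq_square[of s])
    have 2: "(d - a) * Re \<tau> = - (a - d)\<^sup>2 / (2 * c)" by (simp add: \<tau>_def power2_eq_square algebra_simps)
    have bc: "b * c = a * d - 1" using det by simp
    have "c * ((a - d)\<^sup>2 / (4 * c\<^sup>2) - (4 - (a + d)\<^sup>2) / (4 * c\<^sup>2)) + - (a - d)\<^sup>2 / (2 * c) - b = 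
       ((a - d)\<^sup>2 - (4 - (a + d)\<^sup>2) - 2 * (a - d)\<^sup>2 - 4 * (b * c)) / (4 * c)"
      using c by (simp add: divide_simps power2_eq_square)
    also have "\<dots> = 0" unfolding bc by (simp add: power2_eq_square algebra_simps)
    finally show ?thesis unfolding 1 2 .
  qed
  moreover have "Re (of_real c * \<tau>\<^sup>2 + of_real (d - a) * \<tau> - of_real b) = c * ((Re \<tau>)\<^sup>2 - (Im \<tau>)\<^sup>2) + (d - a) * Re \<tau> - b"
    "Im (of_real c * \<tau>\<^sup>2 + of_real (d - a) * \<tau> - of_real b) = Im \<tau> * (2 * c * Re \<tau> + (d - a))"
    by (simp_all add: power2_eq_square algebra_simps)
  moreover have "2 * c * Re \<tau> + (d - a) = 0" using c by (simp add: \<tau>_def)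
  ultimately have "of_real c * \<tau>\<^sup>2 + of_real (d - a) * \<tau> - of_real b = 0"
    by (intro complex_eqI) simp_all
  then have "of_real a * \<tau> + of_real b = \<tau> * (of_real c * \<tau> + of_real d)"
    by (simp add: power2_eq_square algebra_simps)
  then have "real_moebius a b c d \<tau> = \<tau>"
    using real_moebius_denom_nz[OF det t] by (simp add: real_moebius_def)
  with t show ?thesis by (rule that)
qed

text \<open>The translation constant is 0 in the case of the identity.\<close>

lemma moebius_parabolic:
  assumes det: "a * d - b * c = 1" and tr: "(a + d)\<^sup>2 = 4"
  obtains r k where "\<And>\<tau>. \<tau> \<in> UH \<Longrightarrow> cusp_coord r (real_moebius a b c d \<tau>) = cusp_coord r \<tau> + of_real k"
     "c = 0 \<Longrightarrow> r = None"
proof -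
  have \<epsilon>: "a + d = 2 \<or> a + d = -2"
    using tr power2_eq_iff[of "a + d" 2] by simp
  show ?thesis
  proof (cases "c = 0")
    case True
    have "(a - d)\<^sup>2 = 0" using det tr True by (simp add: power2_eq_square algebra_simps)
    then have "a = d" by simp
    with \<epsilon> True have "(a = 1 \<and> d = 1) \<or> (a = -1 \<and> d = -1)" by auto
    then have "cusp_coord None (real_moebius a b c d \<tau>) = cusp_coord None \<tau> + of_real (b * d)" for \<tau>
      using True by (auto simp: real_moebius_def field_simps)
    then show ?thesis by (intro that[of None "b * d"]) auto
  next
    case False
    \<comment> \<open>The double root of the fixed point equation, whose discriminant is 0
      here.\<close>
    define r where "r = (a - d) / (2 * c)"
    \<comment> \<open>Half the trace, hence 1 or -1; together with \<open>c\<close> and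
      \<open>r\<close> it determines the whole matrix.\<close>
    define e where "e = (a + d) / 2"
    have e: "e * e = 1" using \<epsilon> by (auto simp: e_def)
    have a: "a = e + c * r" and d: "d = e - c * r"
      using False by (simp_all add: r_def e_def field_simps)
    have "b * c = - c * r * (c * r)" using det e unfolding a d by (simp add: algebra_simps)
      then have "b * c = (- c * r * r) * c" by simp
    then have b: "b = - c * r * r" using False mult_cancel_right by blast
    have "cusp_coord (Some r) (real_moebius a b c d \<tau>) = cusp_coord (Some r) \<tau> + of_real (- c * e)" if t: "\<tau> \<in> UH" for \<tau>
    proof -
      define D where "D = of_real c * \<tau> + of_real d"
      have D: "D \<noteq> 0" using real_moebius_denom_nz[OF det t] by (simp add: D_def)
      have tr: "\<tau> - of_real r \<noteq> 0" using t by (auto simp: UH_iff complex_eq_iff)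
      have ec: "complex_of_real e * of_real e = 1" using e by (metis of_real_mult of_real_1)
      have "real_moebius a b c d \<tau> - of_real r = (of_real a * \<tau> + of_real b - of_real r * D) / D"
        using D by (simp add: real_moebius_def D_def diff_divide_distrib)
      also have "of_real a * \<tau> + of_real b - of_real r * D = of_real e * (\<tau> - of_real r)"
        by (simp add: D_def a b d algebra_simps)
      finally have "cusp_coord (Some r) (real_moebius a b c d \<tau>) = - (D / (of_real e * (\<tau> - of_real r)))"
        by simp
      also have "D / (of_real e * (\<tau> - of_real r)) = (of_real e * D) / (\<tau> - of_real r)"
        using ec tr by (auto simp: divide_simps)
      also have "of_real e * D = 1 + of_real e * of_real c * (\<tau> - of_real r)"
        using ec by (simp add: D_def d algebra_simps)
      finally show ?thesis using tr by (simp add: field_simps)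
    qed
    with False show ?thesis by (intro that[of "Some r" "- c * e"]) auto
  qed
qed

subsection \<open>The Schwarzian derivative\<close>

text \<open>This is \<open>2 (f'' / f')' - (f'' / f')\<^sup>2\<close> with the derivative of the
  quotient carried out, thus twice the classical Schwarzian.\<close>

definition schwarzian :: "(complex \<Rightarrow> complex) \<Rightarrow> complex \<Rightarrow> complex" where
  "schwarzian f z = 2 * (deriv (deriv (deriv f)) z / deriv f z) - 3 * (deriv (deriv f) z / deriv f z)\<^sup>2"

lemma deriv_cong_open:
  assumes "open S" "z \<in> S" "\<And>z. z \<in> S \<Longrightarrow> f z = g z"
  shows "deriv f z = deriv g z"
  using assms by (intro deriv_cong_ev) (auto simp: eventually_nhds)

lemma schwarzian_cong:
  assumes S: "open S" "z \<in> S" and eq: "\<And>z. z \<in> S \<Longrightarrow> f z = g z"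
  shows "schwarzian f z = schwarzian g z"
proof -
  have 1: "deriv f z = deriv g z" if "z \<in> S" for z
    using deriv_cong_open[OF S(1) that eq] .
  have 2: "deriv (deriv f) z = deriv (deriv g) z" if "z \<in> S" for z
    using deriv_cong_open[OF S(1) that 1] .
  have 3: "deriv (deriv (deriv f)) z = deriv (deriv (deriv g)) z"
    using deriv_cong_open[OF S 2] .
  show ?thesis unfolding schwarzian_def 1[OF S(2)] 2[OF S(2)] 3 ..
qed

text \<open>Iterated \<open>deriv\<close> can be evaluated once each derivative is known on an open
  set and not just at the point, hence formulas on all of \<open>S\<close>.\<close>

lemma derivs_eqI:
  assumes S: "open S" "z \<in> S"
    and 1: "\<And>z. z \<in> S \<Longrightarrow> (f has_field_derivative f1 z) (at z)"
    and 2: "\<And>z. z \<in> S \<Longrightarrow> (f1 has_field_derivative f2 z) (at z)"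
    and 3: "\<And>z. z \<in> S \<Longrightarrow> (f2 has_field_derivative f3 z) (at z)"
  shows "deriv f z = f1 z" "deriv (deriv f) z = f2 z" "deriv (deriv (deriv f)) z = f3 z"
proof -
  have d1: "deriv f z = f1 z" if "z \<in> S" for z using DERIV_imp_deriv[OF 1[OF that]] .
  have d2: "deriv (deriv f) z = f2 z" if "z \<in> S" for z
    using deriv_cong_open[OF S(1) that d1] DERIV_imp_deriv[OF 2[OF that]] by simp
  have d3: "deriv (deriv (deriv f)) z = f3 z" if "z \<in> S" for z
    using deriv_cong_open[OF S(1) that d2] DERIV_imp_deriv[OF 3[OF that]] by simp
  show "deriv f z = f1 z" "deriv (deriv f) z = f2 z" "deriv (deriv (deriv f)) z = f3 z"
    using d1 d2 d3 S(2) by auto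
qed

lemma deriv_compose_derivs:
  assumes S: "open S" "z \<in> S" and T: "open T"
    and h: "h holomorphic_on S" "h ` S \<subseteq> T" and g: "g holomorphic_on T"
  shows "deriv (\<lambda>z. g (h z)) z = deriv g (h z) * deriv h z"
    "deriv (deriv (\<lambda>z. g (h z))) z = deriv (deriv g) (h z) * (deriv h z)\<^sup>2 + deriv g (h z) * deriv (deriv h) z"
    "deriv (deriv (deriv (\<lambda>z. g (h z)))) z = deriv (deriv (deriv g)) (h z) * (deriv h z) ^ 3
       + 3 * deriv (deriv g) (h z) * deriv h z * deriv (deriv h) z
       + deriv g (h z) * deriv (deriv (deriv h)) z"
proof -
  have dh: "(h has_field_derivative deriv h z) (at z)"
    "(deriv h has_field_derivative deriv (deriv h) z) (at z)"
    "(deriv (deriv h) has_field_derivative deriv (deriv (deriv h)) z) (at z)" if "z \<in> S" for z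
    using that S by (auto intro!: holomorphic_derivI[of _ S] holomorphic_deriv h)
  have dg: "(g has_field_derivative deriv g z) (at z)"
    "(deriv g has_field_derivative deriv (deriv g) z) (at z)"
    "(deriv (deriv g) has_field_derivative deriv (deriv (deriv g)) z) (at z)" if "z \<in> T" for z
    using that T by (auto intro!: holomorphic_derivI[of _ T] holomorphic_deriv g)
  have hT: "h z \<in> T" if "z \<in> S" for z using that h(2) by auto
  have c: "((\<lambda>z. g (h z)) has_field_derivative deriv g (h z) * deriv h z) (at z)"
    "((\<lambda>z. deriv g (h z)) has_field_derivative deriv (deriv g) (h z) * deriv h z) (at z)"
    "((\<lambda>z. deriv (deriv g) (h z)) has_field_derivative deriv (deriv (deriv g)) (h z) * deriv h z) (at z)"
    if "z \<in> S" for z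
    using DERIV_chain2[OF dg(1)[OF hT[OF that]] dh(1)[OF that]]
      DERIV_chain2[OF dg(2)[OF hT[OF that]] dh(1)[OF that]]
      DERIV_chain2[OF dg(3)[OF hT[OF that]] dh(1)[OF that]] by auto
  note * = derivs_eqI[OF S, of "\<lambda>z. g (h z)" "\<lambda>z. deriv g (h z) * deriv h z"
      "\<lambda>z. deriv (deriv g) (h z) * (deriv h z)\<^sup>2 + deriv g (h z) * deriv (deriv h) z"
      "\<lambda>z. deriv (deriv (deriv g)) (h z) * (deriv h z) ^ 3
       + 3 * deriv (deriv g) (h z) * deriv h z * deriv (deriv h) z
       + deriv g (h z) * deriv (deriv (deriv h)) z", OF c(1)]
  have 2: "((\<lambda>z. deriv g (h z) * deriv h z) has_field_derivative
     deriv (deriv g) (h z) * (deriv h z)\<^sup>2 + deriv g (h z) * deriv (deriv h) z) (at z)" if "z \<in> S" for z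
    using DERIV_mult[OF c(2)[OF that] dh(2)[OF that]]
    by (rule DERIV_cong) (simp add: power2_eq_square algebra_simps)
  have 3: "((\<lambda>z. deriv (deriv g) (h z) * (deriv h z)\<^sup>2 + deriv g (h z) * deriv (deriv h) z) has_field_derivative
     deriv (deriv (deriv g)) (h z) * (deriv h z) ^ 3
       + 3 * deriv (deriv g) (h z) * deriv h z * deriv (deriv h) z
       + deriv g (h z) * deriv (deriv (deriv h)) z) (at z)" if "z \<in> S" for z
    using DERIV_add[OF DERIV_mult[OF c(3)[OF that] DERIV_mult[OF dh(2)[OF that] dh(2)[OF that]]]
        DERIV_mult[OF c(2)[OF that] dh(3)[OF that]]] unfolding power2_eq_square
    by (rule DERIV_cong) (simp add: power2_eq_square power3_eq_cube algebra_simps)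
  show "deriv (\<lambda>z. g (h z)) z = deriv g (h z) * deriv h z"
    "deriv (deriv (\<lambda>z. g (h z))) z = deriv (deriv g) (h z) * (deriv h z)\<^sup>2 + deriv g (h z) * deriv (deriv h) z"
    "deriv (deriv (deriv (\<lambda>z. g (h z)))) z = deriv (deriv (deriv g)) (h z) * (deriv h z) ^ 3
       + 3 * deriv (deriv g) (h z) * deriv h z * deriv (deriv h) z
       + deriv g (h z) * deriv (deriv (deriv h)) z"
    using *[OF _ 2 3] by auto
qed

text \<open>The cocycle rule; through it Moebius factors, whose Schwarzian is 0, disappear.\<close>

lemma schwarzian_compose:
  assumes S: "open S" "z \<in> S" and T: "open T"
    and h: "h holomorphic_on S" "h ` S \<subseteq> T" and g: "g holomorphic_on T"
    and nz: "deriv h z \<noteq> 0" "deriv g (h z) \<noteq> 0"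
  shows "schwarzian (\<lambda>z. g (h z)) z = schwarzian g (h z) * (deriv h z)\<^sup>2 + schwarzian h z"
  unfolding schwarzian_def deriv_compose_derivs[OF S T h g] using nz
  by (simp add: divide_simps) (simp add: power2_eq_square power3_eq_cube algebra_simps)

lemma derivs_exp_linear:
  "deriv (\<lambda>z. exp (\<kappa> * z)) z = \<kappa> * exp (\<kappa> * z)"
  "schwarzian (\<lambda>z. exp (\<kappa> * z)) z = - \<kappa>\<^sup>2" if "\<kappa> \<noteq> 0"
proof -
  have *: "((\<lambda>z. c * exp (\<kappa> * z)) has_field_derivative c * \<kappa> * exp (\<kappa> * z)) (at z)" for c z
    by (auto intro!: derivative_eq_intros)
  from *[of 1] have 1: "((\<lambda>z. exp (\<kappa> * z)) has_field_derivative \<kappa> * exp (\<kappa> * z)) (at z)" for z by simp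
  note d = derivs_eqI[OF open_UNIV UNIV_I 1 * *]
  show "deriv (\<lambda>z. exp (\<kappa> * z)) z = \<kappa> * exp (\<kappa> * z)" by (rule d)
  show "schwarzian (\<lambda>z. exp (\<kappa> * z)) z = - \<kappa>\<^sup>2"
    unfolding schwarzian_def d using that by (simp add: power2_eq_square)
qed

lemma schwarzian_real_moebius:
  assumes det: "a * d - b * c = 1" and t: "\<tau> \<in> UH"
  shows "real_moebius a b c d holomorphic_on UH" "deriv (real_moebius a b c d) \<tau> \<noteq> 0"
    "schwarzian (real_moebius a b c d) \<tau> = 0"
proof -
  let ?D = "\<lambda>\<tau>. complex_of_real c * \<tau> + of_real d"
  have nz: "?D z \<noteq> 0" if "z \<in> UH" for z using real_moebius_denom_nz[OF det that] .
  have d1: "(real_moebius a b c d has_field_derivative 1 / (?D z)\<^sup>2) (at z)" if "z \<in> UH" for z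
    using real_moebius_has_derivative[OF det that] .
  then show "real_moebius a b c d holomorphic_on UH"
    by (auto simp: holomorphic_on_open[OF open_UH])
  have d2: "((\<lambda>z. 1 / (?D z)\<^sup>2) has_field_derivative - 2 * of_real c / (?D z) ^ 3) (at z)" if "z \<in> UH" for z
    using nz[OF that] by (auto intro!: derivative_eq_intros simp: divide_simps power2_eq_square power3_eq_cube)
  have d3: "((\<lambda>z. - 2 * of_real c / (?D z) ^ 3) has_field_derivative 6 * (of_real c)\<^sup>2 / (?D z) ^ 4) (at z)" if "z \<in> UH" for z
    using nz[OF that] by (auto intro!: derivative_eq_intros simp: divide_simps power2_eq_square power3_eq_cube power4_eq_xxxx)
  note d = derivs_eqI[of UH \<tau> "real_moebius a b c d" "\<lambda>z. 1 / (?D z)\<^sup>2" "\<lambda>z. - 2 * of_real c / (?D z) ^ 3"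
      "\<lambda>z. 6 * (of_real c)\<^sup>2 / (?D z) ^ 4", OF open_UH t d1 d2 d3]
  show "deriv (real_moebius a b c d) \<tau> \<noteq> 0" using nz[OF t] by (simp add: d)
  have alg: "2 * ((6 * C\<^sup>2 / D ^ 4) / (1 / D\<^sup>2)) - 3 * ((- 2 * C / D ^ 3) / (1 / D\<^sup>2))\<^sup>2 = 0" if "D \<noteq> 0" for C D :: complex
  proof -
    have "(6 * C\<^sup>2 / D ^ 4) / (1 / D\<^sup>2) = 6 * C\<^sup>2 / D\<^sup>2" "(- 2 * C / D ^ 3) / (1 / D\<^sup>2) = - 2 * C / D"
      using that by (simp_all add: power2_eq_square power3_eq_cube power4_eq_xxxx)
    then show ?thesis by (simp add: power_divide power_mult_distrib)
  qed
  have "schwarzian (real_moebius a b c d) \<tau> = 2 * ((6 * (of_real c)\<^sup>2 / (?D \<tau>) ^ 4) / (1 / (?D \<tau>)\<^sup>2))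
      - 3 * ((- 2 * of_real c / (?D \<tau>) ^ 3) / (1 / (?D \<tau>)\<^sup>2))\<^sup>2"
    unfolding schwarzian_def by (simp only: d)
  also have "\<dots> = 0" by (rule alg[OF nz[OF t]])
  finally show "schwarzian (real_moebius a b c d) \<tau> = 0" .
qed

lemma cusp_coord_moebius:
  obtains a b c d where "a * d - b * c = 1" "cusp_coord r = real_moebius a b c d"
proof (cases r)
  case None
  then show ?thesis by (intro that[of 1 1 0 0]) (auto simp: real_moebius_def fun_eq_iff)
next
  case (Some s)
  \<comment> \<open>The instantiation follows the order of occurrence \<open>a\<close>,
    \<open>d\<close>, \<open>b\<close>, \<open>c\<close>: the matrix has the rows 0, -1 and 1,
    -s.\<close>
  then show ?thesis by (intro that[of 0 "-s" "-1" 1]) (auto simp: real_moebius_def fun_eq_iff)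
qed

lemma cusp_coord_in_UH: "\<tau> \<in> UH \<Longrightarrow> cusp_coord r \<tau> \<in> UH"
proof -
  assume t: "\<tau> \<in> UH"
  obtain a b c d where 1: "a * d - b * c = 1" "cusp_coord r = real_moebius a b c d"
    by (rule cusp_coord_moebius)
  show ?thesis using Im_real_moebius[OF 1(1) t] real_moebius_denom_nz[OF 1(1) t] t
    by (simp add: UH_iff 1(2))
qed

text \<open>The Schwarzian of the inverse function of \<open>G\<close>, as a function of the parameter of \<open>G\<close>.\<close>

definition inv_schwarzian :: "(complex \<Rightarrow> complex) \<Rightarrow> complex \<Rightarrow> complex" where
  "inv_schwarzian G \<tau> = - schwarzian G \<tau> / (deriv G \<tau>)\<^sup>2"

text \<open>The numerator of the Schwarzian derivative of \<open>log \<Phi>\<close>; the denominator is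
  \<open>(\<Phi> * \<Phi>')\<^sup>2\<close>.\<close>

definition log_schwarzian_num :: "(complex \<Rightarrow> complex) \<Rightarrow> complex \<Rightarrow> complex" where
  "log_schwarzian_num \<Phi> w = 2 * deriv (deriv (deriv \<Phi>)) w * deriv \<Phi> w * (\<Phi> w)\<^sup>2
     - 3 * (deriv (deriv \<Phi>) w)\<^sup>2 * (\<Phi> w)\<^sup>2 + (deriv \<Phi> w) ^ 4"

text \<open>The cocycle rule is applied to both sides of \<open>rel\<close>: on the left it involves
  the Schwarzians of \<open>\<Phi>\<close> and \<open>G\<close>, on the right only the exponential
  contributes. Denominators are cleared so that the relation makes sense at zeros of
  \<open>\<Phi>\<close> and of its derivative and can be continued analytically.\<close>

lemma inv_schwarzian_uniformizing:
  assumes U: "open U" "U \<subseteq> UH" "\<tau> \<in> U" and G: "G holomorphic_on U" "deriv G \<tau> \<noteq> 0"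
    and V: "open V" "G ` U \<subseteq> V" and \<Phi>: "\<Phi> holomorphic_on V"
    and rel: "\<And>\<tau>. \<tau> \<in> U \<Longrightarrow> \<Phi> (G \<tau>) = exp (\<kappa> * cusp_coord r \<tau>)" and \<kappa>: "\<kappa> \<noteq> 0"
  shows "\<Phi> (G \<tau>) \<noteq> 0" "deriv \<Phi> (G \<tau>) \<noteq> 0"
    "inv_schwarzian G \<tau> * (\<Phi> (G \<tau>) * deriv \<Phi> (G \<tau>))\<^sup>2 = log_schwarzian_num \<Phi> (G \<tau>)"
proof -
  have t: "\<tau> \<in> UH" using U by auto
  obtain a b c d where m: "a * d - b * c = 1" "cusp_coord r = real_moebius a b c d"
    by (rule cusp_coord_moebius)
  define \<mu> where "\<mu> = cusp_coord r"
  have \<mu>: "\<mu> holomorphic_on UH" "deriv \<mu> \<tau> \<noteq> 0" "schwarzian \<mu> \<tau> = 0"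
    using schwarzian_real_moebius[OF m(1) t] by (simp_all add: \<mu>_def m(2))
  define E where "E = (\<lambda>z. exp (\<kappa> * z))"
  have holE: "E holomorphic_on UNIV" unfolding E_def by (intro holomorphic_intros)
  have dE: "deriv E z = \<kappa> * E z" "schwarzian E z = - \<kappa>\<^sup>2" for z
    using derivs_exp_linear[OF \<kappa>] by (simp_all add: E_def)
  have Enz: "E z \<noteq> 0" for z by (simp add: E_def)
  have rel': "\<Phi> (G \<tau>) = E (\<mu> \<tau>)" if "\<tau> \<in> U" for \<tau> using rel[OF that] by (simp add: E_def \<mu>_def)
  have c1: "deriv (\<lambda>z. \<Phi> (G z)) \<tau> = deriv \<Phi> (G \<tau>) * deriv G \<tau>"
    by (rule deriv_compose_derivs(1)[OF U(1,3) V(1) G(1) V(2) \<Phi>])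
  have c2: "deriv (\<lambda>z. E (\<mu> z)) \<tau> = \<kappa> * E (\<mu> \<tau>) * deriv \<mu> \<tau>"
    using deriv_compose_derivs(1)[OF open_UH t open_UNIV \<mu>(1) subset_UNIV holE] dE by simp
  have d: "deriv \<Phi> (G \<tau>) * deriv G \<tau> = \<kappa> * E (\<mu> \<tau>) * deriv \<mu> \<tau>"
    using deriv_cong_open[OF U(1,3) rel'] c1 c2 by simp
  show nz1: "\<Phi> (G \<tau>) \<noteq> 0" using rel'[OF U(3)] Enz by simp
  show nz2: "deriv \<Phi> (G \<tau>) \<noteq> 0" using d \<kappa> Enz \<mu>(2) by auto
  have s1: "schwarzian (\<lambda>z. \<Phi> (G z)) \<tau> = schwarzian \<Phi> (G \<tau>) * (deriv G \<tau>)\<^sup>2 + schwarzian G \<tau>"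
    by (rule schwarzian_compose[OF U(1,3) V(1) G(1) V(2) \<Phi> G(2) nz2])
  have s2: "schwarzian (\<lambda>z. E (\<mu> z)) \<tau> = - \<kappa>\<^sup>2 * (deriv \<mu> \<tau>)\<^sup>2"
    using schwarzian_compose[OF open_UH t open_UNIV \<mu>(1) subset_UNIV holE \<mu>(2)] dE Enz \<kappa> \<mu>(3) by simp
  have s: "schwarzian \<Phi> (G \<tau>) * (deriv G \<tau>)\<^sup>2 + schwarzian G \<tau> = - (\<kappa> * deriv \<mu> \<tau>)\<^sup>2"
    using schwarzian_cong[OF U(1,3) rel'] s1 s2 by (simp add: power_mult_distrib)
  have "\<kappa> * deriv \<mu> \<tau> = deriv \<Phi> (G \<tau>) * deriv G \<tau> / \<Phi> (G \<tau>)"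
    using d nz1 rel'[OF U(3)] by (simp add: field_simps)
  then have "- schwarzian G \<tau> = (deriv G \<tau>)\<^sup>2 * (schwarzian \<Phi> (G \<tau>) + (deriv \<Phi> (G \<tau>) / \<Phi> (G \<tau>))\<^sup>2)"
  proof -
    assume *: "\<kappa> * deriv \<mu> \<tau> = deriv \<Phi> (G \<tau>) * deriv G \<tau> / \<Phi> (G \<tau>)"
    have "- schwarzian G \<tau> = schwarzian \<Phi> (G \<tau>) * (deriv G \<tau>)\<^sup>2 + (\<kappa> * deriv \<mu> \<tau>)\<^sup>2"
      using s by (simp add: eq_neg_iff_add_eq_0 neg_eq_iff_add_eq_0 add_ac)
    then show ?thesis unfolding * by (simp add: power_divide power_mult_distrib distrib_left mult.commute)
  qed
  then have "inv_schwarzian G \<tau> = schwarzian \<Phi> (G \<tau>) + (deriv \<Phi> (G \<tau>) / \<Phi> (G \<tau>))\<^sup>2"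
    using G(2) by (simp add: inv_schwarzian_def)
  then have e: "inv_schwarzian G \<tau> = 2 * (deriv (deriv (deriv \<Phi>)) (G \<tau>) / deriv \<Phi> (G \<tau>))
      - 3 * (deriv (deriv \<Phi>) (G \<tau>) / deriv \<Phi> (G \<tau>))\<^sup>2 + (deriv \<Phi> (G \<tau>) / \<Phi> (G \<tau>))\<^sup>2"
    by (simp add: schwarzian_def)
  have alg: "(2 * (f3 / f1) - 3 * (f2 / f1)\<^sup>2 + (f1 / f0)\<^sup>2) * (f0 * f1)\<^sup>2
      = 2 * f3 * f1 * f0\<^sup>2 - 3 * f2\<^sup>2 * f0\<^sup>2 + f1 ^ 4" if "f0 \<noteq> 0" "f1 \<noteq> 0" for f0 f1 f2 f3 :: complex
  proof -
    have "(2 * (f3 / f1) - 3 * (f2 / f1)\<^sup>2 + (f1 / f0)\<^sup>2) * (f0 * f1)\<^sup>2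
       = 2 * (f3 / f1 * f1) * f1 * f0\<^sup>2 - 3 * (f2 / f1 * f1)\<^sup>2 * f0\<^sup>2 + (f1 / f0 * f0)\<^sup>2 * f1\<^sup>2"
    proof -
      have "(2 * g3 - 3 * g2\<^sup>2 + g1\<^sup>2) * (f0 * f1)\<^sup>2
         = 2 * (g3 * f1) * f1 * f0\<^sup>2 - 3 * (g2 * f1)\<^sup>2 * f0\<^sup>2 + (g1 * f0)\<^sup>2 * f1\<^sup>2" for g1 g2 g3
        by algebra
      then show ?thesis .
    qed
    then show ?thesis using that by (simp add: power2_eq_square power4_eq_xxxx)
  qed
  show "inv_schwarzian G \<tau> * (\<Phi> (G \<tau>) * deriv \<Phi> (G \<tau>))\<^sup>2 = log_schwarzian_num \<Phi> (G \<tau>)"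
    unfolding e log_schwarzian_num_def using nz1 nz2 by (rule alg)
qed

subsection \<open>Holomorphic coverings of plane domains by the upper half plane\<close>

locale plane_cover =
  fixes F :: "complex \<Rightarrow> complex" and Y :: "complex set"
  assumes hol: "F holomorphic_on UH" and cov: "covering_space UH F Y"
begin

lemma F_in: "\<tau> \<in> UH \<Longrightarrow> F \<tau> \<in> Y" and F_surj: "F ` UH = Y"
  using covering_space_imp_surjective[OF cov] by auto

lemma locally_inj:
  assumes "\<tau> \<in> UH"
  obtains T where "open T" "\<tau> \<in> T" "T \<subseteq> UH" "inj_on F T"
proof -
  obtain T u q where T: "\<tau> \<in> T" "openin (top_of_set UH) T" "homeomorphism T u F q"
    using covering_space_local_homeomorphism[OF cov assms] by metis
  then have "open T" "T \<subseteq> UH" using openin_open_eq[OF open_UH] by auto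
  moreover have "inj_on F T" using T(3) by (metis homeomorphism_apply1 inj_onI)
  ultimately show ?thesis using T(1) that by blast
qed

lemma deriv_nz: "\<tau> \<in> UH \<Longrightarrow> deriv F \<tau> \<noteq> 0"
proof -
  assume "\<tau> \<in> UH"
  then obtain T where T: "open T" "\<tau> \<in> T" "T \<subseteq> UH" "inj_on F T" by (rule locally_inj)
  show ?thesis
    using holomorphic_injective_imp_regular[OF holomorphic_on_subset[OF hol T(3)] T(1,4,2)] .
qed

text \<open>A convex domain is simply connected, so the lifting criterion applies; the lift is
  holomorphic as \<open>F\<close> is locally biholomorphic.\<close>

lemma lift:
  assumes D: "open D" "convex D" "s0 \<in> D" and E: "E holomorphic_on D" "E ` D \<subseteq> Y"
    and t: "\<tau>0 \<in> UH" "F \<tau>0 = E s0"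
  obtains L where "L holomorphic_on D" "L ` D \<subseteq> UH" "L s0 = \<tau>0" "\<And>s. s \<in> D \<Longrightarrow> F (L s) = E s"
proof -
  obtain L where L: "continuous_on D L" "L \<in> D \<rightarrow> UH" "L s0 = \<tau>0" "\<And>s. s \<in> D \<Longrightarrow> F (L s) = E s"
    using covering_space_lift_strong[OF cov t(1) D(3), of E]
      convex_imp_simply_connected[OF D(2)] convex_imp_locally_path_connected[OF D(2)]
      holomorphic_on_imp_continuous_on[OF E(1)] E(2) t(2) by auto
  have "L holomorphic_on D"
    by (rule covering_space_lift_is_holomorphic[OF cov open_UH hol E(1) _ L(2,1,4)]) (use E(2) in auto)
  with L that show ?thesis by auto
qed

lemma lift_unique:
  assumes D: "connected D" "s0 \<in> D" "s \<in> D"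
    and 1: "continuous_on D L1" "L1 ` D \<subseteq> UH" and 2: "continuous_on D L2" "L2 ` D \<subseteq> UH"
    and eq: "\<And>s. s \<in> D \<Longrightarrow> F (L1 s) = F (L2 s)" and s0: "L1 s0 = L2 s0"
  shows "L1 s = L2 s"
proof (rule covering_space_lift_unique[where p = F and c = UH and S = Y and T = D and a = s0
      and f = "\<lambda>s. F (L1 s)", OF cov])
  show "continuous_on D (\<lambda>s. F (L1 s))"
    using continuous_on_compose2[OF holomorphic_on_imp_continuous_on[OF hol] 1] .
qed (use assms F_in in auto)

end

text \<open>Each covering lifts through the other, and by uniqueness of lifts one lift inverts the
  other, as \<open>UH_automorphism_moebius\<close> requires. With \<open>F1 = F2\<close> this yields
  the deck transformations; with different coverings it compares their expansions.\<close>

lemma plane_covers_related: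
  assumes "plane_cover F1 Y" "plane_cover F2 Y" and t: "\<tau>1 \<in> UH" "\<tau>2 \<in> UH" "F2 \<tau>1 = F1 \<tau>2"
  obtains a b c d where "a * d - b * c = 1" "real_moebius a b c d \<tau>1 = \<tau>2"
    "\<And>\<tau>. \<tau> \<in> UH \<Longrightarrow> real_moebius a b c d \<tau> \<in> UH \<and> F1 (real_moebius a b c d \<tau>) = F2 \<tau>"
proof -
  interpret F1: plane_cover F1 Y by fact
  interpret F2: plane_cover F2 Y by fact
  obtain g where g: "g holomorphic_on UH" "g ` UH \<subseteq> UH" "g \<tau>1 = \<tau>2" "\<And>s. s \<in> UH \<Longrightarrow> F1 (g s) = F2 s"
    using F1.lift[OF open_UH convex_UH t(1) F2.hol _ t(2)] F2.F_surj t(3) by auto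
  obtain h where h: "h holomorphic_on UH" "h ` UH \<subseteq> UH" "h \<tau>2 = \<tau>1" "\<And>s. s \<in> UH \<Longrightarrow> F2 (h s) = F1 s"
    using F2.lift[OF open_UH convex_UH t(2) F1.hol _ t(1)] F1.F_surj t(3) by auto
  have "h (g \<tau>) = \<tau>" if "\<tau> \<in> UH" for \<tau>
  proof (rule F2.lift_unique[OF connected_UH t(1) that, of "\<lambda>s. h (g s)" "\<lambda>s. s"])
    show "continuous_on UH (\<lambda>s. h (g s))"
      using continuous_on_compose2[OF holomorphic_on_imp_continuous_on[OF h(1)] holomorphic_on_imp_continuous_on[OF g(1)] g(2)] .
    have gU: "g s \<in> UH" if "s \<in> UH" for s using that g(2) by auto
    show "F2 (h (g s)) = F2 s" if "s \<in> UH" for s using h(4)[OF gU[OF that]] g(4)[OF that] by simp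
  qed (use g h in auto)
  then obtain a b c d where m: "a * d - b * c = 1" "\<And>\<tau>. \<tau> \<in> UH \<Longrightarrow> g \<tau> = real_moebius a b c d \<tau>"
    using UH_automorphism_moebius[OF g(1,2) h(1,2)] by metis
  show ?thesis
  proof (rule that[OF m(1)])
    show "real_moebius a b c d \<tau>1 = \<tau>2" using g(3) m(2)[OF t(1)] by simp
    show "real_moebius a b c d \<tau> \<in> UH \<and> F1 (real_moebius a b c d \<tau>) = F2 \<tau>" if "\<tau> \<in> UH" for \<tau>
      using g(2,4) m(2)[OF that, symmetric] that by auto
  qed
qed

context plane_cover
begin

lemma deck:
  assumes "\<tau>1 \<in> UH" "\<tau>2 \<in> UH" "F \<tau>1 = F \<tau>2"
  obtains a b c d where "a * d - b * c = 1" "real_moebius a b c d \<tau>1 = \<tau>2"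
    "\<And>\<tau>. \<tau> \<in> UH \<Longrightarrow> real_moebius a b c d \<tau> \<in> UH \<and> F (real_moebius a b c d \<tau>) = F \<tau>"
  using plane_covers_related[of F Y F, OF _ _ assms] plane_cover_axioms by metis

text \<open>Obtained from the invariance of \<open>F\<close> by the chain rule and the cocycle rule,
  the Schwarzian of the deck transformation itself being 0.\<close>

lemma deck_deriv:
  assumes det: "a * d - b * c = 1" and t: "\<tau> \<in> UH"
    and deck: "\<And>\<tau>. \<tau> \<in> UH \<Longrightarrow> real_moebius a b c d \<tau> \<in> UH \<and> F (real_moebius a b c d \<tau>) = F \<tau>"
  shows "deriv F \<tau> = deriv F (real_moebius a b c d \<tau>) * deriv (real_moebius a b c d) \<tau>"
    "schwarzian F \<tau> = schwarzian F (real_moebius a b c d \<tau>) * (deriv (real_moebius a b c d) \<tau>)\<^sup>2"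
proof -
  let ?g = "real_moebius a b c d"
  have im: "?g ` UH \<subseteq> UH" and gU: "?g \<tau> \<in> UH" using deck t by auto
  note g = schwarzian_real_moebius[OF det t]
  have eq: "F \<tau> = F (?g \<tau>)" if "\<tau> \<in> UH" for \<tau> using deck[OF that] by simp
  show "deriv F \<tau> = deriv F (?g \<tau>) * deriv ?g \<tau>"
    using deriv_cong_open[OF open_UH t eq] deriv_compose_derivs(1)[OF open_UH t open_UH g(1) im hol] by simp
  show "schwarzian F \<tau> = schwarzian F (?g \<tau>) * (deriv ?g \<tau>)\<^sup>2"
    using schwarzian_cong[OF open_UH t eq] schwarzian_compose[OF open_UH t open_UH g(1) im hol g(2) deriv_nz[OF gU]] g(3)
    by simp
qed

text \<open>The squared derivative of the deck transformation cancels between numerator and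
  denominator. This is why the Schwarzian of the multivalued inverse is single valued.\<close>

lemma inv_schwarzian_deck:
  assumes t: "\<tau>1 \<in> UH" "\<tau>2 \<in> UH" "F \<tau>1 = F \<tau>2"
  shows "inv_schwarzian F \<tau>1 = inv_schwarzian F \<tau>2"
proof -
  obtain a b c d where m: "a * d - b * c = 1" "real_moebius a b c d \<tau>1 = \<tau>2"
    "\<And>\<tau>. \<tau> \<in> UH \<Longrightarrow> real_moebius a b c d \<tau> \<in> UH \<and> F (real_moebius a b c d \<tau>) = F \<tau>"
    using deck[OF t] by metis
  show ?thesis
    using deck_deriv[OF m(1) t(1) m(3)] schwarzian_real_moebius(2)[OF m(1) t(1)] deriv_nz[OF t(2)]
    by (simp add: inv_schwarzian_def m(2) power_mult_distrib)
qed

text \<open>The product is the reciprocal of the hyperbolic density at the common image point; it is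
  invariant because a deck transformation \<open>g\<close> has
  \<open>norm (deriv g \<tau>) = Im (g \<tau>) / Im \<tau>\<close>.\<close>

lemma deck_isometry:
  assumes t: "\<tau>1 \<in> UH" "\<tau>2 \<in> UH" "F \<tau>1 = F \<tau>2"
  shows "Im \<tau>1 * norm (deriv F \<tau>1) = Im \<tau>2 * norm (deriv F \<tau>2)"
proof -
  obtain a b c d where m: "a * d - b * c = 1" "real_moebius a b c d \<tau>1 = \<tau>2"
    "\<And>\<tau>. \<tau> \<in> UH \<Longrightarrow> real_moebius a b c d \<tau> \<in> UH \<and> F (real_moebius a b c d \<tau>) = F \<tau>"
    using deck[OF t] by metis
  have "deriv (real_moebius a b c d) \<tau>1 = 1 / (of_real c * \<tau>1 + of_real d)\<^sup>2"
    using DERIV_imp_deriv[OF real_moebius_has_derivative[OF m(1) t(1)]] .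
  then have "norm (deriv F \<tau>1) = norm (deriv F \<tau>2) / (norm (of_real c * \<tau>1 + of_real d))\<^sup>2"
    by (simp only: deck_deriv(1)[OF m(1) t(1) m(3)] m(2) norm_mult norm_divide norm_power norm_one times_divide_eq_right mult_1_right)
  moreover have "Im \<tau>2 = Im \<tau>1 / (norm (of_real c * \<tau>1 + of_real d))\<^sup>2"
    using Im_real_moebius[OF m(1) t(1)] by (simp only: m(2))
  ultimately show ?thesis by (simp only: times_divide_eq_left times_divide_eq_right)
qed

text \<open>The Schwarzian derivative of the inverse of \<open>F\<close>, as a function on
  \<open>Y\<close>; the chosen preimage is immaterial by \<open>inv_schwarzian_deck\<close>.\<close>

definition Sch :: "complex \<Rightarrow> complex" where
  "Sch v = inv_schwarzian F (SOME \<tau>. \<tau> \<in> UH \<and> F \<tau> = v)"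

lemma Sch_F: "\<tau> \<in> UH \<Longrightarrow> Sch (F \<tau>) = inv_schwarzian F \<tau>"
proof -
  assume t: "\<tau> \<in> UH"
  define \<tau>' where "\<tau>' = (SOME \<tau>'. \<tau>' \<in> UH \<and> F \<tau>' = F \<tau>)"
  have "\<tau>' \<in> UH \<and> F \<tau>' = F \<tau>" unfolding \<tau>'_def by (rule someI) (use t in auto)
  then have "inv_schwarzian F \<tau>' = inv_schwarzian F \<tau>" using inv_schwarzian_deck[OF _ t] by blast
  then show ?thesis by (simp add: Sch_def \<tau>'_def)
qed

lemma inv_schwarzian_holomorphic: "inv_schwarzian F holomorphic_on UH"
proof -
  show ?thesis
    unfolding inv_schwarzian_def[abs_def] schwarzian_def[abs_def]
    by (intro holomorphic_intros hol open_UH) (auto simp: deriv_nz)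
qed

lemma Sch_holomorphic: "Sch holomorphic_on Y"
proof -
  have "Sch field_differentiable at v" if v: "v \<in> Y" for v
  proof -
    have "v \<in> F ` UH" using v by (simp add: F_surj)
    then obtain \<tau> where t: "\<tau> \<in> UH" "F \<tau> = v" by blast
    obtain T where T: "open T" "\<tau> \<in> T" "T \<subseteq> UH" "inj_on F T" using t(1) by (rule locally_inj)
    have holT: "F holomorphic_on T" using hol T(3) holomorphic_on_subset by blast
    obtain g where g: "g holomorphic_on F ` T" "\<And>z. z \<in> T \<Longrightarrow> deriv F z * deriv g (F z) = 1" "\<And>z. z \<in> T \<Longrightarrow> g (F z) = z"
      using holomorphic_has_inverse[OF holT T(1,4)] by metis
    have op: "open (F ` T)" using open_mapping_thm3[OF holT T(1,4)] .
    have "(inv_schwarzian F \<circ> g) holomorphic_on F ` T"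
      by (rule holomorphic_on_compose_gen[OF g(1) inv_schwarzian_holomorphic])
        (use g(3) T(3) in force)
    moreover have "(inv_schwarzian F \<circ> g) x = Sch x" if x: "x \<in> F ` T" for x
    proof -
      obtain z where z: "z \<in> T" "x = F z" using x by blast
      then have "z \<in> UH" using T(3) by blast
      then show ?thesis using g(3)[OF z(1)] Sch_F z(2) by simp
    qed
    ultimately have "Sch holomorphic_on F ` T"
      by (rule holomorphic_transform)
    then show ?thesis
      by (rule holomorphic_on_imp_differentiable_at[OF _ op]) (use t T(2) in blast)
  qed
  then show ?thesis unfolding holomorphic_on_def by (metis field_differentiable_at_within)
qed

end

subsection \<open>The Schwarzian derivative near a puncture\<close>

lemma bounded_holomorphic_extends:
  assumes "f holomorphic_on ball p r - {p}" "0 < r" "\<And>z. z \<in> ball p r - {p} \<Longrightarrow> norm (f z) \<le> B"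
  obtains g where "g holomorphic_on ball p r" "\<And>z. z \<in> ball p r - {p} \<Longrightarrow> g z = f z"
proof -
  have "eventually (\<lambda>z. norm (f z) \<le> B) (at p)"
    unfolding eventually_at using assms(2,3) by (intro exI[of _ r]) (auto simp: dist_commute)
  then show ?thesis
    using holomorphic_on_extend_bounded[of f "ball p r" p] assms(1,2) that by auto
qed

text \<open>For \<open>h = (w - p)^n g\<close> the logarithmic derivative times \<open>w - p\<close>
  is \<open>n + (w - p) g' / g\<close>; written without quotients, the relation includes
  \<open>w = p\<close>.\<close>

lemma log_derivative_holomorphic:
  assumes h: "h holomorphic_on ball p \<rho>" and \<rho>: "0 < \<rho>" and nz: "\<exists>w\<in>ball p \<rho>. h w \<noteq> 0"
  obtains r y where "0 < r" "r \<le> \<rho>" "y holomorphic_on ball p r"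
    "\<And>w. w \<in> ball p r \<Longrightarrow> (w - p) * deriv h w = y w * h w"
    "\<And>w. w \<in> ball p r - {p} \<Longrightarrow> h w \<noteq> 0"
proof -
  obtain g r n where g: "0 < r" "r \<le> \<rho>" "g holomorphic_on ball p r"
      "\<And>w. w \<in> ball p r \<Longrightarrow> h w = (w - p) ^ n * g w" "\<And>w. w \<in> ball p r \<Longrightarrow> g w \<noteq> 0"
  \<comment> \<open>The factorisation requires a genuine zero; order 0 is handled by shrinking to a
    disc without zeros.\<close>
  proof (cases "h p = 0")
    case True
    have nc: "\<not> h constant_on ball p \<rho>"
      using True nz \<rho> by (force simp: constant_on_def)
    obtain g r n where g: "0 < (n::nat)"  "0 < r" "ball p r \<subseteq> ball p \<rho>" "g holomorphic_on ball p r"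
      "\<And>w. w \<in> ball p r \<Longrightarrow> h w = (w - p) ^ n * g w" "\<And>w. w \<in> ball p r \<Longrightarrow> g w \<noteq> 0"
      by (rule holomorphic_factor_zero_nonconstant[OF h open_ball connected_ball _ True nc]) (use \<rho> in auto)
    show ?thesis
    proof (rule that[of "min r \<rho>" g n])
      show "g holomorphic_on ball p (min r \<rho>)" by (rule holomorphic_on_subset[OF g(4)]) auto
    qed (use g \<rho> in auto)
  next
    case False
    have "continuous_on (ball p \<rho>) h" using h by (rule holomorphic_on_imp_continuous_on)
    then have "open (ball p \<rho> \<inter> h -` (- {0}))"
      by (intro continuous_open_preimage) auto
    then obtain r where r: "r > 0" "ball p r \<subseteq> ball p \<rho> \<inter> h -` (- {0})"
      using False \<rho> open_contains_ball by (metis (no_types, lifting) Compl_iff IntI centre_in_ball empty_iff insert_iff vimageI)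
    show ?thesis
    proof (rule that[of "min r \<rho>" h 0])
      show "h holomorphic_on ball p (min r \<rho>)" by (rule holomorphic_on_subset[OF h]) auto
    qed (use r \<rho> in auto)
  qed
  define y where "y = (\<lambda>w. of_nat n + (w - p) * deriv g w / g w)"
  have y: "y holomorphic_on ball p r"
    unfolding y_def using g(5) by (intro holomorphic_intros g(3) open_ball) auto
  have "(w - p) * deriv h w = y w * h w" if w: "w \<in> ball p r" for w
  proof -
    have dg: "(g has_field_derivative deriv g w) (at w)"
      using g(3) w by (intro holomorphic_derivI[of _ "ball p r"]) auto
    have "((\<lambda>w. (w - p) ^ n * g w) has_field_derivative
        (w - p) ^ n * deriv g w + of_nat n * (w - p) ^ (n - 1) * g w) (at w)"
      by (rule derivative_eq_intros dg refl)+ simp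
    then have "(h has_field_derivative (w - p) ^ n * deriv g w + of_nat n * (w - p) ^ (n - 1) * g w) (at w)"
      by (rule has_field_derivative_transform_within_open[OF _ open_ball w]) (use g(4) in auto)
    then have dh: "deriv h w = (w - p) ^ n * deriv g w + of_nat n * (w - p) ^ (n - 1) * g w"
      by (rule DERIV_imp_deriv)
    have yg: "y w * g w = of_nat n * g w + (w - p) * deriv g w"
      using g(5)[OF w] by (simp add: y_def distrib_right)
    have "x * (x ^ n * a + of_nat n * x ^ (n - 1) * b) = x ^ n * (of_nat n * b + x * a)" for x a b :: complex
      by (cases n) (simp_all add: algebra_simps)
    then have "(w - p) * deriv h w = (w - p) ^ n * (y w * g w)" unfolding dh yg .
    then show ?thesis using g(4)[OF w] by (simp only: mult_ac)
  qed
  then show ?thesis using that[OF g(1,2) y] g(4,5) by auto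
qed

text \<open>The function \<open>g = log P\<close> has \<open>g' = y / x\<close> and
  \<open>x g'' / g' = u - 1\<close>, so \<open>x\<^sup>2\<close> times its Schwarzian is \<open>2 (x
  u' - (u - 1)) - (u - 1)\<^sup>2 = 1 - u\<^sup>2 + 2 x u'\<close>. Here the denominator
  \<open>(P P')\<^sup>2\<close> is cleared.\<close>

lemma log_schwarzian_algebra:
  fixes x P P1 P2 P3 y y1 y2 u u1 :: complex
  assumes x: "x \<noteq> 0" and "x * P1 = y * P" "P1 + x * P2 = y1 * P + y * P1"
    "2 * P2 + x * P3 = y2 * P + 2 * y1 * P1 + y * P2"
    "x * y1 = u * y" "y1 + x * y2 = u1 * y + u * y1"
  shows "x\<^sup>2 * (2 * P3 * P1 * P\<^sup>2 - 3 * P2\<^sup>2 * P\<^sup>2 + P1 ^ 4) = (1 - u\<^sup>2 + 2 * x * u1) * (P * P1)\<^sup>2"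
proof -
  have 1: "x * P1 = y * P" by fact
  have 2: "x\<^sup>2 * P2 = y * P * (u + y - 1)" using assms by algebra
  have 3: "x ^ 3 * P3 = y * P * ((u + y - 2) * (u + y - 1) + x * u1 + u * y)" using assms 2 by algebra
  \<comment> \<open>The factor \<open>x ^ 4\<close> provides each derivative of order j with the
    power \<open>x^j\<close> that occurs in 1, 2 and 3.\<close>
  have "x ^ 4 * (2 * P3 * P1 * P\<^sup>2 - 3 * P2\<^sup>2 * P\<^sup>2 + P1 ^ 4)
      = 2 * (x ^ 3 * P3) * (x * P1) * P\<^sup>2 - 3 * (x\<^sup>2 * P2)\<^sup>2 * P\<^sup>2 + (x * P1) ^ 4"
    by algebra
  also have "\<dots> = (1 - u\<^sup>2 + 2 * x * u1) * (P * (x * P1))\<^sup>2"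
    unfolding 1 2 3 by algebra
  finally have "x\<^sup>2 * (x\<^sup>2 * (2 * P3 * P1 * P\<^sup>2 - 3 * P2\<^sup>2 * P\<^sup>2 + P1 ^ 4)) = x\<^sup>2 * ((1 - u\<^sup>2 + 2 * x * u1) * (P * P1)\<^sup>2)"
    by algebra
  moreover have "x\<^sup>2 \<noteq> 0" using x by simp
  ultimately show ?thesis by (rule mult_left_cancel[THEN iffD1, rotated])
qed

lemma deriv_open_mult:
  assumes S: "open S" and f: "f holomorphic_on S" and g: "g holomorphic_on S" and z: "z \<in> S"
  shows "deriv (\<lambda>z. f z * g z) z = deriv f z * g z + f z * deriv g z"
  using holomorphic_on_imp_differentiable_at[OF f S z] holomorphic_on_imp_differentiable_at[OF g S z]
  by (simp add: mult.commute add.commute)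

text \<open>If \<open>\<Phi>\<close> is the exponential of a multiple of a branch of the inverse of the covering map, this
  is the behaviour of the Schwarzian derivative \<open>S\<close> of that branch at the puncture \<open>p\<close>.\<close>

lemma schwarzian_at_puncture:
  assumes \<rho>: "0 < \<rho>" and S: "S holomorphic_on ball p \<rho> - {p}" and \<Phi>: "\<Phi> holomorphic_on ball p \<rho>"
    and W: "open W" "W \<noteq> {}" "W \<subseteq> ball p \<rho> - {p}"
    and eq: "\<And>w. w \<in> W \<Longrightarrow> S w * (\<Phi> w * deriv \<Phi> w)\<^sup>2 = log_schwarzian_num \<Phi> w"
    and nz: "\<And>w. w \<in> W \<Longrightarrow> \<Phi> w \<noteq> 0 \<and> deriv \<Phi> w \<noteq> 0"
  obtains r y u where "0 < r" "r \<le> \<rho>" "y holomorphic_on ball p r" "u holomorphic_on ball p r"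
    "\<And>w. w \<in> ball p r \<Longrightarrow> (w - p) * deriv \<Phi> w = y w * \<Phi> w"
    "\<And>w. w \<in> ball p r \<Longrightarrow> (w - p) * deriv y w = u w * y w"
    "\<And>w. w \<in> ball p r - {p} \<Longrightarrow> \<Phi> w \<noteq> 0 \<and> y w \<noteq> 0"
    "\<And>w. w \<in> ball p r - {p} \<Longrightarrow> (w - p)\<^sup>2 * S w = 1 - (u w)\<^sup>2 + 2 * (w - p) * deriv u w"
proof -
  obtain w0 where w0: "w0 \<in> W" using W by auto
  have d\<Phi>: "deriv \<Phi> holomorphic_on ball p \<rho>" "deriv (deriv \<Phi>) holomorphic_on ball p \<rho>"
     "deriv (deriv (deriv \<Phi>)) holomorphic_on ball p \<rho>"
    by (intro holomorphic_deriv \<Phi> open_ball)+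
  have sub: "ball p \<rho> - {p} \<subseteq> ball p \<rho>" by auto
  have "(\<lambda>w. S w * (\<Phi> w * deriv \<Phi> w)\<^sup>2) holomorphic_on ball p \<rho> - {p}"
    by (intro holomorphic_on_mult holomorphic_on_power S holomorphic_on_subset[OF \<Phi> sub]
        holomorphic_on_subset[OF d\<Phi>(1) sub])
  moreover have "log_schwarzian_num \<Phi> holomorphic_on ball p \<rho> - {p}"
    unfolding log_schwarzian_num_def[abs_def]
    by (intro holomorphic_on_mult holomorphic_on_power holomorphic_on_add holomorphic_on_diff holomorphic_on_const
        holomorphic_on_subset[OF \<Phi> sub] holomorphic_on_subset[OF d\<Phi>(1) sub]
        holomorphic_on_subset[OF d\<Phi>(2) sub] holomorphic_on_subset[OF d\<Phi>(3) sub])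
  moreover have "connected (ball p \<rho> - {p})"
    by (intro connected_punctured_ball) simp
  \<comment> \<open>Known on \<open>W\<close> only, the identity extends over the connected
    punctured disc, where both sides are holomorphic.\<close>
  ultimately have eq': "S w * (\<Phi> w * deriv \<Phi> w)\<^sup>2 = log_schwarzian_num \<Phi> w" if "w \<in> ball p \<rho> - {p}" for w
    using analytic_continuation_open[OF W(1) _ W(2) _ W(3) _ _ eq, of "\<lambda>w. w"] that open_ball
    by (smt (verit, ccfv_SIG) W analytic_continuation_open eq open_ball open_delete)
  have "\<exists>w\<in>ball p \<rho>. \<Phi> w \<noteq> 0" using w0 W nz by auto
  then obtain r1 y where r1: "0 < r1" "r1 \<le> \<rho>" "y holomorphic_on ball p r1"
    "\<And>w. w \<in> ball p r1 \<Longrightarrow> (w - p) * deriv \<Phi> w = y w * \<Phi> w"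
    "\<And>w. w \<in> ball p r1 - {p} \<Longrightarrow> \<Phi> w \<noteq> 0"
    using log_derivative_holomorphic[OF \<Phi> \<rho>] by metis
  \<comment> \<open>If \<open>y\<close> vanished identically, the derivative of
    \<open>\<Phi>\<close> would vanish near \<open>p\<close> and then on the whole disc, against
    \<open>nz\<close>.\<close>
  have "\<exists>w\<in>ball p r1. y w \<noteq> 0"
  proof (rule ccontr)
    assume "\<not> ?thesis"
    then have "(w - p) * deriv \<Phi> w = 0" if "w \<in> ball p r1" for w using r1(4)[OF that] that by simp
    then have *: "deriv \<Phi> w = 0" if "w \<in> ball p r1 - {p}" for w using that by fastforce
    have opn: "open (ball p r1 - {p})" by (intro open_delete open_ball)
    have ne: "ball p r1 - {p} \<noteq> {}"
    proof -
      have "p + of_real (r1 / 2) \<in> ball p r1 - {p}" using r1(1) by (simp add: dist_norm)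
      then show ?thesis by blast
    qed
    have "deriv \<Phi> w0 = 0"
      by (rule analytic_continuation_open[OF opn open_ball ne connected_ball _ d\<Phi>(1) holomorphic_on_const[of 0]])
        (use * r1(2) w0 W in auto)
    with nz[OF w0] show False by simp
  qed
  then obtain r u where r: "0 < r" "r \<le> r1" "u holomorphic_on ball p r"
    "\<And>w. w \<in> ball p r \<Longrightarrow> (w - p) * deriv y w = u w * y w"
    "\<And>w. w \<in> ball p r - {p} \<Longrightarrow> y w \<noteq> 0"
    using log_derivative_holomorphic[OF r1(3,1)] by metis
  let ?B = "ball p r"
  have hB: "\<Phi> holomorphic_on ?B" "y holomorphic_on ?B" "u holomorphic_on ?B"
    using \<Phi> r1(2,3) r(2,3) by (auto elim!: holomorphic_on_subset)
  have hB': "deriv \<Phi> holomorphic_on ?B" "deriv y holomorphic_on ?B" "deriv u holomorphic_on ?B"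
    "deriv (deriv \<Phi>) holomorphic_on ?B" "deriv (deriv y) holomorphic_on ?B"
    by (intro holomorphic_deriv hB open_ball)+
  have idp: "(\<lambda>w. w - p) holomorphic_on ?B" by (intro holomorphic_intros)
  have dx: "deriv (\<lambda>w. w - p) z = 1" for z :: complex by (auto intro!: DERIV_imp_deriv derivative_eq_intros)
  have 1: "(w - p) * deriv \<Phi> w = y w * \<Phi> w" if "w \<in> ?B" for w using r1(4)[of w] that r(2) by auto
  note m = deriv_open_mult[OF open_ball]
  \<comment> \<open>The two first order relations are differentiated to meet the hypotheses of
    \<open>log_schwarzian_algebra\<close>.\<close>
  have 2: "deriv \<Phi> w + (w - p) * deriv (deriv \<Phi>) w = deriv y w * \<Phi> w + y w * deriv \<Phi> w" if "w \<in> ?B" for w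
    using deriv_cong_open[OF open_ball that 1] m[OF idp hB'(1) that] m[OF hB(2,1) that] by (simp add: dx)
  have 3: "2 * deriv (deriv \<Phi>) w + (w - p) * deriv (deriv (deriv \<Phi>)) w
      = deriv (deriv y) w * \<Phi> w + 2 * deriv y w * deriv \<Phi> w + y w * deriv (deriv \<Phi>) w" if w: "w \<in> ?B" for w
  proof -
    have "deriv (\<lambda>w. deriv \<Phi> w + (w - p) * deriv (deriv \<Phi>) w) w = deriv (\<lambda>w. deriv y w * \<Phi> w + y w * deriv \<Phi> w) w"
      by (rule deriv_cong_open[OF open_ball w 2])
    moreover have "deriv (\<lambda>w. deriv \<Phi> w + (w - p) * deriv (deriv \<Phi>) w) w
        = deriv (deriv \<Phi>) w + deriv (\<lambda>w. (w - p) * deriv (deriv \<Phi>) w) w"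
      by (intro deriv_add holomorphic_on_imp_differentiable_at[OF _ open_ball w] hB' holomorphic_intros idp)
    moreover have "deriv (\<lambda>w. deriv y w * \<Phi> w + y w * deriv \<Phi> w) w
        = deriv (\<lambda>w. deriv y w * \<Phi> w) w + deriv (\<lambda>w. y w * deriv \<Phi> w) w"
      by (intro deriv_add holomorphic_on_imp_differentiable_at[OF _ open_ball w] holomorphic_on_mult hB hB')
    ultimately show ?thesis
      using m[OF idp hB'(4) w] m[OF hB'(2) hB(1) w] m[OF hB(2) hB'(1) w] by (simp add: dx)
  qed
  have 5: "deriv y w + (w - p) * deriv (deriv y) w = deriv u w * y w + u w * deriv y w" if "w \<in> ?B" for w
    using deriv_cong_open[OF open_ball that r(4)] m[OF idp hB'(2) that] m[OF hB(3,2) that] by (simp add: dx)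
  have main: "(w - p)\<^sup>2 * S w = 1 - (u w)\<^sup>2 + 2 * (w - p) * deriv u w" if w: "w \<in> ?B - {p}" for w
  proof -
    have wB: "w \<in> ?B" and wp: "w - p \<noteq> 0" using w by auto
    have nzw: "\<Phi> w \<noteq> 0" "y w \<noteq> 0" using w r r1 by auto
    then have "\<Phi> w * deriv \<Phi> w \<noteq> 0" using 1[OF wB] wp by auto
    moreover have "(w - p)\<^sup>2 * log_schwarzian_num \<Phi> w = (1 - (u w)\<^sup>2 + 2 * (w - p) * deriv u w) * (\<Phi> w * deriv \<Phi> w)\<^sup>2"
      unfolding log_schwarzian_num_def
      by (rule log_schwarzian_algebra[OF wp 1[OF wB] 2[OF wB] 3[OF wB] r(4)[OF wB] 5[OF wB]])
    moreover have "S w * (\<Phi> w * deriv \<Phi> w)\<^sup>2 = log_schwarzian_num \<Phi> w" using eq'[of w] w r r1 by auto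
    ultimately show ?thesis by (metis mult.assoc mult_right_cancel power_not_zero)
  qed
  show ?thesis
    by (rule that[OF r(1) _ hB(2,3) 1 r(4) _ main]) (use r r1 in auto)
qed

text \<open>With \<open>x = w - p\<close>, the expansion
  \<open>\<Phi> = \<alpha> x + \<beta> x\<^sup>2 + ...\<close> gives
  \<open>y = 1 + (\<beta> / \<alpha>) x + ...\<close> and
  \<open>u = (\<beta> / \<alpha>) x + ...\<close>, so \<open>1 - u\<^sup>2 + 2 x u'\<close> begins
  with \<open>1 + 2 (\<beta> / \<alpha>) x\<close>.\<close>

lemma schwarzian_at_simple_puncture:
  assumes r: "0 < r" and hol: "\<Phi> holomorphic_on ball p r" "y holomorphic_on ball p r" "u holomorphic_on ball p r"
    and y: "\<And>w. w \<in> ball p r \<Longrightarrow> (w - p) * deriv \<Phi> w = y w * \<Phi> w"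
    and u: "\<And>w. w \<in> ball p r \<Longrightarrow> (w - p) * deriv y w = u w * y w"
    and S: "\<And>w. w \<in> ball p r - {p} \<Longrightarrow> (w - p)\<^sup>2 * S w = 1 - (u w)\<^sup>2 + 2 * (w - p) * deriv u w"
    and \<Phi>: "\<Phi> p = 0" "deriv \<Phi> p = \<alpha>" "deriv (deriv \<Phi>) p = 2 * \<beta>" and \<alpha>: "\<alpha> \<noteq> 0"
  obtains H where "H holomorphic_on ball p r"
    "\<And>w. w \<in> ball p r - {p} \<Longrightarrow> S w = 1 / (w - p)\<^sup>2 + 2 * \<beta> / \<alpha> / (w - p) + H w"
    "y p = 1" "u p = 0" "deriv u p = \<beta> / \<alpha>"
proof -
  let ?B = "ball p r"
  have p: "p \<in> ?B" using r by simp
  have hB': "deriv \<Phi> holomorphic_on ?B" "deriv y holomorphic_on ?B" "deriv u holomorphic_on ?B"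
    "deriv (deriv \<Phi>) holomorphic_on ?B"
    by (intro holomorphic_deriv hol open_ball)+
  have idp: "(\<lambda>w. w - p) holomorphic_on ?B" by (intro holomorphic_intros)
  have dx: "deriv (\<lambda>w. w - p) z = 1" for z :: complex by (auto intro!: DERIV_imp_deriv derivative_eq_intros)
  note m = deriv_open_mult[OF open_ball]
  have 2: "deriv \<Phi> w + (w - p) * deriv (deriv \<Phi>) w = deriv y w * \<Phi> w + y w * deriv \<Phi> w" if "w \<in> ?B" for w
    using deriv_cong_open[OF open_ball that y] m[OF idp hB'(1) that] m[OF hol(2,1) that] by (simp add: dx)
  have yp: "y p = 1" using 2[OF p] \<Phi> \<alpha> by simp
  have up: "u p = 0" using u[OF p] yp by simp
  have "deriv (\<lambda>w. deriv \<Phi> w + (w - p) * deriv (deriv \<Phi>) w) p = deriv (\<lambda>w. deriv y w * \<Phi> w + y w * deriv \<Phi> w) p"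
    by (rule deriv_cong_open[OF open_ball p 2])
  moreover have "deriv (\<lambda>w. deriv \<Phi> w + (w - p) * deriv (deriv \<Phi>) w) p
      = deriv (deriv \<Phi>) p + deriv (\<lambda>w. (w - p) * deriv (deriv \<Phi>) w) p"
    by (intro deriv_add holomorphic_on_imp_differentiable_at[OF _ open_ball p] hB' holomorphic_intros idp)
  moreover have "deriv (\<lambda>w. deriv y w * \<Phi> w + y w * deriv \<Phi> w) p
      = deriv (\<lambda>w. deriv y w * \<Phi> w) p + deriv (\<lambda>w. y w * deriv \<Phi> w) p"
    by (intro deriv_add holomorphic_on_imp_differentiable_at[OF _ open_ball p] holomorphic_on_mult hol hB')
  ultimately have "2 * deriv (deriv \<Phi>) p = 2 * deriv y p * deriv \<Phi> p + deriv (deriv \<Phi>) p"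
    using m[OF idp hB'(4) p] m[OF hB'(2) hol(1) p] m[OF hol(2) hB'(1) p] \<Phi>(1) yp by (simp add: dx)
  then have dy: "deriv y p = \<beta> / \<alpha>" using \<Phi> \<alpha> by (simp add: field_simps)
  have "deriv (\<lambda>w. (w - p) * deriv y w) p = deriv (\<lambda>w. u w * y w) p"
    by (rule deriv_cong_open[OF open_ball p u])
  then have du: "deriv u p = \<beta> / \<alpha>"
    using m[OF idp hB'(2) p] m[OF hol(3,2) p] dy yp up by (simp add: dx)
  \<comment> \<open>Two successive difference quotients, \<open>u = x v\<close> and
    \<open>v = \<beta> / \<alpha> + x t\<close> with \<open>x = w - p\<close>, isolate the terms of
    order at least 2, which form \<open>H\<close>.\<close>
  define v where "v = (\<lambda>w. if w = p then deriv u p else (u w - u p) / (w - p))"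
  have v: "v holomorphic_on ?B" unfolding v_def by (rule pole_lemma_open[OF hol(3) open_ball])
  define t where "t = (\<lambda>w. if w = p then deriv v p else (v w - v p) / (w - p))"
  have t: "t holomorphic_on ?B" unfolding t_def by (rule pole_lemma_open[OF v open_ball])
  have uv: "u w = (w - p) * v w" for w by (simp add: v_def up)
  have vt: "v w = \<beta> / \<alpha> + (w - p) * t w" for w by (simp add: t_def v_def du)
  have dv: "deriv v holomorphic_on ?B" by (intro holomorphic_deriv v open_ball)
  have du': "deriv u w = v w + (w - p) * deriv v w" if "w \<in> ?B" for w
    using deriv_cong_open[OF open_ball that uv] m[OF idp v that] by (simp add: dx)
  define H where "H = (\<lambda>w. - (v w)\<^sup>2 + 2 * deriv v w + 2 * t w)"
  show ?thesis
  proof (rule that[of H, OF _ _ yp up du])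
    show "H holomorphic_on ?B"
      unfolding H_def by (intro holomorphic_on_add holomorphic_on_minus holomorphic_on_mult holomorphic_on_power holomorphic_on_const v t dv)
    fix w assume w: "w \<in> ?B - {p}"
    then have x: "w - p \<noteq> 0" by simp
    have alg: "1 - (x * a)\<^sup>2 + 2 * x * (a + x * b) = 1 + 2 * c * x + x\<^sup>2 * (- a\<^sup>2 + 2 * b + 2 * e)"
      if "a = c + x * e" for x a b c e :: complex
      unfolding that by algebra
    have "(w - p)\<^sup>2 * S w = 1 + 2 * (\<beta> / \<alpha>) * (w - p) + (w - p)\<^sup>2 * H w"
      unfolding H_def S[OF w] du'[OF DiffD1[OF w]] uv[of w] by (rule alg[OF vt])
    then have "S w = (1 + 2 * (\<beta> / \<alpha>) * (w - p) + (w - p)\<^sup>2 * H w) / (w - p)\<^sup>2"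
      using x by (simp add: eq_divide_eq mult.commute)
    also have "\<dots> = 1 / (w - p)\<^sup>2 + 2 * \<beta> / \<alpha> / (w - p) + H w"
      using x by (simp add: add_divide_distrib power2_eq_square)
    finally show "S w = 1 / (w - p)\<^sup>2 + 2 * \<beta> / \<alpha> / (w - p) + H w" .
  qed
qed

text \<open>A bound that is independent of the order of \<open>\<Phi>\<close> at \<open>p\<close>;
  it serves the point where \<open>f\<close> is infinite, where no expansion of
  \<open>\<Phi>\<close> is given.\<close>

lemma schwarzian_double_pole_bound:
  assumes r: "0 < r" and u: "u holomorphic_on ball p r"
    and S: "\<And>w. w \<in> ball p r - {p} \<Longrightarrow> (w - p)\<^sup>2 * S w = 1 - (u w)\<^sup>2 + 2 * (w - p) * deriv u w"
  obtains B \<delta> where "\<delta> > 0" "\<delta> \<le> r" "\<And>w. w \<in> ball p \<delta> - {p} \<Longrightarrow> norm ((w - p)\<^sup>2 * S w) \<le> B"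
proof -
  have sub: "cball p (r / 2) \<subseteq> ball p r" using r by auto
  have "(\<lambda>w. 1 - (u w)\<^sup>2 + 2 * (w - p) * deriv u w) holomorphic_on ball p r"
    by (intro holomorphic_intros u open_ball)
  then have "continuous_on (cball p (r / 2)) (\<lambda>w. 1 - (u w)\<^sup>2 + 2 * (w - p) * deriv u w)"
    using holomorphic_on_imp_continuous_on continuous_on_subset sub by blast
  then have "compact ((\<lambda>w. 1 - (u w)\<^sup>2 + 2 * (w - p) * deriv u w) ` cball p (r / 2))"
    by (rule compact_continuous_image) simp
  then obtain B where B: "\<And>w. w \<in> cball p (r / 2) \<Longrightarrow> norm (1 - (u w)\<^sup>2 + 2 * (w - p) * deriv u w) \<le> B"
    using compact_imp_bounded bounded_iff by (metis (no_types, lifting) imageI)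
  show ?thesis
  proof (rule that[of "r / 2" B])
    fix w assume w: "w \<in> ball p (r / 2) - {p}"
    then have 1: "w \<in> cball p (r / 2)" "w \<in> ball p r - {p}" using r by auto
    show "norm ((w - p)\<^sup>2 * S w) \<le> B" unfolding S[OF 1(2)] by (rule B[OF 1(1)])
  qed (use r in auto)
qed

subsection \<open>Loops around a puncture\<close>

lemma periodic_exp_eq:
  assumes per: "\<And>s. Re s < R0 \<Longrightarrow> G (s + 2 * of_real pi * \<i>) = G s"
    and s: "Re s < R0" and e: "exp s = exp s'"
  shows "G s = G s'"
proof -
  have nat: "G (t + of_nat n * (2 * of_real pi * \<i>)) = G t" if t: "Re t < R0" for t n
  proof (induction n)
    case (Suc n)
    have "G (t + of_nat (Suc n) * (2 * of_real pi * \<i>)) = G ((t + of_nat n * (2 * of_real pi * \<i>)) + 2 * of_real pi * \<i>)"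
      by (simp add: algebra_simps)
    also have "\<dots> = G (t + of_nat n * (2 * of_real pi * \<i>))" by (rule per) (use t in simp)
    finally show ?case using Suc by simp
  qed simp
  obtain m :: int where m: "s = s' + (of_int (2 * m) * pi) * \<i>" using e unfolding exp_eq by blast
  have s': "Re s' < R0" using s m by simp
  show ?thesis
  proof (cases "m \<ge> 0")
    case True
    then have "s = s' + of_nat (nat m) * (2 * of_real pi * \<i>)" using m by simp
    then show ?thesis using nat[OF s'] by simp
  next
    case False
    then have "s' = s + of_nat (nat (- m)) * (2 * of_real pi * \<i>)" using m by simp
    then show ?thesis using nat[OF s] by simp
  qed
qed

text \<open>The jump of \<open>Ln\<close> across its cut is a period of \<open>G\<close> and hence
  invisible; near each point another branch of the logarithm can take its place.\<close>

lemma periodic_descends: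
  assumes G: "G holomorphic_on {s. Re s < R0}"
    and per: "\<And>s. Re s < R0 \<Longrightarrow> G (s + 2 * of_real pi * \<i>) = G s"
  shows "(\<lambda>z. G (Ln z)) holomorphic_on ball 0 (exp R0) - {0}"
    and "\<And>s. Re s < R0 \<Longrightarrow> G (Ln (exp s)) = G s"
proof -
  have Re_Ln': "Re (Ln z) < R0" if "z \<in> ball 0 (exp R0) - {0}" for z
    using that ln_less_cancel_iff[of "norm z" "exp R0"] by auto
  show 2: "G (Ln (exp s)) = G s" if s: "Re s < R0" for s
  proof -
    have *: "Re (Ln (exp s)) < R0" using s by simp
    have e: "exp (Ln (exp s)) = exp s" by (simp only: exp_Ln exp_not_eq_zero not_False_eq_True)
    show ?thesis by (rule periodic_exp_eq[where G = G and ?R0.0 = R0, OF per * e])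
  qed
  have op: "open (ball 0 (exp R0) - {0::complex})" by (intro open_delete open_ball)
  have "\<exists>g'. ((\<lambda>z. G (Ln z)) has_field_derivative g') (at z0)" if z0: "z0 \<in> ball 0 (exp R0) - {0}" for z0
  proof -
    define \<rho> where "\<rho> = min (norm z0) (exp R0 - norm z0)"
    have \<rho>: "\<rho> > 0" using z0 by (auto simp: \<rho>_def)
    have z0nz: "z0 \<noteq> 0" using z0 by auto
    have in1: "z \<in> ball 0 (exp R0) - {0}" if "z \<in> ball z0 \<rho>" for z
    proof -
      have "dist z0 z < norm z0" "dist z0 z < exp R0 - norm z0" using that by (auto simp: \<rho>_def)
      moreover have "norm z \<le> norm z0 + dist z0 z" by (metis dist_norm norm_triangle_sub dist_commute)
      ultimately show ?thesis by (auto simp: dist_norm)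
    qed
    have in2: "z / z0 \<notin> \<real>\<^sub>\<le>\<^sub>0" if "z \<in> ball z0 \<rho>" for z
    proof -
      have "norm (z / z0 - 1) < 1"
      proof -
        have "norm (z - z0) < norm z0" using that by (auto simp: \<rho>_def dist_norm norm_minus_commute)
        then have "norm ((z - z0) / z0) < 1" using z0nz by (simp add: norm_divide)
        then show ?thesis using z0nz by (simp add: diff_divide_distrib)
      qed
      then have "Re (z / z0) > 0" using abs_Re_le_cmod[of "z / z0 - 1"] by auto
      then show ?thesis using complex_nonpos_Reals_iff by fastforce
    qed
    \<comment> \<open>A branch of the logarithm near \<open>z0\<close>, wherever the cut of
      \<open>Ln\<close> lies: the quotient \<open>z / z0\<close> stays in the right half
      plane.\<close>
    define lg where "lg = (\<lambda>z. Ln (z / z0) + Ln z0)"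
    have e: "exp (lg z) = z" if "z \<in> ball z0 \<rho>" for z
      using in1[OF that] z0nz by (simp add: lg_def exp_add)
    have re: "Re (lg z) < R0" if "z \<in> ball z0 \<rho>" for z
    proof -
      have "exp (Re (lg z)) < exp R0" using in1[OF that] e[OF that] by (metis DiffD1 mem_ball_0 norm_exp_eq_Re)
      then show ?thesis by simp
    qed
    have "lg holomorphic_on ball z0 \<rho>"
      unfolding lg_def using in2 z0nz by (intro holomorphic_intros) auto
    then have "(G \<circ> lg) holomorphic_on ball z0 \<rho>"
      by (rule holomorphic_on_compose_gen[OF _ G]) (use re in auto)
    then have "(\<lambda>z. G (Ln z)) holomorphic_on ball z0 \<rho>"
    proof (rule holomorphic_transform)
      fix z assume z: "z \<in> ball z0 \<rho>"
      show "(G \<circ> lg) z = G (Ln z)"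
        using periodic_exp_eq[where G = G and ?R0.0 = R0, OF per re[OF z], of "Ln z"] e[OF z] in1[OF z] by simp
    qed
    then show ?thesis using \<rho> by (meson centre_in_ball holomorphic_on_open open_ball)
  qed
  then show "(\<lambda>z. G (Ln z)) holomorphic_on ball 0 (exp R0) - {0}"
    by (simp add: holomorphic_on_open[OF op])
qed

lemma open_left_halfplane: "open {s. Re s < R0}" and convex_left_halfplane: "convex {s. Re s < R0}"
  by (simp_all add: open_halfspace_Re_lt convex_halfspace_Re_lt)

text \<open>Far from the boundary of the left half plane, a translation by \<open>2 \<pi> i\<close>
  is a short hyperbolic displacement, and \<open>L\<close> does not lengthen it.\<close>

lemma Schwarz_Pick_shift:
  assumes L: "L holomorphic_on {s. Re s < R0}" "L ` {s. Re s < R0} \<subseteq> UH" and s: "Re s < R0"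
  shows "norm (cayley (L s) (L (s + 2 * of_real pi * \<i>))) \<le> pi / (R0 - Re s)"
proof -
  define g where "g = (\<lambda>\<sigma>. L (of_real R0 + \<i> * \<sigma>))"
  have g: "g holomorphic_on UH" "g ` UH \<subseteq> UH"
  proof -
    have "(L \<circ> (\<lambda>\<sigma>. of_real R0 + \<i> * \<sigma>)) holomorphic_on UH"
      by (rule holomorphic_on_compose_gen[OF _ L(1)]) (auto intro!: holomorphic_intros simp: UH_iff)
    then show "g holomorphic_on UH" by (simp add: g_def o_def)
    show "g ` UH \<subseteq> UH" using L(2) by (auto simp: g_def UH_iff image_subset_iff)
  qed
  define \<sigma> where "\<sigma> = - \<i> * (s - of_real R0)"
  have \<sigma>: "\<sigma> \<in> UH" "\<sigma> + 2 * of_real pi \<in> UH" using s by (auto simp: \<sigma>_def UH_iff)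
  have gs: "g \<sigma> = L s" "g (\<sigma> + 2 * of_real pi) = L (s + 2 * of_real pi * \<i>)"
    by (simp_all add: g_def \<sigma>_def algebra_simps)
  have "norm (cayley \<sigma> (\<sigma> + 2 * of_real pi)) \<le> pi / (R0 - Re s)"
  proof -
    have "Im \<sigma> = R0 - Re s" by (simp add: \<sigma>_def)
    moreover have "2 * Im \<sigma> \<le> norm (\<sigma> + 2 * of_real pi - cnj \<sigma>)"
      using abs_Im_le_cmod[of "\<sigma> + 2 * of_real pi - cnj \<sigma>"] by simp
    ultimately have le: "2 * (R0 - Re s) \<le> norm (\<sigma> + 2 * of_real pi - cnj \<sigma>)" by simp
    have "norm (cayley \<sigma> (\<sigma> + 2 * of_real pi)) = 2 * pi / norm (\<sigma> + 2 * of_real pi - cnj \<sigma>)"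
      by (simp add: cayley_def norm_divide norm_mult)
    also have "\<dots> \<le> 2 * pi / (2 * (R0 - Re s))"
      using le s by (intro divide_left_mono mult_pos_pos) auto
    also have "\<dots> = pi / (R0 - Re s)" by (rule mult_divide_mult_cancel_left) simp
    finally show ?thesis .
  qed
  then show ?thesis using Schwarz_Pick_UH[OF g \<sigma>] unfolding gs by linarith
qed

context plane_cover
begin

text \<open>The segment from \<open>s\<close> to \<open>s + 2 \<pi> i\<close> maps to a closed loop,
  whose lift joins \<open>L s\<close> to its image under a deck transformation. The displacement
  tends to 0 as \<open>Re s\<close> tends to minus infinity, which excludes hyperbolic
  transformations; elliptic ones have fixed points and are excluded by uniqueness of lifts. The
  identity remains possible.\<close>

lemma loop_parabolic:
  assumes E: "E holomorphic_on {s. Re s < R0}" "E ` {s. Re s < R0} \<subseteq> Y"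
    and per: "\<And>s. Re s < R0 \<Longrightarrow> E (s + 2 * of_real pi * \<i>) = E s"
    and s0: "Re s0 < R0" and t: "\<tau>0 \<in> UH" "F \<tau>0 = E s0"
  obtains L a b c d where
    "L holomorphic_on {s. Re s < R0}" "L ` {s. Re s < R0} \<subseteq> UH" "L s0 = \<tau>0"
    "\<And>s. Re s < R0 \<Longrightarrow> F (L s) = E s"
    "a * d - b * c = 1" "(a + d)\<^sup>2 = 4"
    "\<And>\<tau>. \<tau> \<in> UH \<Longrightarrow> F (real_moebius a b c d \<tau>) = F \<tau>"
    "\<And>s. Re s < R0 \<Longrightarrow> L (s + 2 * of_real pi * \<i>) = real_moebius a b c d (L s)"
proof -
  let ?D = "{s. Re s < R0}"
  obtain L where L: "L holomorphic_on ?D" "L ` ?D \<subseteq> UH" "L s0 = \<tau>0" "\<And>s. s \<in> ?D \<Longrightarrow> F (L s) = E s"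
    using lift[OF open_left_halfplane convex_left_halfplane _ E t] s0 by blast
  have LU: "L s \<in> UH" if "Re s < R0" for s using L(2) that by auto
  have LF: "F (L s) = E s" if "Re s < R0" for s using L(4) that by simp
  define p :: complex where "p = 2 * of_real pi * \<i>"
  have Rep: "Re (s + p) = Re s" for s by (simp add: p_def)
  have "F (L s0) = F (L (s0 + p))" using per[OF s0] LF s0 Rep by (simp add: p_def)
  then obtain a b c d where m: "a * d - b * c = 1" "real_moebius a b c d (L s0) = L (s0 + p)"
    "\<And>\<tau>. \<tau> \<in> UH \<Longrightarrow> real_moebius a b c d \<tau> \<in> UH \<and> F (real_moebius a b c d \<tau>) = F \<tau>"
    using deck[of "L s0" "L (s0 + p)"] LU s0 Rep by metis
  let ?g = "real_moebius a b c d"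
  have contL: "continuous_on ?D L" by (rule holomorphic_on_imp_continuous_on[OF L(1)])
  \<comment> \<open>Both sides lift the same map and agree at \<open>s0\<close>.\<close>
  have shift: "L (s + p) = ?g (L s)" if s: "Re s < R0" for s
  proof (rule lift_unique[where D = ?D and ?s0.0 = s0 and ?L1.0 = "\<lambda>s. L (s + p)" and ?L2.0 = "\<lambda>s. ?g (L s)"])
    show "connected ?D" by (intro convex_connected convex_left_halfplane)
    show "continuous_on ?D (\<lambda>s. L (s + p))"
      by (rule continuous_on_compose2[OF contL]) (auto intro!: continuous_intros simp: p_def)
    show "continuous_on ?D (\<lambda>s. ?g (L s))"
      by (rule continuous_on_compose2[OF holomorphic_on_imp_continuous_on[OF schwarzian_real_moebius(1)[OF m(1) i_in_UH]] contL L(2)])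
    show "F (L (s + p)) = F (?g (L s))" if "s \<in> ?D" for s
      using that m(3)[OF LU[of s]] LF Rep per[of s] by (simp add: p_def)
  qed (use s0 s LU m(2,3) Rep in auto)
  have disp: "norm (cayley (L s) (?g (L s))) \<le> pi / (R0 - Re s)" if s: "Re s < R0" for s
    using Schwarz_Pick_shift[OF L(1,2) s] shift[OF s] by (simp add: p_def)
  have le: "(a + d)\<^sup>2 - 4 \<le> 16 / 3 * \<delta>\<^sup>2" if \<delta>: "0 < \<delta>" "\<delta> \<le> 1 / 2" for \<delta>
  proof -
    \<comment> \<open>Chosen so that the Schwarz-Pick bound \<open>pi / (R0 - Re s)\<close> equals
      \<open>\<delta>\<close>.\<close>
    define s where "s = complex_of_real (R0 - pi / \<delta>)"
    have s: "Re s < R0" "pi / (R0 - Re s) = \<delta>" using \<delta> by (auto simp: s_def)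
    have "norm (cayley (L s) (?g (L s))) \<le> \<delta>" using disp[OF s(1)] s(2) by simp
    from moebius_displacement[OF m(1) LU[OF s(1)] this less_imp_le[OF \<delta>(1)] \<delta>(2)]
    show ?thesis by (rule order_trans[rotated]) (simp only: le_add_same_cancel2 zero_le_power2)
  qed
  have le4: "(a + d)\<^sup>2 \<le> 4"
  proof (rule ccontr)
    assume "\<not> ?thesis"
    then have pos: "(a + d)\<^sup>2 - 4 > 0" by simp
    define \<delta> where "\<delta> = min (1 / 2) (((a + d)\<^sup>2 - 4) / 16)"
    have \<delta>: "0 < \<delta>" "\<delta> \<le> 1 / 2" "16 * \<delta> \<le> (a + d)\<^sup>2 - 4" using pos by (auto simp: \<delta>_def min_def)
    have "16 / 3 * \<delta>\<^sup>2 < 16 * \<delta>" using \<delta>(1,2) by (simp add: power2_eq_square)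
    then show False using le[OF \<delta>(1,2)] \<delta>(3) by linarith
  qed
  have "\<not> (a + d)\<^sup>2 < 4"
  proof
    assume lt: "(a + d)\<^sup>2 < 4"
    then obtain \<tau> where \<tau>: "\<tau> \<in> UH" "?g \<tau> = \<tau>" using moebius_fixed_point[OF m(1)] by metis
    \<comment> \<open>A deck transformation with a fixed point and the identity are lifts of
      \<open>F\<close> through \<open>F\<close> that agree at this point.\<close>
    have "?g \<sigma> = \<sigma>" if \<sigma>: "\<sigma> \<in> UH" for \<sigma>
    proof (rule lift_unique[where D = UH and ?s0.0 = \<tau> and ?L1.0 = ?g and ?L2.0 = "\<lambda>\<sigma>. \<sigma>"])
      show "continuous_on UH ?g"
        by (rule holomorphic_on_imp_continuous_on[OF schwarzian_real_moebius(1)[OF m(1) i_in_UH]])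
    qed (use connected_UH \<tau> \<sigma> m(3) in auto)
    \<comment> \<open>The values at two points identify the matrix as the identity up to sign, whose
      trace has square 4, against \<open>lt\<close>.\<close>
    then have fix_i: "?g \<i> = \<i>" and fix_2i: "?g (2 * \<i>) = 2 * \<i>" by (auto simp: UH_iff)
    have "of_real a * \<i> + of_real b = \<i> * (of_real c * \<i> + of_real d)"
      using fix_i real_moebius_denom_nz[OF m(1) i_in_UH] by (simp add: real_moebius_def divide_eq_eq)
    then have 1: "a = d" "b = - c" by (auto simp: complex_eq_iff)
    have "of_real a * (2 * \<i>) + of_real b = (2 * \<i>) * (of_real c * (2 * \<i>) + of_real d)"
      using fix_2i real_moebius_denom_nz[OF m(1), of "2 * \<i>"] by (simp add: real_moebius_def divide_eq_eq UH_iff)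
    then have "b = - 4 * c" by (auto simp: complex_eq_iff)
    with 1 have "c = 0" "b = 0" by auto
    with m(1) 1 have "a * a = 1" by simp
    then have "(a + d)\<^sup>2 = 4" using 1 by (simp add: power2_eq_square)
    with lt show False by simp
  qed
  with le4 have "(a + d)\<^sup>2 = 4" by linarith
  then show ?thesis
    using that[OF L(1-3) LF m(1) _ _ shift[unfolded p_def]] m(3) by blast
qed

text \<open>A bounded periodic function of \<open>s\<close> is a holomorphic function of
  \<open>exp s\<close> on the full disc. Translation constant 0 is permitted, so discs whose centre
  belongs to \<open>Y\<close> are covered too.\<close>

lemma puncture_uniformizer:
  assumes E: "E holomorphic_on {s. Re s < R0}" "E ` {s. Re s < R0} \<subseteq> Y"
    and per: "\<And>s. Re s < R0 \<Longrightarrow> E (s + 2 * of_real pi * \<i>) = E s" and Ene: "Y \<noteq> {}"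
  obtains L r \<kappa> \<Phi> where
    "L holomorphic_on {s. Re s < R0}" "L ` {s. Re s < R0} \<subseteq> UH"
    "\<And>s. Re s < R0 \<Longrightarrow> F (L s) = E s"
    "\<kappa> \<noteq> 0" "\<Phi> holomorphic_on ball 0 (exp R0)"
    "\<And>s. Re s < R0 \<Longrightarrow> \<Phi> (exp s) = exp (\<kappa> * cusp_coord r (L s))"
proof -
  define s0 where "s0 = complex_of_real (R0 - 1)"
  have s0: "Re s0 < R0" by (simp add: s0_def)
  have "E s0 \<in> F ` UH" using E(2) s0 F_surj by auto
  then obtain \<tau>0 where \<tau>0: "\<tau>0 \<in> UH" "F \<tau>0 = E s0" by auto
  show thesis
  proof (rule loop_parabolic[OF E per s0 \<tau>0])
  fix L a b c d
  assume L: "L holomorphic_on {s. Re s < R0}" "L ` {s. Re s < R0} \<subseteq> UH"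
    and LE: "\<And>s. Re s < R0 \<Longrightarrow> F (L s) = E s"
    and m: "a * d - b * c = 1" "(a + d)\<^sup>2 = 4"
    and shift: "\<And>s. Re s < R0 \<Longrightarrow> L (s + 2 * of_real pi * \<i>) = real_moebius a b c d (L s)"
  have LU: "L s \<in> UH" if "Re s < R0" for s using L(2) that by auto
  show thesis
  proof (rule moebius_parabolic[OF m])
  fix r k
  assume rk: "\<And>\<tau>. \<tau> \<in> UH \<Longrightarrow> cusp_coord r (real_moebius a b c d \<tau>) = cusp_coord r \<tau> + of_real k"
  \<comment> \<open>The absolute value fixes the sign of the exponent so that the exponential is
    bounded by 1; for \<open>k = 0\<close> any positive value works, and 1 is a placeholder.\<close>
  define K where "K = (if k = 0 then 1 else \<bar>k\<bar>)"
  have K: "K > 0" by (simp add: K_def)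
  define \<kappa> where "\<kappa> = 2 * of_real pi * \<i> / of_real K"
  have \<kappa>: "\<kappa> \<noteq> 0" using K by (simp add: \<kappa>_def)
  have \<kappa>k: "exp (\<kappa> * of_real k) = 1"
  proof -
    consider "k = 0" | "k > 0" | "k < 0" by linarith
    then show ?thesis
    proof cases
      case 2
      then have "\<kappa> * of_real k = 2 * of_real pi * \<i>" by (simp add: \<kappa>_def K_def)
      then show ?thesis by (simp add: exp_eq_1)
    next
      case 3
      then have "\<kappa> * of_real k = - (2 * of_real pi * \<i>)" by (simp add: \<kappa>_def K_def)
      then show ?thesis by (simp add: exp_minus)
    qed simp
  qed
  define G where "G = (\<lambda>s. exp (\<kappa> * cusp_coord r (L s)))"
  have hol_cusp: "cusp_coord r holomorphic_on UH"
    using cusp_coord_moebius[of r] schwarzian_real_moebius(1)[OF _ i_in_UH] by metis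
  have "(cusp_coord r \<circ> L) holomorphic_on {s. Re s < R0}"
    by (rule holomorphic_on_compose_gen[OF L(1) hol_cusp L(2)])
  then have G: "G holomorphic_on {s. Re s < R0}"
    unfolding G_def o_def by (intro holomorphic_intros)
  have perG: "G (s + 2 * of_real pi * \<i>) = G s" if s: "Re s < R0" for s
    using shift[OF s] rk[OF LU[OF s]] \<kappa>k by (simp add: G_def exp_add distrib_left)
  have bound: "norm (G s) \<le> 1" if "Re s < R0" for s
  proof -
    have "Im (cusp_coord r (L s)) > 0" using cusp_coord_in_UH[OF LU[OF that]] by (simp add: UH_iff)
    then have "Re (\<kappa> * cusp_coord r (L s)) \<le> 0" using K by (simp add: \<kappa>_def Re_divide_of_real)
    then show ?thesis by (simp add: G_def norm_exp_eq_Re)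
  qed
  have bd: "norm (G (Ln z)) \<le> 1" if "z \<in> ball 0 (exp R0) - {0}" for z
    using that ln_less_cancel_iff[of "norm z" "exp R0"] by (intro bound) auto
  obtain \<Phi> where \<Phi>: "\<Phi> holomorphic_on ball 0 (exp R0)" "\<And>z. z \<in> ball 0 (exp R0) - {0} \<Longrightarrow> \<Phi> z = G (Ln z)"
    using bounded_holomorphic_extends[OF periodic_descends(1)[OF G perG] _ bd] by auto
  have rel: "\<Phi> (exp s) = exp (\<kappa> * cusp_coord r (L s))" if s: "Re s < R0" for s
    using \<Phi>(2)[of "exp s"] periodic_descends(2)[OF G perG s] s by (simp add: G_def norm_exp_eq_Re)
  show thesis by (rule that[OF L LE \<kappa> \<Phi>(1) rel])
  qed
  qed
qed

text \<open>Meant for the point 0 of the \<open>F\<close>-plane, where \<open>f\<close> is infinite.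
  This point may or may not be a puncture, so only the punctured disc is assumed to lie in
  \<open>Y\<close>.\<close>

lemma Sch_at_puncture_bound:
  assumes \<epsilon>: "\<epsilon> > 0" "ball p \<epsilon> - {p} \<subseteq> Y"
  obtains B \<delta> where "\<delta> > 0" "\<And>w. w \<in> ball p \<delta> - {p} \<Longrightarrow> norm ((w - p)\<^sup>2 * Sch w) \<le> B"
proof -
  define R0 where "R0 = ln \<epsilon>"
  let ?D = "{s. Re s < R0}"
  have eR: "exp R0 = \<epsilon>" using \<epsilon> by (simp add: R0_def)
  have ex: "p + exp s \<in> ball p \<epsilon> - {p}" if "Re s < R0" for s
  proof -
    have "exp (Re s) < exp R0" using that by simp
    then show ?thesis by (simp add: dist_norm eR)
  qed
  obtain L r \<kappa> \<Phi>0 where L: "L holomorphic_on ?D" "L ` ?D \<subseteq> UH" "\<And>s. Re s < R0 \<Longrightarrow> F (L s) = p + exp s"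
    and \<kappa>: "\<kappa> \<noteq> 0" and \<Phi>0: "\<Phi>0 holomorphic_on ball 0 (exp R0)"
      "\<And>s. Re s < R0 \<Longrightarrow> \<Phi>0 (exp s) = exp (\<kappa> * cusp_coord r (L s))"
  proof (rule puncture_uniformizer[of "\<lambda>s. p + exp s" R0])
    show "(\<lambda>s. p + exp s) holomorphic_on ?D" by (intro holomorphic_intros)
    show "(\<lambda>s. p + exp s) ` ?D \<subseteq> Y" using ex \<epsilon>(2) by auto
    show "Y \<noteq> {}" using ex[of "of_real (R0 - 1)"] \<epsilon>(2) by auto
  qed (auto simp: exp_add)
  define \<Phi> where "\<Phi> = (\<lambda>w. \<Phi>0 (w - p))"
  have \<Phi>: "\<Phi> holomorphic_on ball p \<epsilon>"
  proof -
    have "(\<Phi>0 \<circ> (\<lambda>w. w - p)) holomorphic_on ball p \<epsilon>"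
      by (rule holomorphic_on_compose_gen[OF _ \<Phi>0(1)]) (auto intro!: holomorphic_intros simp: eR dist_norm norm_minus_commute)
    then show ?thesis by (simp add: \<Phi>_def o_def)
  qed
  \<comment> \<open>The disc of radius 1 about \<open>R0 - 2\<close> stays inside the half plane and
    has height 2, less than \<open>2 \<pi>\<close>; therefore \<open>exp\<close>, and with it
    \<open>L\<close>, is injective there.\<close>
  define s0 where "s0 = complex_of_real (R0 - 2)"
  define U0 where "U0 = ball s0 1"
  have U0: "Re s < R0" if "s \<in> U0" for s
  proof -
    have "\<bar>Re (s - s0)\<bar> < 1" using that abs_Re_le_cmod[of "s - s0"] by (simp add: U0_def dist_norm norm_minus_commute)
    then show ?thesis by (simp add: s0_def)
  qed
  have injL: "inj_on L U0"
  proof (rule inj_onI)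
    fix s s' assume s: "s \<in> U0" "s' \<in> U0" "L s = L s'"
    then have "exp s = exp s'" using L(3)[OF U0[OF s(1)]] L(3)[OF U0[OF s(2)]] by simp
    moreover have "\<bar>Im s - Im s'\<bar> < 2 * pi"
    proof -
      have "\<bar>Im (s - s0)\<bar> < 1" "\<bar>Im (s' - s0)\<bar> < 1"
        using s abs_Im_le_cmod[of "s - s0"] abs_Im_le_cmod[of "s' - s0"] by (simp_all add: U0_def dist_norm norm_minus_commute)
      then show ?thesis using pi_gt3 by (simp add: s0_def)
    qed
    ultimately show "s = s'" using exp_complex_eqI by blast
  qed
  have holU0: "L holomorphic_on U0" by (rule holomorphic_on_subset[OF L(1)]) (use U0 in auto)
  define U where "U = L ` U0"
  have opU: "open U" unfolding U_def by (rule open_mapping_thm3[OF holU0 _ injL]) (simp add: U0_def)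
  have subU: "U \<subseteq> UH" using L(2) U0 by (auto simp: U_def)
  define W where "W = F ` U"
  have W1: "W \<subseteq> ball p \<epsilon> - {p}"
  proof
    fix w assume "w \<in> W"
    then obtain s where s: "s \<in> U0" "w = F (L s)" unfolding W_def U_def by blast
    show "w \<in> ball p \<epsilon> - {p}" unfolding s(2) L(3)[OF U0[OF s(1)]] by (rule ex[OF U0[OF s(1)]])
  qed
  have opW: "open W" unfolding W_def
  proof (rule open_mapping_thm3)
    show "F holomorphic_on U" by (rule holomorphic_on_subset[OF hol subU])
    show "inj_on F U"
    proof (rule inj_onI)
      fix t t' assume "t \<in> U" "t' \<in> U" "F t = F t'"
      then obtain s s' where s: "s \<in> U0" "s' \<in> U0" "t = L s" "t' = L s'" by (auto simp: U_def)
      with \<open>F t = F t'\<close> have "exp s = exp s'" using L(3)[OF U0[OF s(1)]] L(3)[OF U0[OF s(2)]] by simp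
      moreover have "\<bar>Im s - Im s'\<bar> < 2 * pi"
      proof -
        have "\<bar>Im (s - s0)\<bar> < 1" "\<bar>Im (s' - s0)\<bar> < 1"
          using s abs_Im_le_cmod[of "s - s0"] abs_Im_le_cmod[of "s' - s0"] by (simp_all add: U0_def dist_norm norm_minus_commute)
        then show ?thesis using pi_gt3 by (simp add: s0_def)
      qed
      ultimately show "t = t'" using exp_complex_eqI s by blast
    qed
  qed (rule opU)
  have rel: "\<Phi> (F \<tau>) = exp (\<kappa> * cusp_coord r \<tau>)" if t: "\<tau> \<in> U" for \<tau>
  proof -
    obtain s where s: "s \<in> U0" "\<tau> = L s" using t by (auto simp: U_def)
    then show ?thesis using L(3)[OF U0[OF s(1)]] \<Phi>0(2)[OF U0[OF s(1)]] by (simp add: \<Phi>_def)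
  qed
  have FU: "F ` U \<subseteq> ball p \<epsilon>" using W1 by (auto simp: W_def)
  have fact: "\<Phi> w \<noteq> 0 \<and> deriv \<Phi> w \<noteq> 0 \<and> Sch w * (\<Phi> w * deriv \<Phi> w)\<^sup>2 = log_schwarzian_num \<Phi> w" if w: "w \<in> W" for w
  proof -
    obtain \<tau> where t: "\<tau> \<in> U" "w = F \<tau>" using w by (auto simp: W_def)
    then have tU: "\<tau> \<in> UH" using subU by auto
    show ?thesis
      using inv_schwarzian_uniformizing[OF opU subU t(1) holomorphic_on_subset[OF hol subU] deriv_nz[OF tU] open_ball FU \<Phi> rel \<kappa>] Sch_F[OF tU] t(2)
      by simp
  qed
  have holS: "Sch holomorphic_on ball p \<epsilon> - {p}" using Sch_holomorphic \<epsilon>(2) holomorphic_on_subset by blast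
  have Wne: "W \<noteq> {}" by (auto simp: W_def U_def U0_def)
  obtain r1 y u where *: "0 < r1" "r1 \<le> \<epsilon>" "u holomorphic_on ball p r1"
    "\<And>w. w \<in> ball p r1 - {p} \<Longrightarrow> (w - p)\<^sup>2 * Sch w = 1 - (u w)\<^sup>2 + 2 * (w - p) * deriv u w"
    using schwarzian_at_puncture[OF \<epsilon>(1) holS \<Phi> opW Wne W1] fact by metis
  show ?thesis
    using schwarzian_double_pole_bound[OF *(1,3,4)] that by metis
qed

end

subsection \<open>The cusp at infinity\<close>

lemma holomorphic_ball_isCont: "f holomorphic_on ball p r \<Longrightarrow> 0 < r \<Longrightarrow> isCont f p"
  using holomorphic_on_imp_differentiable_at[of f "ball p r" p] field_differentiable_imp_continuous_at
  by auto

context plane_cover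
begin

text \<open>In the coordinates q and \<open>z = f = 1 / F\<close> at the cusp, \<open>\<phi>\<close>
  expands \<open>f\<close> in powers of q and \<open>Q\<close> is its local inverse. The disc of
  radius \<open>exp (- 2 * pi * M / K)\<close> is the image of \<open>Im \<tau> > M\<close> with the
  cusp added.\<close>

definition cusp_chart :: "real \<Rightarrow> real \<Rightarrow> real \<Rightarrow> (complex \<Rightarrow> complex) \<Rightarrow> (complex \<Rightarrow> complex) \<Rightarrow> bool" where
  "cusp_chart K M \<epsilon> Q \<phi> \<longleftrightarrow> K > 0 \<and> M \<ge> 0 \<and> \<epsilon> > 0 \<and> Q holomorphic_on ball 0 \<epsilon> \<and>
     \<phi> holomorphic_on ball 0 (exp (- 2 * pi * M / K)) \<and> \<phi> 0 = 0 \<and>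
     (\<forall>q\<in>ball 0 (exp (- 2 * pi * M / K)). \<phi> q \<in> ball 0 \<epsilon> \<and> Q (\<phi> q) = q) \<and>
     (\<forall>\<tau>. M < Im \<tau> \<longrightarrow> F \<tau> \<noteq> 0 \<and> \<phi> (exp (2 * of_real pi * \<i> / of_real K * \<tau>)) = 1 / F \<tau>) \<and>
     (\<forall>\<tau>\<in>UH. F (\<tau> + of_real K) = F \<tau>)"

text \<open>In contrast to the function \<open>\<phi>\<close> of a \<open>cusp_chart\<close>,
  \<open>Fq\<close> lives on the whole punctured unit disc, so it describes \<open>F\<close> on all
  of the upper half plane, but says nothing about q = 0.\<close>

lemma periodic_q_expansion:
  assumes K: "K > 0" and per: "\<And>\<tau>. \<tau> \<in> UH \<Longrightarrow> F (\<tau> + of_real K) = F \<tau>"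
  obtains Fq where "Fq holomorphic_on ball 0 1 - {0}"
    "\<And>\<tau>. \<tau> \<in> UH \<Longrightarrow> Fq (exp (2 * of_real pi * \<i> / of_real K * \<tau>)) = F \<tau>"
proof -
  define \<mu> where "\<mu> = of_real K / (2 * of_real pi * \<i>)"
  have \<mu>: "\<mu> \<noteq> 0" "\<mu> * (2 * of_real pi * \<i>) = of_real K" "2 * of_real pi * \<i> / of_real K * \<mu> = 1"
    using K by (simp_all add: \<mu>_def)
  have Im\<mu>: "Im (\<mu> * s) = - (K / (2 * pi)) * Re s" for s
  proof -
    have "\<mu> = - \<i> * of_real (K / (2 * pi))" by (simp add: \<mu>_def field_simps)
    then show ?thesis by simp
  qed
  have \<mu>U: "\<mu> * s \<in> UH" if "Re s < 0" for s
    unfolding UH_iff Im\<mu> using that K by (intro mult_neg_neg) auto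
  define P where "P = (\<lambda>s. F (\<mu> * s))"
  have P: "P holomorphic_on {s. Re s < 0}"
  proof -
    have "(F \<circ> (\<lambda>s. \<mu> * s)) holomorphic_on {s. Re s < 0}"
      by (rule holomorphic_on_compose_gen[OF _ hol]) (auto intro!: holomorphic_intros \<mu>U)
    then show ?thesis by (simp add: P_def o_def)
  qed
  have perP: "P (s + 2 * of_real pi * \<i>) = P s" if s: "Re s < 0" for s
    using per[OF \<mu>U[OF s]] \<mu>(2) by (simp add: P_def distrib_left)
  have "P (Ln (exp (2 * of_real pi * \<i> / of_real K * \<tau>))) = F \<tau>" if t: "\<tau> \<in> UH" for \<tau>
  proof -
    define s where "s = 2 * of_real pi * \<i> / of_real K * \<tau>"
    have "Re s = - (2 * pi / K) * Im \<tau>"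
    proof -
      have "s = \<i> * of_real (2 * pi / K) * \<tau>" by (simp add: s_def field_simps)
      then show ?thesis by simp
    qed
    then have s: "Re s < 0" using t K by (simp add: UH_iff)
    have "\<mu> * s = (2 * of_real pi * \<i> / of_real K * \<mu>) * \<tau>" by (simp only: s_def mult_ac)
    then have "\<mu> * s = \<tau>" unfolding \<mu>(3) by simp
    then show ?thesis using periodic_descends(2)[OF P perP s] unfolding P_def s_def[symmetric] by simp
  qed
  moreover have "(\<lambda>z. P (Ln z)) holomorphic_on ball 0 1 - {0}"
    using periodic_descends(1)[OF P perP] by simp
  ultimately show ?thesis using that by blast
qed

text \<open>The map \<open>exp (- s)\<close> parametrises a neighbourhood of infinity in the
  \<open>F\<close>-plane, where \<open>loop_parabolic\<close> applies. The growth of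
  \<open>F\<close> shows that the deck transformation fixes infinity, and an open mapping argument
  that it is not trivial; then q and \<open>1 / F\<close> are holomorphic functions of each
  other.\<close>

lemma cusp_chart_exists:
  assumes inf: "\<And>R. \<exists>M\<ge>0. \<forall>\<tau>. M < Im \<tau> \<longrightarrow> R < norm (F \<tau>)"
    and R1: "0 < R1" "\<And>v. R1 < norm v \<Longrightarrow> v \<in> Y"
  shows "\<exists>K M \<epsilon> Q \<phi>. cusp_chart K M \<epsilon> Q \<phi>"
proof -
  obtain M where M: "0 \<le> M" "\<And>\<tau>. M < Im \<tau> \<Longrightarrow> R1 < norm (F \<tau>)" using inf by blast
  define \<epsilon> where "\<epsilon> = 1 / R1"
  define R0 where "R0 = ln \<epsilon>"
  have \<epsilon>: "\<epsilon> > 0" using R1 by (simp add: \<epsilon>_def)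
  have eR: "exp R0 = \<epsilon>" "exp (- R0) = R1" using \<epsilon> R1 by (simp_all add: R0_def \<epsilon>_def exp_minus)
  let ?D = "{s. Re s < R0}"
  define HM where "HM = {\<tau>. M < Im \<tau>}"
  have HM: "open HM" "convex HM" "HM \<subseteq> UH"
    using M(1) unfolding HM_def by (auto simp: open_halfspace_Im_gt convex_halfspace_Im_gt UH_iff)
  have Fnz: "F \<tau> \<noteq> 0" if "\<tau> \<in> HM" for \<tau> using M(2)[of \<tau>] that R1 by (auto simp: HM_def)
  have hol1: "(\<lambda>\<tau>. 1 / F \<tau>) holomorphic_on HM"
    using Fnz by (intro holomorphic_intros holomorphic_on_subset[OF hol HM(3)]) auto
  \<comment> \<open>A logarithm of \<open>1 / F\<close> above height \<open>M\<close>; the lift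
    \<open>L\<close> turns out to be its left inverse.\<close>
  obtain h where h: "h holomorphic_on HM" "\<And>\<tau>. \<tau> \<in> HM \<Longrightarrow> 1 / F \<tau> = exp (h \<tau>)"
    using contractible_imp_holomorphic_log[OF hol1 convex_imp_contractible[OF HM(2)]] Fnz by auto
  have eh: "exp (- h \<tau>) = F \<tau>" if "\<tau> \<in> HM" for \<tau>
    using h(2)[OF that, symmetric] Fnz[OF that] by (simp add: exp_minus)
  have Reh: "Re (h \<tau>) = - ln (norm (F \<tau>))" if "\<tau> \<in> HM" for \<tau>
  proof -
    have "norm (F \<tau>) = exp (- Re (h \<tau>))" using eh[OF that] norm_exp_eq_Re[of "- h \<tau>"] by simp
    then show ?thesis by simp
  qed
  have hD: "Re (h \<tau>) < R0" if "\<tau> \<in> HM" for \<tau>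
  proof -
    have "R1 < norm (F \<tau>)" using that M(2) by (auto simp: HM_def)
    then have "ln R1 < ln (norm (F \<tau>))" using R1(1) by (subst ln_less_cancel_iff) linarith+
    then show ?thesis using R1(1) by (simp add: Reh[OF that] R0_def \<epsilon>_def ln_div)
  qed
  define \<tau>0 where "\<tau>0 = Complex 0 (M + 1)"
  have \<tau>0: "\<tau>0 \<in> HM" "\<tau>0 \<in> UH" using M(1) by (simp_all add: \<tau>0_def HM_def UH_iff)
  have EY: "(\<lambda>s. exp (- s)) ` ?D \<subseteq> Y"
  proof safe
    fix s assume "Re s < R0"
    then have "R1 < norm (exp (- s))" by (simp add: norm_exp_eq_Re eR(2)[symmetric])
    then show "exp (- s) \<in> Y" by (rule R1(2))
  qed
  have holE: "(\<lambda>s. exp (- s)) holomorphic_on ?D" by (intro holomorphic_intros)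
  have perE: "exp (- (s + 2 * of_real pi * \<i>)) = exp (- s)" for s :: complex
    by (simp add: exp_diff)
  show ?thesis
  proof (rule loop_parabolic[OF holE EY perE hD[OF \<tau>0(1)] \<tau>0(2) eh[OF \<tau>0(1), symmetric]])
    fix L a b c d
    assume L: "L holomorphic_on ?D" "L ` ?D \<subseteq> UH" "L (h \<tau>0) = \<tau>0"
      and LE: "\<And>s. Re s < R0 \<Longrightarrow> F (L s) = exp (- s)"
      and det: "a * d - b * c = 1" and tr: "(a + d)\<^sup>2 = 4"
      and dk: "\<And>\<tau>. \<tau> \<in> UH \<Longrightarrow> F (real_moebius a b c d \<tau>) = F \<tau>"
      and shift: "\<And>s. Re s < R0 \<Longrightarrow> L (s + 2 * of_real pi * \<i>) = real_moebius a b c d (L s)"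
    have LU: "L s \<in> UH" if "Re s < R0" for s using L(2) that by auto
    have Lh: "L (h \<tau>) = \<tau>" if t: "\<tau> \<in> HM" for \<tau>
    proof (rule lift_unique[where D = HM and ?s0.0 = \<tau>0 and ?L1.0 = "\<lambda>\<tau>. L (h \<tau>)" and ?L2.0 = "\<lambda>\<tau>. \<tau>"])
      show "connected HM" by (intro convex_connected HM)
      show "continuous_on HM (\<lambda>\<tau>. L (h \<tau>))"
        by (rule continuous_on_compose2[OF holomorphic_on_imp_continuous_on[OF L(1)] holomorphic_on_imp_continuous_on[OF h(1)]])
          (use hD in auto)
      show "F (L (h s)) = F s" if "s \<in> HM" for s using LE[OF hD[OF that]] eh[OF that] by simp
      show "(\<lambda>\<tau>. L (h \<tau>)) ` HM \<subseteq> UH" using LU hD by blast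
    qed (use \<tau>0 t L(3) HM(3) in auto)
    \<comment> \<open>Otherwise the displacement of the point \<open>Complex 0 y\<close> would grow
      like \<open>\<bar>c\<bar> * y\<close>, whereas the loop through it gets short as
      \<open>F\<close> tends to infinity.\<close>
    have c0: "c = 0"
    proof (rule ccontr)
      assume c: "c \<noteq> 0"
      \<comment> \<open>The factor \<open>exp (2 * pi)\<close> makes
        \<open>R0 - Re (h \<tau>)\<close> exceed \<open>2 * pi\<close>, so the displacement is at
        most 1/2, as \<open>moebius_displacement\<close> demands.\<close>
      obtain M2 where M2: "M2 \<ge> 0" "\<And>\<tau>. M2 < Im \<tau> \<Longrightarrow> R1 * exp (2 * pi) < norm (F \<tau>)" using inf by blast
      \<comment> \<open>High enough that \<open>\<bar>c * y\<bar> \<ge> 3 + \<bar>b\<bar>\<close>,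
        which contradicts the bound 2 for \<open>\<bar>c * y - b / y\<bar>\<close>.\<close>
      define y where "y = M + M2 + (3 + \<bar>b\<bar>) / \<bar>c\<bar> + 1"
      have yq: "(3 + \<bar>b\<bar>) / \<bar>c\<bar> \<ge> 0" by simp
      have y: "y > M" "y > M2" "y \<ge> 1" "y \<ge> (3 + \<bar>b\<bar>) / \<bar>c\<bar>" using M(1) M2(1) yq unfolding y_def by linarith+
      define \<tau> where "\<tau> = Complex 0 y"
      have t: "\<tau> \<in> HM" using y by (simp add: \<tau>_def HM_def)
      have p: "0 < R1 * exp (2 * pi)" using R1(1) by simp
      have gt: "R1 * exp (2 * pi) < norm (F \<tau>)" using M2(2)[of \<tau>] y by (simp add: \<tau>_def)
      have "ln (R1 * exp (2 * pi)) < ln (norm (F \<tau>))"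
        using ln_less_cancel_iff[OF p less_trans[OF p gt]] gt by blast
      then have "2 * pi < R0 - Re (h \<tau>)" using R1(1) by (simp add: Reh[OF t] R0_def \<epsilon>_def ln_mult ln_div)
      moreover have pos: "0 < R0 - Re (h \<tau>)" using hD[OF t] by simp
      ultimately have "pi / (R0 - Re (h \<tau>)) \<le> 1 / 2" unfolding pos_divide_le_eq[OF pos] by (simp add: field_simps)
      then have "norm (cayley \<tau> (real_moebius a b c d \<tau>)) \<le> 1 / 2"
      proof -
        assume le: "pi / (R0 - Re (h \<tau>)) \<le> 1 / 2"
        have "norm (cayley \<tau> (real_moebius a b c d \<tau>)) \<le> pi / (R0 - Re (h \<tau>))"
          using Schwarz_Pick_shift[OF L(1,2) hD[OF t]] shift[OF hD[OF t]] Lh[OF t] by simp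
        with le show ?thesis by linarith
      qed
      from moebius_displacement[OF det _ this] t HM(3)
      have *: "((c * ((Re \<tau>)\<^sup>2 + (Im \<tau>)\<^sup>2) + (d - a) * Re \<tau> - b) / Im \<tau>)\<^sup>2 + ((a + d)\<^sup>2 - 4) \<le> 16 / 3 * (1 / 2)\<^sup>2" by auto
      have "(c * ((Re \<tau>)\<^sup>2 + (Im \<tau>)\<^sup>2) + (d - a) * Re \<tau> - b) / Im \<tau> = (c * y\<^sup>2 - b) / y" by (simp add: \<tau>_def)
      with * have "((c * y\<^sup>2 - b) / y)\<^sup>2 + (4 - 4) \<le> 16 / 3 * (1 / 2)\<^sup>2" by (simp only: tr)
      also have "16 / 3 * (1 / 2)\<^sup>2 \<le> (4::real)" by (simp add: power2_eq_square)
      finally have "((c * y\<^sup>2 - b) / y)\<^sup>2 \<le> 4" by simp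
      also have "(c * y\<^sup>2 - b) / y = c * y - b / y" using y by (simp add: power2_eq_square diff_divide_distrib)
      finally have "(c * y - b / y)\<^sup>2 \<le> 2\<^sup>2" by simp
      then have le: "\<bar>c * y - b / y\<bar> \<le> 2" using abs_le_square_iff[of "c * y - b / y" 2] by simp
      have "\<bar>b / y\<bar> \<le> \<bar>b\<bar>" using y(3) by (simp add: abs_divide divide_le_eq mult_le_cancel_left1)
      moreover have "\<bar>c * y\<bar> \<ge> 3 + \<bar>b\<bar>"
        using y(3,4) c by (simp add: abs_mult divide_le_eq mult.commute)
      ultimately show False using le by linarith
    qed
    show ?thesis
    proof (rule moebius_parabolic[OF det tr])
      fix r k
      assume rk: "\<And>\<tau>. \<tau> \<in> UH \<Longrightarrow> cusp_coord r (real_moebius a b c d \<tau>) = cusp_coord r \<tau> + of_real k"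
        and rN: "c = 0 \<Longrightarrow> r = None"
      have mk: "real_moebius a b c d \<tau> = \<tau> + of_real k" if "\<tau> \<in> UH" for \<tau>
        using rk[OF that] rN[OF c0] by simp
      have Lk: "L (s + 2 * of_real pi * \<i>) = L s + of_real k" if "Re s < R0" for s
        using shift[OF that] mk[OF LU[OF that]] by simp
      define tj where "tj = (\<lambda>j::nat. Complex 0 (M + 1 + j))"
      have tj: "tj j \<in> HM" for j using M(1) by (simp add: tj_def HM_def)
      have z_lim: "(\<lambda>j. 1 / F (tj j)) \<longlonglongrightarrow> 0"
      proof (rule LIMSEQ_I)
        fix e :: real assume e: "e > 0"
        obtain M2 where M2: "M2 \<ge> 0" "\<And>\<tau>. M2 < Im \<tau> \<Longrightarrow> 1 / e < norm (F \<tau>)" using inf by blast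
        have "norm (1 / F (tj j) - 0) < e" if "j \<ge> nat \<lceil>M2\<rceil>" for j
        proof -
          have "real j \<ge> M2" using that by linarith
          then have "M2 < Im (tj j)" using M(1) by (simp add: tj_def)
          then have "1 / e < norm (F (tj j))" by (rule M2(2))
          then show ?thesis using e Fnz[OF tj] by (simp add: norm_divide divide_simps mult.commute)
        qed
        then show "\<exists>no. \<forall>j\<ge>no. norm (1 / F (tj j) - 0) < e" by blast
      qed
      have zD: "1 / F \<tau> \<in> ball 0 (exp R0) - {0}" if "\<tau> \<in> HM" for \<tau>
        using hD[OF that] h(2)[OF that] by (simp add: norm_exp_eq_Re)
      \<comment> \<open>For \<open>k = 0\<close> the function \<open>1 / (L + \<i>)\<close> would be
        periodic and bounded, and extend to the disc with value 0 at the centre; its imaginary part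
        is never positive, against the open mapping theorem.\<close>
      have k0: "k \<noteq> 0"
      proof
        assume k: "k = 0"
        define m0 where "m0 = (\<lambda>s. 1 / (L s + \<i>))"
        have nz: "L s + \<i> \<noteq> 0" if "Re s < R0" for s
          using LU[OF that] by (auto simp: UH_iff complex_eq_iff)
        have m0: "m0 holomorphic_on ?D" unfolding m0_def using nz by (intro holomorphic_intros L(1)) auto
        have per: "m0 (s + 2 * of_real pi * \<i>) = m0 s" if "Re s < R0" for s
          using Lk[OF that] k by (simp add: m0_def)
        have b1: "norm (m0 s) \<le> 1 \<and> Im (m0 s) < 0" if s: "Re s < R0" for s
        proof
          have I: "Im (L s + \<i>) > 1" using LU[OF s] by (simp add: UH_iff)
          then have "norm (L s + \<i>) \<ge> 1" using abs_Im_le_cmod[of "L s + \<i>"] by linarith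
          then show "norm (m0 s) \<le> 1" using nz[OF s] by (simp add: m0_def norm_divide divide_le_eq_1)
          have "m0 s = cnj (L s + \<i>) / of_real ((norm (L s + \<i>))\<^sup>2)"
            unfolding m0_def by (subst complex_div_cnj) simp
          then have "Im (m0 s) = - Im (L s + \<i>) / (norm (L s + \<i>))\<^sup>2" by (simp only: Im_divide_of_real complex_cnj cnj.sel)
          then show "Im (m0 s) < 0" using I nz[OF s] by (simp add: divide_neg_pos)
        qed
        have ReLn: "Re (Ln z) < R0" if "z \<in> ball 0 (exp R0) - {0}" for z
          using that ln_less_cancel_iff[of "norm z" "exp R0"] by auto
        have b2: "norm (m0 (Ln z)) \<le> 1" if "z \<in> ball 0 (exp R0) - {0}" for z
          using b1[OF ReLn[OF that]] by blast
        obtain m where m: "m holomorphic_on ball 0 (exp R0)" "\<And>z. z \<in> ball 0 (exp R0) - {0} \<Longrightarrow> m z = m0 (Ln z)"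
          using bounded_holomorphic_extends[OF periodic_descends(1)[OF m0 per] _ b2] by auto
        have mF: "m (1 / F \<tau>) = 1 / (\<tau> + \<i>)" if t: "\<tau> \<in> HM" for \<tau>
          using m(2)[OF zD[OF t]] periodic_descends(2)[OF m0 per hD[OF t]] h(2)[OF t] Lh[OF t] by (simp add: m0_def)
        have "isCont m 0" by (rule holomorphic_ball_isCont[OF m(1)]) simp
        then have "(\<lambda>j. m (1 / F (tj j))) \<longlonglongrightarrow> m 0" using z_lim by (rule isCont_tendsto_compose)
        moreover have "(\<lambda>j. m (1 / F (tj j))) \<longlonglongrightarrow> 0"
        proof (rule Lim_null_comparison[OF _ LIMSEQ_inverse_real_of_nat])
          have "norm (m (1 / F (tj j))) \<le> inverse (real (Suc j))" for j
          proof -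
            have "real (Suc j) \<le> Im (tj j + \<i>)" using M(1) by (simp add: tj_def)
            also have "\<dots> \<le> norm (tj j + \<i>)" using abs_Im_le_cmod[of "tj j + \<i>"] by linarith
            finally have "inverse (norm (tj j + \<i>)) \<le> inverse (real (Suc j))" by (intro le_imp_inverse_le) auto
            then show ?thesis using mF[OF tj[of j]] by (simp add: norm_divide inverse_eq_divide)
          qed
          then show "\<forall>\<^sub>F j in sequentially. norm (m (1 / F (tj j))) \<le> inverse (real (Suc j))" by simp
        qed
        ultimately have m00: "m 0 = 0" by (rule LIMSEQ_unique)
        have neg: "Im (m z) \<le> 0" if "z \<in> ball 0 (exp R0)" for z
          using that m00 m(2)[of z] b1[OF ReLn[of z]] by (cases "z = 0") auto
        have nc: "\<not> m constant_on ball 0 (exp R0)"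
        proof
          assume "m constant_on ball 0 (exp R0)"
          moreover have "0 \<in> ball 0 (exp R0)" "1 / F \<tau>0 \<in> ball 0 (exp R0)" using zD[OF \<tau>0(1)] by simp_all
          ultimately have "m (1 / F \<tau>0) = m 0" unfolding constant_on_def by metis
          then have "\<tau>0 + \<i> = 0" using mF[OF \<tau>0(1)] m00 by simp
          then show False using M(1) by (simp add: complex_eq_iff \<tau>0_def)
        qed
        have "open (m ` ball 0 (exp R0))"
          by (rule open_mapping_thm[OF m(1) open_ball connected_ball open_ball subset_refl nc])
        moreover have "0 \<in> m ` ball 0 (exp R0)" by (rule image_eqI[of _ _ 0]) (simp_all add: m00)
        ultimately obtain e where e: "e > 0" "ball 0 e \<subseteq> m ` ball 0 (exp R0)"
          using open_contains_ball by metis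
        have "\<i> * of_real (e / 2) \<in> ball 0 e" using e(1) by (simp add: norm_mult)
        then have "\<i> * of_real (e / 2) \<in> m ` ball 0 (exp R0)" by (rule subsetD[OF e(2)])
        then obtain z where z: "\<i> * of_real (e / 2) = m z" "z \<in> ball 0 (exp R0)" by (rule imageE)
        have "Im (m z) = e / 2" unfolding z(1)[symmetric] by simp
        then show False using neg[OF z(2)] e(1) by linarith
      qed
      define K where "K = \<bar>k\<bar>"
      have K: "K > 0" using k0 by (simp add: K_def)
      \<comment> \<open>For negative \<open>k\<close> the inverse deck transformation supplies the
        period.\<close>
      have perF: "F (\<tau> + of_real K) = F \<tau>" if t: "\<tau> \<in> UH" for \<tau>
      proof (cases "k > 0")
        case True
        then show ?thesis using dk[OF t] mk[OF t] by (simp add: K_def)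
      next
        case False
        have t': "\<tau> - of_real k \<in> UH" using t by (simp add: UH_iff)
        have "F \<tau> = F (\<tau> - of_real k)" using dk[OF t'] mk[OF t'] by simp
        then show ?thesis using False by (simp add: K_def)
      qed
      define \<kappa> where "\<kappa> = 2 * of_real pi * \<i> / of_real K"
      have \<kappa>': "\<kappa> = \<i> * of_real (2 * pi / K)" by (simp add: \<kappa>_def field_simps)
      have \<kappa>k: "exp (\<kappa> * of_real k) = 1"
      proof (cases "k > 0")
        case True
        then have "\<kappa> * of_real k = 2 * of_real pi * \<i>" by (simp add: \<kappa>_def K_def)
        then show ?thesis by (simp add: exp_eq_1)
      next
        case False
        with k0 have "\<kappa> * of_real k = - (2 * of_real pi * \<i>)" by (simp add: \<kappa>_def K_def)
        then show ?thesis by (simp add: exp_minus)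
      qed
      have norm\<kappa>: "norm (exp (\<kappa> * \<tau>)) = exp (- (2 * pi / K) * Im \<tau>)" for \<tau>
        by (simp add: norm_exp_eq_Re \<kappa>')
      define G where "G = (\<lambda>s. exp (\<kappa> * L s))"
      have G: "G holomorphic_on ?D" unfolding G_def by (intro holomorphic_intros L(1))
      have perG: "G (s + 2 * of_real pi * \<i>) = G s" if "Re s < R0" for s
        using Lk[OF that] \<kappa>k by (simp add: G_def distrib_left exp_add)
      have bG: "norm (G (Ln z)) \<le> 1" if z: "z \<in> ball 0 (exp R0) - {0}" for z
      proof -
        have "Re (Ln z) < R0" using z ln_less_cancel_iff[of "norm z" "exp R0"] by auto
        then have "Im (L (Ln z)) > 0" using LU by (simp add: UH_iff)
        moreover have "norm (G (Ln z)) = exp (- (2 * pi / K) * Im (L (Ln z)))" unfolding G_def by (rule norm\<kappa>)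
        ultimately show ?thesis using K by simp
      qed
      obtain Q where Q: "Q holomorphic_on ball 0 (exp R0)" "\<And>z. z \<in> ball 0 (exp R0) - {0} \<Longrightarrow> Q z = G (Ln z)"
        using bounded_holomorphic_extends[OF periodic_descends(1)[OF G perG] _ bG] by auto
      have QF: "Q (1 / F \<tau>) = exp (\<kappa> * \<tau>)" if t: "\<tau> \<in> HM" for \<tau>
        using Q(2)[OF zD[OF t]] periodic_descends(2)[OF G perG hD[OF t]] h(2)[OF t] Lh[OF t] by (simp add: G_def)
      have q_lim: "(\<lambda>j. exp (\<kappa> * tj j)) \<longlonglongrightarrow> 0"
      proof (rule Lim_null_comparison)
        have "norm (exp (\<kappa> * tj j)) = exp (- (2 * pi / K) * (M + 1)) * exp (- (2 * pi / K)) ^ j" for j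
        proof -
          have "- (2 * pi / K) * (M + 1 + j) = - (2 * pi / K) * (M + 1) + real j * (- (2 * pi / K))" by (simp add: algebra_simps add_divide_distrib)
          then show ?thesis unfolding norm\<kappa> tj_def complex.sel by (simp only: exp_add exp_of_nat_mult)
        qed
        then show "\<forall>\<^sub>F j in sequentially. norm (exp (\<kappa> * tj j)) \<le> exp (- (2 * pi / K) * (M + 1)) * exp (- (2 * pi / K)) ^ j" by simp
        have "(\<lambda>j. exp (- (2 * pi / K)) ^ j) \<longlonglongrightarrow> 0" using K by (intro LIMSEQ_power_zero) auto
        from tendsto_mult_right_zero[OF this] show "(\<lambda>j. exp (- (2 * pi / K) * (M + 1)) * exp (- (2 * pi / K)) ^ j) \<longlonglongrightarrow> 0" .
      qed
      \<comment> \<open>Limits are compared along the points \<open>tj j\<close> of the imaginary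
        axis, where \<open>1 / F\<close> and q both tend to 0.\<close>
      have Q0: "Q 0 = 0"
      proof -
        have "isCont Q 0" by (rule holomorphic_ball_isCont[OF Q(1)]) simp
        then have "(\<lambda>j. Q (1 / F (tj j))) \<longlonglongrightarrow> Q 0" using z_lim by (rule isCont_tendsto_compose)
        then show ?thesis using q_lim QF[OF tj] LIMSEQ_unique by simp
      qed
      define \<eta> where "\<eta> = exp (- 2 * pi * M / K)"
      have \<eta>: "\<eta> > 0" "\<eta> \<le> 1" using M(1) K by (simp_all add: \<eta>_def)
      show ?thesis
      proof (rule periodic_q_expansion[OF K perF])
        fix Fq assume Fq: "Fq holomorphic_on ball 0 1 - {0}"
          and FqF: "\<And>\<tau>. \<tau> \<in> UH \<Longrightarrow> Fq (exp (2 * of_real pi * \<i> / of_real K * \<tau>)) = F \<tau>"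
        have qt: "\<exists>\<tau>\<in>HM. q = exp (\<kappa> * \<tau>)" if q: "q \<in> ball 0 \<eta> - {0}" for q
        proof (intro bexI)
          define \<tau> where "\<tau> = Ln q / \<kappa>"
          have \<kappa>0: "\<kappa> \<noteq> 0" using K by (simp add: \<kappa>_def)
          show eq: "q = exp (\<kappa> * \<tau>)" using q \<kappa>0 by (simp add: \<tau>_def)
          have "exp (- (2 * pi / K) * Im \<tau>) < \<eta>" using q norm\<kappa>[of \<tau>] eq by simp
          then have "- (2 * pi / K) * Im \<tau> < - 2 * pi * M / K" unfolding \<eta>_def by simp
          then have "(2 * pi / K) * M < (2 * pi / K) * Im \<tau>" by simp
          moreover have "0 < 2 * pi / K" using K by simp
          ultimately have "M < Im \<tau>" using mult_less_cancel_left_pos by blast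
          then show "\<tau> \<in> HM" by (simp add: HM_def)
        qed
        have Fq': "Fq (exp (\<kappa> * \<tau>)) = F \<tau>" if "\<tau> \<in> HM" for \<tau> using FqF HM(3) that by (auto simp: \<kappa>_def)
        have sub: "ball 0 \<eta> - {0} \<subseteq> ball 0 1 - {0::complex}" using \<eta>(2) by auto
        \<comment> \<open>Every q of this punctured disc comes from a point of \<open>HM\<close>;
          there \<open>1 / Fq\<close> is bounded and inverted by \<open>Q\<close>. The bound makes q
          = 0 removable and yields \<open>\<phi>\<close>.\<close>
        have in\<epsilon>: "1 / Fq q \<in> ball 0 (exp R0) - {0} \<and> Q (1 / Fq q) = q" if q: "q \<in> ball 0 \<eta> - {0}" for q
        proof -
          obtain \<tau> where t: "\<tau> \<in> HM" "q = exp (\<kappa> * \<tau>)" using qt[OF q] by blast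
          then show ?thesis using zD[OF t(1)] QF[OF t(1)] Fq'[OF t(1)] by simp
        qed
        have hol1: "(\<lambda>q. 1 / Fq q) holomorphic_on ball 0 \<eta> - {0}"
          using in\<epsilon> by (intro holomorphic_intros holomorphic_on_subset[OF Fq sub]) auto
        have "norm (1 / Fq q) \<le> exp R0" if "q \<in> ball 0 \<eta> - {0}" for q using in\<epsilon>[OF that] by auto
        then obtain \<phi> where \<phi>: "\<phi> holomorphic_on ball 0 \<eta>" "\<And>q. q \<in> ball 0 \<eta> - {0} \<Longrightarrow> \<phi> q = 1 / Fq q"
          using bounded_holomorphic_extends[OF hol1 \<eta>(1)] by blast
        have q\<eta>: "exp (\<kappa> * \<tau>) \<in> ball 0 \<eta> - {0}" if "\<tau> \<in> HM" for \<tau>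
        proof -
          have "M < Im \<tau>" using that by (simp add: HM_def)
          moreover have "0 < 2 * pi / K" using K by simp
          ultimately have "(2 * pi / K) * M < (2 * pi / K) * Im \<tau>" using mult_less_cancel_left_pos by blast
          moreover have "- 2 * pi * M / K = - ((2 * pi / K) * M)" by simp
          ultimately have "exp (- (2 * pi / K) * Im \<tau>) < \<eta>" unfolding \<eta>_def by (simp only: exp_less_cancel_iff mult_minus_left neg_less_iff_less)
          then have "norm (exp (\<kappa> * \<tau>)) < \<eta>" unfolding norm\<kappa> .
          then show ?thesis by (simp del: norm_exp_eq_Re)
        qed
        have \<phi>F: "\<phi> (exp (\<kappa> * \<tau>)) = 1 / F \<tau>" if t: "\<tau> \<in> HM" for \<tau>
          using \<phi>(2)[OF q\<eta>[OF t]] Fq'[OF t] by simp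
        have \<phi>0: "\<phi> 0 = 0"
        proof -
          have "isCont \<phi> 0" by (rule holomorphic_ball_isCont[OF \<phi>(1) \<eta>(1)])
          then have "(\<lambda>j. \<phi> (exp (\<kappa> * tj j))) \<longlonglongrightarrow> \<phi> 0" using q_lim by (rule isCont_tendsto_compose)
          then show ?thesis using z_lim \<phi>F[OF tj] LIMSEQ_unique by simp
        qed
        have Q\<phi>: "\<phi> q \<in> ball 0 \<epsilon> \<and> Q (\<phi> q) = q" if "q \<in> ball 0 \<eta>" for q
          using that in\<epsilon>[of q] \<phi>(2)[of q] \<phi>0 Q0 \<epsilon> by (cases "q = 0") (auto simp: eR)
        have "cusp_chart K M \<epsilon> Q \<phi>"
          unfolding cusp_chart_def using K M(1) \<epsilon> Q(1) \<phi>(1) \<phi>0 Q\<phi> \<phi>F Fnz perF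
          by (auto simp: eR(1) \<eta>_def \<kappa>_def HM_def)
        then show ?thesis by blast
      qed
    qed
  qed
qed

end

subsection \<open>From the sphere to the plane\<close>

lemma recip_chart_inf: "recip_coord (chart_inf w) = w"
  by (simp add: chart_inf_def)

lemma chart_inf_recip: "z \<noteq> Fin_pt 0 \<Longrightarrow> chart_inf (recip_coord z) = z"
  by (cases z) (auto simp: chart_inf_def)

lemma chart_inf_nz: "chart_inf w \<noteq> Fin_pt 0"
  by (simp add: chart_inf_def)

lemma homeomorphism_recip: "homeomorphism (UNIV - {Fin_pt 0}) UNIV recip_coord chart_inf"
proof (rule homeomorphismI)
  have op: "open (UNIV - {Fin_pt 0})"
  proof -
    have "Fin_pt -` (UNIV - {Fin_pt 0}) = UNIV - {0}" by auto
    moreover have "chart_inf -` (UNIV - {Fin_pt 0}) = UNIV" using chart_inf_nz by auto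
    ultimately show ?thesis unfolding open_cp1_def by (simp add: open_delete)
  qed
  show "continuous_on (UNIV - {Fin_pt 0}) recip_coord"
    unfolding continuous_on_open_vimage[OF op]
  proof (intro allI impI)
    fix B :: "complex set" assume B: "open B"
    have 1: "Fin_pt -` (recip_coord -` B \<inter> (UNIV - {Fin_pt 0})) = (UNIV - {0}) \<inter> (\<lambda>z. 1 / z) -` B" by auto
    have "open ((UNIV - {0}) \<inter> (\<lambda>z::complex. 1 / z) -` B)"
      by (intro continuous_open_preimage continuous_intros B open_delete) auto
    moreover have "chart_inf -` (recip_coord -` B \<inter> (UNIV - {Fin_pt 0})) = B"
      using chart_inf_nz by (auto simp: recip_chart_inf)
    ultimately show "open (recip_coord -` B \<inter> (UNIV - {Fin_pt 0}))"
      unfolding open_cp1_def 1 using B by simp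
  qed
  show "continuous_on UNIV chart_inf"
    unfolding continuous_on_open_vimage[OF open_UNIV] by (simp add: open_cp1_def)
qed (auto simp: recip_chart_inf chart_inf_recip chart_inf_nz)

text \<open>An evenly covered set is carried by \<open>h\<close> to an evenly covered set with the
  same sheets.\<close>

lemma covering_space_compose_homeomorphism:
  assumes cov: "covering_space c p S" and hom: "homeomorphism S T h k"
  shows "covering_space c (h \<circ> p) T"
proof
  have p: "continuous_on c p" "p ` c = S"
    using covering_space_imp_continuous[OF cov] covering_space_imp_surjective[OF cov] by auto
  have h: "continuous_on S h" "h ` S = T" using hom by (auto simp: homeomorphism_def)
  show "continuous_on c (h \<circ> p)" using continuous_on_compose[OF p(1)] h(1) p(2) by simp
  show "(h \<circ> p) ` c = T" unfolding image_comp[symmetric] p(2) h(2) ..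
  fix y assume y: "y \<in> T"
  have ky: "k y \<in> S" "h (k y) = y" using hom y by (auto simp: homeomorphism_def)
  obtain U v where U: "k y \<in> U" "openin (top_of_set S) U" "\<Union>v = c \<inter> p -` U"
    "\<forall>u\<in>v. openin (top_of_set c) u" "pairwise disjnt v" "\<forall>u\<in>v. \<exists>q. homeomorphism u U p q"
    using cov ky(1) unfolding covering_space_def by blast
  have US: "U \<subseteq> S" using U(2) openin_imp_subset by blast
  have inj: "inj_on h S" using hom by (metis homeomorphism_apply1 inj_onI)
  show "\<exists>W. y \<in> W \<and> openin (top_of_set T) W \<and> (\<exists>v. \<Union> v = c \<inter> (h \<circ> p) -` W \<and>
      (\<forall>u\<in>v. openin (top_of_set c) u) \<and> pairwise disjnt v \<and> (\<forall>u\<in>v. \<exists>q. homeomorphism u W (h \<circ> p) q))"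
  proof (intro exI[of _ "h ` U"] conjI exI[of _ v])
    show "y \<in> h ` U" using U(1) ky(2) by force
    show "openin (top_of_set T) (h ` U)" by (rule homeomorphism_imp_open_map[OF hom U(2)])
    have "p x \<in> U" if "x \<in> c" "h (p x) \<in> h ` U" for x
      using that inj US p(2) by (metis imageI image_iff inj_on_image_mem_iff)
    then show "\<Union> v = c \<inter> (h \<circ> p) -` (h ` U)" unfolding U(3) by auto
    have "homeomorphism U (h ` U) h k" by (rule homeomorphism_of_subsets[OF hom US]) (use US h(2) in auto)
    then show "\<forall>u\<in>v. \<exists>q. homeomorphism u (h ` U) (h \<circ> p) q"
      using U(6) homeomorphism_compose by metis
  qed (use U in auto)
qed

text \<open>As 0 is a puncture, \<open>recip_coord\<close> is a coordinate on the whole base, also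
  at infinity; a puncture at infinity becomes the removed point 0.\<close>

lemma universal_cover_plane:
  assumes f: "universal_covering_map f (UNIV - P)" and P: "Fin_pt 0 \<in> P"
  defines "F \<equiv> \<lambda>\<tau>. recip_coord (f \<tau>)"
  shows "plane_cover F (- (recip_coord ` (P - {Fin_pt 0})))"
    and "\<And>\<tau>. \<tau> \<in> UH \<Longrightarrow> f \<tau> = chart_inf (F \<tau>)"
proof -
  have cov: "covering_space UH f (UNIV - P)" and hol: "holomorphic_to_cp1_on f UH"
    using f by (auto simp: universal_covering_map_def)
  have nz: "f \<tau> \<noteq> Fin_pt 0" if "\<tau> \<in> UH" for \<tau>
    using covering_space_imp_surjective[OF cov] that P by (metis DiffD2 imageI)
  show "f \<tau> = chart_inf (F \<tau>)" if "\<tau> \<in> UH" for \<tau>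
    using chart_inf_recip[OF nz[OF that]] by (simp add: F_def)
  have im: "recip_coord ` (UNIV - P) = - (recip_coord ` (P - {Fin_pt 0}))"
  proof (intro set_eqI iffI)
    fix w assume "w \<in> recip_coord ` (UNIV - P)"
    then obtain z where z: "z \<notin> P" "w = recip_coord z" by auto
    have "w \<noteq> recip_coord z'" if "z' \<in> P - {Fin_pt 0}" for z'
      using z that P chart_inf_recip by (metis DiffD1 DiffD2 insertI1)
    then show "w \<in> - (recip_coord ` (P - {Fin_pt 0}))" by auto
  next
    fix w assume w: "w \<in> - (recip_coord ` (P - {Fin_pt 0}))"
    then have "chart_inf w \<notin> P" using chart_inf_nz[of w] recip_chart_inf[of w] by (metis Compl_iff DiffI empty_iff imageI insert_iff)
    then show "w \<in> recip_coord ` (UNIV - P)" by (metis DiffI UNIV_I imageI recip_chart_inf)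
  qed
  have hom: "homeomorphism (UNIV - P) (- (recip_coord ` (P - {Fin_pt 0}))) recip_coord chart_inf"
    by (rule homeomorphism_of_subsets[OF homeomorphism_recip _ subset_UNIV im]) (use P in auto)
  show "plane_cover F (- (recip_coord ` (P - {Fin_pt 0})))"
  proof
    show "covering_space UH F (- (recip_coord ` (P - {Fin_pt 0})))"
      using covering_space_compose_homeomorphism[OF cov hom] by (simp add: F_def o_def)
    have "F field_differentiable at z" if z: "z \<in> UH" for z
    proof -
      obtain r g where r: "r > 0" "ball z r \<subseteq> UH" "g holomorphic_on ball z r"
        "(\<forall>w\<in>ball z r. f w = Fin_pt (g w)) \<or> (\<forall>w\<in>ball z r. f w = chart_inf (g w))"
        using hol z unfolding holomorphic_to_cp1_on_def by blast
      from r(4) have "F holomorphic_on ball z r"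
      proof
        assume g: "\<forall>w\<in>ball z r. f w = Fin_pt (g w)"
        have "g w \<noteq> 0" if "w \<in> ball z r" for w using nz[of w] g that r(2) by auto
        then have "(\<lambda>w. 1 / g w) holomorphic_on ball z r" by (intro holomorphic_intros r(3)) auto
        then show ?thesis by (rule holomorphic_transform) (use g in \<open>auto simp: F_def\<close>)
      next
        assume g: "\<forall>w\<in>ball z r. f w = chart_inf (g w)"
        show ?thesis by (rule holomorphic_transform[OF r(3)]) (use g in \<open>auto simp: F_def recip_chart_inf\<close>)
      qed
      then show ?thesis using r(1) by (simp add: holomorphic_on_imp_differentiable_at)
    qed
    then show "F holomorphic_on UH" unfolding holomorphic_on_def by (metis field_differentiable_at_within)
  qed
qed

lemma vanishes_at_infinity_recip:
  assumes van: "vanishes_at_infinity f" and nz: "\<And>\<tau>. \<tau> \<in> UH \<Longrightarrow> f \<tau> \<noteq> Fin_pt 0"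
  shows "\<exists>M\<ge>0. \<forall>\<tau>. M < Im \<tau> \<longrightarrow> R < norm (recip_coord (f \<tau>))"
proof -
  define \<epsilon> where "\<epsilon> = 1 / (\<bar>R\<bar> + 1)"
  have \<epsilon>: "\<epsilon> > 0" by (simp add: \<epsilon>_def add_nonneg_pos)
  \<comment> \<open>This image of a disc is open on the sphere: seen from the chart at infinity it
    is the exterior of a disc.\<close>
  define V where "V = Fin_pt ` ball 0 \<epsilon>"
  have "Fin_pt -` V = ball 0 \<epsilon>" by (auto simp: V_def)
  moreover have "chart_inf -` V = {w. 1 / \<epsilon> < norm w}"
  proof (intro set_eqI)
    fix w
    show "w \<in> chart_inf -` V \<longleftrightarrow> w \<in> {w. 1 / \<epsilon> < norm w}"
    proof (cases "w = 0")
      case True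
      then show ?thesis using \<epsilon> by (auto simp: V_def chart_inf_def)
    next
      case False
      then have "w \<in> chart_inf -` V \<longleftrightarrow> norm (1 / w) < \<epsilon>" by (auto simp: V_def chart_inf_def)
      also have "\<dots> \<longleftrightarrow> 1 / \<epsilon> < norm w" using False \<epsilon> by (simp add: norm_divide divide_less_eq mult.commute)
      finally show ?thesis by simp
    qed
  qed
  moreover have "open {w::complex. 1 / \<epsilon> < norm w}" by (intro open_Collect_less continuous_intros)
  ultimately have "open V" by (simp add: open_cp1_def)
  moreover have "Fin_pt 0 \<in> V" using \<epsilon> by (simp add: V_def)
  ultimately have "eventually (\<lambda>\<tau>. f \<tau> \<in> V) (filtercomap Im at_top)"
    using van unfolding vanishes_at_infinity_def tendsto_def by blast
  then obtain M where M: "\<And>\<tau>. M \<le> Im \<tau> \<Longrightarrow> f \<tau> \<in> V"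
    unfolding eventually_filtercomap_at_top_linorder by blast
  have "R < norm (recip_coord (f \<tau>))" if t: "max 0 M < Im \<tau>" for \<tau>
  proof -
    obtain z where z: "f \<tau> = Fin_pt z" "norm z < \<epsilon>" using M[of \<tau>] t by (auto simp: V_def)
    have "z \<noteq> 0" using nz[of \<tau>] t z(1) by (auto simp: UH_iff)
    then have "\<bar>R\<bar> + 1 < norm (1 / z)" using z(2) \<epsilon>
      by (simp add: \<epsilon>_def norm_divide less_divide_eq mult.commute)
    then show ?thesis using z(1) by simp
  qed
  then show ?thesis by (intro exI[of _ "max 0 M"]) auto
qed

subsection \<open>The Schwarzian derivative of the inverse as a rational function\<close>

text \<open>Subtracting all principal parts leaves removable singularities; the resulting entire
  function tends to 0 at infinity and thus vanishes.\<close>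

lemma rational_by_principal_parts:
  fixes S :: "complex \<Rightarrow> complex" and \<sigma> :: "complex \<Rightarrow> complex"
  assumes P: "finite P" and S: "S holomorphic_on - P"
    and loc: "\<And>p. p \<in> P \<Longrightarrow> \<exists>r>0. \<exists>H. H holomorphic_on ball p r \<and>
       (\<forall>w\<in>ball p r - {p}. S w = 1 / (w - p)\<^sup>2 + 2 * \<sigma> p / (w - p) + H w)"
    and lim: "(S \<longlongrightarrow> 0) at_infinity" and w: "w \<notin> P"
  shows "S w = (\<Sum>p\<in>P. 1 / (w - p)\<^sup>2 + 2 * \<sigma> p / (w - p))"
proof -
  define t where "t = (\<lambda>p w. 1 / (w - p)\<^sup>2 + 2 * \<sigma> p / (w - p))"
  define T where "T = (\<lambda>w. S w - (\<Sum>p\<in>P. t p w))"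
  have holt: "t p holomorphic_on - {p}" for p
    unfolding t_def by (intro holomorphic_intros) auto
  have holT: "T holomorphic_on UNIV - P"
    unfolding T_def using S by (intro holomorphic_intros) (auto intro: holomorphic_on_subset[OF holt] simp: Compl_eq_Diff_UNIV)
  have bdd: "T \<in> O[at p](\<lambda>_. 1)" if p: "p \<in> P" for p
  proof -
    obtain r H where r: "r > 0" "H holomorphic_on ball p r" "\<And>w. w \<in> ball p r - {p} \<Longrightarrow> S w = t p w + H w"
      using loc[OF p] unfolding t_def by blast
    have "isCont (\<lambda>w. H w - (\<Sum>p'\<in>P - {p}. t p' w)) p"
    proof (intro continuous_intros)
      show "isCont H p" by (rule holomorphic_ball_isCont[OF r(2,1)])
      fix p' assume "p' \<in> P - {p}"
      then have "p \<in> - {p'}" by auto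
      then show "isCont (t p') p"
        using holt[of p'] by (metis field_differentiable_imp_continuous_at holomorphic_on_imp_differentiable_at open_Compl closed_singleton)
    qed
    then have "(\<lambda>w. H w - (\<Sum>p'\<in>P - {p}. t p' w)) \<in> O[at p](\<lambda>_. 1)"
      by (intro bigoI_tendsto[of _ _ "H p - (\<Sum>p'\<in>P - {p}. t p' p)"]) (auto simp: isCont_def)
    moreover have "eventually (\<lambda>w. H w - (\<Sum>p'\<in>P - {p}. t p' w) = T w) (at p)"
      unfolding eventually_at
    proof (intro exI[of _ r] conjI ballI impI)
      fix w assume "w \<noteq> p \<and> dist w p < r"
      then have "w \<in> ball p r - {p}" by (simp add: dist_commute)
      then show "H w - (\<Sum>p'\<in>P - {p}. t p' w) = T w"
        using r(3) p P by (simp add: T_def sum.remove[of P p])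
    qed (rule r(1))
    ultimately show ?thesis by (rule landau_o.big.in_cong[THEN iffD1, rotated])
  qed
  obtain g where g: "g holomorphic_on UNIV" "\<And>z. z \<in> UNIV - P \<Longrightarrow> g z = T z"
    using removable_singularities[OF P _ holT bdd] by auto
  have "((\<lambda>w. 1 / (w - p)\<^sup>2 + 2 * \<sigma> p / (w - p)) \<longlongrightarrow> 0 + 0) at_infinity" for p
  proof (intro tendsto_add)
    have l: "filterlim (\<lambda>w. w - p) at_infinity at_infinity"
      using tendsto_add_filterlim_at_infinity'[OF filterlim_ident tendsto_const[of "- p"]] by simp
    show "((\<lambda>w. 2 * \<sigma> p / (w - p)) \<longlongrightarrow> 0) at_infinity"
      by (rule tendsto_divide_0[OF tendsto_const l])
    have "filterlim (\<lambda>w. (w - p)\<^sup>2) at_infinity at_infinity"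
      by (rule filterlim_compose[OF filterlim_power_at_infinity l]) simp
    then show "((\<lambda>w. 1 / (w - p)\<^sup>2) \<longlongrightarrow> 0) at_infinity"
      by (rule tendsto_divide_0[OF tendsto_const])
  qed
  then have "(T \<longlongrightarrow> 0 - (\<Sum>p\<in>P. 0)) at_infinity"
    unfolding T_def t_def by (intro tendsto_diff lim tendsto_sum) simp
  then have T0: "(T \<longlongrightarrow> 0) at_infinity" by simp
  have "bounded P" using P by (rule finite_imp_bounded)
  then obtain B where B: "\<And>p. p \<in> P \<Longrightarrow> norm p \<le> B" unfolding bounded_iff by blast
  have ev: "eventually (\<lambda>z. T z = g z) at_infinity"
    unfolding eventually_at_infinity
  proof (intro exI[of _ "B + 1"] allI impI)
    fix z :: complex assume "B + 1 \<le> norm z"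
    then have "z \<notin> P" using B by force
    then show "T z = g z" using g(2) by simp
  qed
  have "(g \<longlongrightarrow> 0) at_infinity" using Lim_transform_eventually[OF T0 ev] .
  then have "g w = 0" by (rule Liouville_weak_0[OF g(1)])
  then show ?thesis using g(2) w by (simp add: T_def t_def)
qed

lemma derivs_inverse:
  fixes z :: complex
  assumes z: "z \<noteq> 0"
  shows "deriv (\<lambda>z. 1 / z) z = - 1 / z\<^sup>2" "schwarzian (\<lambda>z. 1 / z) z = 0"
proof -
  have op: "open (- {0::complex})" by auto
  have d1: "((\<lambda>z. 1 / z) has_field_derivative - 1 / z\<^sup>2) (at z)" if "z \<in> - {0}" for z :: complex
    using that by (auto intro!: derivative_eq_intros simp: power2_eq_square)
  have d2: "((\<lambda>z. - 1 / z\<^sup>2) has_field_derivative 2 / z ^ 3) (at z)" if "z \<in> - {0}" for z :: complex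
    using that by (auto intro!: derivative_eq_intros simp: divide_simps power2_eq_square power3_eq_cube)
  have d3: "((\<lambda>z. 2 / z ^ 3) has_field_derivative - 6 / z ^ 4) (at z)" if "z \<in> - {0}" for z :: complex
    using that by (auto intro!: derivative_eq_intros simp: divide_simps power2_eq_square power3_eq_cube power4_eq_xxxx)
  have zz: "z \<in> - {0}" using z by auto
  note d = derivs_eqI[of "- {0}" z "\<lambda>z. 1 / z" "\<lambda>z. - 1 / z\<^sup>2" "\<lambda>z. 2 / z ^ 3" "\<lambda>z. - 6 / z ^ 4", OF op zz d1 d2 d3]
  show "deriv (\<lambda>z. 1 / z) z = - 1 / z\<^sup>2" by (rule d(1))
  have "schwarzian (\<lambda>z. 1 / z) z = 2 * ((- 6 / z ^ 4) / (- 1 / z\<^sup>2)) - 3 * ((2 / z ^ 3) / (- 1 / z\<^sup>2))\<^sup>2"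
    unfolding schwarzian_def by (simp only: d)
  also have "(- 6 / z ^ 4) / (- 1 / z\<^sup>2) = 6 / z\<^sup>2" using z by (simp add: power2_eq_square power4_eq_xxxx)
  also have "(2 / z ^ 3) / (- 1 / z\<^sup>2) = - 2 / z" using z by (simp add: power2_eq_square power3_eq_cube)
  finally show "schwarzian (\<lambda>z. 1 / z) z = 0" by (simp add: power_divide)
qed

context plane_cover
begin

text \<open>The Schwarzian derivative of the inverse of \<open>1 / F\<close>.\<close>

definition SchI :: "complex \<Rightarrow> complex" where
  "SchI w = Sch (1 / w) / w ^ 4"

lemma SchI_holomorphic: "SchI holomorphic_on {w. w \<noteq> 0 \<and> 1 / w \<in> Y}"
proof -
  have "(Sch \<circ> (\<lambda>w. 1 / w)) holomorphic_on {w. w \<noteq> 0 \<and> 1 / w \<in> Y}"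
    by (rule holomorphic_on_compose_gen[OF _ Sch_holomorphic]) (auto intro!: holomorphic_intros)
  then show ?thesis
    unfolding SchI_def[abs_def] o_def by (intro holomorphic_intros) auto
qed

text \<open>Inversion is a Moebius transformation, so the Schwarzian of \<open>F\<close> is
  unchanged. Only the squared derivative in the denominator changes, which produces the fourth power
  in \<open>SchI\<close>.\<close>

lemma recip_F:
  assumes U: "open U" "U \<subseteq> UH" and nz: "\<And>\<tau>. \<tau> \<in> U \<Longrightarrow> F \<tau> \<noteq> 0" and t: "\<tau> \<in> U"
  shows "(\<lambda>\<tau>. 1 / F \<tau>) holomorphic_on U" "deriv (\<lambda>\<tau>. 1 / F \<tau>) \<tau> = - deriv F \<tau> / (F \<tau>)\<^sup>2"
    "inv_schwarzian (\<lambda>\<tau>. 1 / F \<tau>) \<tau> = SchI (1 / F \<tau>)"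
proof -
  have FU: "F holomorphic_on U" by (rule holomorphic_on_subset[OF hol U(2)])
  show "(\<lambda>\<tau>. 1 / F \<tau>) holomorphic_on U" using nz by (intro holomorphic_intros FU) auto
  have op: "open (- {0::complex})" by auto
  have im: "F ` U \<subseteq> - {0}" using nz by auto
  have inv: "(\<lambda>z::complex. 1 / z) holomorphic_on - {0}" by (intro holomorphic_intros) auto
  have tU: "\<tau> \<in> UH" using t U by auto
  have Ft: "F \<tau> \<noteq> 0" by (rule nz[OF t])
  show d: "deriv (\<lambda>\<tau>. 1 / F \<tau>) \<tau> = - deriv F \<tau> / (F \<tau>)\<^sup>2"
    unfolding deriv_compose_derivs(1)[OF U(1) t op FU im inv] derivs_inverse[OF Ft] by simp
  have "deriv (\<lambda>z. 1 / z) (F \<tau>) \<noteq> 0" unfolding derivs_inverse[OF Ft] using Ft by simp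
  from schwarzian_compose[OF U(1) t op FU im inv deriv_nz[OF tU] this]
  have s: "schwarzian (\<lambda>\<tau>. 1 / F \<tau>) \<tau> = schwarzian F \<tau>" unfolding derivs_inverse[OF Ft] by simp
  have "SchI (1 / F \<tau>) = inv_schwarzian F \<tau> * F \<tau> ^ 4"
    using Sch_F[OF tU] Ft by (simp add: SchI_def power_divide)
  then show "inv_schwarzian (\<lambda>\<tau>. 1 / F \<tau>) \<tau> = SchI (1 / F \<tau>)"
    using Ft deriv_nz[OF tU] unfolding inv_schwarzian_def s d
    by (simp add: power_divide divide_simps power2_eq_square power4_eq_xxxx)
qed

text \<open>The relation with the exponential is given on a set \<open>U\<close> of values of
  \<tau>; the image of a small disc under the nonconstant map \<open>1 / F\<close> is the open set
  that \<open>schwarzian_at_puncture\<close> asks for.\<close>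

lemma SchI_at_puncture:
  assumes \<rho>: "0 < \<rho>" and dom: "ball p \<rho> - {p} \<subseteq> {w. w \<noteq> 0 \<and> 1 / w \<in> Y}"
    and \<Phi>: "\<Phi> holomorphic_on ball p \<rho>" "\<Phi> p = 0" "deriv \<Phi> p = \<alpha>" "deriv (deriv \<Phi>) p = 2 * \<beta>" "\<alpha> \<noteq> 0"
    and U: "open U" "U \<noteq> {}" "U \<subseteq> UH" and \<kappa>: "\<kappa> \<noteq> 0"
    and rel: "\<And>\<tau>. \<tau> \<in> U \<Longrightarrow> F \<tau> \<noteq> 0 \<and> 1 / F \<tau> \<in> ball p \<rho> - {p} \<and> \<Phi> (1 / F \<tau>) = exp (\<kappa> * cusp_coord c \<tau>)"
  shows "\<exists>r y u H. 0 < r \<and> r \<le> \<rho> \<and> y holomorphic_on ball p r \<and> u holomorphic_on ball p r \<and> H holomorphic_on ball p r \<and>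
    (\<forall>w\<in>ball p r. (w - p) * deriv \<Phi> w = y w * \<Phi> w) \<and> (\<forall>w\<in>ball p r. (w - p) * deriv y w = u w * y w) \<and>
    (\<forall>w\<in>ball p r - {p}. \<Phi> w \<noteq> 0 \<and> y w \<noteq> 0 \<and> (w - p)\<^sup>2 * SchI w = 1 - (u w)\<^sup>2 + 2 * (w - p) * deriv u w \<and>
        SchI w = 1 / (w - p)\<^sup>2 + 2 * \<beta> / \<alpha> / (w - p) + H w) \<and> y p = 1 \<and> u p = 0"
proof -
  obtain \<tau>0 where \<tau>0: "\<tau>0 \<in> U" using U by auto
  obtain e where e: "e > 0" "ball \<tau>0 e \<subseteq> U" using U(1) \<tau>0 open_contains_ball by blast
  define V where "V = ball \<tau>0 e"
  have V: "open V" "V \<subseteq> U" "connected V" "\<tau>0 \<in> V" using e by (auto simp: V_def)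
  have VU: "V \<subseteq> UH" using V(2) U(3) by auto
  define G where "G = (\<lambda>\<tau>. 1 / F \<tau>)"
  have nz: "F \<tau> \<noteq> 0" if "\<tau> \<in> V" for \<tau> using rel V(2) that by blast
  note G = recip_F[OF V(1) VU nz, folded G_def]
  have holG: "G holomorphic_on V" by (rule G(1)[OF _ V(4)])
  have dG: "deriv G \<tau> \<noteq> 0" if "\<tau> \<in> V" for \<tau>
  proof -
    have "\<tau> \<in> UH" using that VU by auto
    then show ?thesis using G(2)[OF _ that] deriv_nz nz[OF that] by simp
  qed
  have nc: "\<not> G constant_on V"
  proof
    assume "G constant_on V"
    then obtain k where "\<And>\<tau>. \<tau> \<in> V \<Longrightarrow> G \<tau> = k" unfolding constant_on_def by blast
    then have "deriv G \<tau>0 = deriv (\<lambda>_. k) \<tau>0" by (rule deriv_cong_open[OF V(1,4)])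
    then show False using dG[OF V(4)] by simp
  qed
  define W where "W = G ` V"
  have W: "open W" "W \<noteq> {}"
    using open_mapping_thm[OF holG V(1,3) V(1) subset_refl nc] V(4) by (auto simp: W_def)
  have Wsub: "W \<subseteq> ball p \<rho> - {p}" using rel V(2) by (auto simp: W_def G_def)
  have GV: "G ` V \<subseteq> ball p \<rho>" using Wsub by (auto simp: W_def)
  have rel': "\<Phi> (G \<tau>) = exp (\<kappa> * cusp_coord c \<tau>)" if "\<tau> \<in> V" for \<tau> using rel V(2) that by (auto simp: G_def)
  have fact: "SchI w * (\<Phi> w * deriv \<Phi> w)\<^sup>2 = log_schwarzian_num \<Phi> w" "\<Phi> w \<noteq> 0 \<and> deriv \<Phi> w \<noteq> 0" if w: "w \<in> W" for w
  proof -
    obtain \<tau> where t: "\<tau> \<in> V" "w = G \<tau>" using w by (auto simp: W_def)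
    note * = inv_schwarzian_uniformizing[OF V(1) VU t(1) holG dG[OF t(1)] open_ball GV \<Phi>(1) rel' \<kappa>]
    have "inv_schwarzian G \<tau> = SchI (G \<tau>)" using G(3)[OF _ t(1)] by (simp add: G_def)
    then show "SchI w * (\<Phi> w * deriv \<Phi> w)\<^sup>2 = log_schwarzian_num \<Phi> w" "\<Phi> w \<noteq> 0 \<and> deriv \<Phi> w \<noteq> 0"
      using * t(2) by auto
  qed
  have holS: "SchI holomorphic_on ball p \<rho> - {p}" by (rule holomorphic_on_subset[OF SchI_holomorphic dom])
  show ?thesis
  proof (rule schwarzian_at_puncture[OF \<rho> holS \<Phi>(1) W Wsub fact])
    fix r y u
    assume 1: "0 < r" "r \<le> \<rho>" and hyu: "y holomorphic_on ball p r" "u holomorphic_on ball p r"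
      and y: "\<And>w. w \<in> ball p r \<Longrightarrow> (w - p) * deriv \<Phi> w = y w * \<Phi> w"
      and u: "\<And>w. w \<in> ball p r \<Longrightarrow> (w - p) * deriv y w = u w * y w"
      and n: "\<And>w. w \<in> ball p r - {p} \<Longrightarrow> \<Phi> w \<noteq> 0 \<and> y w \<noteq> 0"
      and s: "\<And>w. w \<in> ball p r - {p} \<Longrightarrow> (w - p)\<^sup>2 * SchI w = 1 - (u w)\<^sup>2 + 2 * (w - p) * deriv u w"
    have \<Phi>r: "\<Phi> holomorphic_on ball p r" by (rule holomorphic_on_subset[OF \<Phi>(1)]) (use 1 in auto)
    show ?thesis
    proof (rule schwarzian_at_simple_puncture[OF 1(1) \<Phi>r hyu y u s \<Phi>(2-5)])
      fix H assume H: "H holomorphic_on ball p r"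
        "\<And>w. w \<in> ball p r - {p} \<Longrightarrow> SchI w = 1 / (w - p)\<^sup>2 + 2 * \<beta> / \<alpha> / (w - p) + H w" "y p = 1" "u p = 0"
      show ?thesis
        by (intro exI[of _ r] exI[of _ y] exI[of _ u] exI[of _ H] conjI ballI 1 hyu H(1,3,4) y u
            n[THEN conjunct1] n[THEN conjunct2] s H(2))
    qed
  qed
qed

text \<open>In the coordinate \<open>1 / w\<close> the Schwarzian has at most a double pole at 0, so
  \<open>SchI\<close> is of order \<open>1 / w\<^sup>2\<close> whether infinity is a puncture or
  not. Therefore a puncture at infinity adds no term.\<close>

lemma SchI_tendsto_0:
  assumes "\<epsilon> > 0" "ball 0 \<epsilon> - {0} \<subseteq> Y"
  shows "(SchI \<longlongrightarrow> 0) at_infinity"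
proof (rule Sch_at_puncture_bound[OF assms])
  fix B \<delta> assume \<delta>: "\<delta> > (0::real)" and B: "\<And>w. w \<in> ball 0 \<delta> - {0} \<Longrightarrow> norm ((w - 0)\<^sup>2 * Sch w) \<le> B"
  show ?thesis
  proof (rule Lim_null_comparison)
    show "\<forall>\<^sub>F w in at_infinity. norm (SchI w) \<le> norm (of_real B / w\<^sup>2)"
      unfolding eventually_at_infinity
    proof (intro exI[of _ "1 / \<delta> + 1"] allI impI)
      fix w :: complex assume w: "1 / \<delta> + 1 \<le> norm w"
      have "1 / \<delta> > 0" using \<delta> by simp
      then have gt: "1 / \<delta> < norm w" and "norm w > 0" using w by linarith+
      then have w0: "w \<noteq> 0" by auto
      have "1 / w \<in> ball 0 \<delta> - {0}" using \<delta> gt w0 by (simp add: norm_divide divide_less_eq mult.commute)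
      from B[OF this] have b: "norm ((1 / w)\<^sup>2 * Sch (1 / w)) \<le> B" by simp
      have "norm (SchI w) = norm ((1 / w)\<^sup>2 * Sch (1 / w)) * norm (1 / w\<^sup>2)"
        unfolding norm_mult[symmetric] using w0 by (intro arg_cong[of _ _ norm]) (simp add: SchI_def power2_eq_square power4_eq_xxxx)
      also have "\<dots> \<le> B * norm (1 / w\<^sup>2)" using b by (intro mult_right_mono) auto
      also have "\<dots> \<le> norm (of_real B / w\<^sup>2)" by (simp add: norm_divide divide_right_mono)
      finally show "norm (SchI w) \<le> norm (of_real B / w\<^sup>2)" .
    qed
    have "filterlim (\<lambda>w::complex. w\<^sup>2) at_infinity at_infinity"
      by (rule filterlim_power_at_infinity) simp
    then have "((\<lambda>w. of_real B / w\<^sup>2) \<longlongrightarrow> (0::complex)) at_infinity"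
      by (rule tendsto_divide_0[OF tendsto_const])
    then show "((\<lambda>w. norm (complex_of_real B / w\<^sup>2)) \<longlongrightarrow> 0) at_infinity"
      by (simp add: tendsto_norm_zero)
  qed
qed

end

subsection \<open>Expansions at the cusp\<close>

lemma fps_eqI_ball:
  fixes f g :: "complex \<Rightarrow> complex"
  assumes r: "0 < r" and F: "f has_fps_expansion F" and G: "g has_fps_expansion G"
    and eq: "\<And>x. x \<in> ball 0 r \<Longrightarrow> f x = g x"
  shows "F = G"
proof -
  have "eventually (\<lambda>x. x \<in> ball 0 r) (nhds (0::complex))"
    using r by (intro eventually_nhds_in_open) auto
  then have "eventually (\<lambda>x. f x = g x) (nhds 0)"
    by eventually_elim (rule eq)
  then have "eventually (\<lambda>x. eval_fps F x = g x) (nhds 0)"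
    using F unfolding has_fps_expansion_def by (auto elim: eventually_elim2)
  then have "g has_fps_expansion F" using F unfolding has_fps_expansion_def by simp
  then show ?thesis using G by (rule fps_expansion_unique_complex)
qed

lemma holomorphic_fps_sums:
  assumes f: "f holomorphic_on ball 0 r" "f has_fps_expansion F" and x: "norm x < r"
  shows "(\<lambda>m. F $ m * x ^ m) sums f x"
  using holomorphic_power_series[OF f(1), of x] x fps_nth_fps_expansion[OF f(2)] by simp

lemma has_fps_expansion_ballI:
  fixes f :: "complex \<Rightarrow> complex"
  assumes "0 < r" "\<And>x. norm x < r \<Longrightarrow> (\<lambda>m. F $ m * x ^ m) sums f x"
  shows "f has_fps_expansion F"
proof (rule has_fps_expansionI)
  have "eventually (\<lambda>x. x \<in> ball 0 r) (nhds (0::complex))"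
    using assms(1) by (intro eventually_nhds_in_open) auto
  then show "\<forall>\<^sub>F u in nhds 0. (\<lambda>m. F $ m * u ^ m) sums f u"
    by eventually_elim (use assms(2) in simp)
qed

lemma has_fps_expansion_geometric:
  "(\<lambda>x. 1 / (1 - c * x)) has_fps_expansion Abs_fps (\<lambda>m. c ^ m)" for c :: complex
proof (rule has_fps_expansion_ballI[of "1 / (norm c + 1)"])
  fix x :: complex assume x: "norm x < 1 / (norm c + 1)"
  have "norm c + 1 > 0" by (simp add: add_nonneg_pos)
  then have "norm x * (norm c + 1) < 1" using x by (simp add: less_divide_eq)
  moreover have "norm c * norm x \<le> norm x * (norm c + 1)" by (simp add: algebra_simps)
  ultimately have "norm (c * x) < 1" by (simp add: norm_mult)
  from geometric_sums[OF this] show "(\<lambda>m. Abs_fps (\<lambda>m. c ^ m) $ m * x ^ m) sums (1 / (1 - c * x))"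
    by (simp add: power_mult_distrib)
qed (simp add: add_nonneg_pos)

lemma geometric_fps_square: "(Abs_fps (\<lambda>m. c ^ m))\<^sup>2 $ m = of_nat (Suc m) * (c::complex) ^ m"
proof -
  have "(Abs_fps (\<lambda>m. c ^ m))\<^sup>2 $ m = (\<Sum>i=0..m. c ^ i * c ^ (m - i))"
    by (simp add: power2_eq_square fps_mult_nth)
  also have "\<dots> = (\<Sum>i=0..m. c ^ m)"
    by (intro sum.cong refl) (simp add: power_add[symmetric])
  finally show ?thesis by simp
qed

lemma holomorphic_has_fps: "f holomorphic_on ball 0 r \<Longrightarrow> 0 < r \<Longrightarrow> f has_fps_expansion fps_expansion f 0"
  by (rule has_fps_expansion_fps_expansion[of "ball 0 r"]) auto

lemma fps_expansion_nth_0: "f has_fps_expansion F \<Longrightarrow> F $ 0 = f 0" for f :: "complex \<Rightarrow> complex"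
  using fps_nth_fps_expansion[of f F 0] by simp

text \<open>The principal parts at \<open>p = 1 / X\<close> are geometric series at 0, since
  \<open>1 / (w - p) = - X / (1 - X w)\<close>; comparing coefficients leads to
  \<open>riccati_coeff_unique\<close>.\<close>

lemma riccati_fps:
  assumes r: "0 < r" and u: "u holomorphic_on ball 0 r" "u 0 = 0"
    and eq: "\<And>x. x \<in> ball 0 r \<Longrightarrow> 2 * (x * deriv u x) - (u x)\<^sup>2 = - 2 * b * x
       + (\<Sum>j=2..n. (A * x)\<^sup>2 * ((X j)\<^sup>2 * (1 / (1 - A * X j * x))\<^sup>2 - 2 * \<rho> j * X j * (1 / (1 - A * X j * x))))"
  shows "u has_fps_expansion Abs_fps (u_coeff n (A, b, X, \<rho>))"
proof -
  define U where "U = fps_expansion u 0"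
  have U: "u has_fps_expansion U" unfolding U_def by (rule holomorphic_has_fps[OF u(1) r])
  have U0: "U $ 0 = 0" using fps_expansion_nth_0[OF U] u(2) by simp
  define g where "g = (\<lambda>c::complex. Abs_fps (\<lambda>m. c ^ m))"
  have gexp: "(\<lambda>x. 1 / (1 - c * x)) has_fps_expansion g c" for c
    unfolding g_def by (rule has_fps_expansion_geometric)
  define G where "G = fps_const (- 2 * b) * fps_X + (\<Sum>j=2..n. (fps_const A * fps_X)\<^sup>2 *
     (fps_const ((X j)\<^sup>2) * (g (A * X j))\<^sup>2 - fps_const (2 * \<rho> j * X j) * g (A * X j)))"
  have 1: "(\<lambda>x. 2 * (x * deriv u x) - (u x)\<^sup>2) has_fps_expansion 2 * (fps_X * fps_deriv U) - U\<^sup>2"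
    unfolding power2_eq_square by (intro fps_expansion_intros U)
  have 2: "(\<lambda>x. - 2 * b * x + (\<Sum>j=2..n. (A * x)\<^sup>2 * ((X j)\<^sup>2 * (1 / (1 - A * X j * x))\<^sup>2
      - 2 * \<rho> j * X j * (1 / (1 - A * X j * x))))) has_fps_expansion G"
    unfolding G_def power2_eq_square by (intro fps_expansion_intros gexp)
  have eqf: "2 * (fps_X * fps_deriv U) - U\<^sup>2 = G"
    by (rule fps_eqI_ball[OF r 1 2 eq])
  have Gm: "G $ m = rhs_coeff n (A, b, X, \<rho>) m" for m
  proof -
    \<comment> \<open>The shift by two degrees turns the coefficient \<open>l + 1\<close> of the
      squared geometric series into \<open>m - 1\<close> with \<open>m = l + 2\<close>, and leaves
      degrees 0 and 1 to the term \<open>- 2 * b * x\<close>.\<close>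
    have t: "((fps_const A * fps_X)\<^sup>2 * (fps_const ((X j)\<^sup>2) * (g (A * X j))\<^sup>2 - fps_const (2 * \<rho> j * X j) * g (A * X j))) $ m
       = (if m < 2 then 0 else A ^ m * (of_nat (m - 1) * X j ^ m - 2 * \<rho> j * X j ^ (m - 1)))" for j
    proof -
      define h where "h = fps_const ((X j)\<^sup>2) * (g (A * X j))\<^sup>2 - fps_const (2 * \<rho> j * X j) * g (A * X j)"
      have "(fps_const A * fps_X)\<^sup>2 * h = fps_const (A\<^sup>2) * (fps_X ^ 2 * h)"
        unfolding power_mult_distrib fps_const_power mult.assoc ..
      then have *: "((fps_const A * fps_X)\<^sup>2 * h) $ m = A\<^sup>2 * (if m < 2 then 0 else h $ (m - 2))"
        by (simp only: fps_mult_left_const_nth fps_X_power_mult_nth)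
      show ?thesis
      proof (cases "m < 2")
        case True
        then show ?thesis using * by (simp add: h_def)
      next
        case False
        then obtain l where l: "m = l + 2" by (metis add.commute le_Suc_ex not_less)
        have "h $ l = (X j)\<^sup>2 * (of_nat (Suc l) * (A * X j) ^ l) - 2 * \<rho> j * X j * (A * X j) ^ l"
          unfolding h_def g_def by (simp add: geometric_fps_square)
        then have "((fps_const A * fps_X)\<^sup>2 * h) $ m = A\<^sup>2 * ((X j)\<^sup>2 * (of_nat (Suc l) * (A * X j) ^ l) - 2 * \<rho> j * X j * (A * X j) ^ l)"
          using * l by simp
        also have "\<dots> = A ^ m * (of_nat (m - 1) * X j ^ m - 2 * \<rho> j * X j ^ (m - 1))"
          by (simp add: l power_add power_mult_distrib power2_eq_square algebra_simps)
        finally show ?thesis using False by (simp add: h_def)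
      qed
    qed
    have "G $ m = - 2 * b * (fps_X $ m) + (\<Sum>j=2..n. if m < 2 then 0 else A ^ m * (of_nat (m - 1) * X j ^ m - 2 * \<rho> j * X j ^ (m - 1)))"
      unfolding G_def fps_add_nth fps_sum_nth t by simp
    then show ?thesis by (cases "m = 0"; cases "m = 1") (auto simp: sum_distrib_left)
  qed
  have "U $ m = u_coeff n (A, b, X, \<rho>) m" for m
    using riccati_coeff_unique[OF U0 eqf] ext[of "fps_nth G", OF Gm] by (simp only: u_coeff_def)
  then have "U = Abs_fps (u_coeff n (A, b, X, \<rho>))" by (simp add: fps_eq_iff)
  with U show ?thesis by simp
qed

lemma linear_fps:
  assumes r: "0 < r" and f: "f holomorphic_on ball 0 r" "f 0 = 1"
    and v: "v has_fps_expansion V" "V $ 0 = 0"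
    and eq: "\<And>x. x \<in> ball 0 r \<Longrightarrow> x * deriv f x = v x * f x"
  shows "f has_fps_expansion Abs_fps (linear_coeff (fps_nth V))"
proof -
  define W where "W = fps_expansion f 0"
  have W: "f has_fps_expansion W" unfolding W_def by (rule holomorphic_has_fps[OF f(1) r])
  have W0: "W $ 0 = 1" using fps_expansion_nth_0[OF W] f(2) by simp
  have 1: "(\<lambda>x. x * deriv f x) has_fps_expansion fps_X * fps_deriv W" by (intro fps_expansion_intros W)
  have 2: "(\<lambda>x. v x * f x) has_fps_expansion V * W" by (intro fps_expansion_intros W v)
  have "fps_X * fps_deriv W = V * W" by (rule fps_eqI_ball[OF r 1 2 eq])
  then have "W = Abs_fps (linear_coeff (fps_nth V))"
    using linear_coeff_unique[OF v(2) W0] by (simp add: fps_eq_iff)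
  with W show ?thesis by simp
qed

text \<open>Dividing out the simple zero gives \<open>\<psi> = x g\<close> with
  \<open>g 0 = 1\<close>, and \<open>g\<close> has a logarithm \<open>\<eta>\<close> on the disc.
  The equations \<open>\<theta>g = (y - 1) g\<close> and \<open>\<theta>\<eta> = y - 1\<close>
  determine both series.\<close>

lemma psi_eta_fps:
  assumes r: "0 < r" and hol: "\<psi> holomorphic_on ball 0 r" "y holomorphic_on ball 0 r"
    and \<psi>: "\<psi> 0 = 0" "deriv \<psi> 0 = 1" "\<And>x. x \<in> ball 0 r - {0} \<Longrightarrow> \<psi> x \<noteq> 0"
    and y: "y has_fps_expansion Abs_fps (y_coeff n d)" "y 0 = 1"
    and eq: "\<And>x. x \<in> ball 0 r \<Longrightarrow> x * deriv \<psi> x = y x * \<psi> x"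
  shows "\<psi> has_fps_expansion psi_fps n d"
    and "\<exists>\<eta>. \<eta> holomorphic_on ball 0 r \<and> \<eta> 0 = 0 \<and> \<eta> has_fps_expansion Abs_fps (eta_coeff n d)
       \<and> (\<forall>x\<in>ball 0 r. \<psi> x = x * exp (\<eta> x))"
proof -
  define g where "g = (\<lambda>x. if x = 0 then deriv \<psi> 0 else (\<psi> x - \<psi> 0) / (x - 0))"
  have g: "g holomorphic_on ball 0 r" unfolding g_def by (rule pole_lemma_open[OF hol(1) open_ball])
  have \<psi>g: "\<psi> x = x * g x" for x by (simp add: g_def \<psi>)
  have g0: "g 0 = 1" by (simp add: g_def \<psi>)
  have gnz: "g x \<noteq> 0" if "x \<in> ball 0 r" for x using \<psi>(3)[of x] that g0 \<psi>g by (cases "x = 0") auto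
  have idp: "(\<lambda>x::complex. x) holomorphic_on ball 0 r" by (rule holomorphic_on_ident)
  have d\<psi>: "deriv \<psi> x = g x + x * deriv g x" if "x \<in> ball 0 r" for x
    using deriv_cong_open[OF open_ball that \<psi>g] deriv_open_mult[OF open_ball idp g that] by simp
  have geq: "x * deriv g x = (y x - 1) * g x" if x: "x \<in> ball 0 r" for x
  proof (cases "x = 0")
    case True
    then show ?thesis using y(2) by simp
  next
    case False
    have "x * (g x + x * deriv g x) = x * (y x * g x)" using eq[OF x] d\<psi>[OF x] \<psi>g[of x] by simp
    then have "g x + x * deriv g x = y x * g x" using False by simp
    then show ?thesis by (simp add: algebra_simps)
  qed
  define V where "V = Abs_fps (\<lambda>m. if m = 0 then 0 else y_coeff n d m)"
  have y0: "y_coeff n d 0 = 1" using fps_expansion_nth_0[OF y(1)] y(2) by simp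
  have "Abs_fps (y_coeff n d) - 1 = V" by (auto simp: fps_eq_iff V_def y0)
  then have V: "(\<lambda>x. y x - 1) has_fps_expansion V"
    using has_fps_expansion_diff[OF y(1) has_fps_expansion_1] by simp
  have "g has_fps_expansion Abs_fps (linear_coeff (fps_nth V))"
    by (rule linear_fps[OF r g g0 V _ geq]) (simp_all add: V_def)
  then have "(\<lambda>x. x * g x) has_fps_expansion fps_X * Abs_fps (linear_coeff (fps_nth V))"
    by (intro fps_expansion_intros)
  moreover have "(\<lambda>x. x * g x) = \<psi>" using \<psi>g by auto
  moreover have "fps_nth V = (\<lambda>m. if m = 0 then 0 else y_coeff n d m)" by (auto simp: V_def)
  ultimately show "\<psi> has_fps_expansion psi_fps n d" by (simp add: psi_fps_def)
  obtain h where h: "h holomorphic_on ball 0 r" "\<And>x. x \<in> ball 0 r \<Longrightarrow> g x = exp (h x)"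
    using contractible_imp_holomorphic_log[OF g convex_imp_contractible[OF convex_ball]] gnz by auto
  \<comment> \<open>A logarithm is fixed only up to multiples of \<open>2 \<pi> i\<close>;
    subtracting \<open>h 0\<close>, where \<open>exp (h 0) = 1\<close>, normalises it.\<close>
  define \<eta> where "\<eta> = (\<lambda>x. h x - h 0)"
  have \<eta>: "\<eta> holomorphic_on ball 0 r" unfolding \<eta>_def by (intro holomorphic_intros h)
  have eh0: "exp (h 0) = 1" using h(2)[of 0] g0 r by simp
  have g\<eta>: "g x = exp (\<eta> x)" if "x \<in> ball 0 r" for x
    using h(2)[OF that] eh0 by (simp add: \<eta>_def exp_diff)
  have \<eta>0: "\<eta> 0 = 0" by (simp add: \<eta>_def)
  have holexp: "exp holomorphic_on (UNIV::complex set)" by (intro holomorphic_intros)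
  have \<eta>eq: "x * deriv \<eta> x = y x - 1" if x: "x \<in> ball 0 r" for x
  proof -
    have "deriv g x = deriv (\<lambda>x. exp (\<eta> x)) x" by (rule deriv_cong_open[OF open_ball x g\<eta>])
    also have "\<dots> = exp (\<eta> x) * deriv \<eta> x"
      using deriv_compose_derivs(1)[OF open_ball x open_UNIV \<eta> subset_UNIV holexp] by (simp add: DERIV_imp_deriv[OF DERIV_exp])
    finally have "deriv g x = g x * deriv \<eta> x" using g\<eta>[OF x] by simp
    then have "g x * (x * deriv \<eta> x) = g x * (y x - 1)" using geq[OF x] by (simp add: mult_ac)
    then show ?thesis using gnz[OF x] by simp
  qed
  define E where "E = fps_expansion \<eta> 0"
  have E: "\<eta> has_fps_expansion E" unfolding E_def by (rule holomorphic_has_fps[OF \<eta> r])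
  have "(\<lambda>x. x * deriv \<eta> x) has_fps_expansion fps_X * fps_deriv E" by (intro fps_expansion_intros E)
  then have XE: "fps_X * fps_deriv E = V" by (rule fps_eqI_ball[OF r _ V \<eta>eq])
  have "E $ m = eta_coeff n d m" for m
  proof (cases "m = 0")
    case True
    then show ?thesis using fps_expansion_nth_0[OF E] \<eta>0 by (simp add: eta_coeff_def)
  next
    case False
    have "(fps_X * fps_deriv E) $ m = of_nat m * E $ m" using False by simp
    then have "of_nat m * E $ m = y_coeff n d m" using XE False by (simp add: V_def)
    then show ?thesis using False by (simp add: eta_coeff_def field_simps)
  qed
  then have "E = Abs_fps (eta_coeff n d)" by (simp add: fps_eq_iff)
  then show "\<exists>\<eta>. \<eta> holomorphic_on ball 0 r \<and> \<eta> 0 = 0 \<and> \<eta> has_fps_expansion Abs_fps (eta_coeff n d)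
       \<and> (\<forall>x\<in>ball 0 r. \<psi> x = x * exp (\<eta> x))"
    using \<eta> \<eta>0 E g\<eta> \<psi>g by auto
qed

text \<open>The usual argument that a right inverse equals a left inverse; the vanishing constant
  terms make composition associative.\<close>

lemma fps_inv_unique_right:
  fixes \<Psi> P :: "complex fps"
  assumes comp: "fps_compose \<Psi> P = fps_X" and 0: "\<Psi> $ 0 = 0" "P $ 0 = 0" "\<Psi> $ 1 \<noteq> 0"
  shows "P = fps_inv \<Psi>"
proof -
  have "P = fps_compose fps_X P" by (simp add: 0)
  also have "fps_X = fps_compose (fps_inv \<Psi>) \<Psi>" using fps_inv[OF 0(1,3)] by simp
  also have "fps_compose (fps_compose (fps_inv \<Psi>) \<Psi>) P = fps_compose (fps_inv \<Psi>) (fps_compose \<Psi> P)"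
    by (rule fps_compose_assoc[symmetric, OF 0(2,1)])
  finally show ?thesis by (simp add: comp)
qed

text \<open>The coefficients of the metric are the Taylor coefficients in \<open>t\<close> of the function
  \<open>y (t w) / (1 + (\<eta> (t w) + \<eta>* (t w*)) / (2 log |w|))\<close>, where the star denotes complex
  conjugation; they are estimated by Cauchy's inequality on a disc whose radius is of order
  \<open>1 / |w|\<close>.\<close>

lemma metric_series:
  assumes r: "0 < r" and hol: "y holomorphic_on ball 0 r" "\<eta> holomorphic_on ball 0 r"
    and y: "y has_fps_expansion Abs_fps (y_coeff n d)" "y 0 = 1"
    and \<eta>: "\<eta> has_fps_expansion Abs_fps (eta_coeff n d)" "\<eta> 0 = 0"
  shows "\<exists>\<delta>>0. \<delta> < r \<and> \<delta> < 1 \<and> (\<forall>w. 0 < norm w \<and> norm w < \<delta> \<longrightarrow>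
     (\<lambda>m. metric_coeff n m (d, w)) sums (y w / of_real (1 + Re (\<eta> w) / ln (norm w))) \<and>
     1 / 2 \<le> 1 + Re (\<eta> w) / ln (norm w) \<and>
     (\<forall>m. norm (metric_coeff n m (d, w)) \<le> 4 * (norm w / (2 * \<delta>)) ^ m))"
proof -
  have cy: "isCont y 0" and c\<eta>: "isCont \<eta> 0" using holomorphic_ball_isCont[OF _ r] hol by auto
  have "\<exists>e>0. \<forall>x. norm x < e \<longrightarrow> norm (y x - 1) < 1"
    using cy y(2) unfolding continuous_at_eps_delta by (force simp: dist_norm dest: spec[of _ 1])
  then obtain e1 where e1: "e1 > 0" "\<And>x. norm x < e1 \<Longrightarrow> norm (y x - 1) < 1" by blast
  have "\<exists>e>0. \<forall>x. norm x < e \<longrightarrow> norm (\<eta> x) < 1"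
    using c\<eta> \<eta>(2) unfolding continuous_at_eps_delta by (force simp: dist_norm dest: spec[of _ 1])
  then obtain e2 where e2: "e2 > 0" "\<And>x. norm x < e2 \<Longrightarrow> norm (\<eta> x) < 1" by blast
  \<comment> \<open>Besides the bounds on \<open>y\<close> and \<open>\<eta>\<close>, the radius
    \<open>exp (- 2)\<close> gives \<open>ln (norm w) < - 2\<close>, which keeps the denominator at
    least 1/2.\<close>
  define \<delta>1 where "\<delta>1 = min (min e1 e2) (min r (exp (- 2)))"
  have \<delta>1: "\<delta>1 > 0" "\<delta>1 \<le> r" "\<delta>1 \<le> exp (- 2)" "\<delta>1 \<le> e1" "\<delta>1 \<le> e2"
    using e1 e2 r by (auto simp: \<delta>1_def)
  \<comment> \<open>A quarter leaves room to scale \<open>w\<close> by \<open>T > 4\<close>;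
    Cauchy's inequality on the radius \<open>T / 2\<close> then has the ratio
    \<open>norm w / (2 * \<delta>)\<close>, which is below 1/2.\<close>
  define \<delta> where "\<delta> = \<delta>1 / 4"
  have "exp (- 2) < (1::real)" by simp
  then have \<delta>: "\<delta> > 0" "\<delta> < r" "\<delta> < 1" using \<delta>1 unfolding \<delta>_def by linarith+
  have yb: "norm (y x) \<le> 2" if "norm x < \<delta>1" for x
    using e1(2)[of x] that \<delta>1(4) norm_triangle_ineq2[of "y x" 1] by simp
  have \<eta>b: "norm (\<eta> x) \<le> 1" if "norm x < \<delta>1" for x using e2(2)[of x] that \<delta>1(5) by simp
  have holy: "y holomorphic_on ball 0 \<delta>1" and hol\<eta>: "\<eta> holomorphic_on ball 0 \<delta>1"
    using hol \<delta>1(2) by (auto elim!: holomorphic_on_subset)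
  \<comment> \<open>Reflection makes the conjugate of \<open>\<eta>\<close> holomorphic in the scale
    \<open>t\<close>; at \<open>t = 1\<close> the two add up to
    \<open>2 * Re (\<eta> w)\<close>.\<close>
  define \<eta>c where "\<eta>c = (\<lambda>x. cnj (\<eta> (cnj x)))"
  have hol\<eta>c: "\<eta>c holomorphic_on ball 0 \<delta>1"
  proof -
    have im: "cnj ` ball 0 \<delta>1 = ball 0 \<delta>1"
    proof (intro set_eqI iffI)
      fix x :: complex assume "x \<in> ball 0 \<delta>1"
      then show "x \<in> cnj ` ball 0 \<delta>1" by (intro image_eqI[of _ _ "cnj x"]) auto
    qed auto
    have "cnj \<circ> \<eta> \<circ> cnj holomorphic_on ball 0 \<delta>1"
      by (rule holomorphic_on_compose_cnj_cnj) (use hol\<eta> im in auto)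
    then show ?thesis by (simp add: \<eta>c_def o_def)
  qed
  have ysum: "(\<lambda>m. y_coeff n d m * x ^ m) sums y x" if "norm x < \<delta>1" for x
    using holomorphic_fps_sums[OF holy y(1) that] by simp
  have \<eta>sum: "(\<lambda>m. eta_coeff n d m * x ^ m) sums \<eta> x" if "norm x < \<delta>1" for x
    using holomorphic_fps_sums[OF hol\<eta> \<eta>(1) that] by simp
  have \<eta>csum: "(\<lambda>m. cnj (eta_coeff n d m) * x ^ m) sums \<eta>c x" if "norm x < \<delta>1" for x
  proof -
    have "norm (cnj x) < \<delta>1" using that by simp
    from sums_cnj[THEN iffD2, OF \<eta>sum[OF this]] show ?thesis by (simp add: \<eta>c_def)
  qed
  have main: "(\<lambda>m. metric_coeff n m (d, w)) sums (y w / of_real (1 + Re (\<eta> w) / ln (norm w))) \<and>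
     1 / 2 \<le> 1 + Re (\<eta> w) / ln (norm w) \<and>
     (\<forall>m. norm (metric_coeff n m (d, w)) \<le> 4 * (norm w / (2 * \<delta>)) ^ m)"
    if w: "0 < norm w" "norm w < \<delta>" for w
  proof -
    define T where "T = \<delta>1 / norm w"
    have "4 * norm w < \<delta>1" using w by (simp add: \<delta>_def)
    then have T4: "T > 4" using w(1) by (simp add: T_def less_divide_eq)
    have "norm w < exp (- 2)" using w \<delta>1 by (simp add: \<delta>_def)
    then have "ln (norm w) < ln (exp (- 2))" using w(1) by (subst ln_less_cancel_iff) auto
    then have l: "ln (norm w) < - 2" by simp
    define \<Lambda> where "\<Lambda> = complex_of_real (ln (norm w))"
    have \<Lambda>2: "norm \<Lambda> > 2" using l by (simp add: \<Lambda>_def)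
    have tw: "norm (t * w) < \<delta>1" "norm (t * cnj w) < \<delta>1" if "norm t < T" for t
      using that w(1) by (simp_all add: T_def norm_mult less_divide_eq)
    define D where "D = (\<lambda>t. 1 + (\<eta> (t * w) + \<eta>c (t * cnj w)) / 2 / \<Lambda>)"
    define N where "N = (\<lambda>t. y (t * w))"
    define H where "H = (\<lambda>t. N t * inverse (D t))"
    have Dn: "norm (D t - 1) \<le> 1 / 2" if t: "norm t < T" for t
    proof -
      have "norm (\<eta> (t * w)) \<le> 1" by (rule \<eta>b[OF tw(1)[OF t]])
      moreover have "norm (\<eta>c (t * cnj w)) \<le> 1"
        unfolding \<eta>c_def complex_mod_cnj
        by (rule \<eta>b) (use tw(2)[OF t] in \<open>simp only: complex_mod_cnj\<close>)
      ultimately have "norm (\<eta> (t * w) + \<eta>c (t * cnj w)) \<le> 2" using norm_triangle_ineq[of "\<eta> (t * w)" "\<eta>c (t * cnj w)"] by linarith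
      then have "norm (\<eta> (t * w) + \<eta>c (t * cnj w)) / 2 \<le> 1" by simp
      then have "norm (\<eta> (t * w) + \<eta>c (t * cnj w)) / 2 / norm \<Lambda> \<le> 1 / 2"
        using \<Lambda>2 by (intro frac_le) auto
      then show ?thesis by (simp add: D_def norm_divide)
    qed
    have Dh: "norm (D t) \<ge> 1 / 2" if "norm t < T" for t
      using Dn[OF that] norm_triangle_ineq2[of 1 "1 - D t"] by (simp add: norm_minus_commute)
    have Dnz: "D t \<noteq> 0" if "norm t < T" for t using Dh[OF that] by auto
    have holN: "N holomorphic_on ball 0 T"
    proof -
      have "(y \<circ> (\<lambda>t. t * w)) holomorphic_on ball 0 T"
        by (rule holomorphic_on_compose_gen[OF _ holy]) (use tw in \<open>auto intro!: holomorphic_intros\<close>)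
      then show ?thesis by (simp add: N_def o_def)
    qed
    have holD: "D holomorphic_on ball 0 T"
    proof -
      have "(\<eta> \<circ> (\<lambda>t. t * w)) holomorphic_on ball 0 T"
        by (rule holomorphic_on_compose_gen[OF _ hol\<eta>]) (use tw in \<open>auto intro!: holomorphic_intros\<close>)
      moreover have "(\<eta>c \<circ> (\<lambda>t. t * cnj w)) holomorphic_on ball 0 T"
        by (rule holomorphic_on_compose_gen[OF _ hol\<eta>c]) (use tw in \<open>auto intro!: holomorphic_intros\<close>)
      ultimately show ?thesis unfolding D_def o_def using \<Lambda>2
        by (intro holomorphic_on_add holomorphic_on_divide holomorphic_on_const) auto
    qed
    have holH: "H holomorphic_on ball 0 T"
      unfolding H_def using Dnz by (intro holomorphic_on_mult holomorphic_on_inverse holN holD) auto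
    have Nf: "N has_fps_expansion numer_fps n (d, w)"
    proof (rule has_fps_expansion_ballI[of T])
      show "(\<lambda>m. numer_fps n (d, w) $ m * t ^ m) sums N t" if "norm t < T" for t
        using ysum[OF tw(1)[OF that]] by (simp add: numer_fps_def N_def power_mult_distrib mult_ac)
    qed (use T4 in simp)
    have Df: "D has_fps_expansion denom_fps n (d, w)"
    proof (rule has_fps_expansion_ballI[of T])
      fix t :: complex assume t: "norm t < T"
      have "(\<lambda>m. (if m = 0 then 1 else 0) * t ^ m) sums 1"
        using sums_single[of 0 "\<lambda>m. 1"] by (rule sums_cong[THEN iffD1, rotated]) auto
      moreover have "(\<lambda>m. (eta_coeff n d m * (t * w) ^ m + cnj (eta_coeff n d m) * (t * cnj w) ^ m) / 2 / \<Lambda>)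
          sums ((\<eta> (t * w) + \<eta>c (t * cnj w)) / 2 / \<Lambda>)"
        by (intro sums_divide sums_add \<eta>sum \<eta>csum tw t)
      ultimately have "(\<lambda>m. (if m = 0 then 1 else 0) * t ^ m
          + (eta_coeff n d m * (t * w) ^ m + cnj (eta_coeff n d m) * (t * cnj w) ^ m) / 2 / \<Lambda>) sums D t"
        unfolding D_def by (rule sums_add)
      moreover have "(if m = 0 then 1 else 0) * t ^ m
          + (eta_coeff n d m * (t * w) ^ m + cnj (eta_coeff n d m) * (t * cnj w) ^ m) / 2 / \<Lambda> = denom_fps n (d, w) $ m * t ^ m" for m
        by (cases "m = 0") (simp_all add: denom_fps_def eta_coeff_def \<Lambda>_def power_mult_distrib add_divide_distrib distrib_left distrib_right mult_ac)
      ultimately show "(\<lambda>m. denom_fps n (d, w) $ m * t ^ m) sums D t" by simp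
    qed (use T4 in simp)
    have "denom_fps n (d, w) $ 0 \<noteq> 0" by (simp add: denom_fps_def)
    then have Hf: "H has_fps_expansion numer_fps n (d, w) * inverse (denom_fps n (d, w))"
      unfolding H_def by (intro has_fps_expansion_mult has_fps_expansion_inverse Nf Df)
    have co: "metric_coeff n m (d, w) = (deriv ^^ m) H 0 / fact m" for m
      unfolding metric_coeff_def by (rule fps_nth_fps_expansion[OF Hf])
    have "(\<lambda>m. metric_coeff n m (d, w) * 1 ^ m) sums H 1"
      using holomorphic_power_series[OF holH, of 1] T4 by (simp add: co)
    moreover have "D 1 = of_real (1 + Re (\<eta> w) / ln (norm w))"
      using complex_add_cnj[of "\<eta> w"] by (simp add: D_def \<eta>c_def \<Lambda>_def)
    ultimately have s: "(\<lambda>m. metric_coeff n m (d, w)) sums (y w / of_real (1 + Re (\<eta> w) / ln (norm w)))"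
      by (simp add: H_def N_def divide_inverse)
    have "norm w < \<delta>1" using w \<delta>1(1) by (simp add: \<delta>_def)
    then have "\<bar>Re (\<eta> w)\<bar> \<le> 1" using \<eta>b abs_Re_le_cmod order_trans by blast
    then have "\<bar>Re (\<eta> w) / ln (norm w)\<bar> \<le> 1 / 2" using l unfolding abs_divide by (intro frac_le) auto
    then have h: "1 / 2 \<le> 1 + Re (\<eta> w) / ln (norm w)" by linarith
    have bound: "norm (metric_coeff n m (d, w)) \<le> 4 * (norm w / (2 * \<delta>)) ^ m" for m
    proof -
      have T2: "T / 2 > 0" "cball 0 (T / 2) \<subseteq> ball (0::complex) T" using T4 by auto
      have "norm ((deriv ^^ m) H 0) \<le> fact m * 4 / (T / 2) ^ m"
      proof (rule Cauchy_inequality[OF _ _ T2(1)])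
        show "H holomorphic_on ball 0 (T / 2)" by (rule holomorphic_on_subset[OF holH]) (use T4 in auto)
        show "continuous_on (cball 0 (T / 2)) H"
          using holomorphic_on_imp_continuous_on[OF holH] T2(2) continuous_on_subset by blast
        fix t :: complex assume "norm (0 - t) = T / 2"
        then have t: "norm t < T" using T4 by simp
        have "norm (inverse (D t)) \<le> 2" using le_imp_inverse_le[OF Dh[OF t]] by (simp add: norm_inverse)
        then have "norm (H t) \<le> 2 * 2" unfolding H_def norm_mult N_def using yb[OF tw(1)[OF t]] by (intro mult_mono) auto
        then show "norm (H t) \<le> 4" by simp
      qed
      then have "norm (metric_coeff n m (d, w)) \<le> 4 / (T / 2) ^ m"
        by (simp add: co norm_divide divide_le_eq mult_ac)
      also have "4 / (T / 2) ^ m = 4 * (norm w / (2 * \<delta>)) ^ m"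
        using w(1) \<delta>1(1) by (simp add: T_def \<delta>_def power_divide power_mult_distrib)
      finally show ?thesis .
    qed
    show ?thesis using s h bound by blast
  qed
  then show ?thesis using \<delta> by blast
qed

subsection \<open>The Schwarzian derivative in terms of the puncture data\<close>

text \<open>The definition grants convergence of the series only at values taken on
  \<open>U\<close>. One value \<open>G \<tau>1\<close> yields a disc of convergence that just fails
  to contain it; a second value slightly closer to \<open>p\<close> provides an open subset of
  \<open>U\<close> on which sum and exponential can be compared.\<close>

lemma uniformizing_coeffs_SchI:
  assumes "plane_cover F Y" and f: "\<And>\<tau>. \<tau> \<in> UH \<Longrightarrow> f \<tau> = chart_inf (F \<tau>)"
    and uc: "uniformizing_coeffs f p \<alpha> \<beta>"
  shows "\<exists>r>0. \<exists>H. H holomorphic_on ball p r \<and>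
    (\<forall>w\<in>ball p r - {p}. plane_cover.SchI F w = 1 / (w - p)\<^sup>2 + 2 * (\<beta> / \<alpha>) / (w - p) + H w)"
proof -
  interpret plane_cover F Y by fact
  obtain \<epsilon> U c k \<phi> where \<alpha>: "\<alpha> \<noteq> 0" and \<epsilon>: "(\<epsilon>::real) > 0" and k: "(k::real) \<noteq> 0"
    and sub: "Fin_pt ` (ball p \<epsilon> - {p}) \<subseteq> f ` UH"
    and Uc: "U \<in> components (UH \<inter> f -` (Fin_pt ` (ball p \<epsilon> - {p})))"
    and \<phi>: "\<phi> (0::nat) = 0" "\<phi> 1 = \<alpha>" "\<phi> 2 = \<beta>"
    and ser: "\<And>\<tau> w. \<tau> \<in> U \<Longrightarrow> f \<tau> = Fin_pt w \<Longrightarrow>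
           (\<lambda>m. \<phi> m * (w - p) ^ m) sums exp (2 * of_real pi * \<i> / of_real k * cusp_coord c \<tau>)"
    using uc unfolding uniformizing_coeffs_def by blast
  have ci: "chart_inf v = Fin_pt w \<longleftrightarrow> v \<noteq> 0 \<and> w = 1 / v" for v w by (auto simp: chart_inf_def)
  define V where "V = {v. v \<noteq> 0 \<and> 1 / v \<in> ball p \<epsilon> - {p}}"
  have "open ((- {0}) \<inter> (\<lambda>v::complex. 1 / v) -` (ball p \<epsilon> - {p}))"
    by (intro continuous_open_preimage continuous_intros open_delete) auto
  then have opV: "open V" by (simp add: V_def vimage_def Collect_conj_eq[symmetric] Int_def)
  have eqset: "UH \<inter> f -` (Fin_pt ` (ball p \<epsilon> - {p})) = UH \<inter> F -` V"
  proof (intro set_eqI)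
    fix \<tau>
    show "\<tau> \<in> UH \<inter> f -` (Fin_pt ` (ball p \<epsilon> - {p})) \<longleftrightarrow> \<tau> \<in> UH \<inter> F -` V"
    proof (cases "\<tau> \<in> UH")
      case True
      have "chart_inf v \<in> Fin_pt ` S \<longleftrightarrow> v \<noteq> 0 \<and> 1 / v \<in> S" for v S
        by (auto simp: chart_inf_def image_iff)
      then show ?thesis using True by (simp only: f[OF True] vimage_eq Int_iff V_def mem_Collect_eq)
    qed simp
  qed
  have opW: "open (UH \<inter> F -` V)"
    by (rule continuous_open_preimage[OF holomorphic_on_imp_continuous_on[OF hol] open_UH opV])
  have opU: "open U" using open_components[OF opW] Uc eqset by simp
  have Usub: "U \<subseteq> UH \<inter> F -` V" using in_components_subset[OF Uc] eqset by simp
  have Une: "U \<noteq> {}" using in_components_nonempty[OF Uc] .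
  have UU: "U \<subseteq> UH" and UV: "F \<tau> \<noteq> 0 \<and> 1 / F \<tau> \<in> ball p \<epsilon> - {p}" if "\<tau> \<in> U" for \<tau>
    using Usub that by (auto simp: V_def)
  have UUH: "U \<subseteq> UH" using Usub by blast
  obtain \<tau>1 where \<tau>1: "\<tau>1 \<in> U" using Une by blast
  define G where "G = (\<lambda>\<tau>. 1 / F \<tau>)"
  have serG: "(\<lambda>m. \<phi> m * (G \<tau> - p) ^ m) sums exp (2 * of_real pi * \<i> / of_real k * cusp_coord c \<tau>)" if "\<tau> \<in> U" for \<tau>
    using ser[OF that, of "G \<tau>"] f[of \<tau>] UV[OF that] UUH that by (auto simp: ci G_def)
  \<comment> \<open>The value \<open>G \<tau>1\<close> lies on the boundary circle of this disc,
    hence the need for the point \<open>\<tau>2\<close> below.\<close>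
  define \<rho> where "\<rho> = norm (G \<tau>1 - p)"
  have \<rho>: "\<rho> > 0" "\<rho> < \<epsilon>" using UV[OF \<tau>1] by (auto simp: \<rho>_def G_def dist_norm norm_minus_commute)
  define \<Phi> where "\<Phi> = (\<lambda>w. \<Sum>m. \<phi> m * (w - p) ^ m)"
  have \<Phi>s: "(\<lambda>m. \<phi> m * (w - p) ^ m) sums \<Phi> w" if "w \<in> ball p \<rho>" for w
  proof -
    have "norm (w - p) < norm (G \<tau>1 - p)" using that by (simp add: \<rho>_def dist_norm norm_minus_commute)
    then have "summable (\<lambda>m. \<phi> m * (w - p) ^ m)"
      by (rule powser_inside[OF sums_summable[OF serG[OF \<tau>1]]])
    then show ?thesis unfolding \<Phi>_def by (rule summable_sums)
  qed
  have hol\<Phi>: "\<Phi> holomorphic_on ball p \<rho>" by (rule power_series_holomorphic[OF \<Phi>s])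
  have shift: "(\<lambda>x. \<Phi> (p + x)) has_fps_expansion Abs_fps \<phi>"
  proof (rule has_fps_expansion_ballI[OF \<rho>(1)])
    fix x :: complex assume "norm x < \<rho>"
    then show "(\<lambda>m. Abs_fps \<phi> $ m * x ^ m) sums \<Phi> (p + x)" using \<Phi>s[of "p + x"] by (simp add: dist_norm)
  qed
  have hs: "(\<lambda>x. p + x) holomorphic_on ball 0 \<rho>" by (intro holomorphic_intros)
  have im: "(\<lambda>x. p + x) ` ball 0 \<rho> \<subseteq> ball p \<rho>" by (auto simp: dist_norm)
  have d1: "deriv (\<lambda>x. p + x) x = 1" for x by (auto intro!: DERIV_imp_deriv derivative_eq_intros)
  have d2: "deriv (deriv (\<lambda>x. p + x)) x = 0" for x unfolding d1[abs_def] by simp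
  have z0: "(0::complex) \<in> ball 0 \<rho>" using \<rho> by simp
  note dc = deriv_compose_derivs[OF open_ball z0 open_ball hs im hol\<Phi>, unfolded d1 d2]
  have \<Phi>p: "\<Phi> p = 0" using fps_expansion_nth_0[OF shift] \<phi>(1) by simp
  have "deriv (\<lambda>x. \<Phi> (p + x)) 0 = \<alpha>" using fps_nth_fps_expansion[OF shift, of 1] \<phi>(2) by simp
  then have \<Phi>1: "deriv \<Phi> p = \<alpha>" using dc(1) by simp
  have "deriv (deriv (\<lambda>x. \<Phi> (p + x))) 0 = 2 * \<beta>"
    using fps_nth_fps_expansion[OF shift, of 2] \<phi>(3) by (simp add: numeral_2_eq_2 mult.commute)
  then have \<Phi>2: "deriv (deriv \<Phi>) p = 2 * \<beta>" using dc(2) by simp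
  have dom: "ball p \<rho> - {p} \<subseteq> {w. w \<noteq> 0 \<and> 1 / w \<in> Y}"
  proof
    fix w assume "w \<in> ball p \<rho> - {p}"
    then have "w \<in> ball p \<epsilon> - {p}" using \<rho> by auto
    then obtain \<tau> where t: "\<tau> \<in> UH" "f \<tau> = Fin_pt w" using sub by (metis (no_types, lifting) imageE imageI subsetD)
    then have "F \<tau> \<noteq> 0" "w = 1 / F \<tau>" using f[OF t(1)] by (auto simp: ci)
    then show "w \<in> {w. w \<noteq> 0 \<and> 1 / w \<in> Y}" using F_in[OF t(1)] by simp
  qed
  have nzU: "F \<tau> \<noteq> 0" if "\<tau> \<in> U" for \<tau> using UV[OF that] by blast
  note rF = recip_F[OF opU UUH nzU, folded G_def]
  have holG: "G holomorphic_on U" by (rule rF(1)[OF _ \<tau>1])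
  obtain e where e: "e > 0" "ball \<tau>1 e \<subseteq> U" using opU \<tau>1 open_contains_ball by blast
  have nc: "\<not> G constant_on ball \<tau>1 e"
  proof
    assume "G constant_on ball \<tau>1 e"
    then obtain k0 where "\<And>\<tau>. \<tau> \<in> ball \<tau>1 e \<Longrightarrow> G \<tau> = k0" unfolding constant_on_def by blast
    then have "deriv G \<tau>1 = deriv (\<lambda>_. k0) \<tau>1" using e(1) by (intro deriv_cong_open[OF open_ball]) auto
    moreover have "\<tau>1 \<in> UH" using \<tau>1 UUH by blast
    ultimately show False using rF(2)[OF _ \<tau>1] deriv_nz nzU[OF \<tau>1] by simp
  qed
  have "open (G ` ball \<tau>1 e)"
    by (rule open_mapping_thm[OF holomorphic_on_subset[OF holG e(2)] open_ball connected_ball open_ball subset_refl nc])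
  moreover have "G \<tau>1 \<in> G ` ball \<tau>1 e" using e(1) by simp
  ultimately obtain e' where e': "e' > 0" "ball (G \<tau>1) e' \<subseteq> G ` ball \<tau>1 e" using open_contains_ball by metis
  \<comment> \<open>Moves \<open>G \<tau>1\<close> at most half way to \<open>p\<close> and by less
    than \<open>e'\<close>, so the new value is still attained on
    \<open>ball \<tau>1 e\<close>.\<close>
  define s where "s = min (1 / 2) (e' / (2 * \<rho>))"
  have s: "0 < s" "s < 1" "s * \<rho> < e'"
  proof -
    show "0 < s" "s < 1" using e'(1) \<rho>(1) by (simp_all add: s_def)
    have "s * \<rho> \<le> e' / (2 * \<rho>) * \<rho>" using \<rho>(1) by (intro mult_right_mono) (simp_all add: s_def)
    also have "\<dots> = e' / 2" using \<rho>(1) by simp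
    also have "\<dots> < e'" using e'(1) by simp
    finally show "s * \<rho> < e'" .
  qed
  define w2 where "w2 = G \<tau>1 - of_real s * (G \<tau>1 - p)"
  have "w2 \<in> ball (G \<tau>1) e'" using s by (simp add: w2_def dist_norm norm_mult \<rho>_def[symmetric])
  then obtain \<tau>2 where \<tau>2: "\<tau>2 \<in> U" "G \<tau>2 = w2" using e'(2) e(2) by (metis (no_types, lifting) imageE subsetD)
  have w2p: "w2 - p = of_real (1 - s) * (G \<tau>1 - p)" by (simp add: w2_def algebra_simps)
  have "norm (w2 - p) = (1 - s) * \<rho>" unfolding w2p norm_mult norm_of_real \<rho>_def using s by simp
  also have "\<dots> < \<rho>" using s \<rho> by (simp add: algebra_simps)
  finally have w2: "w2 \<in> ball p \<rho>" by (simp add: dist_norm norm_minus_commute)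
  define U' where "U' = U \<inter> G -` ball p \<rho>"
  have U': "open U'" "U' \<noteq> {}" "U' \<subseteq> UH"
    using continuous_open_preimage[OF holomorphic_on_imp_continuous_on[OF holG] opU open_ball] \<tau>2 w2 UUH
    by (auto simp: U'_def)
  have \<kappa>: "2 * of_real pi * \<i> / of_real k \<noteq> (0::complex)" using k by simp
  have rel: "F \<tau> \<noteq> 0 \<and> 1 / F \<tau> \<in> ball p \<rho> - {p} \<and> \<Phi> (1 / F \<tau>) = exp (2 * of_real pi * \<i> / of_real k * cusp_coord c \<tau>)" if t: "\<tau> \<in> U'" for \<tau>
  proof -
    have tU: "\<tau> \<in> U" "G \<tau> \<in> ball p \<rho>" using t by (auto simp: U'_def)
    have "\<Phi> (G \<tau>) = exp (2 * of_real pi * \<i> / of_real k * cusp_coord c \<tau>)"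
      using sums_unique2[OF \<Phi>s[OF tU(2)] serG[OF tU(1)]] .
    then show ?thesis using UV[OF tU(1)] tU(2) by (simp add: G_def)
  qed
  from SchI_at_puncture[OF \<rho>(1) dom hol\<Phi> \<Phi>p \<Phi>1 \<Phi>2 \<alpha> U' \<kappa> rel]
  obtain r H where "0 < r" "H holomorphic_on ball p r"
    "\<And>w. w \<in> ball p r - {p} \<Longrightarrow> SchI w = 1 / (w - p)\<^sup>2 + 2 * \<beta> / \<alpha> / (w - p) + H w" by blast
  then show ?thesis by (intro exI[of _ r] conjI exI[of _ H]) auto
qed

context plane_cover
begin

text \<open>First and second derivative of \<open>Q (\<phi> q) = q\<close> at q = 0.\<close>

lemma cusp_chart_derivs:
  assumes "cusp_chart K M \<epsilon> Q \<phi>"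
  shows "deriv Q 0 * deriv \<phi> 0 = 1"
    "deriv (deriv Q) 0 * (deriv \<phi> 0)\<^sup>2 + deriv Q 0 * deriv (deriv \<phi>) 0 = 0" "Q 0 = 0"
proof -
  define \<eta> where "\<eta> = exp (- 2 * pi * M / K)"
  have c: "Q holomorphic_on ball 0 \<epsilon>" "\<phi> holomorphic_on ball 0 \<eta>" "\<phi> 0 = 0"
    "\<And>q. q \<in> ball 0 \<eta> \<Longrightarrow> \<phi> q \<in> ball 0 \<epsilon> \<and> Q (\<phi> q) = q"
    using assms unfolding cusp_chart_def \<eta>_def by blast+
  have 0: "(0::complex) \<in> ball 0 \<eta>" by (simp add: \<eta>_def)
  have im: "\<phi> ` ball 0 \<eta> \<subseteq> ball 0 \<epsilon>" using c(4) by blast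
  note d = deriv_compose_derivs[OF open_ball _ open_ball c(2) im c(1)]
  have id: "Q (\<phi> q) = q" if "q \<in> ball 0 \<eta>" for q using c(4)[OF that] by blast
  have d1: "deriv (\<lambda>q. Q (\<phi> q)) q = 1" if "q \<in> ball 0 \<eta>" for q
    using deriv_cong_open[OF open_ball that id] by simp
  show "deriv Q 0 * deriv \<phi> 0 = 1" using d(1)[OF 0] d1[OF 0] c(3) by simp
  have "deriv (deriv (\<lambda>q. Q (\<phi> q))) 0 = 0"
    using deriv_cong_open[OF open_ball 0 d1] by simp
  then show "deriv (deriv Q) 0 * (deriv \<phi> 0)\<^sup>2 + deriv Q 0 * deriv (deriv \<phi>) 0 = 0"
    using d(2)[OF 0] c(3) by simp
  show "Q 0 = 0" using id[OF 0] c(3) by simp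
qed

lemma cusp_chart_rel:
  assumes "cusp_chart K M \<epsilon> Q \<phi>" and t: "M < Im \<tau>"
  defines "q \<equiv> exp (2 * of_real pi * \<i> / of_real K * \<tau>)"
  shows "q \<in> ball 0 (exp (- 2 * pi * M / K))" "F \<tau> \<noteq> 0" "\<phi> q = 1 / F \<tau>" "1 / F \<tau> \<in> ball 0 \<epsilon>" "Q (1 / F \<tau>) = q"
    "norm q = exp (- (2 * pi / K) * Im \<tau>)"
proof -
  have K: "K > 0" using assms(1) by (simp add: cusp_chart_def)
  have "2 * of_real pi * \<i> / of_real K * \<tau> = \<i> * of_real (2 * pi / K) * \<tau>" by (simp add: field_simps)
  then have "Re (2 * of_real pi * \<i> / of_real K * \<tau>) = - (2 * pi / K) * Im \<tau>" by (simp only:) simp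
  then show n: "norm q = exp (- (2 * pi / K) * Im \<tau>)" by (simp only: q_def norm_exp_eq_Re)
  have "0 < 2 * pi / K" using K by simp
  then have "(2 * pi / K) * M < (2 * pi / K) * Im \<tau>" using t mult_less_cancel_left_pos by blast
  moreover have "- 2 * pi * M / K = - ((2 * pi / K) * M)" by simp
  ultimately have "exp (- (2 * pi / K) * Im \<tau>) < exp (- 2 * pi * M / K)"
    by (simp only: exp_less_cancel_iff mult_minus_left neg_less_iff_less)
  then show q: "q \<in> ball 0 (exp (- 2 * pi * M / K))" using n by simp
  show "F \<tau> \<noteq> 0" and \<phi>: "\<phi> q = 1 / F \<tau>" using assms(1) t unfolding cusp_chart_def q_def by blast+
  have "\<phi> q \<in> ball 0 \<epsilon> \<and> Q (\<phi> q) = q" using assms(1) q unfolding cusp_chart_def by blast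
  then show "1 / F \<tau> \<in> ball 0 \<epsilon>" "Q (1 / F \<tau>) = q" unfolding \<phi> by auto
qed

text \<open>Inverting \<open>f = A q + B q\<^sup>2 + ...\<close> gives
  \<open>Q z = z / A - (B / A ^ 3) z\<^sup>2 + ...\<close>; the quotient
  \<open>- B / A\<^sup>2\<close> of these coefficients plays the role of
  \<open>\<beta> / \<alpha>\<close> at the puncture 0.\<close>

lemma cusp_SchI:
  assumes ch: "cusp_chart K M \<epsilon> Q \<phi>"
    and inf: "\<And>R. \<exists>M\<ge>0. \<forall>\<tau>. M < Im \<tau> \<longrightarrow> R < norm (F \<tau>)"
    and R1: "0 < R1" "\<And>v. R1 < norm v \<Longrightarrow> v \<in> Y"
    and A: "A = deriv \<phi> 0" and B: "B = deriv (deriv \<phi>) 0 / 2"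
  shows "A \<noteq> 0" "\<exists>r y u H. 0 < r \<and> r \<le> \<epsilon> \<and> y holomorphic_on ball 0 r \<and> u holomorphic_on ball 0 r \<and> H holomorphic_on ball 0 r \<and>
    (\<forall>w\<in>ball 0 r. w * deriv Q w = y w * Q w) \<and> (\<forall>w\<in>ball 0 r. w * deriv y w = u w * y w) \<and>
    (\<forall>w\<in>ball 0 r - {0}. Q w \<noteq> 0 \<and> w\<^sup>2 * SchI w = 1 - (u w)\<^sup>2 + 2 * w * deriv u w \<and>
        SchI w = 1 / w\<^sup>2 + 2 * (- B / A\<^sup>2) / w + H w) \<and> y 0 = 1 \<and> u 0 = 0"
proof -
  note d = cusp_chart_derivs[OF ch]
  have K: "K > 0" and \<epsilon>: "\<epsilon> > 0" and Q: "Q holomorphic_on ball 0 \<epsilon>" using ch by (auto simp: cusp_chart_def)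
  show A0: "A \<noteq> 0" using d(1) A by auto
  have Q1: "deriv Q 0 = 1 / A" using d(1) A A0 by (simp add: field_simps)
  have "deriv (deriv Q) 0 * A\<^sup>2 + 1 / A * (2 * B) = 0" using d(2) Q1 by (simp add: A[symmetric] B)
  then have "deriv (deriv Q) 0 * A\<^sup>2 = - (2 * B / A)" by (simp add: eq_neg_iff_add_eq_0)
  then have Q2: "deriv (deriv Q) 0 = 2 * (- B / A ^ 3)"
    using A0 by (simp add: field_simps power2_eq_square power3_eq_cube)
  \<comment> \<open>For nonzero \<open>w\<close> inside the radius \<open>1 / R1\<close> the
    reciprocal has modulus above \<open>R1\<close> and so lies in \<open>Y\<close>.\<close>
  define \<rho> where "\<rho> = min \<epsilon> (1 / R1)"
  have \<rho>: "0 < \<rho>" "\<rho> \<le> \<epsilon>" "\<rho> \<le> 1 / R1" using \<epsilon> R1(1) by (auto simp: \<rho>_def)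
  have dom: "ball 0 \<rho> - {0} \<subseteq> {w. w \<noteq> 0 \<and> 1 / w \<in> Y}"
  proof
    fix w :: complex assume w: "w \<in> ball 0 \<rho> - {0}"
    then have "norm w < 1 / R1" "0 < norm w" using \<rho>(3) by auto
    then have "R1 < norm (1 / w)" using R1(1) by (simp add: norm_divide less_divide_eq mult.commute)
    then show "w \<in> {w. w \<noteq> 0 \<and> 1 / w \<in> Y}" using R1(2) w by auto
  qed
  obtain M' where M': "M' \<ge> 0" "\<And>\<tau>. M' < Im \<tau> \<Longrightarrow> 1 / \<rho> < norm (F \<tau>)" using inf by blast
  define U where "U = {\<tau>. max M M' < Im \<tau>}"
  have "Complex 0 (max M M' + 1) \<in> U" by (auto simp: U_def max_def)
  moreover have "open U" unfolding U_def by (rule open_halfspace_Im_gt)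
  moreover have "U \<subseteq> UH" using M'(1) by (auto simp: U_def UH_iff)
  ultimately have U: "open U" "U \<noteq> {}" "U \<subseteq> UH" by blast+
  have \<kappa>: "2 * of_real pi * \<i> / of_real K \<noteq> (0::complex)" using K by simp
  have rel: "F \<tau> \<noteq> 0 \<and> 1 / F \<tau> \<in> ball 0 \<rho> - {0} \<and> Q (1 / F \<tau>) = exp (2 * of_real pi * \<i> / of_real K * cusp_coord None \<tau>)"
    if t: "\<tau> \<in> U" for \<tau>
  proof -
    have t': "M < Im \<tau>" "M' < Im \<tau>" using t by (auto simp: U_def)
    note r = cusp_chart_rel[OF ch t'(1)]
    have "norm (1 / F \<tau>) < \<rho>" using M'(2)[OF t'(2)] \<rho>(1) r(2) by (simp add: norm_divide divide_less_eq mult.commute)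
    then show ?thesis using r by simp
  qed
  have "1 / A \<noteq> 0" using A0 by simp
  from SchI_at_puncture[OF \<rho>(1) dom holomorphic_on_subset[OF Q] d(3) Q1 Q2 this U \<kappa> rel]
  obtain r y u H where *: "0 < r" "r \<le> \<rho>" "y holomorphic_on ball 0 r" "u holomorphic_on ball 0 r" "H holomorphic_on ball 0 r"
    "\<forall>w\<in>ball 0 r. (w - 0) * deriv Q w = y w * Q w" "\<forall>w\<in>ball 0 r. (w - 0) * deriv y w = u w * y w"
    "\<forall>w\<in>ball 0 r - {0}. Q w \<noteq> 0 \<and> y w \<noteq> 0 \<and> (w - 0)\<^sup>2 * SchI w = 1 - (u w)\<^sup>2 + 2 * (w - 0) * deriv u w \<and>
        SchI w = 1 / (w - 0)\<^sup>2 + 2 * (- B / A ^ 3) / (1 / A) / (w - 0) + H w" "y 0 = 1" "u 0 = 0"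
    using \<rho>(2) by (auto simp: subset_ball)
  have e: "2 * (- B / A ^ 3) / (1 / A) = 2 * (- B / A\<^sup>2)" using A0 by (simp add: power2_eq_square power3_eq_cube)
  note ** = *[unfolded diff_zero e]
  have r\<epsilon>: "r \<le> \<epsilon>" using *(2) \<rho>(2) by linarith
  have 8: "\<forall>w\<in>ball 0 r - {0}. Q w \<noteq> 0 \<and> w\<^sup>2 * SchI w = 1 - (u w)\<^sup>2 + 2 * w * deriv u w \<and>
        SchI w = 1 / w\<^sup>2 + 2 * (- B / A\<^sup>2) / w + H w" using **(8) by blast
  show "\<exists>r y u H. 0 < r \<and> r \<le> \<epsilon> \<and> y holomorphic_on ball 0 r \<and> u holomorphic_on ball 0 r \<and> H holomorphic_on ball 0 r \<and>
    (\<forall>w\<in>ball 0 r. w * deriv Q w = y w * Q w) \<and> (\<forall>w\<in>ball 0 r. w * deriv y w = u w * y w) \<and>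
    (\<forall>w\<in>ball 0 r - {0}. Q w \<noteq> 0 \<and> w\<^sup>2 * SchI w = 1 - (u w)\<^sup>2 + 2 * w * deriv u w \<and>
        SchI w = 1 / w\<^sup>2 + 2 * (- B / A\<^sup>2) / w + H w) \<and> y 0 = 1 \<and> u 0 = 0"
    by (intro exI[of _ r] exI[of _ y] exI[of _ u] exI[of _ H] conjI r\<epsilon> **(1,3-7,9,10) 8)
qed

text \<open>The nonzero poles are the points \<open>1 / X j\<close> with
  \<open>X j \<noteq> 0\<close>. An index with \<open>X j = 0\<close> stands for infinity, and as
  its summand vanishes the sum may run over all of \<open>{2..n}\<close>.\<close>

lemma SchI_formula:
  fixes X \<rho> :: "nat \<Rightarrow> complex"
  assumes Y: "Y = - (X ` {2..n})" and inj: "inj_on X {2..n}"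
    and loc: "\<And>j. j \<in> {2..n} \<Longrightarrow> X j \<noteq> 0 \<Longrightarrow> \<exists>r>0. \<exists>H. H holomorphic_on ball (1 / X j) r \<and>
      (\<forall>w\<in>ball (1 / X j) r - {1 / X j}. SchI w = 1 / (w - 1 / X j)\<^sup>2 + 2 * \<rho> j / (w - 1 / X j) + H w)"
    and loc0: "\<exists>r>0. \<exists>H. H holomorphic_on ball 0 r \<and> (\<forall>w\<in>ball 0 r - {0}. SchI w = 1 / w\<^sup>2 + 2 * \<sigma>0 / w + H w)"
  shows "\<exists>e>0. \<forall>w\<in>ball 0 e - {0}. SchI w = 1 / w\<^sup>2 + 2 * \<sigma>0 / w
     + (\<Sum>j=2..n. (X j)\<^sup>2 * (1 / (1 - X j * w))\<^sup>2 - 2 * \<rho> j * X j * (1 / (1 - X j * w)))"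
proof -
  define J where "J = {j\<in>{2..n}. X j \<noteq> 0}"
  define P1 where "P1 = (\<lambda>j. 1 / X j) ` J"
  define P where "P = insert 0 P1"
  have fin: "finite P1" "finite P" "finite J" by (simp_all add: P_def P1_def J_def)
  have injJ: "inj_on (\<lambda>j. 1 / X j) J" using inj by (auto simp: inj_on_def J_def)
  have P10: "0 \<notin> P1" by (auto simp: P1_def J_def)
  define \<sigma> where "\<sigma> = (\<lambda>p. if p = 0 then \<sigma>0 else \<rho> (the_inv_into J (\<lambda>j. 1 / X j) p))"
  have \<sigma>J: "\<sigma> (1 / X j) = \<rho> j" if "j \<in> J" for j
    using the_inv_into_f_f[OF injJ that] that by (simp add: \<sigma>_def J_def)
  have sub: "- P \<subseteq> {w. w \<noteq> 0 \<and> 1 / w \<in> Y}"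
  proof
    fix w assume w: "w \<in> - P"
    then have w0: "w \<noteq> 0" by (simp add: P_def)
    have "1 / w \<noteq> X j" if "j \<in> {2..n}" for j
    proof
      assume e: "1 / w = X j"
      then have "X j \<noteq> 0" "w = 1 / X j" unfolding e[symmetric] using w0 by auto
      then have "w \<in> P" using that by (auto simp: P_def P1_def J_def)
      with w show False by simp
    qed
    then have "1 / w \<notin> X ` {2..n}" by blast
    then show "w \<in> {w. w \<noteq> 0 \<and> 1 / w \<in> Y}" using w0 Y by simp
  qed
  have hol: "SchI holomorphic_on - P" by (rule holomorphic_on_subset[OF SchI_holomorphic sub])
  have fX: "finite (X ` {2..n})" by simp
  \<comment> \<open>Near 0 in the \<open>F\<close>-plane at most 0 itself is missing from
    \<open>Y\<close>; this is what the decay of \<open>SchI\<close> at infinity rests on.\<close>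
  obtain \<epsilon> where \<epsilon>: "\<epsilon> > 0" "ball 0 \<epsilon> - {0} \<subseteq> Y"
  proof -
    obtain d where d: "d > 0" "\<forall>x\<in>X ` {2..n}. x \<noteq> 0 \<longrightarrow> d \<le> dist 0 x" using finite_set_avoid[OF fX, of 0] by blast
    have "ball 0 d - {0} \<subseteq> Y"
    proof
      fix x :: complex assume "x \<in> ball 0 d - {0}"
      then have "dist 0 x < d" "x \<noteq> 0" by auto
      then show "x \<in> Y" using d(2) Y by fastforce
    qed
    with d(1) show ?thesis by (rule that)
  qed
  have locP: "\<exists>r>0. \<exists>H. H holomorphic_on ball p r \<and>
       (\<forall>w\<in>ball p r - {p}. SchI w = 1 / (w - p)\<^sup>2 + 2 * \<sigma> p / (w - p) + H w)" if p: "p \<in> P" for p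
  proof (cases "p = 0")
    case True
    then show ?thesis using loc0 by (simp add: \<sigma>_def)
  next
    case False
    then obtain j where j: "j \<in> J" "p = 1 / X j" using p by (auto simp: P_def P1_def)
    then have j2: "j \<in> {2..n}" "X j \<noteq> 0" by (auto simp: J_def)
    show ?thesis using loc[OF j2] \<sigma>J[OF j(1)] unfolding j(2) by simp
  qed
  obtain e where e: "e > 0" "\<forall>x\<in>P. x \<noteq> 0 \<longrightarrow> e \<le> dist 0 x" using finite_set_avoid[OF fin(2), of 0] by blast
  have "SchI w = 1 / w\<^sup>2 + 2 * \<sigma>0 / w
     + (\<Sum>j=2..n. (X j)\<^sup>2 * (1 / (1 - X j * w))\<^sup>2 - 2 * \<rho> j * X j * (1 / (1 - X j * w)))" if w: "w \<in> ball 0 e - {0}" for w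
  proof -
    have wP: "w \<notin> P" using w e(2) by fastforce
    have "SchI w = (\<Sum>p\<in>P. 1 / (w - p)\<^sup>2 + 2 * \<sigma> p / (w - p))"
      by (rule rational_by_principal_parts[OF fin(2) hol locP SchI_tendsto_0[OF \<epsilon>] wP])
    also have "\<dots> = 1 / w\<^sup>2 + 2 * \<sigma>0 / w + (\<Sum>p\<in>P1. 1 / (w - p)\<^sup>2 + 2 * \<sigma> p / (w - p))"
      using fin(1) P10 by (simp add: P_def \<sigma>_def)
    also have "(\<Sum>p\<in>P1. 1 / (w - p)\<^sup>2 + 2 * \<sigma> p / (w - p)) = (\<Sum>j\<in>J. 1 / (w - 1 / X j)\<^sup>2 + 2 * \<rho> j / (w - 1 / X j))"
      unfolding P1_def sum.reindex[OF injJ] o_def by (intro sum.cong refl) (simp add: \<sigma>J)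
    also have "\<dots> = (\<Sum>j\<in>J. (X j)\<^sup>2 * (1 / (1 - X j * w))\<^sup>2 - 2 * \<rho> j * X j * (1 / (1 - X j * w)))"
    proof (intro sum.cong refl)
      fix j assume j: "j \<in> J"
      then have Xj: "X j \<noteq> 0" by (simp add: J_def)
      have "1 / X j \<in> P" using j by (auto simp: P_def P1_def)
      then have "w \<noteq> 1 / X j" using wP by auto
      then have nz: "1 - X j * w \<noteq> 0" using Xj by (auto simp: field_simps)
      have "w - 1 / X j = - ((1 - X j * w) / X j)" using Xj by (simp add: field_simps)
      then show "1 / (w - 1 / X j)\<^sup>2 + 2 * \<rho> j / (w - 1 / X j)
         = (X j)\<^sup>2 * (1 / (1 - X j * w))\<^sup>2 - 2 * \<rho> j * X j * (1 / (1 - X j * w))"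
        using Xj nz by (simp add: power_divide)
    qed
    also have "\<dots> = (\<Sum>j=2..n. (X j)\<^sup>2 * (1 / (1 - X j * w))\<^sup>2 - 2 * \<rho> j * X j * (1 / (1 - X j * w)))"
      by (rule sum.mono_neutral_left) (auto simp: J_def)
    finally show ?thesis .
  qed
  with e(1) show ?thesis by blast
qed

text \<open>The substitution \<open>w = A x\<close> normalises the linear coefficient of
  \<open>Q\<close> to 1 and produces the powers of \<open>A\<close> in \<open>rhs_coeff\<close>. The
  double pole at 0 cancels against the 1 in \<open>1 - u\<^sup>2 + 2 w u'\<close>, and the Riccati
  equation remains.\<close>

lemma cusp_expansion:
  fixes X \<rho> :: "nat \<Rightarrow> complex"
  assumes ch: "cusp_chart K M \<epsilon> Q \<phi>"
    and inf: "\<And>R. \<exists>M\<ge>0. \<forall>\<tau>. M < Im \<tau> \<longrightarrow> R < norm (F \<tau>)"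
    and Y: "Y = - (X ` {2..n})" and inj: "inj_on X {2..n}"
    and loc: "\<And>j. j \<in> {2..n} \<Longrightarrow> X j \<noteq> 0 \<Longrightarrow> \<exists>r>0. \<exists>H. H holomorphic_on ball (1 / X j) r \<and>
      (\<forall>w\<in>ball (1 / X j) r - {1 / X j}. SchI w = 1 / (w - 1 / X j)\<^sup>2 + 2 * \<rho> j / (w - 1 / X j) + H w)"
    and A: "A = deriv \<phi> 0" and B: "B = deriv (deriv \<phi>) 0 / 2" and d: "d = (A, B / A, X, \<rho>)"
  shows "A \<noteq> 0" "(\<lambda>q. \<phi> q / A) has_fps_expansion Abs_fps (\<lambda>m. cusp_coeff n m d)"
    "\<exists>r y \<eta>. 0 < r \<and> norm A * r \<le> \<epsilon> \<and> y holomorphic_on ball 0 r \<and> \<eta> holomorphic_on ball 0 r \<and>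
      y has_fps_expansion Abs_fps (y_coeff n d) \<and> y 0 = 1 \<and> \<eta> has_fps_expansion Abs_fps (eta_coeff n d) \<and> \<eta> 0 = 0 \<and>
      (\<forall>x\<in>ball 0 r. Q (A * x) = x * exp (\<eta> x) \<and> A * x * deriv Q (A * x) = y x * Q (A * x))"
proof -
  have "bounded (X ` {2..n})" by (intro finite_imp_bounded) simp
  then obtain R where R: "\<And>x. x \<in> X ` {2..n} \<Longrightarrow> norm x \<le> R" unfolding bounded_iff by blast
  define R1 where "R1 = \<bar>R\<bar> + 1"
  have R1: "0 < R1" "\<And>v. R1 < norm v \<Longrightarrow> v \<in> Y" using R by (force simp: R1_def Y)+
  note cS = cusp_SchI[OF ch inf R1 A B]
  show A0: "A \<noteq> 0" by (rule cS(1))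
  obtain r0 y u H where c: "0 < r0" "r0 \<le> \<epsilon>" "y holomorphic_on ball 0 r0" "u holomorphic_on ball 0 r0" "H holomorphic_on ball 0 r0"
    "\<forall>w\<in>ball 0 r0. w * deriv Q w = y w * Q w" "\<forall>w\<in>ball 0 r0. w * deriv y w = u w * y w"
    "\<forall>w\<in>ball 0 r0 - {0}. Q w \<noteq> 0 \<and> w\<^sup>2 * SchI w = 1 - (u w)\<^sup>2 + 2 * w * deriv u w \<and>
        SchI w = 1 / w\<^sup>2 + 2 * (- B / A\<^sup>2) / w + H w" "y 0 = 1" "u 0 = 0"
    using cS(2) by blast
  have "\<exists>r>0. \<exists>H. H holomorphic_on ball 0 r \<and> (\<forall>w\<in>ball 0 r - {0}. SchI w = 1 / w\<^sup>2 + 2 * (- B / A\<^sup>2) / w + H w)"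
    using c(1,5,8) by blast
  from SchI_formula[OF Y inj loc this] obtain e where e: "e > 0"
    "\<And>w. w \<in> ball 0 e - {0} \<Longrightarrow> SchI w = 1 / w\<^sup>2 + 2 * (- B / A\<^sup>2) / w
     + (\<Sum>j=2..n. (X j)\<^sup>2 * (1 / (1 - X j * w))\<^sup>2 - 2 * \<rho> j * X j * (1 / (1 - X j * w)))" by blast
  define r where "r = min r0 e / norm A"
  have nA: "norm A > 0" using A0 by simp
  have r: "0 < r" using c(1) e(1) nA by (simp add: r_def)
  have Ar: "norm A * r = min r0 e" using nA by (simp add: r_def)
  have Ax: "A * x \<in> ball 0 r0" "A * x \<in> ball 0 e" if "x \<in> ball 0 r" for x
  proof -
    have "norm A * norm x < norm A * r" using that nA by simp
    then show "A * x \<in> ball 0 r0" "A * x \<in> ball 0 e" unfolding Ar by (simp_all add: norm_mult)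
  qed
  have Q: "Q holomorphic_on ball 0 r0"
    using ch c(2) unfolding cusp_chart_def by (meson holomorphic_on_subset subset_ball)
  have hA: "(\<lambda>x. A * x) holomorphic_on ball 0 r" by (intro holomorphic_intros)
  have imA: "(\<lambda>x. A * x) ` ball 0 r \<subseteq> ball 0 r0" using Ax by blast
  have dA: "deriv (\<lambda>x. A * x) x = A" for x by (auto intro!: DERIV_imp_deriv derivative_eq_intros)
  have scale: "(\<lambda>x. g (A * x)) holomorphic_on ball 0 r \<and> (\<forall>x\<in>ball 0 r. deriv (\<lambda>x. g (A * x)) x = deriv g (A * x) * A)"
    if g: "g holomorphic_on ball 0 r0" for g
  proof
    show "(\<lambda>x. g (A * x)) holomorphic_on ball 0 r"
      using holomorphic_on_compose_gen[OF hA g imA] by (simp add: o_def)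
    show "\<forall>x\<in>ball 0 r. deriv (\<lambda>x. g (A * x)) x = deriv g (A * x) * A"
      using deriv_compose_derivs(1)[OF open_ball _ open_ball hA imA g] by (simp add: dA)
  qed
  define y1 where "y1 = (\<lambda>x. y (A * x))"
  define u1 where "u1 = (\<lambda>x. u (A * x))"
  define \<psi> where "\<psi> = (\<lambda>x. Q (A * x))"
  have y1: "y1 holomorphic_on ball 0 r" "\<And>x. x \<in> ball 0 r \<Longrightarrow> deriv y1 x = deriv y (A * x) * A"
    using scale[OF c(3)] by (auto simp: y1_def)
  have u1: "u1 holomorphic_on ball 0 r" "\<And>x. x \<in> ball 0 r \<Longrightarrow> deriv u1 x = deriv u (A * x) * A"
    using scale[OF c(4)] by (auto simp: u1_def)
  have \<psi>: "\<psi> holomorphic_on ball 0 r" "\<And>x. x \<in> ball 0 r \<Longrightarrow> deriv \<psi> x = deriv Q (A * x) * A"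
    using scale[OF Q] by (auto simp: \<psi>_def)
  have ric: "2 * (x * deriv u1 x) - (u1 x)\<^sup>2 = - 2 * (B / A) * x
       + (\<Sum>j=2..n. (A * x)\<^sup>2 * ((X j)\<^sup>2 * (1 / (1 - A * X j * x))\<^sup>2 - 2 * \<rho> j * X j * (1 / (1 - A * X j * x))))"
    if x: "x \<in> ball 0 r" for x
  proof (cases "x = 0")
    case True
    then show ?thesis using c(10) by (simp add: u1_def)
  next
    case False
    define w where "w = A * x"
    have w0: "w \<noteq> 0" using False A0 by (simp add: w_def)
    have wr: "w \<in> ball 0 r0 - {0}" "w \<in> ball 0 e - {0}" using Ax[OF x] w0 by (auto simp: w_def)
    define \<Sigma> where "\<Sigma> = (\<Sum>j=2..n. (X j)\<^sup>2 * (1 / (1 - X j * w))\<^sup>2 - 2 * \<rho> j * X j * (1 / (1 - X j * w)))"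
    have s1: "w\<^sup>2 * SchI w = 1 + 2 * (- B / A\<^sup>2) * w + w\<^sup>2 * \<Sigma>"
    proof -
      have "w\<^sup>2 * (1 / w\<^sup>2 + a / w + \<Sigma>) = 1 + a * w + w\<^sup>2 * \<Sigma>" for a
        using w0 by (simp add: power2_eq_square distrib_left)
      then show ?thesis unfolding e(2)[OF wr(2)] \<Sigma>_def[symmetric] .
    qed
    have s2: "w\<^sup>2 * SchI w = 1 - (u w)\<^sup>2 + 2 * w * deriv u w" using c(8) wr(1) by blast
    have "1 - (u w)\<^sup>2 + 2 * w * deriv u w = 1 + 2 * (- B / A\<^sup>2) * w + w\<^sup>2 * \<Sigma>"
      by (rule trans[OF sym[OF s2] s1])
    moreover have "q - p = a + b" if "1 - p + q = 1 + a + b" for p q a b :: complex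
      using that by (simp add: algebra_simps)
    ultimately have "2 * w * deriv u w - (u w)\<^sup>2 = 2 * (- B / A\<^sup>2) * w + w\<^sup>2 * \<Sigma>" by blast
    moreover have "2 * (- B / A\<^sup>2) * w = - 2 * (B / A) * x" using A0 by (simp add: w_def power2_eq_square)
    moreover have "2 * (x * deriv u1 x) - (u1 x)\<^sup>2 = 2 * w * deriv u w - (u w)\<^sup>2"
      using u1(2)[OF x] by (simp add: u1_def w_def mult_ac)
    ultimately show ?thesis by (simp add: \<Sigma>_def w_def sum_distrib_left mult_ac)
  qed
  have u10: "u1 0 = 0" using c(10) by (simp add: u1_def)
  have U: "u1 has_fps_expansion Abs_fps (u_coeff n d)"
    unfolding d by (rule riccati_fps[OF r u1(1) u10 ric])
  have y10: "y1 0 = 1" using c(9) by (simp add: y1_def)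
  have yeq: "x * deriv y1 x = u1 x * y1 x" if "x \<in> ball 0 r" for x
  proof -
    have "A * x * deriv y (A * x) = u (A * x) * y (A * x)" using c(7) Ax(1)[OF that] by blast
    then show ?thesis unfolding y1(2)[OF that] by (simp only: y1_def u1_def mult_ac)
  qed
  have U0: "Abs_fps (u_coeff n d) $ 0 = 0" using fps_expansion_nth_0[OF U] u10 by simp
  have "fps_nth (Abs_fps (u_coeff n d)) = u_coeff n d" by auto
  then have Yf: "y1 has_fps_expansion Abs_fps (y_coeff n d)"
    using linear_fps[OF r y1(1) y10 U U0 yeq] by (simp add: y_coeff_def)
  note dQ = cusp_chart_derivs[OF ch]
  have \<psi>0: "\<psi> 0 = 0" using dQ(3) by (simp add: \<psi>_def)
  have d\<psi>0: "deriv \<psi> 0 = 1" using \<psi>(2)[of 0] r dQ(1) A by simp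
  have \<psi>nz: "\<psi> x \<noteq> 0" if "x \<in> ball 0 r - {0}" for x
    using c(8) Ax(1)[of x] that A0 by (auto simp: \<psi>_def)
  have \<psi>eq: "x * deriv \<psi> x = y1 x * \<psi> x" if "x \<in> ball 0 r" for x
  proof -
    have "A * x * deriv Q (A * x) = y (A * x) * Q (A * x)" using c(6) Ax(1)[OF that] by blast
    then show ?thesis unfolding \<psi>(2)[OF that] by (simp only: y1_def \<psi>_def mult_ac)
  qed
  note pe = psi_eta_fps[OF r \<psi>(1) y1(1) \<psi>0 d\<psi>0 \<psi>nz Yf y10 \<psi>eq]
  obtain \<eta> where \<eta>: "\<eta> holomorphic_on ball 0 r" "\<eta> 0 = 0" "\<eta> has_fps_expansion Abs_fps (eta_coeff n d)"
    "\<forall>x\<in>ball 0 r. \<psi> x = x * exp (\<eta> x)" using pe(2) by blast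
  have "norm A * r \<le> \<epsilon>" using Ar c(2) by simp
  moreover have "A * x * deriv Q (A * x) = y1 x * Q (A * x)" if "x \<in> ball 0 r" for x
    using c(6) Ax(1)[OF that] by (simp add: y1_def)
  ultimately show "\<exists>r y \<eta>. 0 < r \<and> norm A * r \<le> \<epsilon> \<and> y holomorphic_on ball 0 r \<and> \<eta> holomorphic_on ball 0 r \<and>
      y has_fps_expansion Abs_fps (y_coeff n d) \<and> y 0 = 1 \<and> \<eta> has_fps_expansion Abs_fps (eta_coeff n d) \<and> \<eta> 0 = 0 \<and>
      (\<forall>x\<in>ball 0 r. Q (A * x) = x * exp (\<eta> x) \<and> A * x * deriv Q (A * x) = y x * Q (A * x))"
    using r y1(1) Yf y10 \<eta> by (intro exI[of _ r] exI[of _ y1] exI[of _ \<eta>]) (auto simp: \<psi>_def)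
  define \<theta> where "\<theta> = exp (- 2 * pi * M / K)"
  have \<theta>: "\<theta> > 0" by (simp add: \<theta>_def)
  have \<phi>: "\<phi> holomorphic_on ball 0 \<theta>" "\<phi> 0 = 0" "\<And>q. q \<in> ball 0 \<theta> \<Longrightarrow> Q (\<phi> q) = q"
    using ch unfolding cusp_chart_def \<theta>_def by blast+
  define p1 where "p1 = (\<lambda>q. \<phi> q / A)"
  have hp1: "p1 holomorphic_on ball 0 \<theta>" unfolding p1_def using A0 by (intro holomorphic_intros \<phi>(1)) auto
  define P where "P = fps_expansion p1 0"
  have P: "p1 has_fps_expansion P" unfolding P_def by (rule holomorphic_has_fps[OF hp1 \<theta>])
  have P0: "P $ 0 = 0" using fps_expansion_nth_0[OF P] \<phi>(2) by (simp add: p1_def)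
  \<comment> \<open>Here \<open>\<psi>\<close> is q as a function of \<open>x\<close> and
    \<open>p1\<close> is \<open>x\<close> as a function of q, so the composite is the
    identity.\<close>
  have comp: "(\<psi> \<circ> p1) has_fps_expansion fps_compose (psi_fps n d) P" by (rule has_fps_expansion_compose[OF pe(1) P P0])
  have "fps_compose (psi_fps n d) P = fps_X"
    by (rule fps_eqI_ball[OF \<theta> comp has_fps_expansion_fps_X]) (use A0 \<phi>(3) in \<open>simp add: \<psi>_def p1_def\<close>)
  then have "P = fps_inv (psi_fps n d)"
    by (rule fps_inv_unique_right) (use P0 psi_fps_nth_1[of n d] in \<open>simp_all add: psi_fps_def\<close>)
  then have "P = Abs_fps (\<lambda>m. cusp_coeff n m d)" by (simp add: fps_eq_iff cusp_coeff_def)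
  then show "(\<lambda>q. \<phi> q / A) has_fps_expansion Abs_fps (\<lambda>m. cusp_coeff n m d)" using P by (simp add: p1_def)
qed

end

subsection \<open>Uniqueness of the covering map up to a rotation\<close>

lemma exp_q_surj:
  assumes K: "K > 0" and q: "q \<noteq> 0" "norm q < exp (- 2 * pi * M / K)"
  obtains \<tau> where "M < Im \<tau>" "q = exp (2 * of_real pi * \<i> / of_real K * \<tau>)"
    "norm q = exp (- (2 * pi / K) * Im \<tau>)"
proof -
  define \<kappa> where "\<kappa> = 2 * of_real pi * \<i> / complex_of_real K"
  have \<kappa>0: "\<kappa> \<noteq> 0" using K by (simp add: \<kappa>_def)
  define \<tau> where "\<tau> = Ln q / \<kappa>"
  have qe: "q = exp (\<kappa> * \<tau>)" using q(1) \<kappa>0 by (simp add: \<tau>_def)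
  have "\<kappa> = \<i> * of_real (2 * pi / K)" by (simp add: \<kappa>_def field_simps)
  then have "Re (\<kappa> * \<tau>) = - (2 * pi / K) * Im \<tau>" by simp
  then have n: "norm q = exp (- (2 * pi / K) * Im \<tau>)" unfolding qe norm_exp_eq_Re by simp
  have "- 2 * pi * M / K = - ((2 * pi / K) * M)" by simp
  then have "(2 * pi / K) * M < (2 * pi / K) * Im \<tau>"
    using q(2) unfolding n by (simp only: exp_less_cancel_iff mult_minus_left neg_less_iff_less)
  moreover have "0 < 2 * pi / K" using K by simp
  ultimately have "M < Im \<tau>" using mult_less_cancel_left_pos by blast
  with qe n show ?thesis by (intro that[of \<tau>]) (simp_all only: \<kappa>_def)
qed

text \<open>The left inverse \<open>Q\<close> makes \<open>\<phi>\<close> injective and hence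
  open.\<close>

lemma cusp_chart_image:
  assumes "plane_cover F Y" and ch: "plane_cover.cusp_chart F K M \<epsilon> Q \<phi>"
  obtains e where "e > 0" "e \<le> \<epsilon>" "ball 0 e \<subseteq> \<phi> ` ball 0 (exp (- 2 * pi * M / K))"
proof -
  interpret plane_cover F Y by fact
  define \<theta> where "\<theta> = exp (- 2 * pi * M / K)"
  have c: "\<phi> holomorphic_on ball 0 \<theta>" "\<phi> 0 = 0" "\<And>q. q \<in> ball 0 \<theta> \<Longrightarrow> Q (\<phi> q) = q" "\<epsilon> > 0"
    using ch unfolding cusp_chart_def \<theta>_def by blast+
  have "inj_on \<phi> (ball 0 \<theta>)" using c(3) by (metis inj_onI)
  then have "open (\<phi> ` ball 0 \<theta>)" by (rule open_mapping_thm3[OF c(1) open_ball])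
  moreover have "0 \<in> \<phi> ` ball 0 \<theta>" by (rule image_eqI[of _ _ 0]) (simp_all add: c(2) \<theta>_def)
  ultimately obtain e where e: "e > 0" "ball 0 e \<subseteq> \<phi> ` ball 0 \<theta>" using open_contains_ball by metis
  have "ball 0 (min e \<epsilon>) \<subseteq> \<phi> ` ball 0 \<theta>" using e(2) by (auto simp: subset_iff)
  then show ?thesis using that[of "min e \<epsilon>"] e(1) c(4) by (simp add: \<theta>_def)
qed

text \<open>A real Moebius map \<open>g\<close> with \<open>F1 \<circ> g = F2\<close> induces the
  transition \<open>H = Q1 \<circ> \<phi>2\<close> between the two coordinates q. It has to fix
  infinity, and comparing rates of decay matches its scaling with the two periods, so
  \<open>H\<close> is multiplication by a constant of modulus 1.\<close>

lemma cusp_chart_unique: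
  assumes p1: "plane_cover F1 Y" and p2: "plane_cover F2 Y"
    and ch1: "plane_cover.cusp_chart F1 K1 M1 \<epsilon>1 Q1 \<phi>1" and ch2: "plane_cover.cusp_chart F2 K2 M2 \<epsilon>2 Q2 \<phi>2"
  obtains u where "norm u = 1" "deriv \<phi>2 0 = u * deriv \<phi>1 0" "deriv (deriv \<phi>2) 0 = u\<^sup>2 * deriv (deriv \<phi>1) 0"
proof -
  interpret F1: plane_cover F1 Y by fact
  interpret F2: plane_cover F2 Y by fact
  define \<theta>1 where "\<theta>1 = exp (- 2 * pi * M1 / K1)"
  define \<theta>2 where "\<theta>2 = exp (- 2 * pi * M2 / K2)"
  define \<kappa>1 where "\<kappa>1 = 2 * of_real pi * \<i> / complex_of_real K1"
  define \<kappa>2 where "\<kappa>2 = 2 * of_real pi * \<i> / complex_of_real K2"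
  have c1: "K1 > 0" "M1 \<ge> 0" "Q1 holomorphic_on ball 0 \<epsilon>1" "\<phi>1 0 = 0"
    using ch1 by (auto simp: F1.cusp_chart_def)
  have c2: "K2 > 0" "M2 \<ge> 0" "\<phi>2 holomorphic_on ball 0 \<theta>2" "\<phi>2 0 = 0"
    using ch2 by (auto simp: F2.cusp_chart_def \<theta>2_def)
  obtain e where e: "e > 0" "e \<le> \<epsilon>1" "ball 0 e \<subseteq> \<phi>1 ` ball 0 \<theta>1"
    using cusp_chart_image[OF p1 ch1] unfolding \<theta>1_def by metis
  have "isCont \<phi>2 0" by (rule holomorphic_ball_isCont[OF c2(3)]) (simp add: \<theta>2_def)
  then have "\<exists>s>0. \<forall>q. norm q < s \<longrightarrow> norm (\<phi>2 q) < e"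
    using e(1) c2(4) unfolding continuous_at_eps_delta by (auto simp: dist_norm)
  then obtain s where s: "s > 0" "\<And>q. norm q < s \<Longrightarrow> norm (\<phi>2 q) < e" by blast
  \<comment> \<open>Above this height the second coordinate q has modulus below \<open>s\<close>, so
    \<open>\<phi>2\<close> takes values in \<open>ball 0 e\<close>, which is covered by the first
    chart.\<close>
  define M where "M = max M2 (- K2 * ln s / (2 * pi))"
  have Ms: "exp (- (2 * pi / K2) * y) < s" if "M < y" for y
  proof -
    have "- K2 * ln s / (2 * pi) < y" using that by (simp add: M_def)
    then have "- K2 * ln s < y * (2 * pi)" by (simp only: pos_divide_less_eq[OF mult_pos_pos[OF zero_less_numeral pi_gt_zero]])
    then have "- (y * (2 * pi)) / K2 < ln s" using c2(1) by (simp only: pos_divide_less_eq) (simp add: mult.commute)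
    then have "exp (- (2 * pi / K2) * y) < exp (ln s)" by (simp add: mult_ac)
    then show ?thesis using s(1) by simp
  qed
  define HM where "HM = {\<tau>. M < Im \<tau>}"
  have HM: "open HM" "connected HM" "HM \<subseteq> UH"
  proof -
    show "open HM" "connected HM"
      unfolding HM_def by (intro open_halfspace_Im_gt convex_connected convex_halfspace_Im_gt)+
    show "HM \<subseteq> UH" using c2(2) by (auto simp: HM_def UH_iff M_def)
  qed
  have q2: "exp (\<kappa>2 * \<tau>) \<in> ball 0 \<theta>2" "\<phi>2 (exp (\<kappa>2 * \<tau>)) = 1 / F2 \<tau>" "F2 \<tau> \<noteq> 0"
    "norm (exp (\<kappa>2 * \<tau>)) = exp (- (2 * pi / K2) * Im \<tau>)" "norm (exp (\<kappa>2 * \<tau>)) < s" if "\<tau> \<in> HM" for \<tau>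
  proof -
    have M2: "M2 < Im \<tau>" "M < Im \<tau>" using that by (auto simp: HM_def M_def)
    note r = F2.cusp_chart_rel[OF ch2 M2(1), folded \<kappa>2_def \<theta>2_def]
    show "exp (\<kappa>2 * \<tau>) \<in> ball 0 \<theta>2" "\<phi>2 (exp (\<kappa>2 * \<tau>)) = 1 / F2 \<tau>" "F2 \<tau> \<noteq> 0" by (rule r(1) r(3) r(2))+
    show n: "norm (exp (\<kappa>2 * \<tau>)) = exp (- (2 * pi / K2) * Im \<tau>)" by (rule r(6))
    show "norm (exp (\<kappa>2 * \<tau>)) < s" unfolding n by (rule Ms[OF M2(2)])
  qed
  define \<tau>0 where "\<tau>0 = Complex 0 (M + 1)"
  have \<tau>0: "\<tau>0 \<in> HM" by (simp add: \<tau>0_def HM_def)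
  define z0 where "z0 = 1 / F2 \<tau>0"
  have "z0 \<in> ball 0 e" using s(2)[OF q2(5)[OF \<tau>0]] q2(2)[OF \<tau>0] by (simp add: z0_def)
  then obtain q1 where q1: "q1 \<in> ball 0 \<theta>1" "z0 = \<phi>1 q1" using e(3) by blast
  have "z0 \<noteq> 0" using q2(3)[OF \<tau>0] by (simp add: z0_def)
  then have "q1 \<noteq> 0" using q1(2) c1(4) by auto
  moreover have "norm q1 < exp (- 2 * pi * M1 / K1)" using q1(1) by (simp add: \<theta>1_def)
  ultimately obtain \<tau>1 where \<tau>1: "M1 < Im \<tau>1" "q1 = exp (\<kappa>1 * \<tau>1)"
    using exp_q_surj[OF c1(1)] unfolding \<kappa>1_def by metis
  have \<tau>1U: "\<tau>1 \<in> UH" using \<tau>1(1) c1(2) by (simp add: UH_iff)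
  note r1 = F1.cusp_chart_rel[OF ch1, folded \<kappa>1_def \<theta>1_def]
  have "1 / F1 \<tau>1 = 1 / F2 \<tau>0" using r1(3)[OF \<tau>1(1)] \<tau>1(2) q1(2) by (simp add: z0_def)
  then have F12: "F2 \<tau>0 = F1 \<tau>1" by simp
  have \<tau>0U: "\<tau>0 \<in> UH" using \<tau>0 HM(3) by blast
  obtain a b c d where det: "a * d - b * c = 1" and g0: "real_moebius a b c d \<tau>0 = \<tau>1"
    and g: "\<And>\<tau>. \<tau> \<in> UH \<Longrightarrow> real_moebius a b c d \<tau> \<in> UH \<and> F1 (real_moebius a b c d \<tau>) = F2 \<tau>"
    using plane_covers_related[OF p1 p2 \<tau>0U \<tau>1U F12] by metis
  let ?g = "real_moebius a b c d"
  have holg: "?g holomorphic_on HM" using schwarzian_real_moebius(1)[OF det \<tau>0U] HM(3) holomorphic_on_subset by blast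
  define sb where "sb = min s \<theta>2"
  have sb: "sb > 0" using s(1) by (simp add: sb_def \<theta>2_def)
  define H where "H = (\<lambda>q. Q1 (\<phi>2 q))"
  have \<phi>2sb: "\<phi>2 holomorphic_on ball 0 sb" by (rule holomorphic_on_subset[OF c2(3)]) (simp add: sb_def subset_ball)
  have im: "\<phi>2 ` ball 0 sb \<subseteq> ball 0 \<epsilon>1" using s(2) e(2) by (force simp: sb_def)
  have holH: "H holomorphic_on ball 0 sb"
    using holomorphic_on_compose_gen[OF \<phi>2sb c1(3) im] by (simp add: H_def o_def)
  have qsb: "exp (\<kappa>2 * \<tau>) \<in> ball 0 sb" if "\<tau> \<in> HM" for \<tau> using q2(1,5)[OF that] by (simp add: sb_def)
  \<comment> \<open>Directly, the relation is available only where \<open>g \<tau>\<close> lies in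
    the first cusp region; this open set contains \<open>\<tau>0\<close>, and the relation continues
    to \<open>HM\<close>.\<close>
  have EH: "exp (\<kappa>1 * ?g \<tau>) = H (exp (\<kappa>2 * \<tau>))" if t: "\<tau> \<in> HM" for \<tau>
  proof (rule analytic_continuation_open[where s = "HM \<inter> ?g -` {\<tau>. M1 < Im \<tau>}" and s' = HM
        and f = "\<lambda>\<tau>. exp (\<kappa>1 * ?g \<tau>)" and g = "\<lambda>\<tau>. H (exp (\<kappa>2 * \<tau>))"])
    show "open (HM \<inter> ?g -` {\<tau>. M1 < Im \<tau>})"
      by (rule continuous_open_preimage[OF holomorphic_on_imp_continuous_on[OF holg] HM(1) open_halfspace_Im_gt])
    show "HM \<inter> ?g -` {\<tau>. M1 < Im \<tau>} \<noteq> {}" using \<tau>0 g0 \<tau>1(1) by auto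
    show "(\<lambda>\<tau>. exp (\<kappa>1 * ?g \<tau>)) holomorphic_on HM" by (intro holomorphic_intros holg)
    have "(H \<circ> (\<lambda>\<tau>. exp (\<kappa>2 * \<tau>))) holomorphic_on HM"
      by (rule holomorphic_on_compose_gen[OF _ holH]) (use qsb in \<open>auto intro!: holomorphic_intros\<close>)
    then show "(\<lambda>\<tau>. H (exp (\<kappa>2 * \<tau>))) holomorphic_on HM" by (simp add: o_def)
    fix z assume z: "z \<in> HM \<inter> ?g -` {\<tau>. M1 < Im \<tau>}"
    then have zH: "z \<in> HM" and zM: "M1 < Im (?g z)" by auto
    have "1 / F1 (?g z) = \<phi>2 (exp (\<kappa>2 * z))" using g[of z] q2(2)[OF zH] HM(3) zH by auto
    then show "exp (\<kappa>1 * ?g z) = H (exp (\<kappa>2 * z))" using r1(5)[OF zM] by (simp add: H_def)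
  qed (use HM t in auto)
  have norm1: "norm (exp (\<kappa>1 * \<sigma>)) = exp (- (2 * pi / K1) * Im \<sigma>)" for \<sigma>
  proof -
    have "\<kappa>1 = \<i> * of_real (2 * pi / K1)" by (simp add: \<kappa>1_def field_simps)
    then have "Re (\<kappa>1 * \<sigma>) = - (2 * pi / K1) * Im \<sigma>" by simp
    then show ?thesis unfolding norm_exp_eq_Re by simp
  qed
  define tj where "tj = (\<lambda>j::nat. Complex 0 (M + 1 + j))"
  have M0: "M \<ge> 0" using c2(2) by (simp add: M_def)
  have tj: "tj j \<in> HM" for j by (simp add: tj_def HM_def)
  define qj where "qj = (\<lambda>j. exp (\<kappa>2 * tj j))"
  have qj_lim: "qj \<longlonglongrightarrow> 0"
  proof (rule Lim_null_comparison)
    have "norm (qj j) = exp (- (2 * pi / K2) * (M + 1)) * exp (- (2 * pi / K2)) ^ j" for j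
    proof -
      have e: "- (2 * pi / K2) * (M + 1 + j) = - (2 * pi / K2) * (M + 1) + real j * (- (2 * pi / K2))"
        by (simp add: algebra_simps add_divide_distrib)
      show ?thesis unfolding qj_def q2(4)[OF tj] unfolding tj_def complex.sel e by (simp only: exp_add exp_of_nat_mult)
    qed
    then show "\<forall>\<^sub>F j in sequentially. norm (qj j) \<le> exp (- (2 * pi / K2) * (M + 1)) * exp (- (2 * pi / K2)) ^ j" by simp
    have "(\<lambda>j. exp (- (2 * pi / K2)) ^ j) \<longlonglongrightarrow> 0" using c2(1) by (intro LIMSEQ_power_zero) auto
    from tendsto_mult_right_zero[OF this] show "(\<lambda>j. exp (- (2 * pi / K2) * (M + 1)) * exp (- (2 * pi / K2)) ^ j) \<longlonglongrightarrow> 0" .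
  qed
  note d1 = F1.cusp_chart_derivs[OF ch1]
  note d2 = F2.cusp_chart_derivs[OF ch2]
  have H0: "H 0 = 0" using d1(3) c2(4) by (simp add: H_def)
  have "isCont H 0" by (rule holomorphic_ball_isCont[OF holH sb])
  then have "(\<lambda>j. H (qj j)) \<longlonglongrightarrow> H 0" using qj_lim by (rule isCont_tendsto_compose)
  then have Hj: "(\<lambda>j. norm (H (qj j))) \<longlonglongrightarrow> 0" using H0 by (simp add: tendsto_norm_zero)
  \<comment> \<open>Otherwise \<open>Im (?g (tj j))\<close> would stay below
    \<open>1 / c\<^sup>2\<close> and the first coordinate q away from 0, against
    \<open>H 0 = 0\<close>.\<close>
  have c0: "c = 0"
  proof (rule ccontr)
    assume c: "c \<noteq> 0"
    define m where "m = exp (- (2 * pi / K1) * (1 / c\<^sup>2))"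
    have "m \<le> norm (H (qj j))" for j
    proof -
      define y where "y = M + 1 + j"
      have y: "y \<ge> 1" using M0 by (simp add: y_def)
      have tjU: "tj j \<in> UH" using tj HM(3) by blast
      have "(norm (of_real c * tj j + of_real d))\<^sup>2 = d\<^sup>2 + (c * y)\<^sup>2"
        unfolding cmod_power2 by (simp add: tj_def y_def)
      then have "Im (?g (tj j)) = y / (d\<^sup>2 + (c * y)\<^sup>2)" using Im_real_moebius[OF det tjU] by (simp add: tj_def y_def)
      also have "\<dots> \<le> y / (c * y)\<^sup>2" using y c by (intro divide_left_mono) (auto simp: add_nonneg_pos)
      also have "\<dots> = 1 / c\<^sup>2 / y" using y by (simp add: power2_eq_square)
      also have "\<dots> \<le> 1 / c\<^sup>2 / 1" using y by (intro divide_left_mono) auto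
      finally have "(2 * pi / K1) * Im (?g (tj j)) \<le> (2 * pi / K1) * (1 / c\<^sup>2)" using c1(1) by (intro mult_left_mono) auto
      then have "m \<le> norm (exp (\<kappa>1 * ?g (tj j)))" unfolding norm1 m_def by simp
      then show ?thesis using EH[OF tj] by (simp add: qj_def)
    qed
    then have "m \<le> 0" by (intro LIMSEQ_le_const[OF Hj]) auto
    then show False by (simp add: m_def)
  qed
  then have ad: "a * d = 1" using det by simp
  then have dn: "d \<noteq> 0" by auto
  have gaff: "?g \<tau> = of_real (a\<^sup>2) * \<tau> + of_real (a * b)" for \<tau>
  proof -
    have "1 / d = a" using ad dn by (simp add: field_simps)
    then have "1 / complex_of_real d = of_real a" by (metis of_real_1 of_real_divide)
    then have "?g \<tau> = (of_real a * \<tau> + of_real b) * of_real a" using c0 by (simp add: real_moebius_def divide_inverse)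
    then show ?thesis by (simp add: power2_eq_square algebra_simps)
  qed
  have dH: "deriv H 0 = deriv Q1 0 * deriv \<phi>2 0"
    "deriv (deriv H) 0 = deriv (deriv Q1) 0 * (deriv \<phi>2 0)\<^sup>2 + deriv Q1 0 * deriv (deriv \<phi>2) 0"
    using deriv_compose_derivs(1,2)[OF open_ball _ open_ball \<phi>2sb im c1(3), of 0] sb c2(4) by (simp_all add: H_def)
  have h0: "deriv H 0 \<noteq> 0" using d1(1) d2(1) unfolding dH(1) by auto
  have "(H has_field_derivative deriv H 0) (at 0)" using holH sb by (intro holomorphic_derivI[of _ "ball 0 sb"]) auto
  then have "((\<lambda>q. (H q - H 0) / (q - 0)) \<longlongrightarrow> deriv H 0) (at 0)" by (simp add: has_field_derivative_iff)
  then have "((\<lambda>q. H q / q) \<longlongrightarrow> deriv H 0) (at 0)" using H0 by simp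
  moreover have "filterlim qj (at 0) sequentially"
    using qj_lim by (simp add: filterlim_at qj_def)
  ultimately have "(\<lambda>j. H (qj j) / qj j) \<longlonglongrightarrow> deriv H 0" by (rule filterlim_compose)
  then have lim: "(\<lambda>j. norm (H (qj j) / qj j)) \<longlonglongrightarrow> norm (deriv H 0)" by (rule tendsto_norm)
  \<comment> \<open>The rate of decay of \<open>H q / q\<close> along the imaginary axis. This
    quotient tends to \<open>deriv H 0\<close>, which is not 0, so the rate must be 0.\<close>
  define t where "t = 2 * pi * (a\<^sup>2 / K1 - 1 / K2)"
  have rat: "norm (H (qj j) / qj j) = exp (- t * (M + 1 + j))" for j
  proof -
    have "norm (H (qj j)) = exp (- (2 * pi / K1) * (a\<^sup>2 * (M + 1 + j)))"
      using EH[OF tj[of j]] norm1[of "?g (tj j)"] by (simp add: qj_def gaff tj_def)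
    moreover have "norm (qj j) = exp (- (2 * pi / K2) * (M + 1 + j))" using q2(4)[OF tj[of j]] by (simp add: qj_def tj_def)
    ultimately have "norm (H (qj j) / qj j) = exp (- (2 * pi / K1) * (a\<^sup>2 * (M + 1 + j)) - - (2 * pi / K2) * (M + 1 + j))"
      by (simp only: norm_divide exp_diff)
    also have "- (2 * pi / K1) * (a\<^sup>2 * (M + 1 + j)) - - (2 * pi / K2) * (M + 1 + j) = - t * (M + 1 + j)"
      unfolding t_def by (simp add: algebra_simps add_divide_distrib)
    finally show ?thesis .
  qed
  have "norm (H (qj (Suc j)) / qj (Suc j)) = exp (- t) * norm (H (qj j) / qj j)" for j
  proof -
    have e: "- t * (M + 1 + Suc j) = - t + - t * (M + 1 + j)" by (simp add: algebra_simps)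
    show ?thesis unfolding rat e exp_add ..
  qed
  moreover have "(\<lambda>j. norm (H (qj (Suc j)) / qj (Suc j))) \<longlonglongrightarrow> norm (deriv H 0)" by (rule LIMSEQ_Suc[OF lim])
  ultimately have "(\<lambda>j. exp (- t) * norm (H (qj j) / qj j)) \<longlonglongrightarrow> norm (deriv H 0)" by simp
  moreover have "(\<lambda>j. exp (- t) * norm (H (qj j) / qj j)) \<longlonglongrightarrow> exp (- t) * norm (deriv H 0)" by (rule tendsto_mult_left[OF lim])
  ultimately have "norm (deriv H 0) = exp (- t) * norm (deriv H 0)" by (rule LIMSEQ_unique)
  then have "t = 0" using h0 by simp
  then have aK: "a\<^sup>2 / K1 = 1 / K2" by (simp add: t_def)
  \<comment> \<open>The translation part \<open>a * b\<close> of \<open>g\<close> is real, so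
    \<open>u\<close> has modulus 1.\<close>
  define u where "u = exp (\<kappa>1 * of_real (a * b))"
  have nu: "norm u = 1" unfolding u_def norm1 by simp
  have Hq: "H (exp (\<kappa>2 * \<tau>)) = u * exp (\<kappa>2 * \<tau>)" if t: "\<tau> \<in> HM" for \<tau>
  proof -
    have "\<kappa>1 * of_real (a\<^sup>2) = 2 * of_real pi * \<i> * of_real (a\<^sup>2 / K1)" by (simp add: \<kappa>1_def)
    also have "\<dots> = \<kappa>2" unfolding aK by (simp add: \<kappa>2_def)
    finally have "\<kappa>1 * ?g \<tau> = \<kappa>2 * \<tau> + \<kappa>1 * of_real (a * b)" unfolding gaff by (simp add: distrib_left mult.assoc[symmetric])
    then show ?thesis using EH[OF t] by (simp add: u_def exp_add mult.commute)
  qed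
  define \<theta> where "\<theta> = exp (- 2 * pi * M / K2)"
  have \<theta>: "\<theta> > 0" by (simp add: \<theta>_def)
  have Hu: "H q = u * q" if q: "q \<in> ball 0 \<theta>" for q
  proof (cases "q = 0")
    case False
    have "norm q < exp (- 2 * pi * M / K2)" using q by (simp add: \<theta>_def)
    then obtain \<tau> where "M < Im \<tau>" "q = exp (\<kappa>2 * \<tau>)" using exp_q_surj[OF c2(1) False] unfolding \<kappa>2_def by metis
    then show ?thesis using Hq by (simp add: HM_def)
  qed (simp add: H0)
  have du: "deriv H q = u" if "q \<in> ball 0 \<theta>" for q
    using deriv_cong_open[OF open_ball that Hu] by (auto intro!: DERIV_imp_deriv derivative_eq_intros)
  have 0: "(0::complex) \<in> ball 0 \<theta>" using \<theta> by simp
  have ddu: "deriv (deriv H) 0 = 0" using deriv_cong_open[OF open_ball 0 du] by simp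
  have e1: "deriv Q1 0 * deriv \<phi>2 0 = u" using du[OF 0] dH(1) by simp
  have nz: "deriv Q1 0 \<noteq> 0" using d1(1) by auto
  have A: "deriv \<phi>2 0 = u * deriv \<phi>1 0"
  proof -
    have "deriv Q1 0 * deriv \<phi>2 0 = deriv Q1 0 * (u * deriv \<phi>1 0)" using e1 d1(1) by (simp add: mult_ac)
    then show ?thesis using nz by simp
  qed
  have "deriv Q1 0 * deriv (deriv \<phi>2) 0 = - (deriv (deriv Q1) 0 * (deriv \<phi>2 0)\<^sup>2)"
    using ddu unfolding dH(2) by (simp add: eq_neg_iff_add_eq_0 add.commute)
  also have "\<dots> = u\<^sup>2 * - (deriv (deriv Q1) 0 * (deriv \<phi>1 0)\<^sup>2)" unfolding A by (simp add: power_mult_distrib mult_ac)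
  also have "- (deriv (deriv Q1) 0 * (deriv \<phi>1 0)\<^sup>2) = deriv Q1 0 * deriv (deriv \<phi>1) 0"
    using d1(2) by (simp add: neg_eq_iff_add_eq_0)
  finally have "deriv Q1 0 * deriv (deriv \<phi>2) 0 = deriv Q1 0 * (u\<^sup>2 * deriv (deriv \<phi>1) 0)" by (simp add: mult_ac)
  then have "deriv (deriv \<phi>2) 0 = u\<^sup>2 * deriv (deriv \<phi>1) 0" using nz by simp
  with nu A show ?thesis by (rule that)
qed

subsection \<open>The power series and the metric\<close>

context plane_cover
begin

text \<open>The expansion is claimed wherever \<open>f\<close> has no pole at or above the height of
  \<tau>, not just deep in the cusp. The functions \<open>\<phi>\<close> and \<open>1 / Fq\<close>
  are glued to one that is holomorphic on a neighbourhood of the closed disc of radius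
  \<open>norm q\<close>, hence equal to its Taylor series at q.\<close>

lemma cusp_series:
  fixes c :: "nat \<Rightarrow> complex"
  assumes ch: "cusp_chart K M \<epsilon> Q \<phi>" and A: "A \<noteq> 0"
    and fps: "(\<lambda>q. \<phi> q / A) has_fps_expansion Abs_fps c" and c: "c 0 = 0" "c 1 = 1"
    and t: "Im \<tau> > 0" and nz: "\<And>\<sigma>. Im \<sigma> \<ge> Im \<tau> \<Longrightarrow> F \<sigma> \<noteq> 0"
    and q: "q = exp (2 * of_real pi * \<i> / of_real K * \<tau>)"
  shows "summable (\<lambda>m. c (m + 4) * q ^ (m + 4))"
    "1 / F \<tau> = A * (q + c 2 * q\<^sup>2 + c 3 * q ^ 3 + (\<Sum>m. c (m + 4) * q ^ (m + 4)))"
proof -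
  define \<theta> where "\<theta> = exp (- 2 * pi * M / K)"
  define \<kappa> where "\<kappa> = 2 * of_real pi * \<i> / complex_of_real K"
  have K: "K > 0" and M: "M \<ge> 0" and \<phi>: "\<phi> holomorphic_on ball 0 \<theta>"
    and per: "\<And>\<tau>. \<tau> \<in> UH \<Longrightarrow> F (\<tau> + of_real K) = F \<tau>"
    using ch unfolding cusp_chart_def \<theta>_def by blast+
  obtain Fq where Fq: "Fq holomorphic_on ball 0 1 - {0}"
    "\<And>\<tau>. \<tau> \<in> UH \<Longrightarrow> Fq (exp (\<kappa> * \<tau>)) = F \<tau>"
    using periodic_q_expansion[OF K per] unfolding \<kappa>_def by blast
  have nq: "norm (exp (\<kappa> * \<sigma>)) = exp (- (2 * pi / K) * Im \<sigma>)" for \<sigma>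
  proof -
    have "\<kappa> = \<i> * of_real (2 * pi / K)" by (simp add: \<kappa>_def field_simps)
    then have "Re (\<kappa> * \<sigma>) = - (2 * pi / K) * Im \<sigma>" by simp
    then show ?thesis unfolding norm_exp_eq_Re by simp
  qed
  have pK: "0 < 2 * pi / K" using K by simp
  define O2 where "O2 = {z \<in> ball 0 1 - {0}. Fq z \<noteq> 0}"
  have "O2 = (ball 0 1 - {0}) \<inter> Fq -` (- {0})" by (auto simp: O2_def)
  then have opO2: "open O2"
    using continuous_open_preimage[OF holomorphic_on_imp_continuous_on[OF Fq(1)], of "- {0}"]
    by (simp add: open_delete open_Compl)
  \<comment> \<open>Near the centre \<open>\<phi>\<close> is used, farther out
    \<open>1 / Fq\<close>; on the overlap both are \<open>1 / F\<close>.\<close>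
  define \<psi> where "\<psi> = (\<lambda>z. if z \<in> ball 0 \<theta> then \<phi> z else 1 / Fq z)"
  have over: "\<psi> z = 1 / Fq z" if z: "z \<in> O2" for z
  proof (cases "z \<in> ball 0 \<theta>")
    case True
    have "z \<noteq> 0" using z by (simp add: O2_def)
    moreover have "norm z < exp (- 2 * pi * M / K)" using True by (simp add: \<theta>_def)
    ultimately obtain \<sigma> where s: "M < Im \<sigma>" "z = exp (\<kappa> * \<sigma>)" using exp_q_surj[OF K] unfolding \<kappa>_def by metis
    have "\<sigma> \<in> UH" using s(1) M by (simp add: UH_iff)
    then show ?thesis using True cusp_chart_rel(3)[OF ch s(1)] Fq(2) s(2) by (simp add: \<psi>_def \<kappa>_def)
  qed (simp add: \<psi>_def)
  have "\<psi> holomorphic_on ball 0 \<theta>" by (rule holomorphic_transform[OF \<phi>]) (simp add: \<psi>_def)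
  moreover have "\<psi> holomorphic_on O2"
  proof (rule holomorphic_transform[of "\<lambda>z. 1 / Fq z"])
    show "(\<lambda>z. 1 / Fq z) holomorphic_on O2"
      by (intro holomorphic_intros holomorphic_on_subset[OF Fq(1)]) (auto simp: O2_def)
  qed (use over in simp)
  ultimately have hol\<psi>: "\<psi> holomorphic_on (ball 0 \<theta> \<union> O2)" using opO2 by (intro holomorphic_on_Un) auto
  have q\<kappa>: "q = exp (\<kappa> * \<tau>)" by (simp add: q \<kappa>_def)
  have q0: "q \<noteq> 0" by (simp add: q)
  \<comment> \<open>A nonzero point of modulus at most \<open>norm q\<close> comes from some
    \<sigma> with \<open>Im \<sigma> \<ge> Im \<tau>\<close>, where \<open>F\<close> has no
    zero.\<close>
  have inO2: "z \<in> O2" if z: "z \<noteq> 0" "norm z \<le> norm q" for z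
  proof -
    have "- (2 * pi / K) * Im \<tau> < 0" using mult_pos_pos[OF pK t] by simp
    then have q1: "norm q < 1" unfolding q\<kappa> nq by simp
    then have "norm z < exp (- 2 * pi * 0 / K)" using z(2) by simp
    then obtain \<sigma> where s: "0 < Im \<sigma>" "z = exp (\<kappa> * \<sigma>)" using exp_q_surj[OF K z(1)] unfolding \<kappa>_def by metis
    have "(2 * pi / K) * Im \<tau> \<le> (2 * pi / K) * Im \<sigma>" using z(2) unfolding s(2) q\<kappa> nq by (simp only: exp_le_cancel_iff mult_minus_left neg_le_iff_le)
    then have "Im \<tau> \<le> Im \<sigma>" using mult_le_cancel_left_pos[OF pK] by blast
    then have "F \<sigma> \<noteq> 0" by (rule nz)
    then have "Fq z \<noteq> 0" using Fq(2)[of \<sigma>] s by (simp add: UH_iff)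
    then show ?thesis using z q1 by (simp add: O2_def)
  qed
  have sub: "cball 0 (norm q) \<subseteq> ball 0 \<theta> \<union> O2"
  proof
    fix z :: complex assume "z \<in> cball 0 (norm q)"
    then show "z \<in> ball 0 \<theta> \<union> O2" using inO2[of z] by (cases "z = 0") (auto simp: \<theta>_def)
  qed
  have op: "open (ball 0 \<theta> \<union> O2)" using opO2 by (intro open_Un open_ball)
  obtain e where e: "e > 0" "(\<Union>x\<in>cball 0 (norm q). ball x e) \<subseteq> ball 0 \<theta> \<union> O2"
    by (rule compact_subset_open_imp_ball_epsilon_subset[OF compact_cball op sub])
  obtain r where r: "r > norm q" "ball 0 r \<subseteq> ball 0 \<theta> \<union> O2"
  proof -
    have "ball (0::complex) (norm q + e) \<subseteq> (\<Union>x\<in>cball 0 (norm q). ball x e)"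
    proof
      fix z :: complex assume z: "z \<in> ball 0 (norm q + e)"
      show "z \<in> (\<Union>x\<in>cball 0 (norm q). ball x e)"
      proof (cases "norm z \<le> norm q")
        case True
        then show ?thesis using e(1) by (intro UN_I[of z]) auto
      next
        case False
        \<comment> \<open>The radial projection of \<open>z\<close> to the circle of radius
          \<open>norm q\<close>.\<close>
        define x where "x = of_real (norm q / norm z) * z"
        have zn: "norm z > 0" using False by (smt (verit) norm_ge_zero)
        have nx: "norm x = norm q" unfolding x_def norm_mult norm_of_real using zn by simp
        have "x - z = of_real (norm q / norm z - 1) * z" by (simp add: x_def algebra_simps)
        then have "norm (x - z) = \<bar>norm q / norm z - 1\<bar> * norm z" by (simp only: norm_mult norm_of_real)
        also have "\<dots> = norm z - norm q" using False zn by (simp add: abs_if divide_less_eq field_simps)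
        finally have "dist x z < e" using z by (simp add: dist_norm)
        then show ?thesis using nx by (intro UN_I[of x]) auto
      qed
    qed
    then have "ball 0 (norm q + e) \<subseteq> ball 0 \<theta> \<union> O2" using e(2) by (rule subset_trans)
    with e(1) show ?thesis by (intro that[of "norm q + e"]) simp_all
  qed
  have hr: "\<psi> holomorphic_on ball 0 r" by (rule holomorphic_on_subset[OF hol\<psi> r(2)])
  have r0: "r > 0" using r(1) norm_ge_zero[of q] by linarith
  have \<theta>0: "\<theta> > 0" by (simp add: \<theta>_def)
  have "eventually (\<lambda>z. z \<in> ball 0 \<theta>) (nhds (0::complex))" using \<theta>0 by (intro eventually_nhds_in_open) auto
  then have "eventually (\<lambda>z. \<phi> z / A = \<psi> z / A) (nhds 0)" by eventually_elim (simp add: \<psi>_def)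
  then have "eventually (\<lambda>z. eval_fps (Abs_fps c) z = \<psi> z / A) (nhds 0)"
    using fps unfolding has_fps_expansion_def by (auto elim: eventually_elim2)
  then have fps\<psi>: "(\<lambda>z. \<psi> z / A) has_fps_expansion Abs_fps c"
    using fps unfolding has_fps_expansion_def by simp
  have "(\<lambda>z. \<psi> z / A) holomorphic_on ball 0 r" using A by (intro holomorphic_intros hr) auto
  from holomorphic_fps_sums[OF this fps\<psi> r(1)]
  have s: "(\<lambda>m. c m * q ^ m) sums (\<psi> q / A)" by simp
  have sm: "summable (\<lambda>m. c m * q ^ m)" by (rule sums_summable[OF s])
  then show "summable (\<lambda>m. c (m + 4) * q ^ (m + 4))" using summable_ignore_initial_segment[of "\<lambda>m. c m * q ^ m" 4] by simp
  have "q \<in> O2" using inO2[OF q0] by simp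
  then have "\<psi> q = 1 / F \<tau>" using over Fq(2)[of \<tau>] t q\<kappa> by (simp add: UH_iff)
  then have "1 / F \<tau> / A = (\<Sum>m. c m * q ^ m)" using sums_unique[OF s] by simp
  also have "\<dots> = (\<Sum>m. c (m + 4) * q ^ (m + 4)) + (\<Sum>m<4. c m * q ^ m)" by (rule suminf_split_initial_segment[OF sm])
  also have "(\<Sum>m<4. c m * q ^ m) = q + c 2 * q\<^sup>2 + c 3 * q ^ 3"
    using c by (simp add: numeral_eq_Suc)
  finally have *: "1 / F \<tau> / A = (\<Sum>m. c (m + 4) * q ^ (m + 4)) + (q + c 2 * q\<^sup>2 + c 3 * q ^ 3)" .
  have "1 / F \<tau> = A * (1 / F \<tau> / A)" using A by simp
  then have "1 / F \<tau> = A * ((\<Sum>m. c (m + 4) * q ^ (m + 4)) + (q + c 2 * q\<^sup>2 + c 3 * q ^ 3))"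
    unfolding * .
  then show "1 / F \<tau> = A * (q + c 2 * q\<^sup>2 + c 3 * q ^ 3 + (\<Sum>m. c (m + 4) * q ^ (m + 4)))"
    by (simp only: add.commute)
qed

text \<open>By \<open>deck_isometry\<close> the condition defining \<open>ke_density\<close> does
  not depend on the preimage, so the description has a unique solution. It is then computed by the
  chain rule through q; the factor \<open>2 * pi / K\<close> in \<open>ln (norm q)\<close> cancels
  the one in the derivative of q.\<close>

lemma ke_density_cusp:
  assumes f: "\<And>\<tau>. \<tau> \<in> UH \<Longrightarrow> f \<tau> = chart_inf (F \<tau>)" and ch: "cusp_chart K M \<epsilon> Q \<phi>"
    and q: "q \<in> ball 0 (exp (- 2 * pi * M / K))" "q \<noteq> 0"
  shows "ke_density f (\<phi> q) = norm (deriv Q (\<phi> q)) / (norm q * \<bar>ln (norm q)\<bar>)"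
proof -
  define \<theta> where "\<theta> = exp (- 2 * pi * M / K)"
  define \<kappa> where "\<kappa> = 2 * of_real pi * \<i> / complex_of_real K"
  have K: "K > 0" and M: "M \<ge> 0" and \<phi>: "\<phi> holomorphic_on ball 0 \<theta>"
    and Q: "Q holomorphic_on ball 0 \<epsilon>" and Q\<phi>: "\<And>q. q \<in> ball 0 \<theta> \<Longrightarrow> \<phi> q \<in> ball 0 \<epsilon> \<and> Q (\<phi> q) = q"
    using ch unfolding cusp_chart_def \<theta>_def by blast+
  have q\<theta>: "q \<in> ball 0 \<theta>" using q(1) by (simp add: \<theta>_def)
  define z where "z = \<phi> q"
  have "norm q < exp (- 2 * pi * M / K)" using q(1) by simp
  then obtain \<tau> where t: "M < Im \<tau>" "q = exp (\<kappa> * \<tau>)" and nq: "norm q = exp (- (2 * pi / K) * Im \<tau>)"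
    using exp_q_surj[OF K q(2)] unfolding \<kappa>_def by metis
  have tU: "\<tau> \<in> UH" using t(1) M by (simp add: UH_iff)
  note rel = cusp_chart_rel[OF ch, folded \<kappa>_def \<theta>_def]
  have Ft: "F \<tau> \<noteq> 0" and zF: "z = 1 / F \<tau>" using rel(2,3)[OF t(1)] t(2) by (simp_all add: z_def)
  have fz: "f \<sigma> = Fin_pt z \<longleftrightarrow> F \<sigma> = F \<tau>" if "\<sigma> \<in> UH" for \<sigma>
    using f[OF that] Ft zF by (auto simp: chart_inf_def)
  have D: "norm (deriv (\<lambda>\<sigma>. affine_coord (f \<sigma>)) \<sigma>) = norm (deriv F \<sigma>) / (norm (F \<sigma>))\<^sup>2"
    if s: "\<sigma> \<in> UH" "F \<sigma> \<noteq> 0" for \<sigma>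
  proof -
    have "affine_coord (f \<sigma>) = 1 / F \<sigma>" if "\<sigma> \<in> UH" for \<sigma> using f[OF that] by (simp add: chart_inf_def)
    then have 1: "deriv (\<lambda>\<sigma>. affine_coord (f \<sigma>)) \<sigma> = deriv (\<lambda>\<sigma>. 1 / F \<sigma>) \<sigma>" by (rule deriv_cong_open[OF open_UH s(1)])
    define V where "V = UH \<inter> F -` (- {0})"
    have V: "open V" "V \<subseteq> UH" "\<sigma> \<in> V"
      using continuous_open_preimage[OF holomorphic_on_imp_continuous_on[OF hol] open_UH, of "- {0}"] s
      by (auto simp: V_def open_Compl)
    have "deriv (\<lambda>\<sigma>. 1 / F \<sigma>) \<sigma> = - deriv F \<sigma> / (F \<sigma>)\<^sup>2" by (rule recip_F(2)[OF V(1,2) _ V(3)]) (simp add: V_def)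
    then show ?thesis unfolding 1 by (simp add: norm_divide norm_power)
  qed
  have It: "Im \<tau> > 0" using tU by (simp add: UH_iff)
  have dFt: "norm (deriv F \<tau>) > 0" using deriv_nz[OF tU] by simp
  \<comment> \<open>The condition at \<tau> solved for the density, using that \<open>1 / F\<close>
    has derivative \<open>- F' / F\<^sup>2\<close>.\<close>
  define l where "l = (norm (F \<tau>))\<^sup>2 / (Im \<tau> * norm (deriv F \<tau>))"
  have "ke_density f z = l"
    unfolding ke_density_def
  proof (rule the_equality)
    show "\<forall>\<sigma>\<in>UH. f \<sigma> = Fin_pt z \<longrightarrow> l * norm (deriv (\<lambda>\<sigma>. affine_coord (f \<sigma>)) \<sigma>) = 1 / Im \<sigma>"
    proof (intro ballI impI)
      fix \<sigma> assume s: "\<sigma> \<in> UH" "f \<sigma> = Fin_pt z"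
      have Fs: "F \<sigma> = F \<tau>" using fz[OF s(1)] s(2) by blast
      have I: "Im \<sigma> * norm (deriv F \<sigma>) = Im \<tau> * norm (deriv F \<tau>)" by (rule deck_isometry[OF s(1) tU Fs])
      have pos: "Im \<sigma> > 0" "norm (deriv F \<sigma>) > 0" "norm (F \<tau>) > 0" using s(1) deriv_nz[OF s(1)] Ft by (auto simp: UH_iff)
      have "norm (deriv (\<lambda>\<sigma>. affine_coord (f \<sigma>)) \<sigma>) = norm (deriv F \<sigma>) / (norm (F \<tau>))\<^sup>2" using D[OF s(1)] Fs Ft by simp
      moreover have "l = (norm (F \<tau>))\<^sup>2 / (Im \<sigma> * norm (deriv F \<sigma>))" by (simp add: l_def I)
      ultimately show "l * norm (deriv (\<lambda>\<sigma>. affine_coord (f \<sigma>)) \<sigma>) = 1 / Im \<sigma>" using pos by simp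
    qed
    fix l' assume "\<forall>\<sigma>\<in>UH. f \<sigma> = Fin_pt z \<longrightarrow> l' * norm (deriv (\<lambda>\<sigma>. affine_coord (f \<sigma>)) \<sigma>) = 1 / Im \<sigma>"
    then have "l' * norm (deriv (\<lambda>\<sigma>. affine_coord (f \<sigma>)) \<tau>) = 1 / Im \<tau>" using tU fz[OF tU] by blast
    then have "l' * (norm (deriv F \<tau>) / (norm (F \<tau>))\<^sup>2) = 1 / Im \<tau>" using D[OF tU Ft] by simp
    then show "l' = l" using It dFt Ft by (simp add: l_def field_simps)
  qed
  moreover have "l = norm (deriv Q z) / (norm q * \<bar>ln (norm q)\<bar>)"
  proof -
    define HM where "HM = {\<tau>. M < Im \<tau>}"
    have HM: "open HM" "\<tau> \<in> HM" "HM \<subseteq> UH" using t(1) M by (auto simp: HM_def open_halfspace_Im_gt UH_iff)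
    define E where "E = (\<lambda>\<sigma>. exp (\<kappa> * \<sigma>))"
    have hE: "E holomorphic_on HM" unfolding E_def by (intro holomorphic_intros)
    have imE: "E ` HM \<subseteq> ball 0 \<theta>" using rel(1) by (auto simp: E_def HM_def)
    have "1 / F \<sigma> = \<phi> (E \<sigma>)" if "\<sigma> \<in> HM" for \<sigma> using rel(3)[of \<sigma>] that by (simp add: HM_def E_def)
    then have "deriv (\<lambda>\<sigma>. 1 / F \<sigma>) \<tau> = deriv (\<lambda>\<sigma>. \<phi> (E \<sigma>)) \<tau>" by (rule deriv_cong_open[OF HM(1,2)])
    also have "\<dots> = deriv \<phi> (E \<tau>) * deriv E \<tau>" by (rule deriv_compose_derivs(1)[OF HM(1,2) open_ball hE imE \<phi>])
    also have "deriv E \<tau> = \<kappa> * q"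
      unfolding E_def t(2) by (auto intro!: DERIV_imp_deriv derivative_eq_intros)
    finally have d1: "deriv (\<lambda>\<sigma>. 1 / F \<sigma>) \<tau> = deriv \<phi> q * (\<kappa> * q)" by (simp add: E_def t(2))
    have nzHM: "F \<sigma> \<noteq> 0" if "\<sigma> \<in> HM" for \<sigma> using rel(2)[of \<sigma>] that by (simp add: HM_def)
    have "deriv (\<lambda>\<sigma>. 1 / F \<sigma>) \<tau> = - deriv F \<tau> / (F \<tau>)\<^sup>2" by (rule recip_F(2)[OF HM(1,3) nzHM HM(2)])
    then have d2: "norm (deriv F \<tau>) / (norm (F \<tau>))\<^sup>2 = norm (deriv \<phi> q) * (norm \<kappa> * norm q)"
      using arg_cong[OF d1, of norm] by (simp add: norm_divide norm_power norm_mult)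
    have im\<phi>: "\<phi> ` ball 0 \<theta> \<subseteq> ball 0 \<epsilon>" using Q\<phi> by blast
    have "deriv (\<lambda>q. Q (\<phi> q)) q = deriv (\<lambda>q. q) q" by (rule deriv_cong_open[OF open_ball q\<theta>]) (use Q\<phi> in blast)
    then have "deriv Q z * deriv \<phi> q = 1"
      using deriv_compose_derivs(1)[OF open_ball q\<theta> open_ball \<phi> im\<phi> Q] by (simp add: z_def)
    then have d3: "norm (deriv Q z) * norm (deriv \<phi> q) = 1" by (metis norm_mult norm_one)
    have n\<kappa>: "norm \<kappa> = 2 * pi / K" using K by (simp add: \<kappa>_def norm_divide norm_mult)
    have "ln (norm q) = - (2 * pi / K) * Im \<tau>" unfolding nq by simp
    moreover have "0 < (2 * pi / K) * Im \<tau>" using K It by simp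
    ultimately have lnq: "\<bar>ln (norm q)\<bar> = norm \<kappa> * Im \<tau>" unfolding n\<kappa> by (simp only: mult_minus_left abs_minus_cancel abs_of_pos)
    have pos: "norm \<kappa> > 0" "norm q > 0" "norm (deriv \<phi> q) > 0" using n\<kappa> K q(2) d3 by auto
    have "l = 1 / (Im \<tau> * (norm (deriv F \<tau>) / (norm (F \<tau>))\<^sup>2))" by (simp add: l_def)
    also have "\<dots> = 1 / (Im \<tau> * (norm (deriv \<phi> q) * (norm \<kappa> * norm q)))" unfolding d2 ..
    also have "\<dots> = (norm (deriv Q z) * norm (deriv \<phi> q)) / (Im \<tau> * (norm (deriv \<phi> q) * (norm \<kappa> * norm q)))" unfolding d3 ..
    also have "\<dots> = norm (deriv Q z) / (norm q * (norm \<kappa> * Im \<tau>))" using pos It by (simp add: field_simps)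
    finally show ?thesis unfolding lnq .
  qed
  ultimately show ?thesis by (simp add: z_def)
qed

end

section \<open>Assembling the statement for the punctured sphere\<close>

lemma cover_data:
  assumes a: "a (1::nat) = Fin_pt 0" "inj_on a {1..n}" and n: "1 \<le> n"
    and f: "universal_covering_map f (UNIV - a ` {1..n})" "vanishes_at_infinity f"
  defines "X \<equiv> \<lambda>j. recip_coord (a j)" and "F \<equiv> \<lambda>\<tau>. recip_coord (f \<tau>)"
  shows "plane_cover F (- (X ` {2..n}))" "\<And>\<tau>. \<tau> \<in> UH \<Longrightarrow> f \<tau> = chart_inf (F \<tau>)"
    "\<And>R. \<exists>M\<ge>0. \<forall>\<tau>. M < Im \<tau> \<longrightarrow> R < norm (F \<tau>)"
    "\<exists>K M \<epsilon> Q \<phi>. plane_cover.cusp_chart F K M \<epsilon> Q \<phi>"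
proof -
  have split: "{1..n} = insert 1 {2..n}" using n by auto
  have ne: "a j \<noteq> Fin_pt 0" if "j \<in> {2..n}" for j
    using inj_onD[OF a(2), of j 1] that n a(1) by auto
  have "Fin_pt 0 \<in> a ` {1..n}" using a(1) n by (metis atLeastAtMost_iff imageI order_refl)
  note ucp = universal_cover_plane[OF f(1) this, folded F_def]
  have "a ` {1..n} - {Fin_pt 0} = a ` {2..n}" unfolding split using a(1) ne by auto
  then have im: "recip_coord ` (a ` {1..n} - {Fin_pt 0}) = X ` {2..n}" by (simp add: image_image X_def)
  show pc: "plane_cover F (- (X ` {2..n}))" using ucp(1) unfolding im .
  show fF: "f \<tau> = chart_inf (F \<tau>)" if "\<tau> \<in> UH" for \<tau>
    using ucp(2)[OF that] by (simp add: F_def)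
  have "f \<tau> \<noteq> Fin_pt 0" if "\<tau> \<in> UH" for \<tau> using fF[OF that] chart_inf_nz by simp
  from vanishes_at_infinity_recip[OF f(2) this]
  show inf: "\<exists>M\<ge>0. \<forall>\<tau>. M < Im \<tau> \<longrightarrow> R < norm (F \<tau>)" for R by (simp add: F_def)
  have "bounded (X ` {2..n})" by (intro finite_imp_bounded) simp
  then obtain R where R: "\<And>x. x \<in> X ` {2..n} \<Longrightarrow> norm x \<le> R" unfolding bounded_iff by blast
  have "v \<in> - (X ` {2..n})" if "\<bar>R\<bar> + 1 < norm v" for v using R[of v] that by auto
  then show "\<exists>K M \<epsilon> Q \<phi>. plane_cover.cusp_chart F K M \<epsilon> Q \<phi>"
    by (intro plane_cover.cusp_chart_exists[OF pc inf, of "\<bar>R\<bar> + 1"]) auto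
qed

lemma recip_coord_inj:
  assumes "inj_on a J" "\<And>j. j \<in> J \<Longrightarrow> a j \<noteq> Fin_pt 0"
  shows "inj_on (\<lambda>j. recip_coord (a j)) J"
proof (rule inj_onI)
  fix i j assume ij: "i \<in> J" "j \<in> J" and "recip_coord (a i) = recip_coord (a j)"
  then have "chart_inf (recip_coord (a i)) = chart_inf (recip_coord (a j))" by simp
  then have "a i = a j" using chart_inf_recip assms(2) ij by simp
  then show "i = j" using inj_onD[OF assms(1)] ij by blast
qed

text \<open>On the disc the bounds decrease at least by the factor 1/2, so the tail is at most twice
  the bound of its first term; this gives the constant 8 = 2 * 4.\<close>

lemma metric_tail_bigo:
  fixes R :: "nat \<Rightarrow> complex \<Rightarrow> complex"
  assumes \<delta>: "0 < \<delta>" and A: "A \<noteq> 0"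
    and bound: "\<And>w m. 0 < norm w \<Longrightarrow> norm w < \<delta> \<Longrightarrow> norm (R m w) \<le> 4 * (norm w / (2 * \<delta>)) ^ m"
  shows "(\<lambda>z. \<Sum>m. R (m + N) (z / A)) \<in> O[at 0](\<lambda>z. z ^ N)"
proof (rule bigoI[of _ "8 / (2 * \<delta> * norm A) ^ N"])
  show "\<forall>\<^sub>F z in at 0. norm (\<Sum>m. R (m + N) (z / A)) \<le> 8 / (2 * \<delta> * norm A) ^ N * norm (z ^ N)"
    unfolding eventually_at
  proof (intro exI[of _ "\<delta> * norm A"] conjI ballI impI)
    show "0 < \<delta> * norm A" using \<delta> A by simp
    fix z :: complex assume z: "z \<noteq> 0 \<and> dist z 0 < \<delta> * norm A"
    define x where "x = norm (z / A) / (2 * \<delta>)"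
    have w: "0 < norm (z / A)" "norm (z / A) < \<delta>" using z A by (simp_all add: norm_divide divide_less_eq)
    have x: "0 \<le> x" "x < 1 / 2" using w \<delta> by (simp_all add: x_def divide_less_eq)
    have "norm (R (m + N) (z / A)) \<le> 4 * x ^ N * x ^ m" for m
      using bound[OF w, of "m + N"] by (simp add: x_def power_add mult_ac)
    moreover have s: "(\<lambda>m. 4 * x ^ N * x ^ m) sums (4 * x ^ N * (1 / (1 - x)))"
      using x by (intro sums_mult geometric_sums) auto
    ultimately have "norm (\<Sum>m. R (m + N) (z / A)) \<le> (\<Sum>m. 4 * x ^ N * x ^ m)"
      by (intro norm_suminf_le sums_summable[OF s])
    also have "\<dots> = 4 * x ^ N * (1 / (1 - x))" using sums_unique[OF s] by simp
    also have "\<dots> \<le> 4 * x ^ N * 2" using x by (intro mult_left_mono) (simp_all add: divide_le_eq)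
    also have "\<dots> = 8 / (2 * \<delta> * norm A) ^ N * norm (z ^ N)"
      using A by (simp add: x_def norm_divide norm_power power_divide power_mult_distrib)
    finally show "norm (\<Sum>m. R (m + N) (z / A)) \<le> 8 / (2 * \<delta> * norm A) ^ N * norm (z ^ N)" .
  qed
qed

text \<open>All expansions for one covering and one cusp chart; the comparison of different
  coverings is left to the theorem.\<close>

lemma expansions_at_cusp:
  fixes \<alpha> \<beta> :: "nat \<Rightarrow> complex"
  assumes a: "a (1::nat) = Fin_pt 0" "inj_on a {1..n}" and n: "1 \<le> n"
    and f: "universal_covering_map f (UNIV - a ` {1..n})" "vanishes_at_infinity f"
    and uc: "\<And>j. j \<in> {2..n} \<Longrightarrow> a j \<noteq> Inf_pt \<Longrightarrow> uniformizing_coeffs f (affine_coord (a j)) (\<alpha> j) (\<beta> j)"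
    and ch: "plane_cover.cusp_chart (\<lambda>\<tau>. recip_coord (f \<tau>)) K M \<epsilon> Q \<phi>"
    and A: "A = deriv \<phi> 0" and B: "B = deriv (deriv \<phi>) 0 / 2"
    and d: "d = (A, B / A, \<lambda>j. recip_coord (a j), \<lambda>j. if a j = Inf_pt then 0 else \<beta> j / \<alpha> j)"
  shows "K > 0"
    "\<And>\<tau> q. Im \<tau> > 0 \<Longrightarrow> (\<forall>\<sigma>. Im \<sigma> \<ge> Im \<tau> \<longrightarrow> f \<sigma> \<noteq> Inf_pt) \<Longrightarrow>
        q = exp (2 * of_real pi * \<i> / of_real K * \<tau>) \<Longrightarrow>
        summable (\<lambda>m. cusp_coeff n (m + 4) d * q ^ (m + 4)) \<and>
        f \<tau> = Fin_pt (A * (q + B / A * q\<^sup>2 + cusp_coeff n 3 d * q ^ 3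
                        + (\<Sum>m. cusp_coeff n (m + 4) d * q ^ (m + 4))))"
    "cusp_coeff n 3 d = 1 / 16 * (19 * (B\<^sup>2 / A\<^sup>2)
       - A\<^sup>2 * (\<Sum>j | j \<in> {2..n} \<and> a j \<noteq> Inf_pt.
           1 / (affine_coord (a j))\<^sup>2 - 1 / affine_coord (a j) * (2 * \<beta> j / \<alpha> j)))"
    "\<exists>\<delta>>0. \<forall>z w. 0 < norm z \<and> norm z < \<delta> \<and> w = z / A \<longrightarrow>
        summable (\<lambda>m. metric_coeff n (m + 2) (d, w)) \<and>
        ke_density f z = 1 / (norm z * \<bar>ln (norm w)\<bar>) *
          norm (1 - (B / A * w - of_real (Re (B / A * w) / ln (norm w))) + (\<Sum>m. metric_coeff n (m + 2) (d, w)))"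
    "\<And>N. (\<lambda>z. \<Sum>m. metric_coeff n (m + N) (d, z / A)) \<in> O[at 0](\<lambda>z. z ^ N)"
proof -
  define X where "X = (\<lambda>j. recip_coord (a j))"
  define F where "F = (\<lambda>\<tau>. recip_coord (f \<tau>))"
  define \<rho> where "\<rho> = (\<lambda>j. if a j = Inf_pt then 0 else \<beta> j / \<alpha> j)"
  define Y where "Y = - (X ` {2..n})"
  have cd1: "plane_cover F Y" using cover_data(1)[OF a n f] by (simp add: F_def X_def Y_def)
  have cd2: "f \<tau> = chart_inf (F \<tau>)" if "\<tau> \<in> UH" for \<tau>
    using cover_data(2)[OF a n f that] by (simp add: F_def)
  have cd3: "\<exists>M\<ge>0. \<forall>\<tau>. M < Im \<tau> \<longrightarrow> R < norm (F \<tau>)" for R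
    using cover_data(3)[OF a n f] by (simp add: F_def)
  interpret plane_cover F Y by (rule cd1)
  have ch: "cusp_chart K M \<epsilon> Q \<phi>" using ch by (simp add: F_def)
  have d: "d = (A, B / A, X, \<rho>)" by (simp add: d X_def \<rho>_def)
  show K: "K > 0" using ch by (simp add: cusp_chart_def)
  have ne: "a j \<noteq> Fin_pt 0" if "j \<in> {2..n}" for j
    using inj_onD[OF a(2), of j 1] that n a(1) by auto
  have injX: "inj_on X {2..n}"
    unfolding X_def by (rule recip_coord_inj) (use ne inj_on_subset[OF a(2), of "{2..n}"] in auto)
  have fin: "a j \<noteq> Inf_pt \<and> affine_coord (a j) = 1 / X j \<and> affine_coord (a j) \<noteq> 0" if "j \<in> {2..n}" "X j \<noteq> 0" for j
    using that ne[OF that(1)] by (cases "a j") (auto simp: X_def)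
  have loc: "\<exists>r>0. \<exists>H. H holomorphic_on ball (1 / X j) r \<and>
      (\<forall>w\<in>ball (1 / X j) r - {1 / X j}. SchI w = 1 / (w - 1 / X j)\<^sup>2 + 2 * \<rho> j / (w - 1 / X j) + H w)"
    if j: "j \<in> {2..n}" "X j \<noteq> 0" for j
  proof -
    have "uniformizing_coeffs f (1 / X j) (\<alpha> j) (\<beta> j)" using uc[OF j(1)] fin[OF j] by simp
    from uniformizing_coeffs_SchI[OF cd1 cd2 this] show ?thesis using fin[OF j] by (simp add: \<rho>_def)
  qed
  note ce = cusp_expansion[OF ch cd3 Y_def injX loc A B d]
  have A0: "A \<noteq> 0" by (rule ce(1))
  show "summable (\<lambda>m. cusp_coeff n (m + 4) d * q ^ (m + 4)) \<and>
        f \<tau> = Fin_pt (A * (q + B / A * q\<^sup>2 + cusp_coeff n 3 d * q ^ 3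
                        + (\<Sum>m. cusp_coeff n (m + 4) d * q ^ (m + 4))))"
    if t: "Im \<tau> > 0" and fi: "\<forall>\<sigma>. Im \<sigma> \<ge> Im \<tau> \<longrightarrow> f \<sigma> \<noteq> Inf_pt"
      and q: "q = exp (2 * of_real pi * \<i> / of_real K * \<tau>)" for \<tau> q
  proof -
    have nz: "F \<sigma> \<noteq> 0" if "Im \<sigma> \<ge> Im \<tau>" for \<sigma>
    proof
      assume "F \<sigma> = 0"
      moreover have "\<sigma> \<in> UH" using that t by (simp add: UH_iff)
      ultimately have "f \<sigma> = Inf_pt" using cd2[of \<sigma>] by (simp add: chart_inf_def)
      with fi that show False by blast
    qed
    note cs = cusp_series[OF ch A0 ce(2) cusp_coeff_low(1) cusp_coeff_low(2) t nz q]
    have "cusp_coeff n 2 d = B / A" unfolding d by (rule cusp_coeff_low(3))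
    moreover have "f \<tau> = Fin_pt (1 / F \<tau>)" using cd2[of \<tau>] t nz[of \<tau>] by (simp add: UH_iff chart_inf_def)
    ultimately show ?thesis using cs by simp
  qed
  \<comment> \<open>An index with \<open>a j = Inf_pt\<close> has \<open>X j = 0\<close> and
    contributes nothing.\<close>
  have "(\<Sum>j=2..n. (X j)\<^sup>2 - 2 * \<rho> j * X j) = (\<Sum>j | j \<in> {2..n} \<and> a j \<noteq> Inf_pt. (X j)\<^sup>2 - 2 * \<rho> j * X j)"
    by (rule sum.mono_neutral_right) (auto simp: X_def)
  also have "\<dots> = (\<Sum>j | j \<in> {2..n} \<and> a j \<noteq> Inf_pt.
           1 / (affine_coord (a j))\<^sup>2 - 1 / affine_coord (a j) * (2 * \<beta> j / \<alpha> j))"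
  proof (intro sum.cong refl)
    fix j assume j: "j \<in> {j. j \<in> {2..n} \<and> a j \<noteq> Inf_pt}"
    then obtain p where p: "a j = Fin_pt p" by (cases "a j") auto
    then show "(X j)\<^sup>2 - 2 * \<rho> j * X j = 1 / (affine_coord (a j))\<^sup>2 - 1 / affine_coord (a j) * (2 * \<beta> j / \<alpha> j)"
      by (simp add: X_def \<rho>_def power_divide)
  qed
  finally show "cusp_coeff n 3 d = 1 / 16 * (19 * (B\<^sup>2 / A\<^sup>2)
       - A\<^sup>2 * (\<Sum>j | j \<in> {2..n} \<and> a j \<noteq> Inf_pt.
           1 / (affine_coord (a j))\<^sup>2 - 1 / affine_coord (a j) * (2 * \<beta> j / \<alpha> j)))"
    unfolding d cusp_coeff_low(4) by (simp add: power_divide)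
  obtain r y \<eta> where r: "0 < r" "norm A * r \<le> \<epsilon>" "y holomorphic_on ball 0 r" "\<eta> holomorphic_on ball 0 r"
      "y has_fps_expansion Abs_fps (y_coeff n d)" "y 0 = 1" "\<eta> has_fps_expansion Abs_fps (eta_coeff n d)" "\<eta> 0 = 0"
      "\<And>x. x \<in> ball 0 r \<Longrightarrow> Q (A * x) = x * exp (\<eta> x) \<and> A * x * deriv Q (A * x) = y x * Q (A * x)"
    using ce(3) by blast
  obtain \<delta> where \<delta>: "\<delta> > 0" "\<delta> < r" "\<delta> < 1" and ms: "\<And>w. 0 < norm w \<Longrightarrow> norm w < \<delta> \<Longrightarrow>
     (\<lambda>m. metric_coeff n m (d, w)) sums (y w / of_real (1 + Re (\<eta> w) / ln (norm w))) \<and>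
     1 / 2 \<le> 1 + Re (\<eta> w) / ln (norm w) \<and>
     (\<forall>m. norm (metric_coeff n m (d, w)) \<le> 4 * (norm w / (2 * \<delta>)) ^ m)"
    using metric_series[OF r(1,3,4,5,6,7,8)] by blast
  show "(\<lambda>z. \<Sum>m. metric_coeff n (m + N) (d, z / A)) \<in> O[at 0](\<lambda>z. z ^ N)" for N
    using metric_tail_bigo[OF \<delta>(1) A0, of "\<lambda>m w. metric_coeff n m (d, w)"] ms by blast
  define \<theta> where "\<theta> = exp (- 2 * pi * M / K)"
  obtain e where e: "e > 0" "e \<le> \<epsilon>" "ball 0 e \<subseteq> \<phi> ` ball 0 \<theta>"
    using cusp_chart_image[OF cd1 ch] unfolding \<theta>_def by metis
  have Q\<phi>: "Q (\<phi> q) = q" if "q \<in> ball 0 \<theta>" for q using ch that unfolding cusp_chart_def \<theta>_def by blast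
  have \<phi>0: "\<phi> 0 = 0" using ch by (simp add: cusp_chart_def)
  have nA: "norm A > 0" using A0 by simp
  show "\<exists>\<delta>>0. \<forall>z w. 0 < norm z \<and> norm z < \<delta> \<and> w = z / A \<longrightarrow>
        summable (\<lambda>m. metric_coeff n (m + 2) (d, w)) \<and>
        ke_density f z = 1 / (norm z * \<bar>ln (norm w)\<bar>) *
          norm (1 - (B / A * w - of_real (Re (B / A * w) / ln (norm w))) + (\<Sum>m. metric_coeff n (m + 2) (d, w)))"
  proof (intro exI[of _ "min e (\<delta> * norm A)"] conjI allI impI; (elim conjE)?)
    show "0 < min e (\<delta> * norm A)" using e(1) \<delta>(1) nA by simp
    fix z w assume z: "0 < norm z" "norm z < min e (\<delta> * norm A)" and wz: "w = z / A"
    have zA: "z = A * w" using A0 wz by simp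
    have w: "0 < norm w" "norm w < \<delta>" using z nA by (simp_all add: wz norm_divide divide_less_eq)
    note m = ms[OF w]
    define S where "S = 1 + Re (\<eta> w) / ln (norm w)"
    have S: "S \<ge> 1 / 2" using m by (simp add: S_def)
    have sm: "summable (\<lambda>m. metric_coeff n m (d, w))" using m sums_summable by blast
    then show "summable (\<lambda>m. metric_coeff n (m + 2) (d, w))" by (rule summable_ignore_initial_segment)
    have "y w / of_real S = (\<Sum>m. metric_coeff n m (d, w))" using m sums_unique unfolding S_def by blast
    also have "\<dots> = (\<Sum>m. metric_coeff n (m + 2) (d, w)) + (\<Sum>m<2. metric_coeff n m (d, w))"
      by (rule suminf_split_initial_segment[OF sm])
    also have "(\<Sum>m<2. metric_coeff n m (d, w)) = metric_coeff n 0 (d, w) + metric_coeff n 1 (d, w)"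
      by (simp add: numeral_2_eq_2)
    also have "\<dots> = 1 - (B / A * w - of_real (Re (B / A * w) / ln (norm w)))"
      unfolding d metric_coeff_low by (simp only: add_uminus_conv_diff)
    finally have yS: "y w / of_real S = 1 - (B / A * w - of_real (Re (B / A * w) / ln (norm w)))
       + (\<Sum>m. metric_coeff n (m + 2) (d, w))" by (simp only: add.commute)
    have "z \<in> \<phi> ` ball 0 \<theta>" using z(2) e(3) by auto
    then obtain q where q: "q \<in> ball 0 \<theta>" "z = \<phi> q" by blast
    have q0: "q \<noteq> 0" using q(2) \<phi>0 z(1) by auto
    have Qz: "Q z = q" using Q\<phi>[OF q(1)] q(2) by simp
    have wr: "w \<in> ball 0 r" using w(2) \<delta>(2) by simp
    have q1: "q = w * exp (\<eta> w)" and zQ: "z * deriv Q z = y w * q" using r(9)[OF wr] Qz zA by auto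
    have ke: "ke_density f z = norm (deriv Q z) / (norm q * \<bar>ln (norm q)\<bar>)"
      unfolding q(2) by (rule ke_density_cusp[OF cd2 ch _ q0]) (use q(1) in \<open>simp_all add: \<theta>_def\<close>)
    have lnw: "ln (norm w) < 0" using w \<delta>(3) by simp
    have "norm q = norm w * exp (Re (\<eta> w))" by (simp add: q1 norm_mult norm_exp_eq_Re)
    \<comment> \<open>The logarithm of q thus equals that of \<open>w\<close> times
      \<open>S\<close>, which is the denominator summed by the metric coefficients.\<close>
    then have "ln (norm q) = ln (norm w) + Re (\<eta> w)" using w(1) by (simp add: ln_mult)
    also have "\<dots> = ln (norm w) * S" using lnw by (simp add: S_def distrib_left)
    finally have lnq: "\<bar>ln (norm q)\<bar> = \<bar>ln (norm w)\<bar> * S" using S by (simp add: abs_mult)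
    have "norm z * norm (deriv Q z) = norm (y w) * norm q" using arg_cong[OF zQ, of norm] by (simp only: norm_mult)
    then have dQ: "norm (deriv Q z) = norm (y w) * norm q / norm z" using z(1) by (simp add: field_simps)
    have "ke_density f z = norm (y w) / (norm z * (\<bar>ln (norm w)\<bar> * S))"
      unfolding ke lnq dQ using q0 by simp
    also have "\<dots> = 1 / (norm z * \<bar>ln (norm w)\<bar>) * norm (y w / of_real S)"
      using S by (simp add: norm_divide)
    finally show "ke_density f z = 1 / (norm z * \<bar>ln (norm w)\<bar>) *
          norm (1 - (B / A * w - of_real (Re (B / A * w) / ln (norm w))) + (\<Sum>m. metric_coeff n (m + 2) (d, w)))"
      unfolding yS .
  qed
qed

theorem theorem1:
  fixes n :: nat
  assumes "n \<ge> 3"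
  shows "\<exists>(c :: nat \<Rightarrow> cusp_data \<Rightarrow> complex) (R :: nat \<Rightarrow> cusp_data \<times> complex \<Rightarrow> complex).
    (\<forall>m\<ge>3. c m \<in> polynomials_in (data_gens n)) \<and>
    (\<forall>m\<ge>2. R m \<in> polynomials_in (metric_gens n m)) \<and>
    (\<forall>a :: nat \<Rightarrow> cp1. a 1 = Fin_pt 0 \<and> inj_on a {1..n} \<longrightarrow>
      (\<exists>A\<^sub>0 B\<^sub>0. A\<^sub>0 \<noteq> 0 \<and>
        (\<forall>f \<alpha> \<beta>.
          universal_covering_map f (UNIV - a ` {1..n}) \<and> vanishes_at_infinity f \<and>
          (\<forall>j\<in>{2..n}. a j \<noteq> Inf_pt \<longrightarrow>
             uniformizing_coeffs f (affine_coord (a j)) (\<alpha> j) (\<beta> j)) \<longrightarrow>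
          (\<exists>(k :: real) u A B d.
             k > 0 \<and> norm u = 1 \<and> A = u * A\<^sub>0 \<and> B = u\<^sup>2 * B\<^sub>0 \<and>
             d = (A, B / A, \<lambda>j. recip_coord (a j),
                  \<lambda>j. if a j = Inf_pt then 0 else \<beta> j / \<alpha> j) \<and>
             (\<forall>\<tau> q. Im \<tau> > 0 \<and> (\<forall>\<sigma>. Im \<sigma> \<ge> Im \<tau> \<longrightarrow> f \<sigma> \<noteq> Inf_pt) \<and>
                q = exp (2 * of_real pi * \<i> / of_real k * \<tau>) \<longrightarrow>
                summable (\<lambda>m. c (m + 4) d * q ^ (m + 4)) \<and>
                f \<tau> = Fin_pt (A * (q + B / A * q\<^sup>2 + c 3 d * q ^ 3
                                + (\<Sum>m. c (m + 4) d * q ^ (m + 4))))) \<and>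
             c 3 d = 1 / 16 * (19 * (B\<^sup>2 / A\<^sup>2)
               - A\<^sup>2 * (\<Sum>j | j \<in> {2..n} \<and> a j \<noteq> Inf_pt.
                   1 / (affine_coord (a j))\<^sup>2
                   - 1 / affine_coord (a j) * (2 * \<beta> j / \<alpha> j))) \<and>
             (\<exists>\<delta>>0. \<forall>z w. 0 < norm z \<and> norm z < \<delta> \<and> w = z / A \<longrightarrow>
                summable (\<lambda>m. R (m + 2) (d, w)) \<and>
                ke_density f z =
                  1 / (norm z * \<bar>ln (norm w)\<bar>) *
                  norm (1 - (B / A * w - of_real (Re (B / A * w) / ln (norm w)))
                        + (\<Sum>m. R (m + 2) (d, w)))) \<and>
             (\<forall>N\<ge>2. (\<lambda>z. \<Sum>m. R (m + N) (d, z / A)) \<in> O[at 0](\<lambda>z. z ^ N))))))"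
proof (rule exI[of _ "cusp_coeff n"], rule exI[of _ "metric_coeff n"], intro conjI)
  show "\<forall>m\<ge>3. cusp_coeff n m \<in> polynomials_in (data_gens n)" using cusp_coeff_poly by blast
  show "\<forall>m\<ge>2. metric_coeff n m \<in> polynomials_in (metric_gens n m)" using metric_coeff_poly by blast
  have n: "1 \<le> n" using assms by simp
  show "\<forall>a :: nat \<Rightarrow> cp1. a 1 = Fin_pt 0 \<and> inj_on a {1..n} \<longrightarrow>
      (\<exists>A\<^sub>0 B\<^sub>0. A\<^sub>0 \<noteq> 0 \<and>
        (\<forall>f \<alpha> \<beta>.
          universal_covering_map f (UNIV - a ` {1..n}) \<and> vanishes_at_infinity f \<and>
          (\<forall>j\<in>{2..n}. a j \<noteq> Inf_pt \<longrightarrow>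
             uniformizing_coeffs f (affine_coord (a j)) (\<alpha> j) (\<beta> j)) \<longrightarrow>
          (\<exists>(k :: real) u A B d.
             k > 0 \<and> norm u = 1 \<and> A = u * A\<^sub>0 \<and> B = u\<^sup>2 * B\<^sub>0 \<and>
             d = (A, B / A, \<lambda>j. recip_coord (a j),
                  \<lambda>j. if a j = Inf_pt then 0 else \<beta> j / \<alpha> j) \<and>
             (\<forall>\<tau> q. Im \<tau> > 0 \<and> (\<forall>\<sigma>. Im \<sigma> \<ge> Im \<tau> \<longrightarrow> f \<sigma> \<noteq> Inf_pt) \<and>
                q = exp (2 * of_real pi * \<i> / of_real k * \<tau>) \<longrightarrow>
                summable (\<lambda>m. cusp_coeff n (m + 4) d * q ^ (m + 4)) \<and>
                f \<tau> = Fin_pt (A * (q + B / A * q\<^sup>2 + cusp_coeff n 3 d * q ^ 3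
                                + (\<Sum>m. cusp_coeff n (m + 4) d * q ^ (m + 4))))) \<and>
             cusp_coeff n 3 d = 1 / 16 * (19 * (B\<^sup>2 / A\<^sup>2)
               - A\<^sup>2 * (\<Sum>j | j \<in> {2..n} \<and> a j \<noteq> Inf_pt.
                   1 / (affine_coord (a j))\<^sup>2
                   - 1 / affine_coord (a j) * (2 * \<beta> j / \<alpha> j))) \<and>
             (\<exists>\<delta>>0. \<forall>z w. 0 < norm z \<and> norm z < \<delta> \<and> w = z / A \<longrightarrow>
                summable (\<lambda>m. metric_coeff n (m + 2) (d, w)) \<and>
                ke_density f z =
                  1 / (norm z * \<bar>ln (norm w)\<bar>) *
                  norm (1 - (B / A * w - of_real (Re (B / A * w) / ln (norm w)))
                        + (\<Sum>m. metric_coeff n (m + 2) (d, w)))) \<and>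
             (\<forall>N\<ge>2. (\<lambda>z. \<Sum>m. metric_coeff n (m + N) (d, z / A)) \<in> O[at 0](\<lambda>z. z ^ N)))))"
    (is "\<forall>a. ?pre a \<longrightarrow> (\<exists>A\<^sub>0 B\<^sub>0. A\<^sub>0 \<noteq> 0 \<and> (\<forall>f \<alpha> \<beta>. ?cov a f \<alpha> \<beta> \<longrightarrow> ?concl a A\<^sub>0 B\<^sub>0 f \<alpha> \<beta>))")
  proof (intro allI impI)
    fix a :: "nat \<Rightarrow> cp1" assume "?pre a"
    then have a: "a 1 = Fin_pt 0" "inj_on a {1..n}" by blast+
    define good where "good f \<longleftrightarrow> universal_covering_map f (UNIV - a ` {1..n}) \<and> vanishes_at_infinity f" for f
    define rc where "rc f = (\<lambda>\<tau>. recip_coord (f \<tau>))" for f :: "complex \<Rightarrow> cp1"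
    define Y where "Y = - ((\<lambda>j. recip_coord (a j)) ` {2..n})"
    have pc: "plane_cover (rc f) Y" and chart: "\<exists>K M \<epsilon> Q \<phi>. plane_cover.cusp_chart (rc f) K M \<epsilon> Q \<phi>" if "good f" for f
      using cover_data(1,4)[OF a n, of f] that by (simp_all add: good_def rc_def Y_def)
    \<comment> \<open>The constants may depend on the punctures but not on the covering. They are
      read off from one admissible \<open>f0\<close>; by \<open>cusp_chart_unique\<close> every
      other covering agrees with it up to a rotation.\<close>
    have "\<exists>A\<^sub>0 B\<^sub>0. A\<^sub>0 \<noteq> 0 \<and> (\<forall>f K M \<epsilon> Q \<phi>. good f \<longrightarrow> plane_cover.cusp_chart (rc f) K M \<epsilon> Q \<phi> \<longrightarrow>
        (\<exists>u. norm u = 1 \<and> deriv \<phi> 0 = u * A\<^sub>0 \<and> deriv (deriv \<phi>) 0 / 2 = u\<^sup>2 * B\<^sub>0))"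
    proof (cases "\<exists>f. good f")
      case True
      then obtain f0 where f0: "good f0" by blast
      obtain K0 M0 \<epsilon>0 Q0 \<phi>0 where c0: "plane_cover.cusp_chart (rc f0) K0 M0 \<epsilon>0 Q0 \<phi>0" using chart[OF f0] by blast
      show ?thesis
      proof (rule exI[of _ "deriv \<phi>0 0"], rule exI[of _ "deriv (deriv \<phi>0) 0 / 2"], intro conjI allI impI)
        show "deriv \<phi>0 0 \<noteq> 0" using plane_cover.cusp_chart_derivs(1)[OF pc[OF f0] c0] by auto
        fix f K M \<epsilon> Q \<phi> assume f: "good f" "plane_cover.cusp_chart (rc f) K M \<epsilon> Q \<phi>"
        obtain u where "norm u = 1" "deriv \<phi> 0 = u * deriv \<phi>0 0" "deriv (deriv \<phi>) 0 = u\<^sup>2 * deriv (deriv \<phi>0) 0"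
          by (rule cusp_chart_unique[OF pc[OF f0] pc[OF f(1)] c0 f(2)])
        then show "\<exists>u. norm u = 1 \<and> deriv \<phi> 0 = u * deriv \<phi>0 0 \<and> deriv (deriv \<phi>) 0 / 2 = u\<^sup>2 * (deriv (deriv \<phi>0) 0 / 2)"
          by auto
      qed
    \<comment> \<open>If no admissible covering exists, the condition on \<open>f\<close> is empty
      and any nonzero constant serves as \<open>A\<^sub>0\<close>.\<close>
    qed (use zero_neq_one in metis)
    then obtain A0 B0 where A0: "A0 \<noteq> 0" and rot: "\<And>f K M \<epsilon> Q \<phi>. good f \<Longrightarrow> plane_cover.cusp_chart (rc f) K M \<epsilon> Q \<phi> \<Longrightarrow>
        \<exists>u. norm u = 1 \<and> deriv \<phi> 0 = u * A0 \<and> deriv (deriv \<phi>) 0 / 2 = u\<^sup>2 * B0"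
      by blast
    show "\<exists>A\<^sub>0 B\<^sub>0. A\<^sub>0 \<noteq> 0 \<and> (\<forall>f \<alpha> \<beta>. ?cov a f \<alpha> \<beta> \<longrightarrow> ?concl a A\<^sub>0 B\<^sub>0 f \<alpha> \<beta>)"
    proof (rule exI[of _ A0], rule exI[of _ B0], intro conjI allI impI)
      show "A0 \<noteq> 0" by (rule A0)
      fix f and \<alpha> \<beta> :: "nat \<Rightarrow> complex" assume cov: "?cov a f \<alpha> \<beta>"
      then have f: "universal_covering_map f (UNIV - a ` {1..n})" "vanishes_at_infinity f"
        and uc: "\<And>j. j \<in> {2..n} \<Longrightarrow> a j \<noteq> Inf_pt \<Longrightarrow> uniformizing_coeffs f (affine_coord (a j)) (\<alpha> j) (\<beta> j)"
        by blast+
      have gf: "good f" using f by (simp add: good_def)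
      obtain K M \<epsilon> Q \<phi> where ch: "plane_cover.cusp_chart (rc f) K M \<epsilon> Q \<phi>" using chart[OF gf] by blast
      obtain u where u: "norm u = 1" "deriv \<phi> 0 = u * A0" "deriv (deriv \<phi>) 0 / 2 = u\<^sup>2 * B0"
        using rot[OF gf ch] by blast
      define A where "A = deriv \<phi> 0"
      define B where "B = deriv (deriv \<phi>) 0 / 2"
      define d :: cusp_data where "d = (A, B / A, \<lambda>j. recip_coord (a j), \<lambda>j. if a j = Inf_pt then 0 else \<beta> j / \<alpha> j)"
      note ex = expansions_at_cusp[OF a n f uc ch[unfolded rc_def] A_def B_def d_def]
      have "A = u * A0" "B = u\<^sup>2 * B0" using u by (simp_all add: A_def B_def)
      show "?concl a A0 B0 f \<alpha> \<beta>"
      proof (rule exI[of _ K], rule exI[of _ u], rule exI[of _ A], rule exI[of _ B], rule exI[of _ d], intro conjI)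
        show "0 < K" by (rule ex(1))
        show "norm u = 1" by (rule u(1))
        show "A = u * A0" "B = u\<^sup>2 * B0" by fact+
        show "d = (A, B / A, \<lambda>j. recip_coord (a j), \<lambda>j. if a j = Inf_pt then 0 else \<beta> j / \<alpha> j)" by (rule d_def)
      next
        show "\<forall>\<tau> q. Im \<tau> > 0 \<and> (\<forall>\<sigma>. Im \<sigma> \<ge> Im \<tau> \<longrightarrow> f \<sigma> \<noteq> Inf_pt) \<and>
                q = exp (2 * of_real pi * \<i> / of_real K * \<tau>) \<longrightarrow>
                summable (\<lambda>m. cusp_coeff n (m + 4) d * q ^ (m + 4)) \<and>
                f \<tau> = Fin_pt (A * (q + B / A * q\<^sup>2 + cusp_coeff n 3 d * q ^ 3
                                + (\<Sum>m. cusp_coeff n (m + 4) d * q ^ (m + 4))))"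
          by (intro allI impI, elim conjE, rule ex(2))
        show "cusp_coeff n 3 d = 1 / 16 * (19 * (B\<^sup>2 / A\<^sup>2)
               - A\<^sup>2 * (\<Sum>j | j \<in> {2..n} \<and> a j \<noteq> Inf_pt.
                   1 / (affine_coord (a j))\<^sup>2
                   - 1 / affine_coord (a j) * (2 * \<beta> j / \<alpha> j)))"
          by (rule ex(3))
        show "\<exists>\<delta>>0. \<forall>z w. 0 < norm z \<and> norm z < \<delta> \<and> w = z / A \<longrightarrow>
                summable (\<lambda>m. metric_coeff n (m + 2) (d, w)) \<and>
                ke_density f z =
                  1 / (norm z * \<bar>ln (norm w)\<bar>) *
                  norm (1 - (B / A * w - of_real (Re (B / A * w) / ln (norm w)))
                        + (\<Sum>m. metric_coeff n (m + 2) (d, w)))"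
          by (rule ex(4))
        show "\<forall>N\<ge>2. (\<lambda>z. \<Sum>m. metric_coeff n (m + N) (d, z / A)) \<in> O[at 0](\<lambda>z. z ^ N)"
          using ex(5) by blast
      qed
    qed
  qed
qed

end
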